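(* For any integer $N$, let $(M_i^N)_{i\in\mathcal I}$ be a family of random matrices of size $N$ which is invariant in law by conjugation by the unitary group $U(N)$. Suppose that $(M_i^N)_{i\in\mathcal I}$ converges in non-commutative distribution and satisfies the asymptotic $\mathfrak S$-factorization property. Then for any integer $k$, any $p\in\mathcal P_k$ and any $(i_1,\dots,i_k)\in\mathcal I^k$, $$\lim_{N\to\infty}\mathbb Em_{p^c}(M_{i_1}^N,\dots,M_{i_k}^N)=\delta_{p\in\overline{\mathfrak S_k}}\prod_{(j_1,\dots,j_r)\text{ cycle of }\mathrm{Mb}(p)}\kappa(M_{i_{j_1}},\dots,M_{i_{j_r}}),$$ where $\kappa$ on the right-hand side denotes the free cumulants of the limiting non-commutative distribution.
   Context: Partitions. For $k\ge 0$, $\mathcal P_k$ is the set of partitions of $\{1,\dots,k,1',\dots,k'\}$, drawn with a top row $1,\dots,k$ and a bottom row $1',\dots,k'$. $\mathrm{nc}(p)$ is the number of blocks of $p$; $p\vee p'$ is the finest partition coarser than both; $\mathrm{id}_k=\{\{i,i'\}\}$; ${}^tp$ is obtained by exchanging $i$ and $i'$ for every $i$; $p\otimes p'$ is obtained by putting $p'$ to the right of $p$. A permutation $\sigma\in\mathfrak S_k$ is identified with $\{\{i,\sigma(i)'\}\}\in\mathcal P_k$; a cycle $(j_1,\dots,j_r)$ of $\sigma$ satisfies $\sigma(j_s)=j_{s+1}$ (cyclically). Write $p'\sqsupset p$ if $p'$ is finer than $p$ and $\mathrm{nc}(p')-\mathrm{nc}(p'\vee\mathrm{id}_k)=\mathrm{nc}(p)-\mathrm{nc}(p\vee\mathrm{id}_k)$.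 $\overline{\mathfrak S_k}$ is the set of $p\in\mathcal P_k$ for which there is $\sigma\in\mathfrak S_k$ with $\sigma\sqsupset p$; such a $\sigma$ is then unique and is denoted $\mathrm{Mb}(p)$. Representation. $E_i^j$ is the $N\times N$ matrix sending $e_j$ to $e_i$ and the other basis vectors to $0$. For $I=(i_1,\dots,i_k,i_{1'},\dots,i_{k'})\in\{1,\dots,N\}^{2k}$, $\mathrm{Ker}(I)\in\mathcal P_k$ is the partition where $a,b$ are in the same block iff $i_a=i_b$. $\rho_N(p)$ (resp. $\rho_N(p^c)$) is the sum of $E_{i_{1'}}^{i_1}\otimes\dots\otimes E_{i_{k'}}^{i_k}$ over $I$ such that $\mathrm{Ker}(I)$ is coarser than (or equal to) $p$ (resp. $\mathrm{Ker}(I)=p$). Random matrices have entries with finite moments of all orders. $\mathbb Em_p(M_1,\dots,M_k)=N^{-\mathrm{nc}(p\vee\mathrm{id}_k)}\mathbb E\,\mathrm{Tr}[(M_1\otimes\dots\otimes M_k)\rho_N({}^tp)]$, and $\mathbb Em_{p^c}(M_1,\dots,M_k)=N^{-\mathrm{nc}(p\vee\mathrm{id}_k)}\mathbb E\,\mathrm{Tr}[(M_1\otimes\dots\otimes M_k)\rho_N(({}^tp)^c)]$. In particular for $\sigma\in\mathfrak S_k$, $\mathbb Em_\sigma(M_1,\dots,M_k)=\mathbb E\prod_{(j_1,\dots,j_r)\text{ cycle of }\sigma}\frac1N\mathrm{Tr}(M_{j_1}\cdots M_{j_r})$. Invariance in law by conjugation by $U(N)$: for every $g\in U(N)$ and all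 $i_1,\dots,i_k$, $(gM_{i_1}^Ng^{-1},\dots,gM_{i_k}^Ng^{-1})$ has the same law as $(M^N_{i_1},\dots,M^N_{i_k})$. Convergence in non-commutative distribution: $\mathbb E[\frac1N\mathrm{Tr}(M^N_{i_1}\cdots M^N_{i_k})]$ converges for all $k$ and $i_1,\dots,i_k$. Asymptotic $\mathfrak S$-factorization property: for all $\sigma\in\mathfrak S_k$ the $\mathbb Em_\sigma(M^N_{i_1},\dots,M_{i_k}^N)$ converge to limits $\mathbb Em_\sigma(M_{i_1},\dots,M_{i_k})$ which satisfy $\mathbb Em_{\sigma_1\otimes\sigma_2}(M_{i_1},\dots,M_{i_{k+l}})=\mathbb Em_{\sigma_1}(M_{i_1},\dots,M_{i_k})\mathbb Em_{\sigma_2}(M_{i_{k+1}},\dots,M_{i_{k+l}})$ for $\sigma_1\in\mathfrak S_k$, $\sigma_2\in\mathfrak S_l$. Free cumulants are defined by $\lim_N\mathbb E[\frac1N\mathrm{Tr}(M^N_{i_1}\cdots M^N_{i_n})]=\sum_{\pi\in\mathrm{NC}_n}\prod_{\{j_1<\dots<j_l\}\in\pi}\kappa(M_{i_{j_1}},\dots,M_{i_{j_l}})$, with $\mathrm{NC}_n$ the non-crossing partitions of $\{1,\dots,n\}$. *)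

theory Defs
  imports
    "HOL-Probability.Probability"
    "HOL-Combinatorics.Orbits"
    "HOL-Combinatorics.Cycles"
    "Jordan_Normal_Form.Schur_Decomposition"
begin

section \<open>Partitions of two rows of points\<close>

text \<open>The point \<open>i\<close> of the top row is \<open>Inl i\<close>, the point \<open>i'\<close> of the bottom row is \<open>Inr i\<close>,
  for \<open>i\<close> between \<open>1\<close> and \<open>k\<close>.\<close>

definition points :: "nat \<Rightarrow> (nat + nat) set" where
  "points k = {1..k} <+> {1..k}"

definition partitions :: "nat \<Rightarrow> (nat + nat) set set set" where
  "partitions k = {p. partition_on (points k) p}"

abbreviation nc :: "'a set set \<Rightarrow> nat" where
  "nc p \<equiv> card p"

definition finer :: "'a set set \<Rightarrow> 'a set set \<Rightarrow> bool" where
  "finer p q \<longleftrightarrow> (\<forall>B\<in>p. \<exists>C\<in>q. B \<subseteq> C)"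

definition is_join :: "'a set \<Rightarrow> 'a set set \<Rightarrow> 'a set set \<Rightarrow> 'a set set \<Rightarrow> bool" where
  "is_join A p q r \<longleftrightarrow> partition_on A r \<and> finer p r \<and> finer q r \<and>
     (\<forall>s. partition_on A s \<and> finer p s \<and> finer q s \<longrightarrow> finer r s)"

definition join :: "nat \<Rightarrow> (nat + nat) set set \<Rightarrow> (nat + nat) set set \<Rightarrow> (nat + nat) set set" where
  "join k p q = (THE r. is_join (points k) p q r)"

definition id_part :: "nat \<Rightarrow> (nat + nat) set set" where
  "id_part k = (\<lambda>i. {Inl i, Inr i}) ` {1..k}"

definition flip :: "(nat + nat) set set \<Rightarrow> (nat + nat) set set" where
  "flip p = (\<lambda>B. case_sum Inr Inl ` B) ` p"

text \<open>\<open>k\<close> is the number of columns of the left-hand factor \<open>p\<close>.\<close>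

definition tensor_part ::
    "nat \<Rightarrow> (nat + nat) set set \<Rightarrow> (nat + nat) set set \<Rightarrow> (nat + nat) set set" where
  "tensor_part k p q = p \<union> (\<lambda>B. map_sum (\<lambda>i. k + i) (\<lambda>i. k + i) ` B) ` q"

definition perm_part :: "nat \<Rightarrow> (nat \<Rightarrow> nat) \<Rightarrow> (nat + nat) set set" where
  "perm_part k \<sigma> = (\<lambda>i. {Inl i, Inr (\<sigma> i)}) ` {1..k}"

text \<open>\<open>sqsupset_part k p' p\<close> stands for \<open>p' \<sqsupset> p\<close>.\<close>

definition sqsupset_part :: "nat \<Rightarrow> (nat + nat) set set \<Rightarrow> (nat + nat) set set \<Rightarrow> bool" where
  "sqsupset_part k p' p \<longleftrightarrow> finer p' p \<and>
     int (nc p') - int (nc (join k p' (id_part k))) = int (nc p) - int (nc (join k p (id_part k)))"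

definition S_bar :: "nat \<Rightarrow> (nat + nat) set set set" where
  "S_bar k = {p \<in> partitions k. \<exists>\<sigma>. \<sigma> permutes {1..k} \<and> sqsupset_part k (perm_part k \<sigma>) p}"

definition Mb :: "nat \<Rightarrow> (nat + nat) set set \<Rightarrow> nat \<Rightarrow> nat" where
  "Mb k p = (THE \<sigma>. \<sigma> permutes {1..k} \<and> sqsupset_part k (perm_part k \<sigma>) p)"

text \<open>Each cycle \<open>(j, \<sigma> j, \<sigma> (\<sigma> j), \<dots>)\<close> of \<open>\<sigma>\<close>, fixed points included, is listed once,
  starting from its least element.\<close>

definition cycles :: "nat \<Rightarrow> (nat \<Rightarrow> nat) \<Rightarrow> nat list set" where
  "cycles k \<sigma> = (\<lambda>C. support \<sigma> (Min C)) ` orbit \<sigma> ` {1..k}"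

lemma partition_block_eq:
  assumes "partition_on A p" "B \<in> p" "C \<in> p" "x \<in> B" "x \<in> C"
  shows "B = C"
  using assms(2-) partition_onD2[OF assms(1)] unfolding disjoint_def by blast

lemma is_join_unique:
  assumes "is_join A p q r" "is_join A p q s"
  shows "r = s"
proof -
  have sub: "u \<subseteq> v" if u: "partition_on A u" and v: "partition_on A v"
    and uv: "finer u v" and vu: "finer v u" for u v :: "'a set set"
  proof
    fix B assume B: "B \<in> u"
    obtain C where C: "C \<in> v" "B \<subseteq> C" using uv B by (auto simp: finer_def)
    obtain D where D: "D \<in> u" "C \<subseteq> D" using vu C by (auto simp: finer_def)
    have "B \<noteq> {}" using u B by (auto simp: partition_on_def)
    then obtain x where "x \<in> B" by auto
    hence "B = D" using partition_block_eq[OF u B D(1)] C D by blast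
    thus "B \<in> v" using C D by auto
  qed
  show ?thesis using assms sub[of r s] sub[of s r] by (auto simp: is_join_def)
qed

lemma is_join_exists:
  assumes "partition_on A p" "partition_on A q"
  shows "\<exists>r. is_join A p q r"
proof -
  define R where "R = (\<Union>B\<in>p \<union> q. B \<times> B)\<^sup>+"
  have R0: "(\<Union>B\<in>p \<union> q. B \<times> B) \<subseteq> A \<times> A"
    using assms by (auto simp: partition_on_def)
  have "equiv A R"
  proof (rule equivI)
    show "R \<subseteq> A \<times> A" unfolding R_def by (rule trancl_subset_Sigma[OF R0])
    show "refl_on A R" using assms
      by (fastforce simp: R_def refl_on_def partition_on_def intro: r_into_trancl)
    show "sym R" unfolding R_def by (rule sym_trancl) (auto simp: sym_def)
    show "trans R" unfolding R_def by simp
  qed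
  hence part: "partition_on A (A // R)" by (rule partition_on_quotient)
  have fin: "finer t (A // R)" if t: "t = p \<or> t = q" for t
    unfolding finer_def
  proof
    fix B assume B: "B \<in> t"
    hence "B \<noteq> {}" using t assms by (auto simp: partition_on_def)
    then obtain b where b: "b \<in> B" by auto
    have "b \<in> A" using b B t assms by (auto simp: partition_on_def)
    moreover have "B \<subseteq> R `` {b}" using b B t by (auto simp: R_def)
    ultimately show "\<exists>C\<in>A // R. B \<subseteq> C" by (auto simp: quotient_def)
  qed
  have least: "finer (A // R) s"
    if s: "partition_on A s" "finer p s" "finer q s" for s
  proof -
    have blk: "y \<in> C" if "(x, y) \<in> R" "x \<in> C" "C \<in> s" for x y C
      using that(1) unfolding R_def
    proof induction
      case (base y)
      then obtain B where B: "B \<in> p \<union> q" "x \<in> B" "y \<in> B" by auto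
      then obtain D where D: "D \<in> s" "B \<subseteq> D" using s by (auto simp: finer_def)
      have "D = C" using partition_block_eq[OF s(1) D(1) that(3), of x] B D that(2) by blast
      thus ?case using B D by auto
    next
      case (step y z)
      then obtain B where B: "B \<in> p \<union> q" "y \<in> B" "z \<in> B" by auto
      then obtain D where D: "D \<in> s" "B \<subseteq> D" using s by (auto simp: finer_def)
      have "D = C" using partition_block_eq[OF s(1) D(1) that(3), of y] B D step.IH by blast
      thus ?case using B D by auto
    qed
    show ?thesis unfolding finer_def
    proof
      fix B assume "B \<in> A // R"
      then obtain x where x: "x \<in> A" "B = R `` {x}" by (auto simp: quotient_def)
      then obtain C where "C \<in> s" "x \<in> C" using s(1) by (auto simp: partition_on_def)
      thus "\<exists>C\<in>s. B \<subseteq> C" using x blk by blast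
    qed
  qed
  show ?thesis using part fin least unfolding is_join_def by blast
qed

section \<open>The matrices of a partition\<close>

text \<open>Matrix indices start at \<open>0\<close>, so the basis of \<open>\<complex>\<^sup>N\<close> is indexed by \<open>{..<N}\<close>.\<close>

definition kronecker :: "'a::semiring_1 mat \<Rightarrow> 'a mat \<Rightarrow> 'a mat" where
  "kronecker A B = mat (dim_row A * dim_row B) (dim_col A * dim_col B)
     (\<lambda>(a, b). A $$ (a div dim_row B, b div dim_col B) * B $$ (a mod dim_row B, b mod dim_col B))"

text \<open>\<open>A 1 \<otimes> \<dots> \<otimes> A k\<close>\<close>

primrec tensor_pow :: "nat \<Rightarrow> (nat \<Rightarrow> 'a::semiring_1 mat) \<Rightarrow> 'a mat" where
  "tensor_pow 0 A = 1\<^sub>m 1"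
| "tensor_pow (Suc k) A = kronecker (tensor_pow k A) (A (Suc k))"

definition tr :: "'a::comm_monoid_add mat \<Rightarrow> 'a" where
  "tr A = (\<Sum>a<dim_row A. A $$ (a, a))"

text \<open>\<open>unit_matrix N a b\<close> is \<open>E\<^sub>a\<^sup>b\<close>.\<close>

definition unit_matrix :: "nat \<Rightarrow> nat \<Rightarrow> nat \<Rightarrow> complex mat" where
  "unit_matrix N a b = mat N N (\<lambda>(c, d). if c = a \<and> d = b then 1 else 0)"

definition multi_indices :: "nat \<Rightarrow> nat \<Rightarrow> (nat + nat \<Rightarrow> nat) set" where
  "multi_indices N k = points k \<rightarrow>\<^sub>E {..<N}"

definition Ker :: "nat \<Rightarrow> (nat + nat \<Rightarrow> nat) \<Rightarrow> (nat + nat) set set" where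
  "Ker k I = (\<lambda>a. {b \<in> points k. I b = I a}) ` points k"

text \<open>The library has no sums of matrices over finite index sets, so the sum is taken entrywise.\<close>

definition sum_unit_tensors :: "nat \<Rightarrow> nat \<Rightarrow> (nat + nat \<Rightarrow> nat) set \<Rightarrow> complex mat" where
  "sum_unit_tensors N k S = mat (N ^ k) (N ^ k)
     (\<lambda>ab. \<Sum>I\<in>S. tensor_pow k (\<lambda>j. unit_matrix N (I (Inr j)) (I (Inl j))) $$ ab)"

definition rho :: "nat \<Rightarrow> nat \<Rightarrow> (nat + nat) set set \<Rightarrow> complex mat" where
  "rho N k p = sum_unit_tensors N k {I \<in> multi_indices N k. finer p (Ker k I)}"

text \<open>\<open>rho_c N k p\<close> is \<open>\<rho>\<^sub>N(p\<^sup>c)\<close>.\<close>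

definition rho_c :: "nat \<Rightarrow> nat \<Rightarrow> (nat + nat) set set \<Rightarrow> complex mat" where
  "rho_c N k p = sum_unit_tensors N k {I \<in> multi_indices N k. Ker k I = p}"

section \<open>Random matrices\<close>

definition mat_borel :: "nat \<Rightarrow> complex mat measure" where
  "mat_borel N = vimage_algebra (carrier_mat N N)
     (\<lambda>A. \<lambda>ab\<in>{..<N} \<times> {..<N}. A $$ ab) (\<Pi>\<^sub>M ab\<in>{..<N} \<times> {..<N}. borel)"

definition random_matrix :: "'w measure \<Rightarrow> nat \<Rightarrow> ('w \<Rightarrow> complex mat) \<Rightarrow> bool" where
  "random_matrix W N A \<longleftrightarrow> A \<in> W \<rightarrow>\<^sub>M mat_borel N \<and>
     (\<forall>a<N. \<forall>b<N. \<forall>m::nat. integrable W (\<lambda>\<omega>. cmod (A \<omega> $$ (a, b)) ^ m))"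

definition unitary_group :: "nat \<Rightarrow> complex mat set" where
  "unitary_group N = {g \<in> carrier_mat N N. g * mat_adjoint g = 1\<^sub>m N \<and> mat_adjoint g * g = 1\<^sub>m N}"

definition joint_law :: "'w measure \<Rightarrow> nat \<Rightarrow> nat \<Rightarrow> (nat \<Rightarrow> 'w \<Rightarrow> complex mat)
    \<Rightarrow> (nat \<Rightarrow> complex mat) measure" where
  "joint_law W N k A = distr W (\<Pi>\<^sub>M j\<in>{1..k}. mat_borel N) (\<lambda>\<omega>. \<lambda>j\<in>{1..k}. A j \<omega>)"

text \<open>For unitary \<open>g\<close> the inverse is \<open>mat_adjoint g\<close>.\<close>

definition unitarily_invariant ::
    "'w measure \<Rightarrow> nat \<Rightarrow> 'i set \<Rightarrow> ('i \<Rightarrow> 'w \<Rightarrow> complex mat) \<Rightarrow> bool" where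
  "unitarily_invariant W N \<I> M \<longleftrightarrow>
     (\<forall>g\<in>unitary_group N. \<forall>k. \<forall>i\<in>{1..k} \<rightarrow> \<I>.
        joint_law W N k (\<lambda>j \<omega>. g * M (i j) \<omega> * mat_adjoint g) = joint_law W N k (\<lambda>j. M (i j)))"

definition Em :: "'w measure \<Rightarrow> nat \<Rightarrow> nat \<Rightarrow> (nat + nat) set set \<Rightarrow> (nat \<Rightarrow> 'w \<Rightarrow> complex mat)
    \<Rightarrow> complex" where
  "Em W N k p A = 1 / of_nat N ^ nc (join k p (id_part k)) *
     (LINT \<omega>|W. tr (tensor_pow k (\<lambda>j. A j \<omega>) * rho N k (flip p)))"

text \<open>\<open>Em_c W N k p A\<close> is \<open>\<bbbE> m\<close> with index \<open>p\<^sup>c\<close>.\<close>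

definition Em_c :: "'w measure \<Rightarrow> nat \<Rightarrow> nat \<Rightarrow> (nat + nat) set set \<Rightarrow> (nat \<Rightarrow> 'w \<Rightarrow> complex mat)
    \<Rightarrow> complex" where
  "Em_c W N k p A = 1 / of_nat N ^ nc (join k p (id_part k)) *
     (LINT \<omega>|W. tr (tensor_pow k (\<lambda>j. A j \<omega>) * rho_c N k (flip p)))"

definition mean_trace :: "'w measure \<Rightarrow> nat \<Rightarrow> ('i \<Rightarrow> 'w \<Rightarrow> complex mat) \<Rightarrow> 'i list \<Rightarrow> complex" where
  "mean_trace W N M w = (LINT \<omega>|W. 1 / of_nat N * tr (foldr (\<lambda>i A. M i \<omega> * A) w (1\<^sub>m N)))"

section \<open>Asymptotics\<close>

definition converges_in_nc_distribution ::
    "(nat \<Rightarrow> 'w measure) \<Rightarrow> 'i set \<Rightarrow> (nat \<Rightarrow> 'i \<Rightarrow> 'w \<Rightarrow> complex mat) \<Rightarrow> bool" where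
  "converges_in_nc_distribution W \<I> M \<longleftrightarrow>
     (\<forall>w. set w \<subseteq> \<I> \<longrightarrow> convergent (\<lambda>N. mean_trace (W N) N (M N) w))"

definition limit_distribution ::
    "(nat \<Rightarrow> 'w measure) \<Rightarrow> (nat \<Rightarrow> 'i \<Rightarrow> 'w \<Rightarrow> complex mat) \<Rightarrow> 'i list \<Rightarrow> complex" where
  "limit_distribution W M w = lim (\<lambda>N. mean_trace (W N) N (M N) w)"

definition limit_Em :: "(nat \<Rightarrow> 'w measure) \<Rightarrow> (nat \<Rightarrow> 'i \<Rightarrow> 'w \<Rightarrow> complex mat)
    \<Rightarrow> nat \<Rightarrow> (nat + nat) set set \<Rightarrow> (nat \<Rightarrow> 'i) \<Rightarrow> complex" where
  "limit_Em W M k p i = lim (\<lambda>N. Em (W N) N k p (\<lambda>j. M N (i j)))"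

definition asymptotic_S_factorization ::
    "(nat \<Rightarrow> 'w measure) \<Rightarrow> 'i set \<Rightarrow> (nat \<Rightarrow> 'i \<Rightarrow> 'w \<Rightarrow> complex mat) \<Rightarrow> bool" where
  "asymptotic_S_factorization W \<I> M \<longleftrightarrow>
     (\<forall>k \<sigma>. \<forall>i\<in>{1..k} \<rightarrow> \<I>. \<sigma> permutes {1..k} \<longrightarrow>
        convergent (\<lambda>N. Em (W N) N k (perm_part k \<sigma>) (\<lambda>j. M N (i j)))) \<and>
     (\<forall>k l \<sigma>\<^sub>1 \<sigma>\<^sub>2. \<forall>i\<in>{1..k + l} \<rightarrow> \<I>. \<sigma>\<^sub>1 permutes {1..k} \<and> \<sigma>\<^sub>2 permutes {1..l} \<longrightarrow>
        limit_Em W M (k + l) (tensor_part k (perm_part k \<sigma>\<^sub>1) (perm_part l \<sigma>\<^sub>2)) i =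
        limit_Em W M k (perm_part k \<sigma>\<^sub>1) i * limit_Em W M l (perm_part l \<sigma>\<^sub>2) (\<lambda>j. i (k + j)))"

section \<open>Free cumulants\<close>

definition NC :: "nat \<Rightarrow> nat set set set" where
  "NC n = {\<pi>. partition_on {1..n} \<pi> \<and>
     \<not> (\<exists>B\<in>\<pi>. \<exists>C\<in>\<pi>. B \<noteq> C \<and>
          (\<exists>a\<in>B. \<exists>b\<in>C. \<exists>c\<in>B. \<exists>d\<in>C. a < b \<and> b < c \<and> c < d))}"

text \<open>\<open>\<kappa>\<close> is the family of free cumulants of the distribution \<open>m\<close>; both are functions of words.
  The empty word does not occur in the relation, so \<open>\<kappa> []\<close> is unconstrained.\<close>

definition free_cumulants :: "'i set \<Rightarrow> ('i list \<Rightarrow> complex) \<Rightarrow> ('i list \<Rightarrow> complex) \<Rightarrow> bool" where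
  "free_cumulants \<I> m \<kappa> \<longleftrightarrow>
     (\<forall>n\<ge>1. \<forall>i\<in>{1..n} \<rightarrow> \<I>.
        m (map i [1..<n + 1]) = (\<Sum>\<pi>\<in>NC n. \<Prod>B\<in>\<pi>. \<kappa> (map i (sorted_list_of_set B))))"

lemma NC_block_card:
  assumes "\<pi> \<in> NC n - {{{1..n}}}" "B \<in> \<pi>"
  shows "card B < n"
proof -
  have p: "partition_on {1..n} \<pi>" "\<pi> \<noteq> {{1..n}}" using assms by (auto simp: NC_def)
  have sub: "B \<subseteq> {1..n}" using p assms(2) by (auto simp: partition_on_def)
  have "B \<noteq> {1..n}"
  proof
    assume B: "B = {1..n}"
    have "C = B" if C: "C \<in> \<pi>" for C
    proof -
      have "C \<noteq> {}" "C \<subseteq> B" using C p B by (auto simp: partition_on_def)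
      then obtain x where "x \<in> C" "x \<in> B" by auto
      thus ?thesis using partition_block_eq[OF p(1) C assms(2)] by blast
    qed
    hence "\<pi> = {{1..n}}" using assms(2) B by blast
    thus False using p by simp
  qed
  hence "B \<subset> {1..n}" using sub by auto
  from psubset_card_mono[OF _ this] show ?thesis by simp
qed

function cumulant :: "('i list \<Rightarrow> complex) \<Rightarrow> 'i list \<Rightarrow> complex" where
  "cumulant m w = m w - (\<Sum>\<pi>\<in>NC (length w) - {{{1..length w}}}.
     \<Prod>B\<in>\<pi>. cumulant m (map (\<lambda>j. w ! (j - 1)) (sorted_list_of_set B)))"
  by pat_completeness auto
termination
  by (relation "Wellfounded.measure (\<lambda>(m, w). length w)")
    (simp_all only: wf_measure in_measure prod.case length_map length_sorted_list_of_set NC_block_card)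

declare cumulant.simps [simp del]

lemma free_cumulants_cumulant: "free_cumulants \<I> m (cumulant m)"
  unfolding free_cumulants_def
proof (intro allI impI ballI)
  fix n :: nat and i :: "nat \<Rightarrow> 'a"
  assume n: "n \<ge> 1"
  define w where "w = map i [1..<n + 1]"
  have len: "length w = n" by (simp add: w_def)
  have nth: "w ! (j - 1) = i j" if "j \<in> {1..n}" for j
    using that by (auto simp: w_def simp del: upt_Suc)
  have blk: "map (\<lambda>j. w ! (j - 1)) (sorted_list_of_set B) = map i (sorted_list_of_set B)"
    if "\<pi> \<in> NC n" "B \<in> \<pi>" for \<pi> B
  proof -
    have "B \<subseteq> {1..n}" using that by (auto simp: NC_def partition_on_def)
    moreover from this have "finite B" by (rule finite_subset) simp
    ultimately show ?thesis using nth by auto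
  qed
  have one: "{{1..n}} \<in> NC n" using n by (auto simp: NC_def intro: partition_on_space)
  have fin: "finite (NC n)"
    by (rule finite_subset[OF _ finitely_many_partition_on[of "{1..n}"]]) (auto simp: NC_def)
  have w: "map i (sorted_list_of_set {1..n}) = w"
    by (simp add: w_def flip: atLeastLessThanSuc_atLeastAtMost del: upt_Suc)
  have "(\<Sum>\<pi>\<in>NC n. \<Prod>B\<in>\<pi>. cumulant m (map i (sorted_list_of_set B))) =
      cumulant m w + (\<Sum>\<pi>\<in>NC n - {{{1..n}}}. \<Prod>B\<in>\<pi>. cumulant m (map i (sorted_list_of_set B)))"
    by (subst sum.remove[OF fin one]) (simp add: w del: One_nat_def)
  also have "(\<Sum>\<pi>\<in>NC n - {{{1..n}}}. \<Prod>B\<in>\<pi>. cumulant m (map i (sorted_list_of_set B))) =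
      (\<Sum>\<pi>\<in>NC n - {{{1..n}}}. \<Prod>B\<in>\<pi>. cumulant m (map (\<lambda>j. w ! (j - 1)) (sorted_list_of_set B)))"
    by (intro sum.cong prod.cong refl) (metis DiffD1 blk)
  also have "cumulant m w + \<dots> = m w"
    by (subst cumulant.simps) (simp add: len)
  finally show "m (map i [1..<n + 1]) = (\<Sum>\<pi>\<in>NC n. \<Prod>B\<in>\<pi>. cumulant m (map i (sorted_list_of_set B)))"
    by (simp add: w_def)
qed

end

theory Submission
  imports Defs
begin

text \<open>Let \<open>T r c\<close> be the expectation of the product of the entries \<open>(r j, c j)\<close> of the matrices. The
  unitary invariance, differentiated at the identity, gives linear relations between the \<open>T r c\<close>,
  which imply \<open>T r c = (\<Sum>\<sigma> | c = r \<circ> \<sigma>. F \<sigma>)\<close> as soon as \<open>N \<ge> k\<close>. Put \<open>x \<sigma> = N ^ (k - cyc \<sigma>) * F \<sigma>\<close>.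
  Then \<open>\<bbbE> m\<^sub>\<sigma>\<close> is the sum over all \<open>\<tau>\<close> of \<open>x \<tau>\<close> with the weight
  \<open>N ^ (cyc \<tau> + cyc (\<sigma> \<circ> inv \<tau>) - k - cyc \<sigma>)\<close>, and \<open>\<bbbE> m\<close> with index \<open>p\<^sup>c\<close> is, up to a factor tending to
  \<open>1\<close>, the sum over all \<open>\<sigma>\<close> finer than \<open>p\<close> of \<open>x \<sigma>\<close> with the weight \<open>N ^ (nc p + cyc \<sigma> - k - nc (p \<or> id))\<close>.
  Neither exponent is positive, because the number of vertices of a graph is at most the number of its
  edges plus that of its components. In the limit only the \<open>\<tau>\<close> on a geodesic from \<open>id\<close> to \<open>\<sigma>\<close>
  survive in the first sum, which determines the limits of the \<open>x \<tau>\<close>, and only \<open>Mb p\<close> survives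
  in the second one. For a full cycle \<open>\<sigma>\<close> the geodesics are the noncrossing partitions, whence
  the limit of \<open>x \<tau>\<close> is the product of the free cumulants over the cycles of \<open>\<tau>\<close>.\<close>

text \<open>The invariance enters through few unitaries only: normalized matrices
  \<open>1 + \<i> s H\<close> with \<open>H\<close> carried by a transposition or diagonal, and
  permutation matrices. No Haar integral is computed and no Weingarten function inverted. The price
  is that nothing is known in advance about the size of the \<open>F \<sigma>\<close>; it has to be
  extracted from the linear system for the moments. The power \<open>N ^ (k - cyc \<sigma>)\<close>
  is the one that gives this system the diagonal \<open>1\<close> while no weight grows.

  The factorization hypothesis concerns juxtaposed permutations, whereas a cumulant is attached to a
  cycle read from its least element. Bringing a permutation into juxtaposed form changes the point
  where a cycle starts; hence the cumulants must be shown to be invariant under rotation, and this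
  is where the trace property is used.

  Components of graphs are never defined: colourings count them. So one inequality serves both a
  pair of permutations and a permutation with a partition, and its equality case, the absence of
  flows, gives the uniqueness behind \<open>Mb\<close>.\<close>

unbundle no m_inv_syntax

section \<open>Colourings and forests\<close>

text \<open>In the graph whose vertices are the fibres of \<open>u\<close> and of \<open>v\<close>
  and whose edges are the points of \<open>A\<close>, these are the edge colourings constant on
  components, so there are \<open>N\<close> to the number of components of them. They stand in for
  the components throughout.\<close>

definition const_fns :: "nat \<Rightarrow> 'a set \<Rightarrow> ('a \<Rightarrow> 'b) \<Rightarrow> ('a \<Rightarrow> 'c) \<Rightarrow> ('a \<Rightarrow> nat) set" where
  "const_fns N A u v = {f \<in> A \<rightarrow>\<^sub>E {..<N}. \<forall>x\<in>A. \<forall>y\<in>A. u x = u y \<or> v x = v y \<longrightarrow> f x = f y}"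

text \<open>In the same graph, the edge \<open>a\<close> ends in a leaf on the side of
  \<open>u\<close>.\<close>

definition singleton_fiber :: "'a set \<Rightarrow> ('a \<Rightarrow> 'b) \<Rightarrow> 'a \<Rightarrow> bool" where
  "singleton_fiber A u a \<longleftrightarrow> a \<in> A \<and> (\<forall>x\<in>A. u x = u a \<longrightarrow> x = a)"

lemma singleton_fiberD: "singleton_fiber A u a \<Longrightarrow> x \<in> A \<Longrightarrow> u x = u a \<Longrightarrow> x = a"
  unfolding singleton_fiber_def by blast

lemma singleton_fiber_in: "singleton_fiber A u a \<Longrightarrow> a \<in> A"
  unfolding singleton_fiber_def by blast

lemma const_fnsD:
  assumes "f \<in> const_fns N A u v" "x \<in> A" "y \<in> A" "u x = u y \<or> v x = v y"
  shows "f x = f y"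
  using assms unfolding const_fns_def by blast

lemma const_fns_PiE: "f \<in> const_fns N A u v \<Longrightarrow> f \<in> A \<rightarrow>\<^sub>E {..<N}"
  unfolding const_fns_def by blast

lemma const_fns_outside: "f \<in> const_fns N A u v \<Longrightarrow> x \<notin> A \<Longrightarrow> f x = undefined"
  by (rule PiE_arb[OF const_fns_PiE])

lemma finite_const_fns: "finite A \<Longrightarrow> finite (const_fns N A u v)"
  unfolding const_fns_def by (rule finite_subset[OF _ finite_PiE[of A "\<lambda>_. {..<N}"]]) auto

lemma const_fns_commute: "const_fns N A u v = const_fns N A v u"
  unfolding const_fns_def by auto

text \<open>Give weight 2 to the points that are alone in their fibre and weight 1 to the others;
  then every fibre weighs at least 2. Applied to vertices it bounds their number in a graph without
  leaves, applied to \<open>orbit\<close> it bounds the number of cycles by means of the fixed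
  points.\<close>

lemma card_image_le_singleton_fibers:
  assumes "finite A"
  shows "2 * card (u ` A) \<le> card A + card {a. singleton_fiber A u a}"
proof -
  let ?S = "{a. singleton_fiber A u a}"
  have "2 * card (u ` A) = (\<Sum>y\<in>u ` A. 2)" by simp
  also have "\<dots> \<le> (\<Sum>y\<in>u ` A. (\<Sum>x\<in>{x\<in>A. u x = y}. 1 + (if x \<in> ?S then 1 else 0)))"
  proof (rule sum_mono)
    fix y assume "y \<in> u ` A"
    then obtain a where a: "a \<in> A" "u a = y" by auto
    have fin: "finite {x\<in>A. u x = y}" using assms by auto
    show "2 \<le> (\<Sum>x\<in>{x\<in>A. u x = y}. 1 + (if x \<in> ?S then 1 else 0::nat))"
    proof (cases "a \<in> ?S")
      case True
      have "x = a" if "x \<in> A" "u x = y" for x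
        using True that unfolding singleton_fiber_def mem_Collect_eq a(2) by simp
      then have "{x\<in>A. u x = y} = {a}" using a by blast
      then show ?thesis using True by simp
    next
      case False
      then obtain b where b: "b \<in> A" "u b = y" "b \<noteq> a" using a by (auto simp: singleton_fiber_def)
      have "2 = (\<Sum>x\<in>{a,b}. 1::nat)" using b by simp
      also have "\<dots> \<le> (\<Sum>x\<in>{x\<in>A. u x = y}. 1)" using a b fin by (intro sum_mono2) auto
      also have "\<dots> \<le> (\<Sum>x\<in>{x\<in>A. u x = y}. 1 + (if x \<in> ?S then 1 else 0))" by (intro sum_mono) auto
      finally show ?thesis .
    qed
  qed
  also have "\<dots> = (\<Sum>x\<in>A. 1 + (if x \<in> ?S then 1 else 0))"
    by (rule sum.image_gen[OF assms, symmetric])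
  also have "\<dots> = card A + (\<Sum>x\<in>A. if x \<in> ?S then 1 else 0)" by (simp only: sum.distrib card_eq_sum)
  also have "(\<Sum>x\<in>A. if x \<in> ?S then 1 else 0) = card (A \<inter> ?S)"
    using assms by (simp add: sum.If_cases)
  also have "A \<inter> ?S = ?S" by (auto simp: singleton_fiber_def)
  finally show ?thesis .
qed

lemma card_image_singleton_fiber:
  assumes "finite A" "singleton_fiber A u a"
  shows "card (u ` A) = Suc (card (u ` (A - {a})))"
proof -
  have "a \<in> A" by (rule singleton_fiber_in[OF assms(2)])
  then have "u ` A = insert (u a) (u ` (A - {a}))" by auto
  moreover have "u a \<notin> u ` (A - {a})"
  proof
    assume "u a \<in> u ` (A - {a})"
    then obtain x where "x \<in> A" "x \<noteq> a" "u x = u a" by (metis Diff_iff image_iff singletonI)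
    then show False using singleton_fiberD[OF assms(2)] by blast
  qed
  ultimately show ?thesis using assms(1) by simp
qed

lemma card_image_no_singleton_fiber:
  assumes "a \<in> A" "\<not> singleton_fiber A u a"
  shows "card (u ` A) = card (u ` (A - {a}))"
proof -
  obtain b where "b \<in> A" "u b = u a" "b \<noteq> a" using assms by (auto simp: singleton_fiber_def)
  then have "u a \<in> u ` (A - {a})" by (metis Diff_iff image_eqI singletonD)
  then have "u ` A = u ` (A - {a})" using assms(1) by (metis image_insert insert_Diff insert_absorb)
  then show ?thesis by simp
qed

lemma const_fns_restrict:
  assumes "f \<in> const_fns N A u v"
  shows "f(a := undefined) \<in> const_fns N (A - {a}) u v"
  unfolding const_fns_def mem_Collect_eq
proof (intro conjI ballI impI)
  have "f \<in> A \<rightarrow>\<^sub>E {..<N}" by (rule const_fns_PiE[OF assms])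
  then show "f(a := undefined) \<in> A - {a} \<rightarrow>\<^sub>E {..<N}" by (auto simp: PiE_iff extensional_def)
  fix x y assume xy: "x \<in> A - {a}" "y \<in> A - {a}" "u x = u y \<or> v x = v y"
  have "f x = f y" by (rule const_fnsD[OF assms]) (use xy in auto)
  then show "(f(a := undefined)) x = (f(a := undefined)) y" using xy(1,2) by simp
qed

text \<open>An isolated edge is a component of its own, so its colour is free.\<close>

lemma card_const_fns_both_singleton:
  assumes fin: "finite A" and a: "singleton_fiber A u a" "singleton_fiber A v a"
  shows "card (const_fns N A u v) = N * card (const_fns N (A - {a}) u v)"
proof -
  have aA: "a \<in> A" by (rule singleton_fiber_in[OF a(1)])
  have "bij_betw (\<lambda>(c, f). f(a := c)) ({..<N} \<times> const_fns N (A - {a}) u v) (const_fns N A u v)"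
  proof (rule bij_betw_byWitness[where f' = "\<lambda>f. (f a, f(a := undefined))"])
    show "\<forall>x\<in>{..<N} \<times> const_fns N (A - {a}) u v.
        ((case x of (c, f) \<Rightarrow> f(a := c)) a, (case x of (c, f) \<Rightarrow> f(a := c))(a := undefined)) = x"
      by (clarsimp simp: const_fns_outside[where x = a] fun_upd_idem)
    show "\<forall>f\<in>const_fns N A u v. (case (f a, f(a := undefined)) of (c, f) \<Rightarrow> f(a := c)) = f" by auto
    show "(\<lambda>(c, f). f(a := c)) ` ({..<N} \<times> const_fns N (A - {a}) u v) \<subseteq> const_fns N A u v"
    proof (rule image_subsetI)
      fix z assume z: "z \<in> {..<N} \<times> const_fns N (A - {a}) u v"
      define c f where "c = fst z" and "f = snd z"
      have c: "c \<in> {..<N}" and f: "f \<in> const_fns N (A - {a}) u v" using z by (auto simp: c_def f_def)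
      have "f(a := c) \<in> const_fns N A u v"
        unfolding const_fns_def mem_Collect_eq
      proof (intro conjI ballI impI)
        have "f \<in> (A - {a}) \<rightarrow>\<^sub>E {..<N}" by (rule const_fns_PiE[OF f])
        then show "f(a := c) \<in> A \<rightarrow>\<^sub>E {..<N}" using c aA by (auto simp: PiE_iff extensional_def)
        fix x y assume xy: "x \<in> A" "y \<in> A" "u x = u y \<or> v x = v y"
        have "x = a \<longleftrightarrow> y = a" using xy singleton_fiberD[OF a(1)] singleton_fiberD[OF a(2)] by metis
        then show "(f(a := c)) x = (f(a := c)) y" using const_fnsD[OF f _ _ xy(3)] xy(1,2) by auto
      qed
      then show "(case z of (c, f) \<Rightarrow> f(a := c)) \<in> const_fns N A u v" by (simp add: c_def f_def split_beta)
    qed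
    show "(\<lambda>f. (f a, f(a := undefined))) ` const_fns N A u v \<subseteq> {..<N} \<times> const_fns N (A - {a}) u v"
    proof (rule image_subsetI)
      fix f assume f: "f \<in> const_fns N A u v"
      show "(f a, f(a := undefined)) \<in> {..<N} \<times> const_fns N (A - {a}) u v"
        using const_fns_restrict[OF f] const_fns_PiE[OF f] aA by auto
    qed
  qed
  from bij_betw_same_card[OF this] show ?thesis by (simp add: card_cartesian_product)
qed

text \<open>A pendant edge adds no component: a second point \<open>b\<close> in the
  \<open>v\<close>-fibre of \<open>a\<close> dictates its colour.\<close>

lemma card_const_fns_one_singleton:
  assumes a: "singleton_fiber A u a" "\<not> singleton_fiber A v a"
  shows "card (const_fns N A u v) = card (const_fns N (A - {a}) u v)"
proof -
  have aA: "a \<in> A" by (rule singleton_fiber_in[OF a(1)])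
  obtain b where b: "b \<in> A" "v b = v a" "b \<noteq> a" using a(2) aA unfolding singleton_fiber_def by blast
  have "bij_betw (\<lambda>f. f(a := f b)) (const_fns N (A - {a}) u v) (const_fns N A u v)"
  proof (rule bij_betw_byWitness[where f' = "\<lambda>f. f(a := undefined)"])
    show "\<forall>f\<in>const_fns N (A - {a}) u v. (f(a := f b))(a := undefined) = f"
      by (clarsimp simp: const_fns_outside[where x = a] fun_upd_idem)
    show "\<forall>f\<in>const_fns N A u v. (f(a := undefined))(a := (f(a := undefined)) b) = f"
    proof
      fix f assume "f \<in> const_fns N A u v"
      then have "f a = f b" using aA b unfolding const_fns_def mem_Collect_eq by metis
      then show "(f(a := undefined))(a := (f(a := undefined)) b) = f" using b(3) by (simp add: fun_eq_iff)
    qed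
    show "(\<lambda>f. f(a := f b)) ` const_fns N (A - {a}) u v \<subseteq> const_fns N A u v"
    proof (rule image_subsetI)
      fix f assume f: "f \<in> const_fns N (A - {a}) u v"
      have "f(a := f b) \<in> A \<rightarrow>\<^sub>E {..<N}"
      proof (rule PiE_I)
        have "f \<in> (A - {a}) \<rightarrow>\<^sub>E {..<N}" using f by (simp add: const_fns_def)
        then show "(f(a := f b)) x \<in> {..<N}" if "x \<in> A" for x using that b by (cases "x = a") auto
        show "(f(a := f b)) x = undefined" if "x \<notin> A" for x
          using that aA PiE_arb[OF \<open>f \<in> (A - {a}) \<rightarrow>\<^sub>E {..<N}\<close>] by auto
      qed
      moreover have "(f(a := f b)) x = (f(a := f b)) y" if "x \<in> A" "y \<in> A" "u x = u y \<or> v x = v y" for x y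
      proof -
        have *: "f x = f y" if "x \<in> A" "y \<in> A" "x \<noteq> a" "y \<noteq> a" "u x = u y \<or> v x = v y" for x y
          by (rule const_fnsD[OF f]) (use that in auto)
        have ua: "x = a" if "x \<in> A" "u x = u a" for x by (rule singleton_fiberD[OF a(1) that])
        consider "x = y" | "x = a" "y \<noteq> a" | "x \<noteq> a" "y = a" | "x \<noteq> a" "y \<noteq> a" by blast
        then show ?thesis
        proof cases
          case 2
          then have "v b = v y" using that(2,3) ua[of y] b(2) by metis
          then have "f b = f y" using *[of b y] 2 b(1,3) that(2) by blast
          then show ?thesis using 2 by simp
        next
          case 3
          then have "v x = v b" using that(1,3) ua[of x] b(2) by metis
          then have "f x = f b" using *[of x b] 3 b(1,3) that(1) by blast
          then show ?thesis using 3 by simp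
        next
          case 4
          then have "f x = f y" using *[OF that(1,2) _ _ that(3)] by blast
          then show ?thesis using 4 by simp
        qed simp
      qed
      ultimately show "f(a := f b) \<in> const_fns N A u v" unfolding const_fns_def by blast
    qed
    show "(\<lambda>f. f(a := undefined)) ` const_fns N A u v \<subseteq> const_fns N (A - {a}) u v"
      by (rule image_subsetI) (rule const_fns_restrict)
  qed
  from bij_betw_same_card[OF this] show ?thesis by simp
qed

text \<open>The fibres of \<open>u\<close> and \<open>v\<close> are the vertices of a bipartite graph whose edges are the points of
  \<open>A\<close>. The inequality says that its cyclomatic number is nonnegative (a colouring by \<open>2\<close> colours
  counts the components), and in the equality case the graph is a forest, which carries no nonzero flow.
  The induction removes a leaf; without leaves the vertices are at most as many as the edges.\<close>

lemma forest_inequality: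
  assumes "finite A"
  shows "2 ^ (card (u ` A) + card (v ` A)) \<le> 2 ^ card A * card (const_fns 2 A u v) \<and>
    (2 ^ (card (u ` A) + card (v ` A)) = 2 ^ card A * card (const_fns 2 A u v) \<longrightarrow>
      (\<forall>h :: 'a \<Rightarrow> int. (\<forall>a\<in>A. (\<Sum>x\<in>{x\<in>A. u x = u a}. h x) = 0) \<and>
         (\<forall>a\<in>A. (\<Sum>x\<in>{x\<in>A. v x = v a}. h x) = 0) \<longrightarrow> (\<forall>a\<in>A. h a = 0)))"
  using assms
proof (induction "card A" arbitrary: A u v rule: less_induct)
  case less
  define P where "P = (\<lambda>A (u :: 'a \<Rightarrow> 'b) (v :: 'a \<Rightarrow> 'c). 2 ^ (card (u ` A) + card (v ` A)) \<le> 2 ^ card A * card (const_fns 2 A u v) \<and>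
    (2 ^ (card (u ` A) + card (v ` A)) = 2 ^ card A * card (const_fns 2 A u v) \<longrightarrow>
      (\<forall>h :: 'a \<Rightarrow> int. (\<forall>a\<in>A. (\<Sum>x\<in>{x\<in>A. u x = u a}. h x) = 0) \<and>
         (\<forall>a\<in>A. (\<Sum>x\<in>{x\<in>A. v x = v a}. h x) = 0) \<longrightarrow> (\<forall>a\<in>A. h a = 0))))"
  consider a where "singleton_fiber A u a \<or> singleton_fiber A v a" |
    "\<And>a. \<not> singleton_fiber A u a" "\<And>a. \<not> singleton_fiber A v a" by blast
  then have "P A u v"
  proof cases
    case (1 a)
    let ?A = "A - {a}"
    have aA: "a \<in> A" using 1 singleton_fiber_in[of A u] singleton_fiber_in[of A v] by blast
    have cA: "card A = Suc (card ?A)" using aA less.prems by (metis card_Suc_Diff1)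
    have IH: "P ?A u v" unfolding P_def by (rule less.hyps) (use cA less.prems in auto)
    define m where "m = card (const_fns 2 A u v)"
    define m' where "m' = card (const_fns 2 ?A u v)"
    \<comment> \<open>Removing the edge divides both sides of the inequality by the same factor, 4
      for an isolated edge and 2 for a pendant one. The relation is cross-multiplied to stay within
      the natural numbers.\<close>
    have num: "2 ^ (card (u ` A) + card (v ` A)) * (2 ^ card ?A * m') =
        2 ^ (card (u ` ?A) + card (v ` ?A)) * (2 ^ card A * m)"
    proof -
      consider "singleton_fiber A u a" "singleton_fiber A v a" | "singleton_fiber A u a" "\<not> singleton_fiber A v a"
        | "\<not> singleton_fiber A u a" "singleton_fiber A v a" using 1 by blast
      then show ?thesis
      proof cases
        case 1
        then show ?thesis using card_const_fns_both_singleton[OF less.prems, of u a v 2]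
          by (simp add: m_def m'_def cA card_image_singleton_fiber[OF less.prems])
      next
        case 2
        then show ?thesis using card_const_fns_one_singleton[of A u a v 2]
          by (simp add: m_def m'_def cA card_image_singleton_fiber[OF less.prems]
              card_image_no_singleton_fiber[OF aA])
      next
        case 3
        then show ?thesis using card_const_fns_one_singleton[of A v a u 2]
          by (simp add: m_def m'_def cA card_image_singleton_fiber[OF less.prems]
              card_image_no_singleton_fiber[OF aA] const_fns_commute[of _ _ u])
      qed
    qed
    define X where "X = (2::nat) ^ (card (u ` A) + card (v ` A))"
    define X' where "X' = (2::nat) ^ (card (u ` ?A) + card (v ` ?A))"
    have X0: "X > 0" "X' > 0" by (auto simp: X_def X'_def)
    have IH1: "X' \<le> 2 ^ card ?A * m'" using IH unfolding P_def X'_def m'_def by auto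
    have num': "X * (2 ^ card ?A * m') = X' * (2 ^ card A * m)" using num by (simp add: X_def X'_def)
    have le: "X \<le> 2 ^ card A * m"
    proof -
      have "X * X' \<le> X * (2 ^ card ?A * m')" using IH1 by simp
      also have "\<dots> = X' * (2 ^ card A * m)" by (rule num')
      finally show ?thesis using X0 by (simp add: mult.commute)
    qed
    have eq: "X' = 2 ^ card ?A * m'" if "X = 2 ^ card A * m"
    proof -
      have "X * (2 ^ card ?A * m') = X * X'" using num' that by (simp only: mult.commute)
      then show ?thesis using X0 by (metis mult_left_cancel less_numeral_extra(3))
    qed
    have zero: "\<forall>b\<in>A. h b = 0" if eqX: "X = 2 ^ card A * m"
      and hu: "\<forall>a\<in>A. (\<Sum>x\<in>{x\<in>A. u x = u a}. h x) = 0"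
      and hv: "\<forall>a\<in>A. (\<Sum>x\<in>{x\<in>A. v x = v a}. h x) = 0" for h :: "'a \<Rightarrow> int"
    proof -
      \<comment> \<open>At the leaf the flow condition is a sum with the single term
        \<open>h a\<close>. Once it vanishes, \<open>h\<close> restricts to a flow on the remaining
        edges.\<close>
      have ha: "h a = 0"
      proof -
        have "{x\<in>A. u x = u a} = {a} \<or> {x\<in>A. v x = v a} = {a}"
          using 1 aA singleton_fiberD[of A u a] singleton_fiberD[of A v a] by blast
        then show ?thesis using bspec[OF hu aA] bspec[OF hv aA] by auto
      qed
      have red: "(\<Sum>x\<in>{x\<in>?A. w x = w b}. h x) = (\<Sum>x\<in>{x\<in>A. w x = w b}. h x)" for w :: "'a \<Rightarrow> 'd" and b
        using ha less.prems by (intro sum.mono_neutral_left) auto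
      have "\<forall>b\<in>?A. h b = 0"
      proof -
        have hu': "\<forall>b\<in>?A. (\<Sum>x\<in>{x\<in>?A. u x = u b}. h x) = 0"
          and hv': "\<forall>b\<in>?A. (\<Sum>x\<in>{x\<in>?A. v x = v b}. h x) = 0"
          unfolding red using hu hv by blast+
        have "2 ^ (card (u ` ?A) + card (v ` ?A)) = 2 ^ card ?A * card (const_fns 2 ?A u v)"
          using eq[OF eqX] unfolding X'_def m'_def .
        then show ?thesis using IH hu' hv' unfolding P_def by blast
      qed
      then show ?thesis using ha by auto
    qed
    show ?thesis unfolding P_def using le zero by (auto simp: X_def m_def)
  next
    case 2
    have "2 * card (u ` A) \<le> card A" using card_image_le_singleton_fibers[OF less.prems, of u] 2(1) by simp
    moreover have "2 * card (v ` A) \<le> card A" using card_image_le_singleton_fibers[OF less.prems, of v] 2(2) by simp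
    ultimately have le: "card (u ` A) + card (v ` A) \<le> card A" by simp
    show ?thesis
    proof (cases "A = {}")
      case True
      then show ?thesis by (simp add: P_def const_fns_def)
    next
      case False
      then obtain a where a: "a \<in> A" by auto
      let ?c = "\<lambda>c. \<lambda>x\<in>A. c :: nat"
      \<comment> \<open>Already the two constant colourings make the inequality strict, so the
        equality clause is vacuous here: a nonempty graph without leaves is not a forest.\<close>
      have "?c 0 \<noteq> ?c 1" using a by (metis restrict_apply' zero_neq_one)
      then have "2 = card {?c 0, ?c 1}" by simp
      also have "\<dots> \<le> card (const_fns 2 A u v)"
        by (rule card_mono[OF finite_const_fns[OF less.prems]]) (auto simp: const_fns_def)
      finally have two: "2 \<le> card (const_fns 2 A u v)" .
      have "(2::nat) ^ (card (u ` A) + card (v ` A)) \<le> 2 ^ card A" using le by (intro power_increasing) auto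
      also have "\<dots> < 2 ^ card A * 2" by simp
      also have "\<dots> \<le> 2 ^ card A * card (const_fns 2 A u v)" using two by simp
      finally show ?thesis by (simp add: P_def)
    qed
  qed
  then show ?case unfolding P_def .
qed

section \<open>Cycles and geodesics of permutations\<close>

definition cyc :: "'a set \<Rightarrow> ('a \<Rightarrow> 'a) \<Rightarrow> nat" where
  "cyc A f = card (orbit f ` A)"

text \<open>The first-return map to the complement of \<open>a\<close>, with \<open>a\<close> turned
  into a fixed point so that the result permutes \<open>A - {a}\<close> in the sense of
  \<open>permutes\<close>.\<close>

definition skip :: "'a \<Rightarrow> ('a \<Rightarrow> 'a) \<Rightarrow> 'a \<Rightarrow> 'a" where
  "skip a f x = (if x = a then a else if f x = a then f a else f x)"

lemma permutes_self_in_orbit: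
  assumes "f permutes A" "finite A"
  shows "x \<in> orbit f x"
  by (rule permutation_self_in_orbit) (use assms permutation_permutes in blast)

lemma permutes_orbit_eq:
  assumes "f permutes A" "finite A" "y \<in> orbit f x"
  shows "orbit f y = orbit f x"
  using orbit_cyclic_eq3[OF cyclic_on_orbit[OF assms(1,2)] assms(3)] .

lemma permutes_orbit_apply:
  assumes "f permutes A" "finite A"
  shows "orbit f (f x) = orbit f x"
  by (rule permutes_orbit_eq[OF assms orbit.base])

lemma permutes_orbit_eq_iff:
  assumes "f permutes A" "finite A"
  shows "orbit f x = orbit f y \<longleftrightarrow> y \<in> orbit f x"
  using permutes_orbit_eq[OF assms] permutes_self_in_orbit[OF assms] by blast

lemma skip_permutes:
  assumes "f permutes A" "a \<in> A"
  shows "skip a f permutes (A - {a})"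
proof -
  have inj: "f x = f y \<longleftrightarrow> x = y" for x y using permutes_inj[OF assms(1)] by (auto dest: injD)
  have out: "f x = x" if "x \<notin> A" for x using permutes_not_in[OF assms(1) that] .
  have "\<exists>!x. skip a f x = y" for y
  proof (cases "y = a")
    case True
    then show ?thesis by (auto simp: skip_def split: if_splits) (metis inj)+
  next
    case False
    obtain x where x: "f x = y" using permutes_surj[OF assms(1)] by (metis surjD)
    show ?thesis
    proof (cases "x = a")
      case True
      obtain z where z: "f z = a" using permutes_surj[OF assms(1)] by (metis surjD)
      have "skip a f z = y" using True False x z by (auto simp: skip_def)
      moreover have "w = z" if "skip a f w = y" for w
        using that True False x z inj by (auto simp: skip_def split: if_splits)
      ultimately show ?thesis by blast
    next
      case F: False
      have "skip a f x = y" using F False x by (auto simp: skip_def)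
      moreover have "w = x" if "skip a f w = y" for w
        using that F False x inj by (auto simp: skip_def split: if_splits)
      ultimately show ?thesis by blast
    qed
  qed
  moreover have "skip a f x = x" if "x \<notin> A - {a}" for x
    using out[of x] that by (auto simp: skip_def)
  ultimately show ?thesis unfolding permutes_def by blast
qed

lemma orbit_skip:
  assumes "f permutes A" "finite A" "x \<noteq> a"
  shows "orbit (skip a f) x = orbit f x - {a}"
proof
  have inj: "f x = f y \<longleftrightarrow> x = y" for x y using permutes_inj[OF assms(1)] by (auto dest: injD)
  show "orbit (skip a f) x \<subseteq> orbit f x - {a}"
  proof
    fix y assume "y \<in> orbit (skip a f) x"
    then show "y \<in> orbit f x - {a}"
    proof induction
      case base
      show ?case using assms(3) inj[of x a] orbit.base[of f x] orbit.step[OF orbit.base[of f x]]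
        by (auto simp: skip_def)
    next
      case (step y)
      then show ?case using inj[of y a] orbit.step[of y f x] orbit.step[OF orbit.step[of y f x]]
        by (auto simp: skip_def)
    qed
  qed
  show "orbit f x - {a} \<subseteq> orbit (skip a f) x"
  proof -
    \<comment> \<open>The orbit of \<open>f\<close> may pass through \<open>a\<close>, which the
      shortened orbit does not see; at \<open>a\<close> the invariant therefore looks one step
      ahead.\<close>
    have "(y \<noteq> a \<longrightarrow> y \<in> orbit (skip a f) x) \<and> (y = a \<longrightarrow> f a = a \<or> f a \<in> orbit (skip a f) x)"
      if "y \<in> orbit f x" for y
      using that
    proof induction
      case base
      show ?case using orbit.base[of "skip a f" x] assms(3)
        by (auto simp: skip_def[of a f x] split: if_splits)
    next
      case (step y)
      then show ?case using orbit.step[of y "skip a f" x]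
        by (auto simp: skip_def[of a f y] split: if_splits)
    qed
    then show ?thesis by blast
  qed
qed

lemma cyc_skip:
  assumes "f permutes A" "finite A" "a \<in> A"
  shows "cyc A f = cyc (A - {a}) (skip a f) + (if f a = a then 1 else 0)"
proof -
  have orb: "orbit (skip a f) ` (A - {a}) = (\<lambda>C. C - {a}) ` orbit f ` (A - {a})"
    using orbit_skip[OF assms(1,2)] by (auto simp: image_image)
  show ?thesis
  proof (cases "f a = a")
    case True
    have a: "orbit f a = {a}" using True orbit_eq_singleton_iff by metis
    have no: "a \<notin> orbit f x" if "x \<noteq> a" for x
      using permutes_orbit_eq[OF assms(1,2), of a x] permutes_self_in_orbit[OF assms(1,2), of x] a that by auto
    have "orbit (skip a f) ` (A - {a}) = orbit f ` (A - {a})"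
      using orbit_skip[OF assms(1,2)] no by (intro image_cong) auto
    moreover have "orbit f ` A = insert {a} (orbit f ` (A - {a}))" using a assms(3) by auto
    moreover have "{a} \<notin> orbit f ` (A - {a})"
      using permutes_self_in_orbit[OF assms(1,2)] by fastforce
    ultimately show ?thesis using True assms(2) by (simp add: cyc_def)
  next
    case False
    have fa: "f a \<in> A" using assms(3) by (simp add: permutes_in_image[OF assms(1)])
    have "orbit f a = orbit f (f a)" using permutes_orbit_apply[OF assms(1,2)] by simp
    then have img: "orbit f ` A = orbit f ` (A - {a})" using fa False assms(3) by blast
    have "inj_on (\<lambda>C. C - {a}) (orbit f ` (A - {a}))"
    proof (rule inj_onI)
      fix C D assume C: "C \<in> orbit f ` (A - {a})" and D: "D \<in> orbit f ` (A - {a})" and eq: "C - {a} = D - {a}"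
      then obtain x y where xy: "x \<noteq> a" "C = orbit f x" "D = orbit f y" by blast
      then have "x \<in> orbit f y" using permutes_self_in_orbit[OF assms(1,2), of x] eq by blast
      then show "C = D" unfolding xy by (rule permutes_orbit_eq[OF assms(1,2)])
    qed
    then show ?thesis using orb img False by (simp add: cyc_def card_image)
  qed
qed

text \<open>Geodesics from the identity to \<open>\<sigma>\<close> in the Cayley graph of the transpositions.\<close>

definition geo :: "'a set \<Rightarrow> ('a \<Rightarrow> 'a) \<Rightarrow> ('a \<Rightarrow> 'a) \<Rightarrow> bool" where
  "geo A \<sigma> \<tau> \<longleftrightarrow> \<tau> permutes A \<and> cyc A \<tau> + cyc A (\<sigma> \<circ> inv \<tau>) = card A + cyc A \<sigma>"

lemma skip_comp:
  assumes "f permutes A" "g permutes A" "f a = a \<or> g a = a"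
  shows "skip a (f \<circ> g) = skip a f \<circ> skip a g"
proof -
  have f: "f x = f y \<longleftrightarrow> x = y" and g: "g x = g y \<longleftrightarrow> x = y" for x y
    using permutes_inj[OF assms(1)] permutes_inj[OF assms(2)] by (auto dest: injD)
  show ?thesis
  proof
    fix x
    show "skip a (f \<circ> g) x = (skip a f \<circ> skip a g) x"
      using assms(3) f[of "g x" a] g[of x a] f[of "g a" a] g[of a a]
      by (cases "x = a"; cases "g x = a"; cases "g a = a"; cases "f (g x) = a") (auto simp: skip_def)
  qed
qed

lemma comp_inv_eq_iff:
  assumes "\<tau> permutes A"
  shows "\<sigma> \<circ> inv \<tau> = \<rho> \<longleftrightarrow> \<sigma> = \<rho> \<circ> \<tau>"
  using permutes_inv_o[OF assms] by (auto simp: comp_assoc)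

text \<open>One of \<open>\<tau>\<close> and \<open>\<rho> = \<sigma> \<circ> inv \<tau>\<close>
  fixes \<open>a\<close>, so deleting \<open>a\<close> costs the left side of the geodesic equation
  one cycle, or two if both fix \<open>a\<close>. On the right it costs one point, and in the second
  case also one cycle of \<open>\<sigma>\<close>.\<close>

lemma geo_skip_iff:
  assumes A: "finite A" "a \<in> A" and \<sigma>: "\<sigma> permutes A" and \<tau>: "\<tau> permutes A"
    and fixd: "\<tau> a = a \<or> \<sigma> (inv \<tau> a) = a"
  shows "geo (A - {a}) (skip a \<sigma>) (skip a \<tau>) \<longleftrightarrow> geo A \<sigma> \<tau>"
proof -
  define \<rho> where "\<rho> = \<sigma> \<circ> inv \<tau>"
  have \<rho>: "\<rho> permutes A" unfolding \<rho>_def by (rule permutes_compose[OF permutes_inv[OF \<tau>] \<sigma>])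
  have \<sigma>_eq: "\<sigma> = \<rho> \<circ> \<tau>" using comp_inv_eq_iff[OF \<tau>] \<rho>_def by metis
  have fix': "\<tau> a = a \<or> \<rho> a = a" using fixd by (simp add: \<rho>_def)
  have sk: "skip a \<sigma> = skip a \<rho> \<circ> skip a \<tau>"
    unfolding \<sigma>_eq by (rule skip_comp[OF \<rho> \<tau>]) (use fix' in blast)
  have "skip a \<sigma> \<circ> inv (skip a \<tau>) = skip a \<rho>"
    using sk comp_inv_eq_iff[OF skip_permutes[OF \<tau> A(2)]] by metis
  moreover have "cyc A \<sigma> = cyc (A - {a}) (skip a \<sigma>) + (if \<tau> a = a \<and> \<rho> a = a then 1 else 0)"
  proof -
    have "\<sigma> a = a \<longleftrightarrow> \<tau> a = a \<and> \<rho> a = a"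
      using fix' permutes_inj[OF \<rho>] unfolding \<sigma>_eq comp_def by (metis injD)
    then show ?thesis using cyc_skip[OF \<sigma> A] by simp
  qed
  moreover have "card A = Suc (card (A - {a}))" using A by (metis card_Suc_Diff1)
  ultimately show ?thesis
    using cyc_skip[OF \<tau> A] cyc_skip[OF \<rho> A] fix' \<tau> skip_permutes[OF \<tau> A(2)]
    by (auto simp: geo_def \<rho>_def[symmetric] simp del: comp_apply)
qed

lemma two_cyc_le:
  assumes "f permutes A" "finite A"
  shows "2 * cyc A f \<le> card A + card {a\<in>A. f a = a}"
proof -
  have "{a. singleton_fiber A (orbit f) a} \<subseteq> {a\<in>A. f a = a}"
  proof clarify
    fix a assume a: "singleton_fiber A (orbit f) a"
    have aA: "a \<in> A" by (rule singleton_fiber_in[OF a])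
    then have "f a \<in> A" by (simp add: permutes_in_image[OF assms(1)])
    then show "a \<in> A \<and> f a = a" using singleton_fiberD[OF a] permutes_orbit_apply[OF assms] aA by blast
  qed
  then have "card {a. singleton_fiber A (orbit f) a} \<le> card {a\<in>A. f a = a}"
    using assms(2) by (intro card_mono) auto
  then show ?thesis using card_image_le_singleton_fibers[OF assms(2), of "orbit f"] by (simp add: cyc_def)
qed

lemma cyc_pos: "finite A \<Longrightarrow> A \<noteq> {} \<Longrightarrow> cyc A f > 0"
  by (simp add: cyc_def card_gt_0_iff)

lemma const_on_orbit:
  assumes "\<And>x. x \<in> A \<Longrightarrow> f (\<sigma> x) = f x" "\<sigma> permutes A" "x \<in> A" "y \<in> orbit \<sigma> x"
  shows "f y = f x"
proof -
  have "y \<in> A \<and> f y = f x" using assms(4)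
  proof induction
    case base then show ?case using assms(1,3) by (simp add: permutes_in_image[OF assms(2)])
  next
    case (step y) then show ?case using assms(1) by (simp add: permutes_in_image[OF assms(2)])
  qed
  then show ?thesis ..
qed

lemma partition_on_orbits:
  assumes "\<tau> permutes A" "finite A"
  shows "partition_on A (orbit \<tau> ` A)"
proof (rule partition_onI)
  show "\<Union> (orbit \<tau> ` A) = A"
    using permutes_orbit_subset[OF assms(1)] permutes_self_in_orbit[OF assms] by blast
  show "disjnt C D" if "C \<in> orbit \<tau> ` A" "D \<in> orbit \<tau> ` A" "C \<noteq> D" for C D
    using that permutes_orbit_eq[OF assms] unfolding disjnt_def by blast
  show "{} \<notin> orbit \<tau> ` A" using orbit_nonempty[of \<tau>] by (metis imageE)
qed

lemma card_const_on_partition: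
  assumes "partition_on A r" and fin: "finite A"
  shows "card {f \<in> A \<rightarrow>\<^sub>E {..<N::nat}. \<forall>B\<in>r. \<forall>x\<in>B. \<forall>y\<in>B. f x = f y} = N ^ card r"
proof -
  let ?F = "{f \<in> A \<rightarrow>\<^sub>E {..<N}. \<forall>B\<in>r. \<forall>x\<in>B. \<forall>y\<in>B. f x = f y}"
  define blk where "blk x = (THE B. B \<in> r \<and> x \<in> B)" for x
  have blk: "blk x = B" if "B \<in> r" "x \<in> B" for x B
    unfolding blk_def
  proof (rule the_equality)
    show "C = B" if "C \<in> r \<and> x \<in> C" for C
      using partition_block_eq[OF assms(1), of C B x] that \<open>B \<in> r\<close> \<open>x \<in> B\<close> by blast
  qed (use that in blast)
  have sub: "B \<subseteq> A" if "B \<in> r" for B using assms(1) that by (auto simp: partition_on_def)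
  have ex: "blk x \<in> r \<and> x \<in> blk x" if "x \<in> A" for x
  proof -
    have "x \<in> \<Union> r" using partition_onD1[OF assms(1)] that by simp
    then obtain B where "B \<in> r" "x \<in> B" by blast
    then show ?thesis using blk[of B x] by simp
  qed
  have rep: "(SOME x. x \<in> B) \<in> B" if "B \<in> r" for B
  proof -
    have "B \<noteq> {}" using that assms(1) by (auto simp: partition_on_def)
    then show ?thesis by (rule some_in_eq[THEN iffD2])
  qed
  have finr: "finite r" by (rule finite_elements[OF fin assms(1)])
  have "bij_betw (\<lambda>g. \<lambda>x\<in>A. g (blk x)) (r \<rightarrow>\<^sub>E {..<N}) ?F"
  proof (rule bij_betw_byWitness[where f' = "\<lambda>f. \<lambda>B\<in>r. f (SOME x. x \<in> B)"])
    show "\<forall>g\<in>r \<rightarrow>\<^sub>E {..<N}. (\<lambda>B\<in>r. (\<lambda>x\<in>A. g (blk x)) (SOME x. x \<in> B)) = g"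
    proof (intro ballI ext)
      fix g B assume g: "g \<in> r \<rightarrow>\<^sub>E {..<N}"
      show "(\<lambda>B\<in>r. (\<lambda>x\<in>A. g (blk x)) (SOME x. x \<in> B)) B = g B"
      proof (cases "B \<in> r")
        case True
        then show ?thesis using rep[OF True] sub[OF True] blk[OF True rep[OF True]] by auto
      next
        case False
        then show ?thesis using PiE_arb[OF g False] by simp
      qed
    qed
    show "\<forall>f\<in>?F. (\<lambda>x\<in>A. (\<lambda>B\<in>r. f (SOME x. x \<in> B)) (blk x)) = f"
    proof (intro ballI ext)
      fix f x assume f: "f \<in> ?F"
      show "(\<lambda>x\<in>A. (\<lambda>B\<in>r. f (SOME x. x \<in> B)) (blk x)) x = f x"
      proof (cases "x \<in> A")
        case True
        then have "f (SOME y. y \<in> blk x) = f x" using f ex[OF True] rep[of "blk x"] by blast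
        then show ?thesis using True ex[OF True] by simp
      next
        case False
        have "f \<in> A \<rightarrow>\<^sub>E {..<N}" using f by simp
        then show ?thesis using False PiE_arb[of f A] by simp
      qed
    qed
    show "(\<lambda>g. \<lambda>x\<in>A. g (blk x)) ` (r \<rightarrow>\<^sub>E {..<N}) \<subseteq> ?F"
    proof (rule image_subsetI, rule CollectI, rule conjI)
      fix g assume g: "g \<in> r \<rightarrow>\<^sub>E {..<N}"
      show "(\<lambda>x\<in>A. g (blk x)) \<in> A \<rightarrow>\<^sub>E {..<N}" using PiE_mem[OF g] ex by simp
      show "\<forall>B\<in>r. \<forall>x\<in>B. \<forall>y\<in>B. (\<lambda>x\<in>A. g (blk x)) x = (\<lambda>x\<in>A. g (blk x)) y"
      proof (intro ballI)
        fix B x y assume B: "B \<in> r" "x \<in> B" "y \<in> B"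
        then show "(\<lambda>x\<in>A. g (blk x)) x = (\<lambda>x\<in>A. g (blk x)) y"
          using blk[OF B(1,2)] blk[OF B(1,3)] sub[OF B(1)] by auto
      qed
    qed
    show "(\<lambda>f. \<lambda>B\<in>r. f (SOME x. x \<in> B)) ` ?F \<subseteq> r \<rightarrow>\<^sub>E {..<N}"
    proof (rule image_subsetI, rule PiE_I)
      fix f B assume f: "f \<in> ?F" and B: "B \<in> r"
      have "f \<in> A \<rightarrow>\<^sub>E {..<N}" using f by simp
      then show "(\<lambda>B\<in>r. f (SOME x. x \<in> B)) B \<in> {..<N}"
        using B rep[OF B] sub[OF B] by (auto simp: PiE_iff)
    qed simp
  qed
  from bij_betw_same_card[OF this] show ?thesis using finr by (simp add: card_funcsetE)
qed

lemma card_invariant_functions: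
  assumes \<sigma>: "\<sigma> permutes A" and fin: "finite A"
  shows "card {f \<in> A \<rightarrow>\<^sub>E {..<N::nat}. \<forall>x\<in>A. f (\<sigma> x) = f x} = N ^ cyc A \<sigma>"
proof -
  have "(\<forall>x\<in>A. f (\<sigma> x) = f x) \<longleftrightarrow> (\<forall>C\<in>orbit \<sigma> ` A. \<forall>x\<in>C. \<forall>y\<in>C. f x = f y)" for f :: "'a \<Rightarrow> nat"
  proof
    assume inv: "\<forall>x\<in>A. f (\<sigma> x) = f x"
    have "f y = f x" if "x \<in> A" "y \<in> orbit \<sigma> x" for x y
      using const_on_orbit[where f = f and A = A and \<sigma> = \<sigma>, OF _ \<sigma> that] inv by blast
    then show "\<forall>C\<in>orbit \<sigma> ` A. \<forall>x\<in>C. \<forall>y\<in>C. f x = f y" by (metis imageE)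
  next
    assume "\<forall>C\<in>orbit \<sigma> ` A. \<forall>x\<in>C. \<forall>y\<in>C. f x = f y"
    then show "\<forall>x\<in>A. f (\<sigma> x) = f x" using orbit.base[of \<sigma>] permutes_self_in_orbit[OF \<sigma> fin] by blast
  qed
  then show ?thesis
    using card_const_on_partition[OF partition_on_orbits[OF \<sigma> fin] fin, of N] by (simp add: cyc_def)
qed

text \<open>The colourings constant on the cycles of \<open>\<tau>\<close> and of \<open>\<sigma> \<circ> inv \<tau>\<close> are constant on those of \<open>\<sigma>\<close>,
  so the forest inequality contains the triangle inequality.\<close>

lemma cyc_triangle:
  assumes fin: "finite A" and \<sigma>: "\<sigma> permutes A" and \<tau>: "\<tau> permutes A"
  shows "cyc A \<tau> + cyc A (\<sigma> \<circ> inv \<tau>) \<le> card A + cyc A \<sigma>"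
    and "geo A \<sigma> \<tau> \<Longrightarrow> f \<in> A \<rightarrow>\<^sub>E {..<2::nat} \<Longrightarrow> (\<And>x. x \<in> A \<Longrightarrow> f (\<sigma> x) = f x) \<Longrightarrow> x \<in> A \<Longrightarrow> f (\<tau> x) = f x"
proof -
  define \<rho> where "\<rho> = \<sigma> \<circ> inv \<tau>"
  have \<rho>: "\<rho> permutes A" unfolding \<rho>_def by (rule permutes_compose[OF permutes_inv[OF \<tau>] \<sigma>])
  have \<sigma>_eq: "\<sigma> = \<rho> \<circ> \<tau>" using comp_inv_eq_iff[OF \<tau>] \<rho>_def by metis
  let ?C = "const_fns 2 A (orbit \<tau>) (orbit \<rho>)"
  let ?F = "{f \<in> A \<rightarrow>\<^sub>E {..<2::nat}. \<forall>x\<in>A. f (\<sigma> x) = f x}"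
  have \<tau>_inv: "f (\<tau> x) = f x" if "f \<in> ?C" "x \<in> A" for f x
    using const_fnsD[OF that(1), of "\<tau> x" x] that(2) permutes_in_image[OF \<tau>]
      permutes_orbit_apply[OF \<tau> fin] by auto
  have \<rho>_inv: "f (\<rho> x) = f x" if "f \<in> ?C" "x \<in> A" for f x
    using const_fnsD[OF that(1), of "\<rho> x" x] that(2) permutes_in_image[OF \<rho>]
      permutes_orbit_apply[OF \<rho> fin] by auto
  have CF: "?C \<subseteq> ?F"
  proof clarify
    fix f assume f: "f \<in> ?C"
    have "f (\<sigma> x) = f x" if "x \<in> A" for x
      using \<tau>_inv[OF f that] \<rho>_inv[OF f, of "\<tau> x"] that permutes_in_image[OF \<tau>] by (simp add: \<sigma>_eq)
    then show "f \<in> A \<rightarrow>\<^sub>E {..<2} \<and> (\<forall>x\<in>A. f (\<sigma> x) = f x)" using const_fns_PiE[OF f] by blast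
  qed
  have finF: "finite ?F" by (rule finite_subset[OF _ finite_PiE[of A "\<lambda>_. {..<2}"]]) (use fin in auto)
  have cF: "card ?F = 2 ^ cyc A \<sigma>" by (rule card_invariant_functions[OF \<sigma> fin])
  have le: "(2::nat) ^ (cyc A \<tau> + cyc A \<rho>) \<le> 2 ^ card A * card ?C"
    using forest_inequality[OF fin, of "orbit \<tau>" "orbit \<rho>"] by (simp add: cyc_def)
  have cC: "card ?C \<le> 2 ^ cyc A \<sigma>" using card_mono[OF finF CF] cF by simp
  have "(2::nat) ^ (cyc A \<tau> + cyc A \<rho>) \<le> 2 ^ card A * 2 ^ cyc A \<sigma>"
    using le cC by (meson le_trans mult_le_mono2)
  then have "(2::nat) ^ (cyc A \<tau> + cyc A \<rho>) \<le> 2 ^ (card A + cyc A \<sigma>)" by (simp add: power_add)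
  then show "cyc A \<tau> + cyc A (\<sigma> \<circ> inv \<tau>) \<le> card A + cyc A \<sigma>"
    unfolding \<rho>_def by (rule power_le_imp_le_exp[rotated]) simp
  assume geo: "geo A \<sigma> \<tau>" and f: "f \<in> A \<rightarrow>\<^sub>E {..<2::nat}" "\<And>x. x \<in> A \<Longrightarrow> f (\<sigma> x) = f x" and x: "x \<in> A"
  \<comment> \<open>On a geodesic the forest inequality turns into the reverse bound of the
    cardinalities, so every \<open>\<sigma>\<close>-invariant colouring is already constant on the
    cycles of \<open>\<tau>\<close>.\<close>
  have "(2::nat) ^ card A * 2 ^ cyc A \<sigma> \<le> 2 ^ card A * card ?C"
  proof -
    have "cyc A \<tau> + cyc A \<rho> = card A + cyc A \<sigma>" using geo by (simp add: geo_def \<rho>_def)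
    then show ?thesis using le by (simp only: power_add)
  qed
  then have "card ?F \<le> card ?C" using cF by simp
  then have "?C = ?F" by (rule card_seteq[OF finF CF])
  then have "f \<in> ?C" using f by blast
  then show "f (\<tau> x) = f x" using \<tau>_inv x by blast
qed

text \<open>The indicator of \<open>S\<close> is a \<open>\<sigma>\<close>-invariant 2-colouring. In
  effect the cycles of \<open>\<tau>\<close> refine those of \<open>\<sigma>\<close>.\<close>

lemma geo_preserves:
  assumes fin: "finite A" and \<sigma>: "\<sigma> permutes A" and geo: "geo A \<sigma> \<tau>" and S: "\<And>x. x \<in> A \<Longrightarrow> \<sigma> x \<in> S \<longleftrightarrow> x \<in> S"
    and x: "x \<in> A"
  shows "\<tau> x \<in> S \<longleftrightarrow> x \<in> S"
proof -
  have \<tau>: "\<tau> permutes A" using geo by (simp add: geo_def)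
  define f where "f = (\<lambda>x\<in>A. if x \<in> S then 1 else 0 :: nat)"
  have "f (\<tau> x) = f x"
    by (rule cyc_triangle(2)[OF fin \<sigma> \<tau> geo _ _ x]) (use S permutes_in_image[OF \<sigma>] in \<open>auto simp: f_def\<close>)
  then show ?thesis using x permutes_in_image[OF \<tau>, of x] by (auto simp: f_def split: if_splits)
qed

text \<open>Two permutations whose numbers of cycles add up to more than \<open>card A\<close> have fixed points.\<close>

lemma geo_fixed_point:
  assumes fin: "finite A" and \<sigma>: "\<sigma> permutes A" and geo: "geo A \<sigma> \<tau>" and ne: "A \<noteq> {}"
  obtains a where "a \<in> A" "\<tau> a = a" | a where "a \<in> A" "a \<noteq> m" "\<sigma> (inv \<tau> a) = a"
proof (cases "\<exists>a\<in>A. \<tau> a = a")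
  case False
  have \<tau>: "\<tau> permutes A" using geo by (simp add: geo_def)
  define \<rho> where "\<rho> = \<sigma> \<circ> inv \<tau>"
  have \<rho>: "\<rho> permutes A" unfolding \<rho>_def by (rule permutes_compose[OF permutes_inv[OF \<tau>] \<sigma>])
  have "{a\<in>A. \<tau> a = a} = {}" using False by blast
  then have "2 * cyc A \<tau> \<le> card A" using two_cyc_le[OF \<tau> fin] by (metis card.empty add_0_right)
  moreover have "cyc A \<tau> + cyc A \<rho> = card A + cyc A \<sigma>" using geo by (simp add: geo_def \<rho>_def)
  moreover have "cyc A \<sigma> > 0" by (rule cyc_pos[OF fin ne])
  \<comment> \<open>Without fixed points \<open>\<tau>\<close> has at most \<open>card A / 2\<close>
    cycles, which leaves more than half of \<open>card A\<close> to \<open>\<rho>\<close>. This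
    forces two fixed points of \<open>\<rho>\<close>, one of which avoids the prescribed
    \<open>m\<close>.\<close>
  ultimately have two: "2 \<le> card {a\<in>A. \<rho> a = a}" using two_cyc_le[OF \<rho> fin] by linarith
  have "\<not> {a\<in>A. \<rho> a = a} \<subseteq> {m}"
  proof
    assume "{a\<in>A. \<rho> a = a} \<subseteq> {m}"
    from card_mono[OF _ this] two show False by simp
  qed
  then show ?thesis using that(2) by (auto simp: \<rho>_def)
qed (use that(1) in blast)

text \<open>Each cycle is run through in increasing order: the first alternative is a step to the
  next larger point of the cycle, the second the return from its greatest to its least point (fixed
  points included).\<close>

definition incr_on :: "nat set \<Rightarrow> (nat \<Rightarrow> nat) \<Rightarrow> bool" where
  "incr_on A \<tau> \<longleftrightarrow> (\<forall>x\<in>A. \<forall>y\<in>orbit \<tau> x. x < \<tau> x \<and> (y \<le> x \<or> \<tau> x \<le> y) \<or> \<tau> x \<le> y \<and> y \<le> x)"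

definition noncrossing_on :: "nat set \<Rightarrow> (nat \<Rightarrow> nat) \<Rightarrow> bool" where
  "noncrossing_on A \<tau> \<longleftrightarrow> (\<forall>a\<in>A. \<forall>b\<in>A. \<forall>c\<in>orbit \<tau> a. \<forall>d\<in>orbit \<tau> b.
     a < b \<and> b < c \<and> c < d \<longrightarrow> b \<in> orbit \<tau> a)"

definition cyclic_succ :: "nat set \<Rightarrow> (nat \<Rightarrow> nat) \<Rightarrow> bool" where
  "cyclic_succ A \<sigma> \<longleftrightarrow> \<sigma> permutes A \<and> (\<forall>x\<in>A. orbit \<sigma> x = A) \<and> incr_on A \<sigma>"

lemma incr_onD:
  "incr_on A \<tau> \<Longrightarrow> x \<in> A \<Longrightarrow> y \<in> orbit \<tau> x \<Longrightarrow>
     x < \<tau> x \<and> (y \<le> x \<or> \<tau> x \<le> y) \<or> \<tau> x \<le> y \<and> y \<le> x"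
  unfolding incr_on_def by blast

lemma noncrossing_onD:
  "noncrossing_on A \<tau> \<Longrightarrow> a \<in> A \<Longrightarrow> b \<in> A \<Longrightarrow> c \<in> orbit \<tau> a \<Longrightarrow> d \<in> orbit \<tau> b \<Longrightarrow>
     a < b \<Longrightarrow> b < c \<Longrightarrow> c < d \<Longrightarrow> b \<in> orbit \<tau> a"
  unfolding noncrossing_on_def by blast

text \<open>If \<open>a\<close> is not fixed, its predecessor \<open>b\<close> is also its lower
  neighbour in \<open>A\<close>. No point of \<open>A\<close> separates the two, so every other
  point compares alike with \<open>a\<close> and with \<open>b\<close>, and \<open>b\<close> can
  take over the role of \<open>a\<close>.\<close>

lemma incr_on_skip:
  assumes \<tau>: "\<tau> permutes A" "finite A" and a: "a \<in> A"
    and fixd: "\<tau> a = a \<or> b \<in> A \<and> b < a \<and> \<tau> b = a \<and> (\<forall>y\<in>A. y \<le> b \<or> a \<le> y)"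
  shows "incr_on (A - {a}) (skip a \<tau>) \<longleftrightarrow> incr_on A \<tau>"
proof
  have inj: "\<tau> x = \<tau> y \<longleftrightarrow> x = y" for x y using permutes_inj[OF \<tau>(1)] by (auto dest: injD)
  have sub: "y \<in> A" if "y \<in> orbit \<tau> x" "x \<in> A" for x y
    using permutes_orbit_subset[OF \<tau>(1) that(2)] that(1) by blast
  have \<tau>A: "\<tau> x \<in> A" if "x \<in> A" for x using that by (simp add: permutes_in_image[OF \<tau>(1)])
  {
    assume inc: "incr_on A \<tau>"
    show "incr_on (A - {a}) (skip a \<tau>)" unfolding incr_on_def
    proof (intro ballI)
      fix x y assume x: "x \<in> A - {a}" and y: "y \<in> orbit (skip a \<tau>) x"
      have y': "y \<in> orbit \<tau> x" "y \<noteq> a" using y orbit_skip[OF \<tau>, of x a] x by auto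
      have yA: "y \<in> A" using sub y' x by blast
      show "x < skip a \<tau> x \<and> (y \<le> x \<or> skip a \<tau> x \<le> y) \<or> skip a \<tau> x \<le> y \<and> y \<le> x"
      proof (cases "\<tau> x = a")
        case False
        then have "skip a \<tau> x = \<tau> x" using x by (simp add: skip_def)
        then show ?thesis using incr_onD[OF inc, of x y] x y' by simp
      next
        case True
        then have b: "b < a" "\<tau> b = a" "x = b" "\<forall>y\<in>A. y \<le> b \<or> a \<le> y"
          using fixd inj[of x a] inj[of x b] x by auto
        have sk: "skip a \<tau> b = \<tau> a" using True x b(3) by (simp add: skip_def)
        have "y \<in> orbit \<tau> a" using y' permutes_orbit_apply[OF \<tau>, of b] b by simp
        then have "a < \<tau> a \<and> (y \<le> a \<or> \<tau> a \<le> y) \<or> \<tau> a \<le> y \<and> y \<le> a"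
          using incr_onD[OF inc a] by blast
        moreover have "y \<le> b \<or> a \<le> y" using b yA by blast
        ultimately show ?thesis unfolding b(3) sk using b(1) y'(2) by linarith
      qed
    qed
  next
    assume inc: "incr_on (A - {a}) (skip a \<tau>)"
    show "incr_on A \<tau>" unfolding incr_on_def
    proof (intro ballI)
      fix x y assume x: "x \<in> A" and y: "y \<in> orbit \<tau> x"
      have yA: "y \<in> A" using sub y x by blast
      show "x < \<tau> x \<and> (y \<le> x \<or> \<tau> x \<le> y) \<or> \<tau> x \<le> y \<and> y \<le> x"
      proof (cases "\<tau> a = a")
        case True
        show ?thesis
        proof (cases "x = a")
          case xa: True
          then have "y = a" using y True orbit_eq_singleton_iff[of \<tau> a] by auto
          then show ?thesis using xa True by simp
        next
          case False
          then have "\<tau> x \<noteq> a" using True inj[of x a] by auto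
          then have sk: "skip a \<tau> x = \<tau> x" using False by (simp add: skip_def)
          have "y \<noteq> a"
          proof
            assume "y = a"
            then have "x \<in> orbit \<tau> a"
              using y permutes_orbit_eq[OF \<tau>, of a x] permutes_self_in_orbit[OF \<tau>, of x] by auto
            then show False using True orbit_eq_singleton_iff[of \<tau> a] False by auto
          qed
          then have "y \<in> orbit (skip a \<tau>) x" using y orbit_skip[OF \<tau> False] by auto
          then show ?thesis using incr_onD[OF inc, of x y] x False sk by simp
        qed
      next
        case False
        then have b: "b \<in> A" "b < a" "\<tau> b = a" and adj: "\<And>y. y \<in> A \<Longrightarrow> y \<le> b \<or> a \<le> y" using fixd by auto
        have ab: "orbit \<tau> a = orbit \<tau> b" using permutes_orbit_apply[OF \<tau>, of b] b by simp
        consider "x = a" | "x = b" | "x \<noteq> a" "x \<noteq> b" by blast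
        then show ?thesis
        proof cases
          case 1
          show ?thesis
          proof (cases "y = a")
            case True
            then show ?thesis using 1 by linarith
          next
            case ya: False
            have sk: "skip a \<tau> b = \<tau> a" using b by (simp add: skip_def)
            have "y \<in> orbit (skip a \<tau>) b" using y 1 ya ab orbit_skip[OF \<tau>, of b a] b by auto
            then have "b < \<tau> a \<and> (y \<le> b \<or> \<tau> a \<le> y) \<or> \<tau> a \<le> y \<and> y \<le> b"
              using incr_onD[OF inc, of b y] b sk by auto
            moreover have "\<tau> a \<le> b \<or> a \<le> \<tau> a" using adj \<tau>A[OF a] by blast
            ultimately show ?thesis unfolding 1 using b(2) False by linarith
          qed
        next
          case 2
          then show ?thesis using b adj[OF yA] by simp
        next
          case 3
          have "\<tau> x \<noteq> a" using 3 b inj[of x b] by auto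
          then have sk: "skip a \<tau> x = \<tau> x" using 3 by (simp add: skip_def)
          show ?thesis
          proof (cases "y = a")
            case False
            then have "y \<in> orbit (skip a \<tau>) x" using y orbit_skip[OF \<tau> 3(1)] by auto
            then show ?thesis using incr_onD[OF inc, of x y] x 3 sk by simp
          next
            case True
            then have "orbit \<tau> x = orbit \<tau> b" using y ab permutes_orbit_eq[OF \<tau>, of a x] by simp
            then have "b \<in> orbit (skip a \<tau>) x"
              using orbit_skip[OF \<tau> 3(1)] permutes_self_in_orbit[OF \<tau>, of b] b by auto
            then have "x < \<tau> x \<and> (b \<le> x \<or> \<tau> x \<le> b) \<or> \<tau> x \<le> b \<and> b \<le> x"
              using incr_onD[OF inc, of x b] x 3 sk by simp
            moreover have "x \<le> b \<or> a \<le> x" using adj x by blast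
            ultimately show ?thesis unfolding True using 3 b(2) by linarith
          qed
        qed
      qed
    qed
  }
qed

lemma noncrossing_on_skip:
  assumes \<tau>: "\<tau> permutes A" "finite A" and a: "a \<in> A"
    and fixd: "\<tau> a = a \<or> b \<in> A \<and> b < a \<and> \<tau> b = a \<and> (\<forall>y\<in>A. y \<le> b \<or> a \<le> y)"
  shows "noncrossing_on (A - {a}) (skip a \<tau>) \<longleftrightarrow> noncrossing_on A \<tau>"
proof
  assume nc: "noncrossing_on A \<tau>"
  show "noncrossing_on (A - {a}) (skip a \<tau>)" unfolding noncrossing_on_def
  proof (intro ballI impI)
    fix p q r s assume "p \<in> A - {a}" "q \<in> A - {a}" "r \<in> orbit (skip a \<tau>) p" "s \<in> orbit (skip a \<tau>) q"
      and "p < q \<and> q < r \<and> r < s"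
    then show "q \<in> orbit (skip a \<tau>) p"
      using noncrossing_onD[OF nc, of p q r s] orbit_skip[OF \<tau>, of p a] orbit_skip[OF \<tau>, of q a] by auto
  qed
next
  assume nc: "noncrossing_on (A - {a}) (skip a \<tau>)"
  have sub: "y \<in> A" if "y \<in> orbit \<tau> x" "x \<in> A" for x y
    using permutes_orbit_subset[OF \<tau>(1) that(2)] that(1) by blast
  note eq = permutes_orbit_eq[OF \<tau>] and self = permutes_self_in_orbit[OF \<tau>]
  show "noncrossing_on A \<tau>" unfolding noncrossing_on_def
  proof (intro ballI impI)
    fix p q r s assume A: "p \<in> A" "q \<in> A" and r: "r \<in> orbit \<tau> p" and s: "s \<in> orbit \<tau> q"
      and ord: "p < q \<and> q < r \<and> r < s"
    have rsA: "r \<in> A" "s \<in> A" using sub A r s by blast+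
    have main: "q' \<in> orbit \<tau> p'"
      if "p' \<in> A - {a}" "q' \<in> A - {a}" "r' \<in> orbit \<tau> p'" "s' \<in> orbit \<tau> q'" "r' \<noteq> a" "s' \<noteq> a"
        "p' < q'" "q' < r'" "r' < s'" for p' q' r' s'
      using noncrossing_onD[OF nc that(1,2) _ _ that(7-9)] that(1-6)
        orbit_skip[OF \<tau>, of p' a] orbit_skip[OF \<tau>, of q' a] by auto
    show "q \<in> orbit \<tau> p"
    proof (cases "\<tau> a = a")
      case True
      then have oa: "orbit \<tau> a = {a}" by (simp add: orbit_eq_singleton_iff)
      have "p \<noteq> a" "q \<noteq> a" using r s oa ord by auto
      moreover have "r \<noteq> a" using eq[OF r] self[of p] oa ord by (metis less_trans less_irrefl singletonD)
      moreover have "s \<noteq> a" using eq[OF s] self[of q] oa ord by (metis less_trans less_irrefl singletonD)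
      ultimately show ?thesis using main[of p q r s] A r s ord by blast
    next
      case False
      then have b: "b \<in> A" "b < a" "\<tau> b = a" and adj: "\<And>y. y \<in> A \<Longrightarrow> y \<le> b \<or> a \<le> y" using fixd by auto
      have ab: "orbit \<tau> a = orbit \<tau> b" using permutes_orbit_apply[OF \<tau>, of b] b by simp
      \<comment> \<open>Moving \<open>a\<close> to its neighbour \<open>b\<close> in the same cycle
        preserves every strict inequality except \<open>b < a\<close>. The three places where this
        exceptional pair may occur among \<open>p < q < r < s\<close> each put \<open>q\<close> into
        the cycle of \<open>p\<close> directly.\<close>
      define \<phi> where "\<phi> x = (if x = a then b else x)" for x
      have orb: "orbit \<tau> (\<phi> x) = orbit \<tau> x" for x using ab by (simp add: \<phi>_def)
      have mem: "\<phi> x \<in> orbit \<tau> y" if "x \<in> orbit \<tau> y" for x y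
        using that eq[OF that] self[of "\<phi> x"] orb[of x] by simp
      have \<phi>A: "\<phi> x \<in> A - {a}" if "x \<in> A" for x using that b by (simp add: \<phi>_def)
      have mono: "\<phi> x < \<phi> y" if "x < y" "x \<in> A" "y \<in> A" "\<not> (x = b \<and> y = a)" for x y
        using that adj[of x] adj[of y] b(2) by (auto simp: \<phi>_def)
      consider "p = b \<and> q = a" | "q = b \<and> r = a" | "r = b \<and> s = a"
        | "\<phi> p < \<phi> q" "\<phi> q < \<phi> r" "\<phi> r < \<phi> s"
        using mono[of p q] mono[of q r] mono[of r s] ord A rsA by blast
      then show ?thesis
      proof cases
        case 1 then show ?thesis using ab self[of a] by simp
      next
        case 2 then show ?thesis using eq[OF r] ab self[of b] by simp
      next
        case 3 then show ?thesis using eq[OF r] eq[OF s] ab self[of q] by simp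
      next
        case 4
        have "\<phi> q \<in> orbit \<tau> (\<phi> p)"
          by (rule main[OF \<phi>A[OF A(1)] \<phi>A[OF A(2)] _ _ _ _ 4])
            (use mem[OF r] mem[OF s] orb \<phi>A[OF rsA(1)] \<phi>A[OF rsA(2)] in auto)
        then have "orbit \<tau> q = orbit \<tau> p" using eq[of "\<phi> q" "\<phi> p"] orb by simp
        then show ?thesis using self[of q] by simp
      qed
    qed
  qed
qed

lemma cyclic_succ_skip:
  assumes "cyclic_succ A \<sigma>" "finite A" "a \<in> A"
  shows "cyclic_succ (A - {a}) (skip a \<sigma>)"
proof -
  have \<sigma>: "\<sigma> permutes A" "\<And>x. x \<in> A \<Longrightarrow> orbit \<sigma> x = A" "incr_on A \<sigma>" using assms by (auto simp: cyclic_succ_def)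
  have inj: "\<sigma> x = \<sigma> y \<longleftrightarrow> x = y" for x y using permutes_inj[OF \<sigma>(1)] by (auto dest: injD)
  have \<sigma>A: "\<sigma> x \<in> A" if "x \<in> A" for x using that by (simp add: permutes_in_image[OF \<sigma>(1)])
  have "incr_on (A - {a}) (skip a \<sigma>)" unfolding incr_on_def
  proof (intro ballI)
    fix x y assume x: "x \<in> A - {a}" and y: "y \<in> orbit (skip a \<sigma>) x"
    have y': "y \<in> A" "y \<noteq> a" using y orbit_skip[OF \<sigma>(1) assms(2), of x a] x \<sigma>(2)[of x] by auto
    show "x < skip a \<sigma> x \<and> (y \<le> x \<or> skip a \<sigma> x \<le> y) \<or> skip a \<sigma> x \<le> y \<and> y \<le> x"
    proof (cases "\<sigma> x = a")
      case False
      then have "skip a \<sigma> x = \<sigma> x" using x by (simp add: skip_def)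
      then show ?thesis using incr_onD[OF \<sigma>(3), of x y] x y' \<sigma>(2)[of x] by simp
    next
      case True
      have sk: "skip a \<sigma> x = \<sigma> a" using True x by (simp add: skip_def)
      have "\<sigma> a \<noteq> a" using True inj[of x a] x by auto
      have "z \<in> A \<Longrightarrow> a < \<sigma> a \<and> (z \<le> a \<or> \<sigma> a \<le> z) \<or> \<sigma> a \<le> z \<and> z \<le> a"
        "z \<in> A \<Longrightarrow> x < a \<and> (z \<le> x \<or> a \<le> z) \<or> a \<le> z \<and> z \<le> x" for z
        using incr_onD[OF \<sigma>(3), of a z] incr_onD[OF \<sigma>(3), of x z] \<sigma>(2)[of x] \<sigma>(2)[of a] x assms(3) True by auto
      from this(1)[of y] this(2)[of y] this(1)[of x] this(2)[of "\<sigma> a"] show ?thesis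
        unfolding sk using y' \<open>\<sigma> a \<noteq> a\<close> \<sigma>A[OF assms(3)] x by auto
    qed
  qed
  moreover have "orbit (skip a \<sigma>) x = A - {a}" if "x \<in> A - {a}" for x
    using orbit_skip[OF \<sigma>(1) assms(2), of x a] that \<sigma>(2)[of x] by auto
  ultimately show ?thesis using skip_permutes[OF \<sigma>(1) assms(3)] by (simp add: cyclic_succ_def)
qed

lemma cyclic_succ_adjacent:
  assumes "cyclic_succ A \<sigma>" "a \<in> A" "b \<in> A" "b < a"
  shows "\<sigma> b = a \<longleftrightarrow> (\<forall>y\<in>A. y \<le> b \<or> a \<le> y)"
proof -
  have \<sigma>: "\<sigma> permutes A" "\<And>x. x \<in> A \<Longrightarrow> orbit \<sigma> x = A" "incr_on A \<sigma>" using assms by (auto simp: cyclic_succ_def)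
  have \<sigma>b: "\<sigma> b \<in> A" using assms by (simp add: permutes_in_image[OF \<sigma>(1)])
  have inc: "b < \<sigma> b \<and> (y \<le> b \<or> \<sigma> b \<le> y) \<or> \<sigma> b \<le> y \<and> y \<le> b" if "y \<in> A" for y
    using incr_onD[OF \<sigma>(3) assms(3)] \<sigma>(2)[OF assms(3)] that by blast
  show ?thesis
  proof
    assume "\<sigma> b = a"
    then show "\<forall>y\<in>A. y \<le> b \<or> a \<le> y" using inc assms(4) by force
  next
    assume "\<forall>y\<in>A. y \<le> b \<or> a \<le> y"
    then show "\<sigma> b = a" using inc[OF assms(2)] inc[OF \<sigma>b] \<sigma>b assms(4) by force
  qed
qed

text \<open>Two points of a common cycle at minimal distance have no point of \<open>A\<close> between them, since the
  cycle of such a point would be enclosed.\<close>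

lemma noncrossing_fixed_or_adjacent:
  assumes \<tau>: "\<tau> permutes A" "finite A" and inc: "incr_on A \<tau>" and nc: "noncrossing_on A \<tau>" and ne: "A \<noteq> {}"
  obtains a where "a \<in> A" "\<tau> a = a"
    | a b where "a \<in> A" "b \<in> A" "b < a" "\<tau> b = a" "\<And>y. y \<in> A \<Longrightarrow> y \<le> b \<or> a \<le> y"
proof (cases "\<exists>a\<in>A. \<tau> a = a")
  case False
  note eq = permutes_orbit_eq[OF \<tau>] and self = permutes_self_in_orbit[OF \<tau>]
  have \<tau>A: "\<tau> x \<in> A" if "x \<in> A" for x using that by (simp add: permutes_in_image[OF \<tau>(1)])
  define Q where "Q = (\<lambda>d. \<exists>x\<in>A. \<exists>y\<in>A. x < y \<and> y \<in> orbit \<tau> x \<and> d = y - x)"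
  have pair: "\<exists>d. Q d \<and> (x < y \<longrightarrow> d = y - x) \<and> (y < x \<longrightarrow> d = x - y)" if "x \<in> A" "y \<in> A" "y \<in> orbit \<tau> x" "x \<noteq> y" for x y
  proof (cases "x < y")
    case True then show ?thesis using that unfolding Q_def by (intro exI[of _ "y - x"]) auto
  next
    case False
    moreover have "x \<in> orbit \<tau> y" using eq[OF that(3)] self[of x] by simp
    ultimately have "Q (x - y)" using that(1,2,4) unfolding Q_def
      by (intro bexI[of _ y] bexI[of _ x]) auto
    then show ?thesis using \<open>\<not> x < y\<close> by blast
  qed
  obtain x0 where x0: "x0 \<in> A" using ne by blast
  have "x0 \<noteq> \<tau> x0" using False x0 by force
  then have "\<exists>d. Q d" using pair[OF x0 \<tau>A[OF x0] orbit.base] by blast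
  then obtain d where d: "Q d" "\<And>e. Q e \<Longrightarrow> d \<le> e" by (metis LeastI Least_le)
  then obtain x y where xy: "x \<in> A" "y \<in> A" "x < y" "y \<in> orbit \<tau> x" "d = y - x" by (auto simp: Q_def)
  have between: "z \<le> x \<or> y \<le> z" if z: "z \<in> A" for z
  proof (rule ccontr)
    assume "\<not> ?thesis"
    then have z': "x < z" "z < y" by auto
    have zx: "z \<notin> orbit \<tau> x"
    proof
      assume "z \<in> orbit \<tau> x"
      then have "Q (z - x)" using xy(1) z z' unfolding Q_def by blast
      then show False using d(2) z' xy(5) by force
    qed
    \<comment> \<open>Since \<open>\<tau>\<close> has no fixed point, \<open>w\<close> is a second
      point of the cycle of \<open>z\<close>. Outside the interval from \<open>x\<close> to
      \<open>y\<close> it would produce a crossing; inside, it is closer to \<open>z\<close> than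
      the minimal distance \<open>d\<close> allows.\<close>
    define w where "w = \<tau> z"
    have w: "w \<in> A" "w \<in> orbit \<tau> z" "w \<noteq> z" using \<tau>A[OF z] orbit.base[of \<tau> z] False z by (auto simp: w_def)
    have wz: "orbit \<tau> w = orbit \<tau> z" by (rule eq[OF w(2)])
    have wx: "w \<notin> orbit \<tau> x" using eq[of w x] wz self[of z] zx by auto
    have wne: "w \<noteq> x" "w \<noteq> y" using wx self[of x] xy(4) by auto
    have "\<not> w < x"
    proof
      assume "w < x"
      have "z \<in> orbit \<tau> w" using wz self[of z] by simp
      from noncrossing_onD[OF nc w(1) xy(1) this xy(4) \<open>w < x\<close> z'] have "x \<in> orbit \<tau> w" .
      then have "orbit \<tau> x = orbit \<tau> z" using eq[of x w] wz by simp
      then show False using zx self[of z] by simp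
    qed
    moreover have "\<not> y < w"
    proof
      assume "y < w"
      from noncrossing_onD[OF nc xy(1) z xy(4) w(2) z' this] show False using zx by blast
    qed
    ultimately have wb: "x < w" "w < y" using wne by auto
    obtain e where e: "Q e" "z < w \<longrightarrow> e = w - z" "w < z \<longrightarrow> e = z - w" using pair[OF z w(1,2)] w(3) by blast
    have "d \<le> e" by (rule d(2)[OF e(1)])
    then show False using e(2,3) w(3) wb z' xy(5) by linarith
  qed
  have "x < \<tau> x \<and> (y \<le> x \<or> \<tau> x \<le> y) \<or> \<tau> x \<le> y \<and> y \<le> x" by (rule incr_onD[OF inc xy(1,4)])
  then have "\<tau> x = y" using xy(3) between[OF \<tau>A[OF xy(1)]] by linarith
  then show ?thesis using that(2)[OF xy(2,1,3)] between by blast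
qed (use that(1) in blast)

text \<open>Biane's description of the geodesics to a cycle. Both sides survive the removal of a fixed point
  of \<open>\<tau>\<close>, or of a point which has the same predecessor under \<open>\<sigma>\<close> and \<open>\<tau>\<close>, and both provide such a point.\<close>

theorem geo_cyclic_succ_iff:
  assumes "finite A" "cyclic_succ A \<sigma>"
  shows "geo A \<sigma> \<tau> \<longleftrightarrow> \<tau> permutes A \<and> incr_on A \<tau> \<and> noncrossing_on A \<tau>"
  using assms
proof (induction "card A" arbitrary: A \<sigma> \<tau> rule: less_induct)
  case less
  have fin: "finite A" by fact
  have \<sigma>: "\<sigma> permutes A" "\<And>x. x \<in> A \<Longrightarrow> orbit \<sigma> x = A" "incr_on A \<sigma>" using less.prems by (auto simp: cyclic_succ_def)
  have step: "geo A \<sigma> \<tau> \<longleftrightarrow> incr_on A \<tau> \<and> noncrossing_on A \<tau>"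
    if \<tau>: "\<tau> permutes A" and a: "a \<in> A" and c: "\<tau> a = a \<or> b \<in> A \<and> b < a \<and> \<tau> b = a \<and> \<sigma> b = a" for a b
  proof -
    have c': "\<tau> a = a \<or> b \<in> A \<and> b < a \<and> \<tau> b = a \<and> (\<forall>y\<in>A. y \<le> b \<or> a \<le> y)"
      using c cyclic_succ_adjacent[OF less.prems(2) a, of b] by blast
    have "\<tau> a = a \<or> \<sigma> (inv \<tau> a) = a" using c permutes_inverses(2)[OF \<tau>, of b] by auto
    then have "geo A \<sigma> \<tau> \<longleftrightarrow> geo (A - {a}) (skip a \<sigma>) (skip a \<tau>)"
      using geo_skip_iff[OF fin a \<sigma>(1) \<tau>] by blast
    also have "\<dots> \<longleftrightarrow> skip a \<tau> permutes (A - {a}) \<and> incr_on (A - {a}) (skip a \<tau>) \<and> noncrossing_on (A - {a}) (skip a \<tau>)"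
      by (rule less.hyps) (use a fin cyclic_succ_skip[OF less.prems(2) fin a] card_Diff1_less[OF fin a] in auto)
    also have "\<dots> \<longleftrightarrow> incr_on A \<tau> \<and> noncrossing_on A \<tau>"
      using incr_on_skip[OF \<tau> fin a c'] noncrossing_on_skip[OF \<tau> fin a c'] skip_permutes[OF \<tau> a] by blast
    finally show ?thesis .
  qed
  show ?case
  proof (cases "A = {}")
    case True
    then show ?thesis by (auto simp: geo_def cyc_def incr_on_def noncrossing_on_def)
  next
    case ne: False
    show ?thesis
    proof
      assume geo: "geo A \<sigma> \<tau>"
      then have \<tau>: "\<tau> permutes A" by (simp add: geo_def)
      show "\<tau> permutes A \<and> incr_on A \<tau> \<and> noncrossing_on A \<tau>"
      proof (rule geo_fixed_point[OF fin \<sigma>(1) geo ne, where m = "Min A"])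
        fix a assume "a \<in> A" "\<tau> a = a"
        then show ?thesis using step[OF \<tau>, of a] geo \<tau> by blast
      next
        fix a assume a: "a \<in> A" "a \<noteq> Min A" "\<sigma> (inv \<tau> a) = a"
        define b where "b = inv \<tau> a"
        have b: "b \<in> A" "\<tau> b = a" "\<sigma> b = a"
          using a permutes_in_image[OF permutes_inv[OF \<tau>]] permutes_inverses(1)[OF \<tau>] by (auto simp: b_def)
        \<comment> \<open>A point other than the least one has a smaller predecessor under
          \<open>\<sigma>\<close>. This is why the fixed point of
          \<open>\<sigma> \<circ> inv \<tau>\<close> was asked to avoid
          \<open>Min A\<close>.\<close>
        have "Min A \<in> A" "Min A \<le> a" using fin ne a by auto
        then have "b < a" using incr_onD[OF \<sigma>(3) b(1), of "Min A"] \<sigma>(2)[OF b(1)] b(3) a(2) by auto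
        then show ?thesis using step[OF \<tau> a(1), of b] b geo \<tau> by blast
      qed
    next
      assume \<tau>: "\<tau> permutes A \<and> incr_on A \<tau> \<and> noncrossing_on A \<tau>"
      show "geo A \<sigma> \<tau>"
      proof (rule noncrossing_fixed_or_adjacent[of \<tau> A])
        fix a assume "a \<in> A" "\<tau> a = a"
        then show ?thesis using step[of a] \<tau> by blast
      next
        fix a b assume ab: "a \<in> A" "b \<in> A" "b < a" "\<tau> b = a" "\<And>y. y \<in> A \<Longrightarrow> y \<le> b \<or> a \<le> y"
        then have "\<sigma> b = a" using cyclic_succ_adjacent[OF less.prems(2) ab(1-3)] by blast
        then show ?thesis using step[of a b] \<tau> ab by blast
      qed (use \<tau> fin ne in auto)
    qed
  qed
qed

text \<open>The next larger point of a cycle, or the least one, depends on the cycle as a set only.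
  This is the injectivity in the correspondence between geodesics and partitions.\<close>

lemma incr_on_unique:
  assumes "incr_on A \<tau>" "incr_on A \<tau>'" "x \<in> A" "orbit \<tau> x = orbit \<tau>' x"
  shows "\<tau> x = \<tau>' x"
  using incr_onD[OF assms(1,3), of "\<tau>' x"] incr_onD[OF assms(2,3), of "\<tau> x"]
    incr_onD[OF assms(1,3), of "\<tau> x"] incr_onD[OF assms(2,3), of "\<tau>' x"]
    orbit.base[of \<tau> x] orbit.base[of \<tau>' x] assms(4) by auto

section \<open>Increasing cycles, sorted lists and noncrossing partitions\<close>

lemma funpow_cycle_of_list_nth:
  assumes "distinct xs" "i < length xs"
  shows "(cycle_of_list xs ^^ n) (xs ! i) = xs ! ((n + i) mod length xs)"
proof -
  have "map (cycle_of_list xs ^^ n) xs ! i = rotate n xs ! i" by (simp only: cyclic_rotation[OF assms(1)])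
  then show ?thesis using assms(2) by (simp add: nth_rotate)
qed

lemma orbit_cycle_of_list:
  assumes "distinct xs" "x \<in> set xs"
  shows "orbit (cycle_of_list xs) x = set xs"
proof
  show "orbit (cycle_of_list xs) x \<subseteq> set xs"
    by (rule permutes_orbit_subset[OF cycle_permutes assms(2)])
  obtain i where i: "i < length xs" "x = xs ! i" using assms(2) by (auto simp: in_set_conv_nth)
  show "set xs \<subseteq> orbit (cycle_of_list xs) x"
  proof
    fix y assume "y \<in> set xs"
    then obtain j where j: "j < length xs" "y = xs ! j" by (auto simp: in_set_conv_nth)
    \<comment> \<open>Adding the length avoids truncated subtraction and makes the exponent
      positive, since \<open>orbit\<close> consists of the positive iterates.\<close>
    define n where "n = length xs + j - i"
    have "(cycle_of_list xs ^^ n) x = xs ! ((n + i) mod length xs)"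
      unfolding i(2) by (rule funpow_cycle_of_list_nth[OF assms(1) i(1)])
    also have "n + i = length xs + j" using i by (simp add: n_def)
    finally have "(cycle_of_list xs ^^ n) x = y" using j by simp
    moreover have "n > 0" using i(1) by (simp add: n_def)
    ultimately show "y \<in> orbit (cycle_of_list xs) x" unfolding orbit_altdef by blast
  qed
qed

lemma cyclic_succ_cycle_of_list:
  assumes "sorted xs" "distinct xs"
  shows "cyclic_succ (set xs) (cycle_of_list xs)"
  unfolding cyclic_succ_def
proof (intro conjI ballI cycle_permutes)
  show "orbit (cycle_of_list xs) x = set xs" if "x \<in> set xs" for x
    by (rule orbit_cycle_of_list[OF assms(2) that])
  show "incr_on (set xs) (cycle_of_list xs)" unfolding incr_on_def
  proof (intro ballI)
    fix x y assume x: "x \<in> set xs" and "y \<in> orbit (cycle_of_list xs) x"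
    then have y: "y \<in> set xs" using orbit_cycle_of_list[OF assms(2) x] by simp
    obtain i where i: "i < length xs" "x = xs ! i" using x by (auto simp: in_set_conv_nth)
    obtain j where j: "j < length xs" "y = xs ! j" using y by (auto simp: in_set_conv_nth)
    have \<sigma>: "cycle_of_list xs x = xs ! (Suc i mod length xs)"
      using funpow_cycle_of_list_nth[OF assms(2) i(1), of 1] i(2) by simp
    show "x < cycle_of_list xs x \<and> (y \<le> x \<or> cycle_of_list xs x \<le> y) \<or> cycle_of_list xs x \<le> y \<and> y \<le> x"
    proof (cases "Suc i < length xs")
      case True
      then have "cycle_of_list xs x = xs ! Suc i" using \<sigma> by simp
      moreover have "xs ! i \<le> xs ! Suc i" using assms(1) True by (simp add: sorted_nth_mono)
      moreover have "xs ! i \<noteq> xs ! Suc i" using assms(2) True by (simp add: nth_eq_iff_index_eq)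
      moreover have "xs ! j \<le> xs ! i \<or> xs ! Suc i \<le> xs ! j"
        using sorted_nth_mono[OF assms(1), of j i] sorted_nth_mono[OF assms(1), of "Suc i" j] i j by fastforce
      ultimately show ?thesis using i j by simp
    next
      case False
      then have "Suc i = length xs" using i by simp
      then have "cycle_of_list xs x = xs ! 0" using \<sigma> by simp
      moreover have "xs ! 0 \<le> xs ! j" "xs ! j \<le> xs ! i"
        using sorted_nth_mono[OF assms(1), of 0 j] sorted_nth_mono[OF assms(1), of j i] j i \<open>Suc i = _\<close> by auto
      ultimately show ?thesis using i j by simp
    qed
  qed
qed

lemma set_support_eq_orbit:
  assumes "permutation p"
  shows "set (support p a) = orbit p a"
  unfolding support_set[OF assms] orbit_altdef_permutation[OF assms] by auto

lemma least_power_eq_card_orbit: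
  assumes "permutation p"
  shows "least_power p a = card (orbit p a)"
proof -
  have "card (set (support p a)) = length (support p a)" by (rule distinct_card[OF cycle_of_permutation[OF assms]])
  then show ?thesis unfolding set_support_eq_orbit[OF assms] by simp
qed

text \<open>The goal reads a cycle off by iterating the permutation from its least element, the
  cumulant relation reads a block off as a sorted list. For increasing cycles the two words
  coincide.\<close>

lemma support_incr_on:
  assumes \<tau>: "\<tau> permutes A" "finite A" and inc: "incr_on A \<tau>" and C: "C \<in> orbit \<tau> ` A"
  shows "support \<tau> (Min C) = sorted_list_of_set C"
proof -
  obtain x where x: "x \<in> A" "C = orbit \<tau> x" using C by blast
  have CA: "C \<subseteq> A" using x permutes_orbit_subset[OF \<tau>(1)] by blast
  have fin: "finite C" by (rule finite_subset[OF CA \<tau>(2)])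
  have ne: "C \<noteq> {}" using x orbit_nonempty by metis
  define xs where "xs = sorted_list_of_set C"
  have xs: "set xs = C" "sorted xs" "distinct xs" "length xs = card C" using fin by (auto simp: xs_def)
  have orb: "orbit \<tau> y = C" if "y \<in> C" for y using that x permutes_orbit_eq[OF \<tau>, of y x] by simp
  have succ: "cyclic_succ C (cycle_of_list xs)" using cyclic_succ_cycle_of_list[OF xs(2,3)] xs(1) by simp
  have incC: "incr_on C \<tau>" using inc CA unfolding incr_on_def by blast
  have agree: "\<tau> y = cycle_of_list xs y" if "y \<in> C" for y
    by (rule incr_on_unique[OF incC _ that]) (use succ orb that in \<open>auto simp: cyclic_succ_def\<close>)
  have len: "0 < length xs" using ne fin xs(4) by (simp add: card_gt_0_iff)
  have Min: "Min C = xs ! 0"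
  proof (rule Min_eqI[OF fin])
    show "xs ! 0 \<in> C" using len xs(1) nth_mem by blast
    show "xs ! 0 \<le> y" if y: "y \<in> C" for y
    proof -
      obtain j where "j < length xs" "y = xs ! j" using y xs(1) by (metis in_set_conv_nth)
      then show ?thesis using sorted_nth_mono[OF xs(2), of 0 j] by simp
    qed
  qed
  have pow: "(\<tau> ^^ n) (xs ! 0) = (cycle_of_list xs ^^ n) (xs ! 0) \<and> (\<tau> ^^ n) (xs ! 0) \<in> C" for n
  proof (induction n)
    case 0 then show ?case using len xs(1) nth_mem by auto
  next
    case (Suc n)
    then show ?case using agree orb orbit.base[of \<tau>] by fastforce
  qed
  have perm: "permutation \<tau>" using \<tau> permutation_permutes by blast
  have "least_power \<tau> (Min C) = length xs"
    using least_power_eq_card_orbit[OF perm] orb[of "Min C"] Min_in[OF fin ne] xs(4) by simp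
  moreover have "(\<tau> ^^ n) (Min C) = xs ! n" if "n < length xs" for n
    unfolding Min using pow[of n] funpow_cycle_of_list_nth[OF xs(3) len, of n] that by simp
  ultimately show ?thesis unfolding xs_def[symmetric] by (intro nth_equalityI) auto
qed

text \<open>Every block is made into the cycle of its sorted list. This supplies the preimages in
  the correspondence between geodesics and noncrossing partitions.\<close>

lemma ex_permutation_of_partition:
  assumes "partition_on A \<pi>" and fin: "finite A"
  shows "\<exists>\<tau>. \<tau> permutes A \<and> orbit \<tau> ` A = \<pi> \<and> incr_on A \<tau>"
proof -
  define blk where "blk x = (THE B. B \<in> \<pi> \<and> x \<in> B)" for x
  define cl where "cl B = cycle_of_list (sorted_list_of_set B)" for B :: "nat set"
  define \<tau> where "\<tau> x = (if x \<in> A then cl (blk x) x else x)" for x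
  have sub: "B \<subseteq> A" if "B \<in> \<pi>" for B using assms(1) that by (auto simp: partition_on_def)
  have finB: "finite B" if "B \<in> \<pi>" for B using finite_subset[OF sub[OF that] fin] .
  have blk: "blk x = B" if "B \<in> \<pi>" "x \<in> B" for x B
    unfolding blk_def
  proof (rule the_equality)
    show "C = B" if "C \<in> \<pi> \<and> x \<in> C" for C
      using partition_block_eq[OF assms(1)] that \<open>B \<in> \<pi>\<close> \<open>x \<in> B\<close> by blast
  qed (use that in blast)
  have ex: "\<exists>B\<in>\<pi>. x \<in> B" if "x \<in> A" for x using assms(1) that by (auto simp: partition_on_def)
  have succ: "cyclic_succ B (cl B)" if "B \<in> \<pi>" for B
    using cyclic_succ_cycle_of_list[of "sorted_list_of_set B"] finB[OF that] by (simp add: cl_def)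
  have perm: "cl B permutes B" if "B \<in> \<pi>" for B using succ[OF that] by (simp add: cyclic_succ_def)
  have \<tau>B: "\<tau> x = cl B x" if "B \<in> \<pi>" "x \<in> B" for x B using that blk[OF that] sub by (auto simp: \<tau>_def)
  have \<tau>in: "\<tau> x \<in> B" if "B \<in> \<pi>" "x \<in> B" for x B
    using \<tau>B[OF that] that by (simp add: permutes_in_image[OF perm])
  have orb: "orbit \<tau> x = B" if B: "B \<in> \<pi>" "x \<in> B" for x B
  proof -
    have "orbit \<tau> x = orbit (cl B) x"
      by (rule orbit_cong0[OF B(2)]) (use B \<tau>in \<tau>B in auto)
    then show ?thesis using succ[OF B(1)] B(2) by (simp add: cyclic_succ_def)
  qed
  have inj: "inj_on \<tau> A"
  proof (rule inj_onI)
    fix x y assume x: "x \<in> A" and y: "y \<in> A" and eq: "\<tau> x = \<tau> y"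
    obtain B C where B: "B \<in> \<pi>" "x \<in> B" and C: "C \<in> \<pi>" "y \<in> C" using ex x y by meson
    have "B = C" using partition_block_eq[OF assms(1) B(1) C(1)] \<tau>in[OF B] \<tau>in[OF C] eq by simp
    then show "x = y" using \<tau>B[OF B] \<tau>B[OF C] eq permutes_inj[OF perm[OF B(1)]] by (auto dest: injD)
  qed
  have "\<tau> ` A \<subseteq> A" using \<tau>in ex sub by blast
  then have "bij_betw \<tau> A A" using inj fin by (simp add: bij_betw_def endo_inj_surj)
  then have "\<tau> permutes A" by (rule bij_imp_permutes) (simp add: \<tau>_def)
  moreover have "orbit \<tau> ` A = \<pi>"
  proof
    show "orbit \<tau> ` A \<subseteq> \<pi>" using orb ex by blast
    show "\<pi> \<subseteq> orbit \<tau> ` A"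
    proof
      fix B assume B: "B \<in> \<pi>"
      then have "B \<noteq> {}" using assms(1) by (auto simp: partition_on_def)
      then obtain x where "x \<in> B" by blast
      then show "B \<in> orbit \<tau> ` A" using orb[OF B] sub[OF B] by blast
    qed
  qed
  moreover have "incr_on A \<tau>" unfolding incr_on_def
  proof (intro ballI)
    fix x y assume x: "x \<in> A" and y: "y \<in> orbit \<tau> x"
    obtain B where B: "B \<in> \<pi>" "x \<in> B" using ex x by blast
    have "incr_on B (cl B)" "orbit (cl B) x = B" using succ[OF B(1)] B(2) by (auto simp: cyclic_succ_def)
    then show "x < \<tau> x \<and> (y \<le> x \<or> \<tau> x \<le> y) \<or> \<tau> x \<le> y \<and> y \<le> x"
      using incr_onD[of B "cl B" x y] B y orb[OF B] \<tau>B[OF B] by simp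
  qed
  ultimately show ?thesis by blast
qed

text \<open>Passing from a permutation to its set of cycles is the bijection that turns the
  moment-cumulant relation into a sum over geodesics, the form in which it can be compared with
  matrix moments.\<close>

lemma sum_NC_eq_sum_geo:
  fixes g :: "nat list \<Rightarrow> 'b :: comm_semiring_1"
  assumes \<sigma>: "cyclic_succ {1..n} \<sigma>"
  shows "(\<Sum>\<pi>\<in>NC n. \<Prod>B\<in>\<pi>. g (sorted_list_of_set B)) =
    (\<Sum>\<tau> | geo {1..n} \<sigma> \<tau>. \<Prod>C\<in>orbit \<tau> ` {1..n}. g (support \<tau> (Min C)))"
proof -
  let ?A = "{1..n}"
  let ?G = "{\<tau>. geo ?A \<sigma> \<tau>}"
  have G: "?G = {\<tau>. \<tau> permutes ?A \<and> incr_on ?A \<tau> \<and> noncrossing_on ?A \<tau>}"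
    using geo_cyclic_succ_iff[OF _ \<sigma>] by auto
  have bij: "bij_betw (\<lambda>\<tau>. orbit \<tau> ` ?A) ?G (NC n)"
    unfolding bij_betw_def
  proof
    show "inj_on (\<lambda>\<tau>. orbit \<tau> ` ?A) ?G"
    proof (rule inj_onI, rule ext)
      fix \<tau> \<tau>' x assume "\<tau> \<in> ?G" "\<tau>' \<in> ?G" and eq: "orbit \<tau> ` ?A = orbit \<tau>' ` ?A"
      then have \<tau>: "\<tau> permutes ?A" "incr_on ?A \<tau>" and \<tau>': "\<tau>' permutes ?A" "incr_on ?A \<tau>'"
        unfolding G by auto
      show "\<tau> x = \<tau>' x"
      proof (cases "x \<in> ?A")
        case True
        then obtain y where "orbit \<tau> x = orbit \<tau>' y" using eq by blast
        then have "orbit \<tau> x = orbit \<tau>' x"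
          using permutes_orbit_eq[OF \<tau>'(1), of x y] permutes_self_in_orbit[OF \<tau>(1), of x] by simp
        then show ?thesis by (rule incr_on_unique[OF \<tau>(2) \<tau>'(2) True])
      next
        case False
        then show ?thesis using permutes_not_in[OF \<tau>(1)] permutes_not_in[OF \<tau>'(1)] by simp
      qed
    qed
    show "(\<lambda>\<tau>. orbit \<tau> ` ?A) ` ?G = NC n"
    proof
      show "(\<lambda>\<tau>. orbit \<tau> ` ?A) ` ?G \<subseteq> NC n"
      proof (rule image_subsetI)
        fix \<tau> assume "\<tau> \<in> ?G"
        then have \<tau>: "\<tau> permutes ?A" "noncrossing_on ?A \<tau>" unfolding G by auto
        have False if "x \<in> ?A" "y \<in> ?A" "orbit \<tau> x \<noteq> orbit \<tau> y" and
          abcd: "a \<in> orbit \<tau> x" "b \<in> orbit \<tau> y" "c \<in> orbit \<tau> x" "d \<in> orbit \<tau> y" "a < b" "b < c" "c < d"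
          for x y a b c d
        proof -
          have e: "orbit \<tau> a = orbit \<tau> x" "orbit \<tau> b = orbit \<tau> y"
            using permutes_orbit_eq[OF \<tau>(1)] abcd by auto
          have "a \<in> ?A" "b \<in> ?A" using that permutes_orbit_subset[OF \<tau>(1)] by blast+
          from noncrossing_onD[OF \<tau>(2) this, of c d] abcd e have "b \<in> orbit \<tau> x" by simp
          then show False using permutes_orbit_eq[OF \<tau>(1), of b x] e that(3) by simp
        qed
        then show "orbit \<tau> ` ?A \<in> NC n"
          using partition_on_orbits[OF \<tau>(1)] unfolding NC_def mem_Collect_eq by blast
      qed
      show "NC n \<subseteq> (\<lambda>\<tau>. orbit \<tau> ` ?A) ` ?G"
      proof
        fix \<pi> assume \<pi>: "\<pi> \<in> NC n"
        then have part: "partition_on ?A \<pi>" by (simp add: NC_def)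
        then obtain \<tau> where \<tau>: "\<tau> permutes ?A" "orbit \<tau> ` ?A = \<pi>" "incr_on ?A \<tau>"
          using ex_permutation_of_partition by blast
        have "noncrossing_on ?A \<tau>" unfolding noncrossing_on_def
        proof (intro ballI impI)
          fix a b c d assume ab: "a \<in> ?A" "b \<in> ?A" and c: "c \<in> orbit \<tau> a" and d: "d \<in> orbit \<tau> b"
            and ord: "a < b \<and> b < c \<and> c < d"
          have blocks: "orbit \<tau> a \<in> \<pi>" "orbit \<tau> b \<in> \<pi>" using ab \<tau>(2) by blast+
          have "a \<in> orbit \<tau> a" "b \<in> orbit \<tau> b" using permutes_self_in_orbit[OF \<tau>(1)] by auto
          then have "orbit \<tau> a = orbit \<tau> b" using \<pi> blocks c d ord unfolding NC_def by blast
          then show "b \<in> orbit \<tau> a" using \<open>b \<in> orbit \<tau> b\<close> by simp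
        qed
        then show "\<pi> \<in> (\<lambda>\<tau>. orbit \<tau> ` ?A) ` ?G" unfolding G using \<tau> by blast
      qed
    qed
  qed
  have "(\<Sum>\<pi>\<in>NC n. \<Prod>B\<in>\<pi>. g (sorted_list_of_set B)) =
      (\<Sum>\<tau>\<in>?G. \<Prod>B\<in>orbit \<tau> ` ?A. g (sorted_list_of_set B))"
    by (rule sum.reindex_bij_betw[OF bij, symmetric])
  also have "\<dots> = (\<Sum>\<tau>\<in>?G. \<Prod>C\<in>orbit \<tau> ` ?A. g (support \<tau> (Min C)))"
  proof (intro sum.cong prod.cong refl)
    fix \<tau> C assume "\<tau> \<in> ?G" "C \<in> orbit \<tau> ` ?A"
    then have "support \<tau> (Min C) = sorted_list_of_set C"
      unfolding G by (intro support_incr_on[of \<tau> ?A]) auto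
    then show "g (sorted_list_of_set C) = g (support \<tau> (Min C))" by simp
  qed
  finally show ?thesis .
qed

section \<open>Sums over geodesics\<close>

definition cycle_prod :: "nat set \<Rightarrow> (nat \<Rightarrow> nat) \<Rightarrow> ('i list \<Rightarrow> complex) \<Rightarrow> (nat \<Rightarrow> 'i) \<Rightarrow> complex" where
  "cycle_prod A \<tau> \<kappa> i = (\<Prod>C\<in>orbit \<tau> ` A. \<kappa> (map i (support \<tau> (Min C))))"

definition geo_sum :: "nat set \<Rightarrow> (nat \<Rightarrow> nat) \<Rightarrow> ('i list \<Rightarrow> complex) \<Rightarrow> (nat \<Rightarrow> 'i) \<Rightarrow> complex" where
  "geo_sum A \<sigma> \<kappa> i = (\<Sum>\<tau> | geo A \<sigma> \<tau>. cycle_prod A \<tau> \<kappa> i)"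

text \<open>The point 0 falls under the first case and is fixed there, as permutations of
  \<open>{1..k}\<close> fix it; the points beyond both blocks are fixed through
  \<open>\<sigma>\<^sub>2\<close>. Hence no separate default is needed.\<close>

definition tens :: "nat \<Rightarrow> (nat \<Rightarrow> nat) \<Rightarrow> (nat \<Rightarrow> nat) \<Rightarrow> nat \<Rightarrow> nat" where
  "tens k \<sigma>\<^sub>1 \<sigma>\<^sub>2 x = (if x \<le> k then \<sigma>\<^sub>1 x else k + \<sigma>\<^sub>2 (x - k))"

abbreviation full_cycle :: "nat \<Rightarrow> nat \<Rightarrow> nat" where
  "full_cycle n \<equiv> cycle_of_list [1..<n + 1]"

text \<open>The length bound is the induction parameter of
  \<open>free_cumulants_rotation_invariant\<close>: conjugating a product of short cycles needs the
  invariance for short words only.\<close>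

definition rotation_invariant :: "'i set \<Rightarrow> nat \<Rightarrow> ('i list \<Rightarrow> complex) \<Rightarrow> bool" where
  "rotation_invariant \<I> L \<kappa> \<longleftrightarrow> (\<forall>w. set w \<subseteq> \<I> \<and> length w \<le> L \<longrightarrow> \<kappa> (rotate1 w) = \<kappa> w)"

section \<open>Relabelling cycles and rotating words\<close>

lemma support_apply:
  assumes "permutation \<tau>"
  shows "support \<tau> (\<tau> x) = rotate1 (support \<tau> x)"
proof -
  let ?n = "least_power \<tau> x"
  have n: "least_power \<tau> (\<tau> x) = ?n"
    by (simp add: least_power_eq_card_orbit[OF assms] permutation_orbit_step[OF assms])
  have pos: "?n > 0" and fixd: "(\<tau> ^^ ?n) x = x" using least_power_of_permutation[OF assms] by auto
  show ?thesis
  proof (rule nth_equalityI)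
    fix j assume "j < length (support \<tau> (\<tau> x))"
    then have j: "j < ?n" by (simp add: n)
    have "support \<tau> (\<tau> x) ! j = (\<tau> ^^ Suc j) x" using j by (simp add: n funpow_swap1)
    also have "\<dots> = support \<tau> x ! (Suc j mod ?n)"
    proof (cases "Suc j = ?n")
      case True then show ?thesis using fixd pos by simp
    next
      case False then show ?thesis using j by simp
    qed
    finally show "support \<tau> (\<tau> x) ! j = rotate1 (support \<tau> x) ! j" using j by (simp add: nth_rotate1)
  qed (simp add: n)
qed

lemma rotation_invariant_support:
  assumes \<kappa>: "rotation_invariant \<I> L \<kappa>" and \<tau>: "permutation \<tau>"
    and i: "i ` orbit \<tau> x \<subseteq> \<I>" and L: "card (orbit \<tau> x) \<le> L" and y: "y \<in> orbit \<tau> x"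
  shows "\<kappa> (map i (support \<tau> y)) = \<kappa> (map i (support \<tau> x))"
proof -
  have step: "\<kappa> (map i (support \<tau> (\<tau> z))) = \<kappa> (map i (support \<tau> z))" if "orbit \<tau> z = orbit \<tau> x" for z
  proof -
    have "set (map i (support \<tau> z)) \<subseteq> \<I>" using set_support_eq_orbit[OF \<tau>, of z] i that
      by (metis set_map)
    moreover have "length (map i (support \<tau> z)) \<le> L"
      using L that least_power_eq_card_orbit[OF \<tau>, of z] by simp
    ultimately show ?thesis using \<kappa> unfolding support_apply[OF \<tau>] rotate1_map[symmetric] rotation_invariant_def by blast
  qed
  have "orbit \<tau> y = orbit \<tau> x \<and> ?thesis" using y
  proof induction
    case base
    show ?case using step[of x] permutation_orbit_step[OF \<tau>] by simp
  next
    case (step z)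
    then show ?case using \<open>\<And>z. orbit \<tau> z = orbit \<tau> x \<Longrightarrow> _\<close>[of z] permutation_orbit_step[OF \<tau>, of z] by simp
  qed
  then show ?thesis ..
qed

lemma orbit_semiconj:
  assumes "\<tau> permutes A" "finite A" "x \<in> A" "\<And>x. x \<in> A \<Longrightarrow> \<tau>' (f x) = f (\<tau> x)"
  shows "orbit \<tau>' (f x) = f ` orbit \<tau> x"
proof -
  have "y \<in> A" if "y \<in> orbit \<tau> x" for y using that permutes_orbit_subset[OF assms(1,3)] by blast
  then show ?thesis using orbit_inverse[OF permutes_self_in_orbit[OF assms(1,2)], where f = f and g' = \<tau>'] assms(4)
    by metis
qed

lemma orbits_semiconj:
  assumes \<tau>: "\<tau> permutes A" "finite A" and f: "inj_on f A"
    and sc: "\<And>x. x \<in> A \<Longrightarrow> \<tau>' (f x) = f (\<tau> x)"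
  shows "orbit \<tau>' ` f ` A = (`) f ` orbit \<tau> ` A" "inj_on ((`) f) (orbit \<tau> ` A)"
    "card (orbit \<tau>' ` f ` A) = cyc A \<tau>"
proof -
  show 1: "orbit \<tau>' ` f ` A = (`) f ` orbit \<tau> ` A"
    unfolding image_image using orbit_semiconj[where f = f and \<tau>' = \<tau>', OF \<tau> _ sc] by (intro image_cong) auto
  show 2: "inj_on ((`) f) (orbit \<tau> ` A)"
  proof (rule inj_onI)
    fix C D assume "C \<in> orbit \<tau> ` A" "D \<in> orbit \<tau> ` A" and eq: "f ` C = f ` D"
    then have "C \<subseteq> A" "D \<subseteq> A" using permutes_orbit_subset[OF \<tau>(1)] by blast+
    then show "C = D" using eq inj_on_image_eq_iff[OF f] by blast
  qed
  show "card (orbit \<tau>' ` f ` A) = cyc A \<tau>" unfolding 1 cyc_def by (rule card_image[OF 2])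
qed

text \<open>A relabelling \<open>f\<close> maps cycles to cycles but need not map least elements to
  least elements, so the words read off on the two sides agree only up to rotation. The lemma covers
  conjugation as well as the two inclusions of a tensor product.\<close>

lemma cycle_prod_semiconj:
  assumes \<tau>: "\<tau> permutes A" "finite A" and \<tau>': "permutation \<tau>'" and f: "inj_on f A"
    and sc: "\<And>x. x \<in> A \<Longrightarrow> \<tau>' (f x) = f (\<tau> x)"
    and \<kappa>: "rotation_invariant \<I> L \<kappa>" and i: "\<And>x. x \<in> A \<Longrightarrow> i (f x) \<in> \<I>"
    and L: "\<And>C. C \<in> orbit \<tau> ` A \<Longrightarrow> card C \<le> L"
  shows "cycle_prod (f ` A) \<tau>' \<kappa> i = cycle_prod A \<tau> \<kappa> (i \<circ> f)"
proof -
  have perm: "permutation \<tau>" using \<tau> permutation_permutes by blast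
  have pow: "(\<tau>' ^^ n) (f x) = f ((\<tau> ^^ n) x) \<and> (\<tau> ^^ n) x \<in> A" if "x \<in> A" for n x
  proof (induction n)
    case 0 then show ?case using that by simp
  next
    case (Suc n) then show ?case using sc by (simp add: permutes_in_image[OF \<tau>(1)])
  qed
  have supp: "support \<tau>' (f x) = map f (support \<tau> x)" if x: "x \<in> A" for x
  proof -
    have "orbit \<tau> x \<subseteq> A" by (rule permutes_orbit_subset[OF \<tau>(1) x])
    then have "card (f ` orbit \<tau> x) = card (orbit \<tau> x)" by (intro card_image inj_on_subset[OF f])
    moreover have "orbit \<tau>' (f x) = f ` orbit \<tau> x" by (rule orbit_semiconj[OF \<tau> x]) (rule sc)
    ultimately have "least_power \<tau>' (f x) = least_power \<tau> x"
      by (simp add: least_power_eq_card_orbit[OF perm] least_power_eq_card_orbit[OF \<tau>'])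
    then show ?thesis using pow[OF x] by simp
  qed
  have "cycle_prod (f ` A) \<tau>' \<kappa> i = (\<Prod>C\<in>orbit \<tau> ` A. \<kappa> (map i (support \<tau>' (Min (f ` C)))))"
  proof -
    have 1: "orbit \<tau>' ` f ` A = (`) f ` orbit \<tau> ` A" by (rule orbits_semiconj(1)[OF \<tau> f]) (rule sc)
    have 2: "inj_on ((`) f) (orbit \<tau> ` A)" by (rule orbits_semiconj(2)[OF \<tau> f]) (rule sc)
    show ?thesis unfolding cycle_prod_def 1 by (subst prod.reindex[OF 2]) simp
  qed
  also have "\<dots> = cycle_prod A \<tau> \<kappa> (i \<circ> f)" unfolding cycle_prod_def
  proof (rule prod.cong[OF refl])
    fix C assume C: "C \<in> orbit \<tau> ` A"
    then obtain x where x: "x \<in> A" "C = orbit \<tau> x" by blast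
    have CA: "C \<subseteq> A" using x permutes_orbit_subset[OF \<tau>(1)] by blast
    have ne: "C \<noteq> {}" "finite C" using x orbit_nonempty finite_subset[OF CA \<tau>(2)] by metis+
    then have "Min (f ` C) \<in> f ` C" by (intro Min_in) auto
    then obtain y where y: "y \<in> C" "Min (f ` C) = f y" by blast
    have Min: "Min C \<in> C" using ne by simp
    have orb: "orbit \<tau> z = C" if "z \<in> C" for z using that x permutes_orbit_eq[OF \<tau>, of z x] by simp
    have "\<kappa> (map i (support \<tau>' (Min (f ` C)))) = \<kappa> (map (i \<circ> f) (support \<tau> y))"
    proof -
      have "y \<in> A" using y(1) CA by blast
      show ?thesis unfolding y(2) supp[OF \<open>y \<in> A\<close>] by (simp only: map_map comp_assoc)
    qed
    also have "\<dots> = \<kappa> (map (i \<circ> f) (support \<tau> (Min C)))"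
      by (rule rotation_invariant_support[OF \<kappa> perm]) (use orb[OF Min] y(1) CA i L[OF C] in auto)
    finally show "\<kappa> (map i (support \<tau>' (Min (f ` C)))) = \<kappa> (map (i \<circ> f) (support \<tau> (Min C)))" .
  qed
  finally show ?thesis .
qed

lemma card_orbit_le:
  assumes "\<tau> permutes A" "finite A" "C \<in> orbit \<tau> ` A"
  shows "card C \<le> card A"
  using assms permutes_orbit_subset[OF assms(1)] by (intro card_mono) auto

section \<open>Conjugation of geodesics\<close>

lemma conj_permutes:
  assumes "\<pi> permutes A" "\<tau> permutes A"
  shows "(\<pi> \<circ> \<tau> \<circ> inv \<pi>) permutes A"
  using assms by (intro permutes_compose permutes_inv)

lemma cyc_conj:
  assumes \<pi>: "\<pi> permutes A" and \<tau>: "\<tau> permutes A" "finite A"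
  shows "cyc A (\<pi> \<circ> \<tau> \<circ> inv \<pi>) = cyc A \<tau>"
proof -
  have "card (orbit (\<pi> \<circ> \<tau> \<circ> inv \<pi>) ` \<pi> ` A) = cyc A \<tau>"
    by (rule orbits_semiconj(3)[OF \<tau>]) (auto simp: permutes_inverses[OF \<pi>] intro: permutes_inj_on[OF \<pi>])
  then show ?thesis by (simp add: cyc_def permutes_image[OF \<pi>])
qed

lemma cycle_prod_conj:
  assumes \<pi>: "\<pi> permutes A" and \<tau>: "\<tau> permutes A" "finite A"
    and \<kappa>: "rotation_invariant \<I> L \<kappa>" and i: "i \<in> A \<rightarrow> \<I>"
    and L: "\<And>C. C \<in> orbit \<tau> ` A \<Longrightarrow> card C \<le> L"
  shows "cycle_prod A (\<pi> \<circ> \<tau> \<circ> inv \<pi>) \<kappa> i = cycle_prod A \<tau> \<kappa> (i \<circ> \<pi>)"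
proof -
  have perm: "permutation (\<pi> \<circ> \<tau> \<circ> inv \<pi>)"
    using conj_permutes[OF \<pi> \<tau>(1)] \<tau>(2) permutation_permutes by blast
  have "cycle_prod (\<pi> ` A) (\<pi> \<circ> \<tau> \<circ> inv \<pi>) \<kappa> i = cycle_prod A \<tau> \<kappa> (i \<circ> \<pi>)"
  proof (rule cycle_prod_semiconj[OF \<tau> perm _ _ \<kappa> _ L])
    show "inj_on \<pi> A" by (rule permutes_inj_on[OF \<pi>])
    show "(\<pi> \<circ> \<tau> \<circ> inv \<pi>) (\<pi> x) = \<pi> (\<tau> x)" for x by (simp add: permutes_inverses[OF \<pi>])
    show "i (\<pi> x) \<in> \<I>" if "x \<in> A" for x
      using i that permutes_in_image[OF \<pi>, of x] by auto
  qed
  then show ?thesis by (simp add: permutes_image[OF \<pi>])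
qed

lemma geo_conj_iff:
  assumes \<pi>: "\<pi> permutes A" and \<sigma>: "\<sigma> permutes A" and \<tau>: "\<tau> permutes A" and fin: "finite A"
  shows "geo A (\<pi> \<circ> \<sigma> \<circ> inv \<pi>) (\<pi> \<circ> \<tau> \<circ> inv \<pi>) \<longleftrightarrow> geo A \<sigma> \<tau>"
proof -
  have "inv (\<pi> \<circ> \<tau> \<circ> inv \<pi>) = \<pi> \<circ> inv \<tau> \<circ> inv \<pi>"
    using permutes_bij[OF \<pi>] permutes_bij[OF \<tau>]
    by (simp add: o_inv_distrib bij_comp bij_imp_bij_inv inv_inv_eq comp_assoc)
  then have "(\<pi> \<circ> \<sigma> \<circ> inv \<pi>) \<circ> inv (\<pi> \<circ> \<tau> \<circ> inv \<pi>) = \<pi> \<circ> (\<sigma> \<circ> inv \<tau>) \<circ> inv \<pi>"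
    by (simp add: fun_eq_iff permutes_inverses[OF \<pi>])
  then show ?thesis
    using cyc_conj[OF \<pi> permutes_compose[OF permutes_inv[OF \<tau>] \<sigma>] fin]
    by (simp add: geo_def cyc_conj[OF \<pi> \<tau> fin] cyc_conj[OF \<pi> \<sigma> fin] conj_permutes[OF \<pi> \<tau>] \<tau>)
qed

lemma bij_betw_conj_geo:
  assumes \<pi>: "\<pi> permutes A" and \<sigma>: "\<sigma> permutes A" and fin: "finite A"
  shows "bij_betw (\<lambda>\<tau>. \<pi> \<circ> \<tau> \<circ> inv \<pi>) {\<tau>. geo A \<sigma> \<tau>} {\<tau>. geo A (\<pi> \<circ> \<sigma> \<circ> inv \<pi>) \<tau>}"
proof (rule bij_betw_byWitness[where f' = "\<lambda>\<tau>. inv \<pi> \<circ> \<tau> \<circ> \<pi>"])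
  have a: "inv \<pi> \<circ> (\<pi> \<circ> \<tau> \<circ> inv \<pi>) \<circ> \<pi> = \<tau>" for \<tau> by (simp add: fun_eq_iff permutes_inverses[OF \<pi>])
  have b: "\<pi> \<circ> (inv \<pi> \<circ> \<tau> \<circ> \<pi>) \<circ> inv \<pi> = \<tau>" for \<tau> by (simp add: fun_eq_iff permutes_inverses[OF \<pi>])
  show "\<forall>\<tau>\<in>{\<tau>. geo A \<sigma> \<tau>}. inv \<pi> \<circ> (\<pi> \<circ> \<tau> \<circ> inv \<pi>) \<circ> \<pi> = \<tau>" using a by blast
  show "\<forall>\<tau>\<in>{\<tau>. geo A (\<pi> \<circ> \<sigma> \<circ> inv \<pi>) \<tau>}. \<pi> \<circ> (inv \<pi> \<circ> \<tau> \<circ> \<pi>) \<circ> inv \<pi> = \<tau>" using b by blast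
  show "(\<lambda>\<tau>. \<pi> \<circ> \<tau> \<circ> inv \<pi>) ` {\<tau>. geo A \<sigma> \<tau>} \<subseteq> {\<tau>. geo A (\<pi> \<circ> \<sigma> \<circ> inv \<pi>) \<tau>}"
    using geo_conj_iff[OF \<pi> \<sigma> _ fin] by (auto simp: geo_def)
  show "(\<lambda>\<tau>. inv \<pi> \<circ> \<tau> \<circ> \<pi>) ` {\<tau>. geo A (\<pi> \<circ> \<sigma> \<circ> inv \<pi>) \<tau>} \<subseteq> {\<tau>. geo A \<sigma> \<tau>}"
  proof (rule image_subsetI)
    fix \<tau> assume "\<tau> \<in> {\<tau>. geo A (\<pi> \<circ> \<sigma> \<circ> inv \<pi>) \<tau>}"
    then have g: "geo A (\<pi> \<circ> \<sigma> \<circ> inv \<pi>) \<tau>" by simp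
    then have "\<tau> permutes A" by (simp add: geo_def)
    then have p: "(inv \<pi> \<circ> \<tau> \<circ> \<pi>) permutes A" using \<pi> by (intro permutes_compose permutes_inv)
    show "inv \<pi> \<circ> \<tau> \<circ> \<pi> \<in> {\<tau>. geo A \<sigma> \<tau>}" using geo_conj_iff[OF \<pi> \<sigma> p fin] g b by simp
  qed
qed

lemma geo_sum_conj:
  assumes \<pi>: "\<pi> permutes A" and \<sigma>: "\<sigma> permutes A" and fin: "finite A"
    and \<kappa>: "\<And>L. rotation_invariant \<I> L \<kappa>" and i: "i \<in> A \<rightarrow> \<I>"
  shows "geo_sum A (\<pi> \<circ> \<sigma> \<circ> inv \<pi>) \<kappa> i = geo_sum A \<sigma> \<kappa> (i \<circ> \<pi>)"
proof -
  have "geo_sum A (\<pi> \<circ> \<sigma> \<circ> inv \<pi>) \<kappa> i = (\<Sum>\<tau> | geo A \<sigma> \<tau>. cycle_prod A (\<pi> \<circ> \<tau> \<circ> inv \<pi>) \<kappa> i)"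
    unfolding geo_sum_def by (rule sum.reindex_bij_betw[OF bij_betw_conj_geo[OF \<pi> \<sigma> fin], symmetric])
  also have "\<dots> = geo_sum A \<sigma> \<kappa> (i \<circ> \<pi>)" unfolding geo_sum_def
  proof (rule sum.cong[OF refl])
    fix \<tau> assume "\<tau> \<in> {\<tau>. geo A \<sigma> \<tau>}"
    then have \<tau>: "\<tau> permutes A" by (simp add: geo_def)
    show "cycle_prod A (\<pi> \<circ> \<tau> \<circ> inv \<pi>) \<kappa> i = cycle_prod A \<tau> \<kappa> (i \<circ> \<pi>)"
      by (rule cycle_prod_conj[OF \<pi> \<tau> fin \<kappa> i card_orbit_le[OF \<tau> fin]])
  qed
  finally show ?thesis .
qed

section \<open>Tensor products of permutations\<close>

lemma tens_permutes:
  assumes "\<sigma>\<^sub>1 permutes {1..k}" "\<sigma>\<^sub>2 permutes {1..l}"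
  shows "tens k \<sigma>\<^sub>1 \<sigma>\<^sub>2 permutes {1..k + l}"
proof (rule bij_imp_permutes)
  have 1: "\<sigma>\<^sub>1 x \<in> {1..k} \<longleftrightarrow> x \<in> {1..k}" and 2: "\<sigma>\<^sub>2 x \<in> {1..l} \<longleftrightarrow> x \<in> {1..l}" for x
    by (rule permutes_in_image[OF assms(1)], rule permutes_in_image[OF assms(2)])
  have i1: "\<sigma>\<^sub>1 x = \<sigma>\<^sub>1 y \<longleftrightarrow> x = y" and i2: "\<sigma>\<^sub>2 x = \<sigma>\<^sub>2 y \<longleftrightarrow> x = y" for x y
    using permutes_inj[OF assms(1)] permutes_inj[OF assms(2)] by (auto dest: injD)
  have le: "1 \<le> \<sigma>\<^sub>1 x \<and> \<sigma>\<^sub>1 x \<le> k" if "1 \<le> x" "x \<le> k" for x using 1[of x] that by simp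
  have le': "1 \<le> \<sigma>\<^sub>2 (x - k) \<and> \<sigma>\<^sub>2 (x - k) \<le> l" if "\<not> x \<le> k" "x \<le> k + l" for x 
  proof -
    have "x - k \<in> {1..l}" using that by auto
    then show ?thesis using 2[of "x - k"] by auto
  qed
  have inj: "inj_on (tens k \<sigma>\<^sub>1 \<sigma>\<^sub>2) {1..k + l}"
  proof (rule inj_onI)
    fix x y assume x: "x \<in> {1..k+l}" and y: "y \<in> {1..k+l}" and eq: "tens k \<sigma>\<^sub>1 \<sigma>\<^sub>2 x = tens k \<sigma>\<^sub>1 \<sigma>\<^sub>2 y"
    consider "x \<le> k" "y \<le> k" | "x \<le> k" "\<not> y \<le> k" | "\<not> x \<le> k" "y \<le> k" | "\<not> x \<le> k" "\<not> y \<le> k" by blast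
    then show "x = y"
    proof cases
      case 1 then show ?thesis using eq i1 by (simp add: tens_def)
    next
      case 2 then show ?thesis using eq le[of x] le'[of y] x y by (simp add: tens_def)
    next
      case 3 then show ?thesis using eq le[of y] le'[of x] x y by (simp add: tens_def)
    next
      case 4 then show ?thesis using eq i2[of "x - k" "y - k"] by (simp add: tens_def)
    qed
  qed
  have "tens k \<sigma>\<^sub>1 \<sigma>\<^sub>2 ` {1..k + l} \<subseteq> {1..k + l}"
  proof (rule image_subsetI)
    fix x assume "x \<in> {1..k + l}"
    then show "tens k \<sigma>\<^sub>1 \<sigma>\<^sub>2 x \<in> {1..k + l}" using le[of x] le'[of x] by (cases "x \<le> k") (auto simp: tens_def)
  qed
  then show "bij_betw (tens k \<sigma>\<^sub>1 \<sigma>\<^sub>2) {1..k + l} {1..k + l}"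
    using inj by (simp add: bij_betw_def endo_inj_surj)
  show "tens k \<sigma>\<^sub>1 \<sigma>\<^sub>2 x = x" if "x \<notin> {1..k + l}" for x
  proof (cases "x \<le> k")
    case True
    then show ?thesis using that permutes_not_in[OF assms(1), of x] by (auto simp: tens_def)
  next
    case False
    then have "x - k \<notin> {1..l}" using that by auto
    then show ?thesis using False permutes_not_in[OF assms(2), of "x - k"] by (simp add: tens_def)
  qed
qed

lemma permutes_zero: "\<sigma> permutes {1..k::nat} \<Longrightarrow> \<sigma> 0 = 0"
  by (rule permutes_not_in) auto

lemma permutes_le_iff: "\<sigma> permutes {1..k::nat} \<Longrightarrow> \<sigma> x \<le> k \<longleftrightarrow> x \<le> k"
  using permutes_in_image[of \<sigma> "{1..k}" x] permutes_not_in[of \<sigma> "{1..k}" x] permutes_zero[of \<sigma> k]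
  by (cases "x = 0"; cases "x \<le> k") auto

lemma permutes_pos: "\<sigma> permutes {1..k::nat} \<Longrightarrow> 0 < x \<Longrightarrow> 0 < \<sigma> x"
  using permutes_zero[of \<sigma> k] permutes_inj[of \<sigma> "{1..k}"] by (metis injD neq0_conv)

lemma tens_comp:
  assumes "\<sigma>\<^sub>1 permutes {1..k}" "\<sigma>\<^sub>2 permutes {1..l}" "\<tau>\<^sub>1 permutes {1..k}" "\<tau>\<^sub>2 permutes {1..l}"
  shows "tens k \<sigma>\<^sub>1 \<sigma>\<^sub>2 \<circ> tens k \<tau>\<^sub>1 \<tau>\<^sub>2 = tens k (\<sigma>\<^sub>1 \<circ> \<tau>\<^sub>1) (\<sigma>\<^sub>2 \<circ> \<tau>\<^sub>2)"
proof
  fix x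
  have "0 < \<tau>\<^sub>2 (x - k)" if "\<not> x \<le> k" using permutes_pos[OF assms(4), of "x - k"] that by simp
  then show "(tens k \<sigma>\<^sub>1 \<sigma>\<^sub>2 \<circ> tens k \<tau>\<^sub>1 \<tau>\<^sub>2) x = tens k (\<sigma>\<^sub>1 \<circ> \<tau>\<^sub>1) (\<sigma>\<^sub>2 \<circ> \<tau>\<^sub>2) x"
    using permutes_le_iff[OF assms(3), of x] by (auto simp: tens_def)
qed

lemma tens_id: "tens k id id = id"
  by (auto simp: tens_def)

lemma tens_inv:
  assumes "\<tau>\<^sub>1 permutes {1..k}" "\<tau>\<^sub>2 permutes {1..l}"
  shows "inv (tens k \<tau>\<^sub>1 \<tau>\<^sub>2) = tens k (inv \<tau>\<^sub>1) (inv \<tau>\<^sub>2)"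
proof (rule inv_unique_comp)
  show "tens k \<tau>\<^sub>1 \<tau>\<^sub>2 \<circ> tens k (inv \<tau>\<^sub>1) (inv \<tau>\<^sub>2) = id"
    using tens_comp[OF assms permutes_inv[OF assms(1)] permutes_inv[OF assms(2)]] tens_id
    by (simp add: permutes_inv_o[OF assms(1)] permutes_inv_o[OF assms(2)])
  show "tens k (inv \<tau>\<^sub>1) (inv \<tau>\<^sub>2) \<circ> tens k \<tau>\<^sub>1 \<tau>\<^sub>2 = id"
    using tens_comp[OF permutes_inv[OF assms(1)] permutes_inv[OF assms(2)] assms] tens_id
    by (simp add: permutes_inv_o[OF assms(1)] permutes_inv_o[OF assms(2)])
qed

lemma interval_split: "{1..k + l} = {1..k} \<union> (+) k ` {1..l::nat}"
proof -
  have "(+) k ` {1..l} = {k + 1..k + l}" by (simp add: image_add_atLeastAtMost)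
  then show ?thesis by auto
qed

lemma orbits_tens_disjoint:
  assumes "\<tau>\<^sub>1 permutes {1..k}" "\<tau>\<^sub>2 permutes {1..l}"
  shows "orbit (tens k \<tau>\<^sub>1 \<tau>\<^sub>2) ` {1..k} \<inter> orbit (tens k \<tau>\<^sub>1 \<tau>\<^sub>2) ` (+) k ` {1..l} = {}"
proof -
  have sc1: "tens k \<tau>\<^sub>1 \<tau>\<^sub>2 (id x) = id (\<tau>\<^sub>1 x)" if "x \<in> {1..k}" for x using that by (simp add: tens_def)
  have sc2: "tens k \<tau>\<^sub>1 \<tau>\<^sub>2 (k + x) = k + \<tau>\<^sub>2 x" if "x \<in> {1..l}" for x using that by (simp add: tens_def)
  have 1: "orbit (tens k \<tau>\<^sub>1 \<tau>\<^sub>2) x \<subseteq> {1..k}" if "x \<in> {1..k}" for x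
    using orbit_semiconj[where f = id, OF assms(1) _ that sc1] permutes_orbit_subset[OF assms(1) that] by simp
  have 2: "orbit (tens k \<tau>\<^sub>1 \<tau>\<^sub>2) (k + x) \<subseteq> (+) k ` {1..l}" if "x \<in> {1..l}" for x
    using orbit_semiconj[where f = "(+) k", OF assms(2) _ that sc2] permutes_orbit_subset[OF assms(2) that] by auto
  show ?thesis
  proof (rule ccontr)
    assume "\<not> ?thesis"
    then obtain C where C: "C \<in> orbit (tens k \<tau>\<^sub>1 \<tau>\<^sub>2) ` {1..k}" "C \<in> orbit (tens k \<tau>\<^sub>1 \<tau>\<^sub>2) ` (+) k ` {1..l}"
      by blast
    from C(1) obtain x where x: "x \<in> {1..k}" "C = orbit (tens k \<tau>\<^sub>1 \<tau>\<^sub>2) x" by blast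
    from C(2) obtain y where y: "y \<in> {1..l}" "C = orbit (tens k \<tau>\<^sub>1 \<tau>\<^sub>2) (k + y)" by blast
    have xy: "x \<in> {1..k}" "y \<in> {1..l}" "orbit (tens k \<tau>\<^sub>1 \<tau>\<^sub>2) x = orbit (tens k \<tau>\<^sub>1 \<tau>\<^sub>2) (k + y)"
      using x y by auto
    obtain z where "z \<in> orbit (tens k \<tau>\<^sub>1 \<tau>\<^sub>2) x" using orbit.base by metis
    then have "z \<in> {1..k}" "z \<in> (+) k ` {1..l}" using 1[OF xy(1)] 2[OF xy(2)] xy(3) by auto
    then show False by auto
  qed
qed

lemma cyc_tens:
  assumes "\<tau>\<^sub>1 permutes {1..k}" "\<tau>\<^sub>2 permutes {1..l}"
  shows "cyc {1..k + l} (tens k \<tau>\<^sub>1 \<tau>\<^sub>2) = cyc {1..k} \<tau>\<^sub>1 + cyc {1..l} \<tau>\<^sub>2"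
proof -
  let ?t = "tens k \<tau>\<^sub>1 \<tau>\<^sub>2"
  have "card (orbit ?t ` id ` {1..k}) = cyc {1..k} \<tau>\<^sub>1"
    by (rule orbits_semiconj(3)[OF assms(1)]) (auto simp: tens_def)
  moreover have "card (orbit ?t ` (+) k ` {1..l}) = cyc {1..l} \<tau>\<^sub>2"
    by (rule orbits_semiconj(3)[OF assms(2)]) (auto simp: tens_def)
  moreover have "cyc {1..k + l} ?t = card (orbit ?t ` {1..k}) + card (orbit ?t ` (+) k ` {1..l})"
    unfolding cyc_def interval_split image_Un by (rule card_Un_disjoint[OF _ _ orbits_tens_disjoint[OF assms]]) auto
  ultimately show ?thesis by simp
qed

lemma cycle_prod_tens:
  assumes "\<tau>\<^sub>1 permutes {1..k}" "\<tau>\<^sub>2 permutes {1..l}"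
    and \<kappa>: "\<And>L. rotation_invariant \<I> L \<kappa>" and i: "i \<in> {1..k + l} \<rightarrow> \<I>"
  shows "cycle_prod {1..k + l} (tens k \<tau>\<^sub>1 \<tau>\<^sub>2) \<kappa> i =
    cycle_prod {1..k} \<tau>\<^sub>1 \<kappa> i * cycle_prod {1..l} \<tau>\<^sub>2 \<kappa> (\<lambda>j. i (k + j))"
proof -
  let ?t = "tens k \<tau>\<^sub>1 \<tau>\<^sub>2"
  have perm: "permutation ?t" using tens_permutes[OF assms(1,2)] permutation_permutes by blast
  have "cycle_prod (id ` {1..k}) ?t \<kappa> i = cycle_prod {1..k} \<tau>\<^sub>1 \<kappa> (i \<circ> id)"
    by (rule cycle_prod_semiconj[OF assms(1) _ perm _ _ \<kappa> _ card_orbit_le[OF assms(1)]])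
      (use i in \<open>auto simp: tens_def\<close>)
  moreover have "cycle_prod ((+) k ` {1..l}) ?t \<kappa> i = cycle_prod {1..l} \<tau>\<^sub>2 \<kappa> (i \<circ> (+) k)"
    by (rule cycle_prod_semiconj[OF assms(2) _ perm _ _ \<kappa> _ card_orbit_le[OF assms(2)]])
      (use i in \<open>auto simp: tens_def\<close>)
  moreover have "cycle_prod {1..k + l} ?t \<kappa> i =
      cycle_prod {1..k} ?t \<kappa> i * cycle_prod ((+) k ` {1..l}) ?t \<kappa> i"
    unfolding cycle_prod_def interval_split image_Un
    by (rule prod.union_disjoint[OF _ _ orbits_tens_disjoint[OF assms(1,2)]]) auto
  ultimately show ?thesis by (simp add: comp_def)
qed

lemma preserving_eq_tens:
  assumes \<tau>: "\<tau> permutes {1..k + l}" and pres: "\<And>x. x \<in> {1..k} \<Longrightarrow> \<tau> x \<in> {1..k}"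
  obtains \<tau>\<^sub>1 \<tau>\<^sub>2 where "\<tau> = tens k \<tau>\<^sub>1 \<tau>\<^sub>2" "\<tau>\<^sub>1 permutes {1..k}" "\<tau>\<^sub>2 permutes {1..l}"
proof -
  have inj: "\<tau> x = \<tau> y \<longleftrightarrow> x = y" for x y using permutes_inj[OF \<tau>] by (auto dest: injD)
  have "\<tau> ` {1..k} = {1..k}"
    using pres by (intro endo_inj_surj permutes_inj_on[OF \<tau>]) auto
  have pres': "\<tau> x \<notin> {1..k}" if "x \<notin> {1..k}" for x
  proof
    assume "\<tau> x \<in> {1..k}"
    then have "\<tau> x \<in> \<tau> ` {1..k}" using \<open>\<tau> ` {1..k} = {1..k}\<close> by simp
    then obtain y where "y \<in> {1..k}" "\<tau> x = \<tau> y" by blast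
    then show False using that inj[of x y] by blast
  qed
  have in': "\<tau> (k + x) - k \<in> {1..l} \<and> k + (\<tau> (k + x) - k) = \<tau> (k + x)" if "x \<in> {1..l}" for x
    using pres'[of "k + x"] permutes_in_image[OF \<tau>, of "k + x"] that by auto
  define \<tau>\<^sub>1 where "\<tau>\<^sub>1 x = (if x \<in> {1..k} then \<tau> x else x)" for x
  define \<tau>\<^sub>2 where "\<tau>\<^sub>2 x = (if x \<in> {1..l} then \<tau> (k + x) - k else x)" for x
  have "bij_betw \<tau> {1..k} {1..k}" using \<open>\<tau> ` {1..k} = {1..k}\<close> permutes_inj_on[OF \<tau>] by (simp add: bij_betw_def)
  then have "bij_betw \<tau>\<^sub>1 {1..k} {1..k}" by (subst bij_betw_cong[where g = \<tau>]) (auto simp: \<tau>\<^sub>1_def)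
  then have 1: "\<tau>\<^sub>1 permutes {1..k}" by (rule bij_imp_permutes) (auto simp: \<tau>\<^sub>1_def)
  have \<tau>\<^sub>2: "k + \<tau>\<^sub>2 x = \<tau> (k + x)" if "x \<in> {1..l}" for x
    using in'[OF that] that unfolding \<tau>\<^sub>2_def by presburger
  have "inj_on \<tau>\<^sub>2 {1..l}"
  proof (rule inj_onI)
    fix x y assume x: "x \<in> {1..l}" and y: "y \<in> {1..l}" and "\<tau>\<^sub>2 x = \<tau>\<^sub>2 y"
    then have "\<tau> (k + x) = \<tau> (k + y)" using \<tau>\<^sub>2[OF x] \<tau>\<^sub>2[OF y] by metis
    then show "x = y" using inj[of "k + x" "k + y"] by simp
  qed
  moreover have "\<tau>\<^sub>2 ` {1..l} \<subseteq> {1..l}"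
    by (rule image_subsetI) (use in' in \<open>simp add: \<tau>\<^sub>2_def\<close>)
  ultimately have "bij_betw \<tau>\<^sub>2 {1..l} {1..l}" by (simp add: bij_betw_def endo_inj_surj)
  then have 2: "\<tau>\<^sub>2 permutes {1..l}" by (rule bij_imp_permutes) (auto simp: \<tau>\<^sub>2_def)
  have "\<tau> x = tens k \<tau>\<^sub>1 \<tau>\<^sub>2 x" for x
  proof -
    consider "x = 0" | "x \<in> {1..k}" | "\<not> x \<le> k" "x - k \<in> {1..l}" | "\<not> x \<le> k + l" by (cases x) force+
    then show ?thesis
    proof cases
      case 1 then show ?thesis using permutes_zero[OF \<tau>] by (simp add: tens_def \<tau>\<^sub>1_def)
    next
      case 2 then show ?thesis by (simp add: tens_def \<tau>\<^sub>1_def)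
    next
      case 3
      then have "tens k \<tau>\<^sub>1 \<tau>\<^sub>2 x = \<tau> (k + (x - k))" using \<tau>\<^sub>2[of "x - k"] by (simp add: tens_def)
      then show ?thesis using 3 by simp
    next
      case 4 then show ?thesis using permutes_not_in[OF \<tau>, of x] by (simp add: tens_def \<tau>\<^sub>2_def)
    qed
  qed
  then show thesis using that 1 2 by blast
qed

lemma tens_eq_iff:
  assumes "\<tau>\<^sub>1 permutes {1..k}" "\<tau>\<^sub>2 permutes {1..l}" "\<tau>\<^sub>1' permutes {1..k}" "\<tau>\<^sub>2' permutes {1..l}"
  shows "tens k \<tau>\<^sub>1 \<tau>\<^sub>2 = tens k \<tau>\<^sub>1' \<tau>\<^sub>2' \<longleftrightarrow> \<tau>\<^sub>1 = \<tau>\<^sub>1' \<and> \<tau>\<^sub>2 = \<tau>\<^sub>2'"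
proof
  assume eq: "tens k \<tau>\<^sub>1 \<tau>\<^sub>2 = tens k \<tau>\<^sub>1' \<tau>\<^sub>2'"
  have "\<tau>\<^sub>1 x = \<tau>\<^sub>1' x" for x
    using fun_cong[OF eq, of x] permutes_not_in[OF assms(1), of x] permutes_not_in[OF assms(3), of x]
    by (cases "x \<le> k") (auto simp: tens_def)
  moreover have "\<tau>\<^sub>2 x = \<tau>\<^sub>2' x" for x
    using fun_cong[OF eq, of "k + x"] permutes_zero[OF assms(2)] permutes_zero[OF assms(4)]
    by (cases "x = 0") (auto simp: tens_def)
  ultimately show "\<tau>\<^sub>1 = \<tau>\<^sub>1' \<and> \<tau>\<^sub>2 = \<tau>\<^sub>2'" by blast
qed simp

text \<open>All cycle counts are additive, and by the triangle inequality neither factor can have a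
  negative defect. So the total defect vanishes iff both defects do.\<close>

lemma geo_tens_iff:
  assumes \<sigma>: "\<sigma>\<^sub>1 permutes {1..k}" "\<sigma>\<^sub>2 permutes {1..l}" and \<tau>: "\<tau>\<^sub>1 permutes {1..k}" "\<tau>\<^sub>2 permutes {1..l}"
  shows "geo {1..k + l} (tens k \<sigma>\<^sub>1 \<sigma>\<^sub>2) (tens k \<tau>\<^sub>1 \<tau>\<^sub>2) \<longleftrightarrow> geo {1..k} \<sigma>\<^sub>1 \<tau>\<^sub>1 \<and> geo {1..l} \<sigma>\<^sub>2 \<tau>\<^sub>2"
proof -
  have "tens k \<sigma>\<^sub>1 \<sigma>\<^sub>2 \<circ> inv (tens k \<tau>\<^sub>1 \<tau>\<^sub>2) = tens k (\<sigma>\<^sub>1 \<circ> inv \<tau>\<^sub>1) (\<sigma>\<^sub>2 \<circ> inv \<tau>\<^sub>2)"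
    unfolding tens_inv[OF \<tau>] by (rule tens_comp[OF \<sigma> permutes_inv[OF \<tau>(1)] permutes_inv[OF \<tau>(2)]])
  then have "cyc {1..k + l} (tens k \<sigma>\<^sub>1 \<sigma>\<^sub>2 \<circ> inv (tens k \<tau>\<^sub>1 \<tau>\<^sub>2)) = cyc {1..k} (\<sigma>\<^sub>1 \<circ> inv \<tau>\<^sub>1) + cyc {1..l} (\<sigma>\<^sub>2 \<circ> inv \<tau>\<^sub>2)"
    using cyc_tens[OF permutes_compose[OF permutes_inv[OF \<tau>(1)] \<sigma>(1)] permutes_compose[OF permutes_inv[OF \<tau>(2)] \<sigma>(2)]] by simp
  then show ?thesis
    using cyc_triangle(1)[OF _ \<sigma>(1) \<tau>(1)] cyc_triangle(1)[OF _ \<sigma>(2) \<tau>(2)] tens_permutes[OF \<tau>] \<tau>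
    by (auto simp: geo_def cyc_tens[OF \<sigma>] cyc_tens[OF \<tau>] simp del: One_nat_def)
qed

lemma geo_sum_tens:
  assumes \<sigma>: "\<sigma>\<^sub>1 permutes {1..k}" "\<sigma>\<^sub>2 permutes {1..l}"
    and \<kappa>: "\<And>L. rotation_invariant \<I> L \<kappa>" and i: "i \<in> {1..k + l} \<rightarrow> \<I>"
  shows "geo_sum {1..k + l} (tens k \<sigma>\<^sub>1 \<sigma>\<^sub>2) \<kappa> i =
    geo_sum {1..k} \<sigma>\<^sub>1 \<kappa> i * geo_sum {1..l} \<sigma>\<^sub>2 \<kappa> (\<lambda>j. i (k + j))"
proof -
  let ?G1 = "{\<tau>. geo {1..k} \<sigma>\<^sub>1 \<tau>}" and ?G2 = "{\<tau>. geo {1..l} \<sigma>\<^sub>2 \<tau>}"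
  let ?G = "{\<tau>. geo {1..k + l} (tens k \<sigma>\<^sub>1 \<sigma>\<^sub>2) \<tau>}"
  have perm: "\<tau>\<^sub>1 permutes {1..k} \<and> \<tau>\<^sub>2 permutes {1..l}" if "(\<tau>\<^sub>1, \<tau>\<^sub>2) \<in> ?G1 \<times> ?G2" for \<tau>\<^sub>1 \<tau>\<^sub>2
    using that by (auto simp: geo_def)
  have "bij_betw (\<lambda>(\<tau>\<^sub>1, \<tau>\<^sub>2). tens k \<tau>\<^sub>1 \<tau>\<^sub>2) (?G1 \<times> ?G2) ?G"
    unfolding bij_betw_def
  proof
    show "inj_on (\<lambda>(\<tau>\<^sub>1, \<tau>\<^sub>2). tens k \<tau>\<^sub>1 \<tau>\<^sub>2) (?G1 \<times> ?G2)"
      by (rule inj_onI) (use perm tens_eq_iff in \<open>auto simp: geo_def\<close>)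
    show "(\<lambda>(\<tau>\<^sub>1, \<tau>\<^sub>2). tens k \<tau>\<^sub>1 \<tau>\<^sub>2) ` (?G1 \<times> ?G2) = ?G"
    proof
      show "(\<lambda>(\<tau>\<^sub>1, \<tau>\<^sub>2). tens k \<tau>\<^sub>1 \<tau>\<^sub>2) ` (?G1 \<times> ?G2) \<subseteq> ?G"
      proof (rule image_subsetI)
        fix z assume z: "z \<in> ?G1 \<times> ?G2"
        obtain \<tau>\<^sub>1 \<tau>\<^sub>2 where zz: "z = (\<tau>\<^sub>1, \<tau>\<^sub>2)" by (cases z)
        show "(case z of (\<tau>\<^sub>1, \<tau>\<^sub>2) \<Rightarrow> tens k \<tau>\<^sub>1 \<tau>\<^sub>2) \<in> ?G"
          using z perm[of \<tau>\<^sub>1 \<tau>\<^sub>2] geo_tens_iff[OF \<sigma>, of \<tau>\<^sub>1 \<tau>\<^sub>2] unfolding zz by auto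
      qed
      show "?G \<subseteq> (\<lambda>(\<tau>\<^sub>1, \<tau>\<^sub>2). tens k \<tau>\<^sub>1 \<tau>\<^sub>2) ` (?G1 \<times> ?G2)"
      proof
        fix \<tau> assume "\<tau> \<in> ?G"
        then have g: "geo {1..k + l} (tens k \<sigma>\<^sub>1 \<sigma>\<^sub>2) \<tau>" by simp
        then have \<tau>: "\<tau> permutes {1..k + l}" by (simp add: geo_def)
        \<comment> \<open>The interval \<open>{1..k}\<close> is a union of cycles of the tensor
          product, hence stable under any geodesic to it; this is what splits the geodesic into two
          factors.\<close>
        have "\<tau> x \<in> {1..k}" if x: "x \<in> {1..k}" for x
        proof -
          have "\<tau> x \<in> {1..k} \<longleftrightarrow> x \<in> {1..k}"
          proof (rule geo_preserves[OF _ tens_permutes[OF \<sigma>] g])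
            show "tens k \<sigma>\<^sub>1 \<sigma>\<^sub>2 x \<in> {1..k} \<longleftrightarrow> x \<in> {1..k}" if "x \<in> {1..k + l}" for x
              using that permutes_in_image[OF \<sigma>(1), of x] permutes_pos[OF \<sigma>(2), of "x - k"] by (auto simp: tens_def)
          qed (use x in auto)
          then show ?thesis using x by blast
        qed
        then obtain \<tau>\<^sub>1 \<tau>\<^sub>2 where "\<tau> = tens k \<tau>\<^sub>1 \<tau>\<^sub>2" "\<tau>\<^sub>1 permutes {1..k}" "\<tau>\<^sub>2 permutes {1..l}"
          using preserving_eq_tens[OF \<tau>] by blast
        then show "\<tau> \<in> (\<lambda>(\<tau>\<^sub>1, \<tau>\<^sub>2). tens k \<tau>\<^sub>1 \<tau>\<^sub>2) ` (?G1 \<times> ?G2)"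
          using geo_tens_iff[OF \<sigma>] g by auto
      qed
    qed
  qed
  then have "geo_sum {1..k + l} (tens k \<sigma>\<^sub>1 \<sigma>\<^sub>2) \<kappa> i =
      (\<Sum>z\<in>?G1 \<times> ?G2. cycle_prod {1..k + l} (case z of (\<tau>\<^sub>1, \<tau>\<^sub>2) \<Rightarrow> tens k \<tau>\<^sub>1 \<tau>\<^sub>2) \<kappa> i)"
    unfolding geo_sum_def by (rule sum.reindex_bij_betw[symmetric])
  also have "\<dots> = (\<Sum>z\<in>?G1 \<times> ?G2. case z of (\<tau>\<^sub>1, \<tau>\<^sub>2) \<Rightarrow>
      cycle_prod {1..k} \<tau>\<^sub>1 \<kappa> i * cycle_prod {1..l} \<tau>\<^sub>2 \<kappa> (\<lambda>j. i (k + j)))"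
    by (intro sum.cong refl) (use perm cycle_prod_tens[OF _ _ \<kappa> i] in auto)
  also have "\<dots> = geo_sum {1..k} \<sigma>\<^sub>1 \<kappa> i * geo_sum {1..l} \<sigma>\<^sub>2 \<kappa> (\<lambda>j. i (k + j))"
    unfolding geo_sum_def sum_product by (simp add: sum.cartesian_product)
  finally show ?thesis .
qed

section \<open>The full cycle, rotation of cumulants, and reduction to full cycles\<close>

lemma full_cycle_permutes: "full_cycle n permutes {1..n}"
  using cycle_permutes[of "[1..<n + 1]"] by (simp add: atLeastLessThanSuc_atLeastAtMost del: upt_Suc)

lemma cyclic_succ_full_cycle: "cyclic_succ {1..n} (full_cycle n)"
  using cyclic_succ_cycle_of_list[of "[1..<n + 1]"]
  by (simp add: atLeastLessThanSuc_atLeastAtMost del: upt_Suc)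

lemma full_cycle_apply:
  assumes "j \<in> {1..n}"
  shows "full_cycle n j = (if j = n then 1 else Suc j)"
proof -
  have "(full_cycle n ^^ 1) ([1..<n + 1] ! (j - 1)) = [1..<n + 1] ! ((1 + (j - 1)) mod length [1..<n + 1])"
    by (rule funpow_cycle_of_list_nth) (use assms in auto)
  moreover have "[1..<n + 1] ! (j - 1) = j" using assms by (auto simp del: upt_Suc)
  ultimately have "full_cycle n j = [1..<n + 1] ! (j mod n)" using assms by (simp del: upt_Suc)
  then show ?thesis using assms by (auto simp del: upt_Suc)
qed

lemma free_cumulants_geo_sum:
  assumes "free_cumulants \<I> m \<kappa>" "n \<ge> 1" "i \<in> {1..n} \<rightarrow> \<I>"
  shows "m (map i [1..<n + 1]) = geo_sum {1..n} (full_cycle n) \<kappa> i"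
  using assms sum_NC_eq_sum_geo[OF cyclic_succ_full_cycle, where n = n and g = "\<lambda>c. \<kappa> (map i c)"]
  unfolding free_cumulants_def geo_sum_def cycle_prod_def by simp

lemma geo_full_cycle_self: "geo {1..n} (full_cycle n) (full_cycle n)"
proof -
  have "noncrossing_on {1..n} (full_cycle n)"
    using cyclic_succ_full_cycle[of n] unfolding noncrossing_on_def cyclic_succ_def by blast
  then show ?thesis
    using geo_cyclic_succ_iff[OF _ cyclic_succ_full_cycle, of n] cyclic_succ_full_cycle[of n]
    by (simp add: cyclic_succ_def)
qed

lemma finite_geo: "finite A \<Longrightarrow> finite {\<tau>. geo A \<sigma> \<tau>}"
  by (rule finite_subset[OF _ finite_permutations[of A]]) (auto simp: geo_def)

lemma cycle_prod_full_cycle: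
  assumes "n \<ge> 1"
  shows "cycle_prod {1..n} (full_cycle n) \<kappa> i = \<kappa> (map i [1..<n + 1])"
proof -
  have orb: "orbit (full_cycle n) ` {1..n} = {{1..n}}"
    using cyclic_succ_full_cycle[of n] assms by (auto simp: cyclic_succ_def image_constant_conv cong: image_cong_simp)
  have "support (full_cycle n) (Min {1..n}) = sorted_list_of_set {1..n}"
    by (rule support_incr_on[OF full_cycle_permutes])
      (use cyclic_succ_full_cycle[of n] orb in \<open>auto simp: cyclic_succ_def\<close>)
  also have "\<dots> = [1..<n + 1]"
    by (simp flip: atLeastLessThanSuc_atLeastAtMost del: upt_Suc)
  finally show ?thesis unfolding cycle_prod_def orb by simp
qed

text \<open>Comparing the moment-cumulant relations of a word and of its rotation, all terms but the
  cumulants of the full words agree by induction, because conjugation by the full cycle permutes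
  the geodesics.\<close>

lemma free_cumulants_rotation_invariant:
  assumes \<kappa>: "free_cumulants \<I> m \<kappa>"
    and tracial: "\<And>n i. n \<ge> 1 \<Longrightarrow> i \<in> {1..n} \<rightarrow> \<I> \<Longrightarrow>
      m (map (i \<circ> full_cycle n) [1..<n + 1]) = m (map i [1..<n + 1])"
  shows "rotation_invariant \<I> L \<kappa>"
proof (induction L)
  case 0
  then show ?case by (simp add: rotation_invariant_def)
next
  case (Suc L)
  show ?case unfolding rotation_invariant_def
  proof (intro allI impI, elim conjE)
    fix w :: "'a list" assume w: "set w \<subseteq> \<I>" "length w \<le> Suc L"
    show "\<kappa> (rotate1 w) = \<kappa> w"
    proof (cases "length w = Suc L")
      case False
      then show ?thesis using Suc w unfolding rotation_invariant_def by auto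
    next
      case True
      define n where "n = Suc L"
      let ?A = "{1..n}" and ?\<sigma> = "full_cycle n"
      define i where "i j = w ! (j - 1)" for j
      have n: "n \<ge> 1" by (simp add: n_def)
      have w_eq: "w = map i [1..<n + 1]"
        by (rule nth_equalityI) (use True in \<open>auto simp: i_def n_def simp del: upt_Suc\<close>)
      have rot: "rotate1 w = map (i \<circ> ?\<sigma>) [1..<n + 1]"
        using cyclic_rotation[of "[1..<n + 1]" 1] unfolding w_eq
        by (simp add: rotate1_map flip: map_map del: upt_Suc)
      have iI: "i \<in> ?A \<rightarrow> \<I>" 
      proof
        fix j assume "j \<in> ?A"
        then have "j - 1 < length w" using True by (auto simp: n_def)
        then show "i j \<in> \<I>" using w(1) nth_mem unfolding i_def by blast
      qed
      have iI': "i \<circ> ?\<sigma> \<in> ?A \<rightarrow> \<I>" using iI permutes_in_image[OF full_cycle_permutes[of n]] by auto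
      let ?G = "{\<tau>. geo ?A ?\<sigma> \<tau>}"
      have split: "m (map j [1..<n + 1]) = \<kappa> (map j [1..<n + 1]) + (\<Sum>\<tau>\<in>?G - {?\<sigma>}. cycle_prod ?A \<tau> \<kappa> j)"
        if "j \<in> ?A \<rightarrow> \<I>" for j
        unfolding free_cumulants_geo_sum[OF \<kappa> n that] geo_sum_def cycle_prod_full_cycle[OF n, where \<kappa> = \<kappa>, symmetric]
        by (rule sum.remove[OF finite_geo]) (use geo_full_cycle_self in auto)
      have inv: "?\<sigma> \<circ> ?\<sigma> \<circ> inv ?\<sigma> = ?\<sigma>"
        by (simp only: comp_assoc permutes_inv_o[OF full_cycle_permutes] comp_id)
      have "bij_betw (\<lambda>\<tau>. ?\<sigma> \<circ> \<tau> \<circ> inv ?\<sigma>) ?G ?G"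
        using bij_betw_conj_geo[OF full_cycle_permutes full_cycle_permutes, of n] inv by simp
      then have bij: "bij_betw (\<lambda>\<tau>. ?\<sigma> \<circ> \<tau> \<circ> inv ?\<sigma>) (?G - {?\<sigma>}) (?G - {?\<sigma>})"
        using bij_betw_DiffI[of _ ?G ?G "{?\<sigma>}" "{?\<sigma>}"] geo_full_cycle_self[of n] inv by (auto simp: bij_betw_def)
      have "(\<Sum>\<tau>\<in>?G - {?\<sigma>}. cycle_prod ?A \<tau> \<kappa> (i \<circ> ?\<sigma>)) =
          (\<Sum>\<tau>\<in>?G - {?\<sigma>}. cycle_prod ?A (?\<sigma> \<circ> \<tau> \<circ> inv ?\<sigma>) \<kappa> i)"
      proof (rule sum.cong[OF refl])
        fix \<tau> assume \<tau>: "\<tau> \<in> ?G - {?\<sigma>}"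
        then have perm: "\<tau> permutes ?A" "incr_on ?A \<tau>"
          using geo_cyclic_succ_iff[OF _ cyclic_succ_full_cycle, of n \<tau>] by auto
        \<comment> \<open>A cycle through all points would make \<open>\<tau>\<close> increasing and
          transitive, hence equal to the full cycle, which has been removed from the sum. So only
          cumulants of words of length at most \<open>L\<close> occur and the induction hypothesis
          suffices.\<close>
        have "card C \<le> L" if C: "C \<in> orbit \<tau> ` ?A" for C
        proof (rule ccontr)
          assume "\<not> card C \<le> L"
          then have "card ?A \<le> card C" by (simp add: n_def)
          moreover have CA: "C \<subseteq> ?A" using C permutes_orbit_subset[OF perm(1)] by blast
          ultimately have "C = ?A" using card_seteq[of ?A C] by simp
          then have orb: "orbit \<tau> x = ?A" if "x \<in> ?A" for x
          proof -
            obtain y where "C = orbit \<tau> y" using C by blast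
            then have "x \<in> orbit \<tau> y" using that \<open>C = ?A\<close> by blast
            then show ?thesis using permutes_orbit_eq[OF perm(1), of x y] \<open>C = orbit \<tau> y\<close> \<open>C = ?A\<close> by simp
          qed
          have "\<tau> x = ?\<sigma> x" for x
          proof (cases "x \<in> ?A")
            case True
            have "incr_on ?A ?\<sigma>" "orbit ?\<sigma> x = ?A"
              using cyclic_succ_full_cycle[of n] True unfolding cyclic_succ_def by blast+
            then show ?thesis using incr_on_unique[OF perm(2) _ True] orb[OF True] by simp
          next
            case False
            then show ?thesis
              using permutes_not_in[OF perm(1)] permutes_not_in[OF full_cycle_permutes] by metis
          qed
          then show False using \<tau> by auto
        qed
        then show "cycle_prod ?A \<tau> \<kappa> (i \<circ> ?\<sigma>) = cycle_prod ?A (?\<sigma> \<circ> \<tau> \<circ> inv ?\<sigma>) \<kappa> i"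
          using cycle_prod_conj[OF full_cycle_permutes perm(1) _ Suc iI] by simp
      qed
      also have "\<dots> = (\<Sum>\<tau>\<in>?G - {?\<sigma>}. cycle_prod ?A \<tau> \<kappa> i)"
        by (rule sum.reindex_bij_betw[OF bij])
      finally have "\<kappa> (map (i \<circ> ?\<sigma>) [1..<n + 1]) = \<kappa> (map i [1..<n + 1])"
        using split[OF iI] split[OF iI'] tracial[OF n iI] by simp
      then show ?thesis using rot w_eq by metis
    qed
  qed
qed

text \<open>The factorization hypothesis can only be applied to juxtaposed permutations. Splitting
  off the cycle of \<open>k\<close> by a relabelling makes it available for an arbitrary
  permutation, by induction on the number of points.\<close>

lemma conj_tens_full_cycle:
  assumes \<sigma>: "\<sigma> permutes {1..k}" and k: "k \<ge> 1"
  obtains f l r \<sigma>\<^sub>1 where "f permutes {1..k}" "k = l + r" "r \<ge> 1" "\<sigma>\<^sub>1 permutes {1..l}"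
    "\<sigma> = f \<circ> tens l \<sigma>\<^sub>1 (full_cycle r) \<circ> inv f"
proof -
  have perm: "permutation \<sigma>" using \<sigma> permutation_permutes by blast
  define C where "C = orbit \<sigma> k"
  have kC: "k \<in> C" unfolding C_def by (rule permutes_self_in_orbit[OF \<sigma>]) simp
  have CA: "C \<subseteq> {1..k}" unfolding C_def by (rule permutes_orbit_subset[OF \<sigma>]) (use k in simp)
  have finC: "finite C" by (rule finite_subset[OF CA]) simp
  define r where "r = card C"
  define l where "l = k - r"
  have r: "r \<ge> 1" using kC finC by (auto simp: r_def Suc_le_eq card_gt_0_iff)
  have kr: "k = l + r" using card_mono[OF _ CA] by (simp add: l_def r_def)
  have lp: "least_power \<sigma> k = r" by (simp add: least_power_eq_card_orbit[OF perm] r_def C_def)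
  define xs where "xs = sorted_list_of_set ({1..k} - C)"
  define ys where "ys = support \<sigma> k"
  have xs: "set xs = {1..k} - C" "distinct xs" "length xs = l"
    using CA finC by (auto simp: xs_def l_def r_def card_Diff_subset)
  have ys: "set ys = C" "distinct ys" "length ys = r"
    using set_support_eq_orbit[OF perm] cycle_of_permutation[OF perm] lp by (auto simp: ys_def C_def)
  \<comment> \<open>The new order lists first the points outside the cycle of \<open>k\<close>, then
    that cycle in its own order starting from \<open>k\<close>. The relabelling \<open>f\<close>
    enumerates this list, so in the new labels the cycle is the full cycle on the last
    \<open>r\<close> points.\<close>
  define zs where "zs = xs @ ys"
  have zs: "set zs = {1..k}" "distinct zs" "length zs = k" using xs ys CA kr by (auto simp: zs_def)
  define f where "f j = (if j \<in> {1..k} then zs ! (j - 1) else j)" for j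
  have "inj_on f {1..k}"
    by (rule inj_onI) (use zs(2,3) in \<open>auto simp: f_def nth_eq_iff_index_eq\<close>)
  moreover have "f ` {1..k} \<subseteq> {1..k}"
  proof (rule image_subsetI)
    fix j assume "j \<in> {1..k}"
    moreover from this have "zs ! (j - 1) \<in> set zs" using zs(3) by (intro nth_mem) auto
    ultimately show "f j \<in> {1..k}" using zs(1) by (simp add: f_def)
  qed
  ultimately have "bij_betw f {1..k} {1..k}" by (simp add: bij_betw_def endo_inj_surj)
  then have f: "f permutes {1..k}" by (rule bij_imp_permutes) (auto simp: f_def)
  define \<sigma>' where "\<sigma>' = inv f \<circ> \<sigma> \<circ> f"
  have \<sigma>': "\<sigma>' permutes {1..l + r}"
    unfolding \<sigma>'_def kr[symmetric] by (intro permutes_compose permutes_inv f \<sigma>)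
  have f1: "f x \<in> {1..k} - C" if "x \<in> {1..l}" for x
  proof -
    have lt: "x - 1 < length xs" using that xs(3) by auto
    have "x \<in> {1..k}" unfolding kr using that by auto
    then have "f x = xs ! (x - 1)" using lt unfolding f_def zs_def nth_append by simp
    then show ?thesis using nth_mem[OF lt] xs(1) by simp
  qed
  have f2: "f (l + x) = (\<sigma> ^^ (x - 1)) k" if "x \<in> {1..r}" for x
  proof -
    have ge: "\<not> l + x - 1 < length xs" "l + x - 1 - length xs = x - 1" using that xs(3) by auto
    have "l + x \<in> {1..k}" unfolding kr using that by auto
    then have "f (l + x) = ys ! (x - 1)" unfolding f_def zs_def nth_append using ge by simp
    also have "\<dots> = (\<sigma> ^^ (x - 1)) k" using that lp by (auto simp: ys_def)
    finally show ?thesis .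
  qed
  have f3: "f x \<in> C" if "x \<in> {1..k}" "x \<notin> {1..l}" for x
  proof -
    have xl: "x - l \<in> {1..r}" "l + (x - l) = x" using that kr by auto
    have "f x = (\<sigma> ^^ (x - l - 1)) k" using f2[OF xl(1)] unfolding xl(2) .
    then show ?thesis using kC funpow_in_orbit[of k \<sigma> k] by (simp add: C_def)
  qed
  have "\<sigma>' x \<in> {1..l}" if x: "x \<in> {1..l}" for x
  proof (rule ccontr)
    assume n: "\<sigma>' x \<notin> {1..l}"
    have "\<sigma>' x \<in> {1..l + r}" unfolding permutes_in_image[OF \<sigma>'] using x by auto
    then have "\<sigma>' x \<in> {1..k}" unfolding kr .
    then have "f (\<sigma>' x) \<in> C" using f3 n by blast
    then have "\<sigma> (f x) \<in> C" by (simp add: \<sigma>'_def permutes_inverses[OF f])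
    then have "orbit \<sigma> (\<sigma> (f x)) = C" unfolding C_def by (intro permutes_orbit_eq[OF \<sigma>]) auto
    then have "orbit \<sigma> (f x) = C" using permutes_orbit_apply[OF \<sigma>, of "f x"] by simp
    then have "f x \<in> C" using permutes_self_in_orbit[OF \<sigma>, of "f x"] by auto
    then show False using f1[OF x] by blast
  qed
  then obtain \<sigma>\<^sub>1 \<sigma>\<^sub>2 where t: "\<sigma>' = tens l \<sigma>\<^sub>1 \<sigma>\<^sub>2" "\<sigma>\<^sub>1 permutes {1..l}" "\<sigma>\<^sub>2 permutes {1..r}"
    using preserving_eq_tens[OF \<sigma>'] by blast
  have "\<sigma>\<^sub>2 x = full_cycle r x" for x
  proof (cases "x \<in> {1..r}")
    case True
    have "l + \<sigma>\<^sub>2 x = \<sigma>' (l + x)" using True by (simp add: t tens_def)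
    also have "\<dots> = inv f (\<sigma> (f (l + x)))" by (simp add: \<sigma>'_def)
    also have "\<sigma> (f (l + x)) = (\<sigma> ^^ x) k" unfolding f2[OF True] using True by (cases x) auto
    also have "(\<sigma> ^^ x) k = f (l + (if x = r then 1 else Suc x))"
    proof (cases "x = r")
      case True
      have "(\<sigma> ^^ r) k = k" using least_power_of_permutation(1)[OF perm, of k] lp by simp
      then show ?thesis using True f2[of 1] r by simp
    next
      case False
      then show ?thesis using f2[of "Suc x"] True by simp
    qed
    also have "inv f \<dots> = l + (if x = r then 1 else Suc x)" by (rule permutes_inverses(2)[OF f])
    finally show ?thesis unfolding full_cycle_apply[OF True] by simp
  next
    case False
    then show ?thesis using permutes_not_in[OF t(3)] permutes_not_in[OF full_cycle_permutes] by metis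
  qed
  then have "\<sigma>\<^sub>2 = full_cycle r" by blast
  moreover have "\<sigma> = f \<circ> \<sigma>' \<circ> inv f" by (simp add: \<sigma>'_def fun_eq_iff permutes_inverses[OF f])
  ultimately show thesis using that[OF f kr r t(2)] t(1) by simp
qed

text \<open>\<open>E\<close> abstracts the limits of the permutation moments. The sums over
  geodesics obey the same rules for conjugation and for tensor products and agree with
  \<open>E\<close> on full cycles, so splitting off one cycle after the other proves
  equality.\<close>

lemma moments_eq_geo_sum:
  fixes E :: "nat \<Rightarrow> (nat \<Rightarrow> nat) \<Rightarrow> (nat \<Rightarrow> 'i) \<Rightarrow> complex"
  assumes \<kappa>: "free_cumulants \<I> m \<kappa>"
    and conj: "\<And>k \<pi> \<sigma> i. \<pi> permutes {1..k} \<Longrightarrow> \<sigma> permutes {1..k} \<Longrightarrow> i \<in> {1..k} \<rightarrow> \<I> \<Longrightarrow>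
      E k (\<pi> \<circ> \<sigma> \<circ> inv \<pi>) i = E k \<sigma> (i \<circ> \<pi>)"
    and tensor: "\<And>k l \<sigma>\<^sub>1 \<sigma>\<^sub>2 i. \<sigma>\<^sub>1 permutes {1..k} \<Longrightarrow> \<sigma>\<^sub>2 permutes {1..l} \<Longrightarrow> i \<in> {1..k + l} \<rightarrow> \<I> \<Longrightarrow>
      E (k + l) (tens k \<sigma>\<^sub>1 \<sigma>\<^sub>2) i = E k \<sigma>\<^sub>1 i * E l \<sigma>\<^sub>2 (\<lambda>j. i (k + j))"
    and full: "\<And>n i. n \<ge> 1 \<Longrightarrow> i \<in> {1..n} \<rightarrow> \<I> \<Longrightarrow> E n (full_cycle n) i = m (map i [1..<n + 1])"
    and zero: "\<And>i. E 0 id i = 1"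
  shows "\<And>L. rotation_invariant \<I> L \<kappa>"
    and "\<sigma> permutes {1..k} \<Longrightarrow> i \<in> {1..k} \<rightarrow> \<I> \<Longrightarrow> E k \<sigma> i = geo_sum {1..k} \<sigma> \<kappa> i"
proof -
  have "m (map (i \<circ> full_cycle n) [1..<n + 1]) = m (map i [1..<n + 1])"
    if n: "n \<ge> 1" and i: "i \<in> {1..n} \<rightarrow> \<I>" for n i
  proof -
    have i': "i \<circ> full_cycle n \<in> {1..n} \<rightarrow> \<I>"
      using i permutes_in_image[OF full_cycle_permutes[of n]] by auto
    \<comment> \<open>Conjugating the full cycle by itself changes nothing, so this instance of
      \<open>conj\<close> is the trace property of \<open>m\<close>.\<close>
    have "full_cycle n \<circ> full_cycle n \<circ> inv (full_cycle n) = full_cycle n"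
      by (simp only: comp_assoc permutes_inv_o[OF full_cycle_permutes] comp_id)
    then show ?thesis
      using conj[OF full_cycle_permutes full_cycle_permutes i] full[OF n i] full[OF n i'] by simp
  qed
  then show rot: "\<And>L. rotation_invariant \<I> L \<kappa>" using free_cumulants_rotation_invariant[OF \<kappa>] by blast
  show "\<sigma> permutes {1..k} \<Longrightarrow> i \<in> {1..k} \<rightarrow> \<I> \<Longrightarrow> E k \<sigma> i = geo_sum {1..k} \<sigma> \<kappa> i"
  proof (induction k arbitrary: \<sigma> i rule: less_induct)
    case (less k)
    show ?case
    proof (cases "k = 0")
      case True
      then have "\<sigma> = id" using less.prems by simp
      moreover have "{\<tau>. geo {} id \<tau>} = {id :: nat \<Rightarrow> nat}" by (auto simp: geo_def cyc_def)
      then have "geo_sum {} id \<kappa> i = 1" unfolding geo_sum_def by (simp add: cycle_prod_def)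
      moreover have "{1..k} = {}" using True by simp
      ultimately show ?thesis using True zero[of i] by metis
    next
      case False
      then obtain f l r \<sigma>\<^sub>1 where f: "f permutes {1..k}" and k: "k = l + r" and r: "r \<ge> 1"
        and \<sigma>\<^sub>1: "\<sigma>\<^sub>1 permutes {1..l}" and \<sigma>: "\<sigma> = f \<circ> tens l \<sigma>\<^sub>1 (full_cycle r) \<circ> inv f"
        using conj_tens_full_cycle[OF less.prems(1)] by (metis Suc_le_eq One_nat_def gr0I)
      let ?t = "tens l \<sigma>\<^sub>1 (full_cycle r)" and ?i = "i \<circ> f"
      have t: "?t permutes {1..k}" unfolding k by (rule tens_permutes[OF \<sigma>\<^sub>1 full_cycle_permutes])
      have i: "?i \<in> {1..k} \<rightarrow> \<I>" using less.prems(2) permutes_in_image[OF f] by auto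
      have i': "?i \<in> {1..l + r} \<rightarrow> \<I>" using i k by simp
      have i1: "?i \<in> {1..l} \<rightarrow> \<I>" using i' by auto
      have i2: "(\<lambda>j. ?i (l + j)) \<in> {1..r} \<rightarrow> \<I>" using i' by (auto simp: Pi_iff)
      have "E k \<sigma> i = E k ?t ?i" unfolding \<sigma> by (rule conj[OF f t less.prems(2)])
      also have "\<dots> = E l \<sigma>\<^sub>1 ?i * E r (full_cycle r) (\<lambda>j. ?i (l + j))"
        unfolding k by (rule tensor[OF \<sigma>\<^sub>1 full_cycle_permutes i'])
      also have "E l \<sigma>\<^sub>1 ?i = geo_sum {1..l} \<sigma>\<^sub>1 \<kappa> ?i"
        by (rule less.IH[OF _ \<sigma>\<^sub>1 i1]) (use k r in simp)
      also have "E r (full_cycle r) (\<lambda>j. ?i (l + j)) = geo_sum {1..r} (full_cycle r) \<kappa> (\<lambda>j. ?i (l + j))"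
        unfolding full[OF r i2] by (rule free_cumulants_geo_sum[OF \<kappa> r i2])
      also have "geo_sum {1..l} \<sigma>\<^sub>1 \<kappa> ?i * \<dots> = geo_sum {1..k} ?t \<kappa> ?i"
        unfolding k by (rule geo_sum_tens[OF \<sigma>\<^sub>1 full_cycle_permutes rot i', symmetric])
      also have "\<dots> = geo_sum {1..k} \<sigma> \<kappa> i"
        unfolding \<sigma> by (rule geo_sum_conj[OF f t _ rot less.prems(2), symmetric]) simp
      finally show ?thesis .
    qed
  qed
qed

section \<open>Entry moments\<close>

lemma index_mult_mat_sum:
  assumes "A \<in> carrier_mat n m" "B \<in> carrier_mat m p" "a < n" "b < p"
  shows "(A * B) $$ (a, b) = (\<Sum>x<m. A $$ (a, x) * B $$ (x, b))"
  using assms by (simp add: scalar_prod_def lessThan_atLeast0)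

lemma tr_mult:
  assumes "A \<in> carrier_mat n m" "B \<in> carrier_mat m n"
  shows "tr (A * B) = (\<Sum>a<n. \<Sum>b<m. A $$ (a, b) * B $$ (b, a))"
proof -
  have "dim_row (A * B) = n" using assms by simp
  then show ?thesis unfolding tr_def using index_mult_mat_sum[OF assms] by simp
qed

lemma sum_div_mod:
  fixes f :: "nat \<Rightarrow> nat \<Rightarrow> 'a :: comm_monoid_add"
  shows "(\<Sum>a<m * n. f (a div n) (a mod n)) = (\<Sum>x<m. \<Sum>y<n. f x y)"
proof (cases "n = 0")
  case False
  have "bij_betw (\<lambda>a. (a div n, a mod n)) {..<m * n} ({..<m} \<times> {..<n})"
  proof (rule bij_betw_byWitness[where f' = "\<lambda>(x, y). x * n + y"])
    show "(\<lambda>(x, y). x * n + y) ` ({..<m} \<times> {..<n}) \<subseteq> {..<m * n}"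
    proof clarsimp
      fix x y assume "x < m" "y < n"
      then have "x * n + y < Suc x * n" by simp
      also have "\<dots> \<le> m * n" using \<open>x < m\<close> by (intro mult_right_mono) auto
      finally show "x * n + y < m * n" .
    qed
    show "(\<lambda>a. (a div n, a mod n)) ` {..<m * n} \<subseteq> {..<m} \<times> {..<n}"
      using False by (auto simp: less_mult_imp_div_less)
  qed (use False in auto)
  from sum.reindex_bij_betw[OF this, of "\<lambda>(x, y). f x y"] show ?thesis
    by (simp add: sum.cartesian_product)
qed simp

lemma kronecker_carrier:
  "A \<in> carrier_mat m m' \<Longrightarrow> B \<in> carrier_mat n n' \<Longrightarrow> kronecker A B \<in> carrier_mat (m * n) (m' * n')"
  by (auto simp: kronecker_def)

lemma tr_kronecker_mult:
  fixes A B C D :: "'a :: comm_ring_1 mat"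
  assumes "A \<in> carrier_mat m m" "B \<in> carrier_mat n n" "C \<in> carrier_mat m m" "D \<in> carrier_mat n n"
  shows "tr (kronecker A B * kronecker C D) = tr (A * C) * tr (B * D)"
proof -
  have "tr (kronecker A B * kronecker C D) =
      (\<Sum>a<m * n. \<Sum>b<m * n. (A $$ (a div n, b div n) * B $$ (a mod n, b mod n)) *
        (C $$ (b div n, a div n) * D $$ (b mod n, a mod n)))"
    unfolding tr_mult[OF kronecker_carrier[OF assms(1,2)] kronecker_carrier[OF assms(3,4)]]
    by (intro sum.cong refl) (use assms in \<open>simp add: kronecker_def\<close>)
  also have "\<dots> = (\<Sum>x<m. \<Sum>y<n. \<Sum>z<m. \<Sum>w<n. (A $$ (x, z) * B $$ (y, w)) * (C $$ (z, x) * D $$ (w, y)))"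
    by (simp only: sum_div_mod[of "\<lambda>z w. (A $$ (x, z) * B $$ (y, w)) * (C $$ (z, x) * D $$ (w, y))" for x y]
        sum_div_mod[of "\<lambda>x y. \<Sum>z<m. \<Sum>w<n. (A $$ (x, z) * B $$ (y, w)) * (C $$ (z, x) * D $$ (w, y))"])
  also have "\<dots> = (\<Sum>x<m. \<Sum>y<n. (\<Sum>z<m. A $$ (x, z) * C $$ (z, x)) * (\<Sum>w<n. B $$ (y, w) * D $$ (w, y)))"
    by (simp add: sum_product mult.commute mult.left_commute)
  also have "\<dots> = tr (A * C) * tr (B * D)"
    unfolding tr_mult[OF assms(1,3)] tr_mult[OF assms(2,4)] by (simp add: sum_product)
  finally show ?thesis .
qed

lemma tensor_pow_carrier:
  "(\<And>j. j \<in> {1..k} \<Longrightarrow> A j \<in> carrier_mat N N) \<Longrightarrow> tensor_pow k A \<in> carrier_mat (N ^ k) (N ^ k)"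
proof (induction k)
  case (Suc k)
  then have "tensor_pow k A \<in> carrier_mat (N ^ k) (N ^ k)" "A (Suc k) \<in> carrier_mat N N" by auto
  then show ?case using kronecker_carrier[of "tensor_pow k A" "N ^ k" "N ^ k" "A (Suc k)" N N]
    by (simp add: mult.commute)
qed simp

lemma tr_tensor_pow_mult:
  fixes A B :: "nat \<Rightarrow> 'a :: comm_ring_1 mat"
  assumes "\<And>j. j \<in> {1..k} \<Longrightarrow> A j \<in> carrier_mat N N" "\<And>j. j \<in> {1..k} \<Longrightarrow> B j \<in> carrier_mat N N"
  shows "tr (tensor_pow k A * tensor_pow k B) = (\<Prod>j\<in>{1..k}. tr (A j * B j))"
  using assms
proof (induction k)
  case 0
  show ?case by (simp add: tr_def)
next
  case (Suc k)
  have "tr (tensor_pow (Suc k) A * tensor_pow (Suc k) B) =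
      tr (tensor_pow k A * tensor_pow k B) * tr (A (Suc k) * B (Suc k))"
    unfolding tensor_pow.simps
    by (rule tr_kronecker_mult[where m = "N ^ k" and n = N])
      (use Suc.prems in \<open>auto intro!: tensor_pow_carrier\<close>)
  also have "tr (tensor_pow k A * tensor_pow k B) = (\<Prod>j\<in>{1..k}. tr (A j * B j))"
    by (rule Suc.IH) (use Suc.prems in auto)
  finally show ?case by (simp add: mult.commute)
qed

lemma tr_mult_unit_matrix:
  assumes "A \<in> carrier_mat N N" "x < N" "y < N"
  shows "tr (A * unit_matrix N x y) = A $$ (y, x)"
proof -
  have "unit_matrix N x y \<in> carrier_mat N N" by (simp add: unit_matrix_def)
  then have "tr (A * unit_matrix N x y) = (\<Sum>a<N. \<Sum>b<N. A $$ (a, b) * unit_matrix N x y $$ (b, a))"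
    by (rule tr_mult[OF assms(1)])
  also have "\<dots> = (\<Sum>a<N. \<Sum>b<N. if b = x then (if a = y then A $$ (a, b) else 0) else 0)"
    by (intro sum.cong refl) (auto simp: unit_matrix_def)
  also have "\<dots> = A $$ (y, x)" using assms by (simp add: sum.delta)
  finally show ?thesis .
qed

lemma Inl_points_iff: "Inl j \<in> points k \<longleftrightarrow> j \<in> {1..k}"
  and Inr_points_iff: "Inr j \<in> points k \<longleftrightarrow> j \<in> {1..k}"
  unfolding points_def Plus_def by blast+

lemma tr_mult_sum_unit_tensors:
  assumes A: "\<And>j. j \<in> {1..k} \<Longrightarrow> A j \<in> carrier_mat N N" and S: "finite S" "S \<subseteq> multi_indices N k"
  shows "tr (tensor_pow k A * sum_unit_tensors N k S) = (\<Sum>I\<in>S. \<Prod>j\<in>{1..k}. A j $$ (I (Inl j), I (Inr j)))"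
proof -
  let ?T = "tensor_pow k A"
  let ?U = "\<lambda>I. tensor_pow k (\<lambda>j. unit_matrix N (I (Inr j)) (I (Inl j)))"
  have T: "?T \<in> carrier_mat (N ^ k) (N ^ k)" by (rule tensor_pow_carrier[OF A])
  have U: "?U I \<in> carrier_mat (N ^ k) (N ^ k)" for I by (rule tensor_pow_carrier) (simp add: unit_matrix_def)
  have "sum_unit_tensors N k S \<in> carrier_mat (N ^ k) (N ^ k)" by (simp add: sum_unit_tensors_def)
  then have "tr (?T * sum_unit_tensors N k S) =
      (\<Sum>a<N^k. \<Sum>b<N^k. ?T $$ (a, b) * sum_unit_tensors N k S $$ (b, a))"
    by (rule tr_mult[OF T])
  also have "\<dots> = (\<Sum>a<N^k. \<Sum>b<N^k. \<Sum>I\<in>S. ?T $$ (a, b) * ?U I $$ (b, a))"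
    by (intro sum.cong refl) (simp add: sum_unit_tensors_def sum_distrib_left)
  also have "\<dots> = (\<Sum>a<N^k. \<Sum>I\<in>S. \<Sum>b<N^k. ?T $$ (a, b) * ?U I $$ (b, a))"
    by (intro sum.cong refl sum.swap)
  also have "\<dots> = (\<Sum>I\<in>S. \<Sum>a<N^k. \<Sum>b<N^k. ?T $$ (a, b) * ?U I $$ (b, a))"
    by (rule sum.swap)
  also have "\<dots> = (\<Sum>I\<in>S. tr (?T * ?U I))" using tr_mult[OF T U] by simp
  also have "\<dots> = (\<Sum>I\<in>S. \<Prod>j\<in>{1..k}. A j $$ (I (Inl j), I (Inr j)))"
  proof (rule sum.cong[OF refl])
    fix I assume "I \<in> S"
    then have I: "I \<in> points k \<rightarrow>\<^sub>E {..<N}" using S(2) by (auto simp: multi_indices_def)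
    have lt: "I (Inl j) < N" "I (Inr j) < N" if "j \<in> {1..k}" for j
      using PiE_mem[OF I, of "Inl j"] PiE_mem[OF I, of "Inr j"] that
      unfolding Inl_points_iff Inr_points_iff lessThan_iff by blast+
    have "tr (?T * ?U I) = (\<Prod>j\<in>{1..k}. tr (A j * unit_matrix N (I (Inr j)) (I (Inl j))))"
      by (rule tr_tensor_pow_mult[OF A]) (simp_all add: unit_matrix_def)
    also have "\<dots> = (\<Prod>j\<in>{1..k}. A j $$ (I (Inl j), I (Inr j)))"
      by (rule prod.cong[OF refl]) (use A lt in \<open>simp add: tr_mult_unit_matrix\<close>)
    finally show "tr (?T * ?U I) = (\<Prod>j\<in>{1..k}. A j $$ (I (Inl j), I (Inr j)))" .
  qed
  finally show ?thesis .
qed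

section \<open>Exchange of the two rows\<close>

abbreviation flip_point :: "'a + 'a \<Rightarrow> 'a + 'a" where
  "flip_point \<equiv> case_sum Inr Inl"

lemma flip_point_flip_point: "flip_point (flip_point x) = x"
  by (cases x) auto

lemma flip_point_points: "flip_point x \<in> points k \<longleftrightarrow> x \<in> points k"
  by (cases x) (auto simp: points_def)

lemma flip_flip: "flip (flip p) = p"
  unfolding flip_def by (simp add: image_image flip_point_flip_point)

lemma flip_eq_iff: "flip p = flip q \<longleftrightarrow> p = q"
  by (metis flip_flip)

lemma finer_flip_iff: "finer (flip p) (flip q) \<longleftrightarrow> finer p q"
proof -
  have "finer (flip p) (flip q)" if "finer p q" for p q :: "(nat + nat) set set"
    using that unfolding finer_def flip_def by (auto 4 4 intro: image_mono)
  then show ?thesis by (metis flip_flip)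
qed

lemma Ker_flip: "Ker k (I \<circ> flip_point) = flip (Ker k I)"
proof -
  have blk: "{b \<in> points k. I (flip_point b) = I (flip_point a)} = flip_point ` {b \<in> points k. I b = I (flip_point a)}" for a
  proof
    show "{b \<in> points k. I (flip_point b) = I (flip_point a)} \<subseteq> flip_point ` {b \<in> points k. I b = I (flip_point a)}"
    proof
      fix b assume "b \<in> {b \<in> points k. I (flip_point b) = I (flip_point a)}"
      then show "b \<in> flip_point ` {b \<in> points k. I b = I (flip_point a)}"
        by (intro image_eqI[where x = "flip_point b"]) (auto simp: flip_point_flip_point flip_point_points)
    qed
  qed (auto simp: flip_point_flip_point flip_point_points)
  have pts: "points k = flip_point ` points k"
  proof
    show "points k \<subseteq> flip_point ` points k"
    proof
      fix x assume "x \<in> points k"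
      then show "x \<in> flip_point ` points k"
        by (intro image_eqI[where x = "flip_point x"]) (auto simp: flip_point_flip_point flip_point_points)
    qed
  qed (auto simp: flip_point_points)
  have "Ker k (I \<circ> flip_point) = (\<lambda>a. flip_point ` {b \<in> points k. I b = I (flip_point a)}) ` points k"
    unfolding Ker_def comp_def blk ..
  also have "\<dots> = (\<lambda>a. flip_point ` {b \<in> points k. I b = I a}) ` flip_point ` points k"
    by (simp add: image_image)
  also have "\<dots> = flip (Ker k I)" unfolding flip_def Ker_def pts[symmetric] by (simp add: image_image)
  finally show ?thesis .
qed

lemma bij_betw_flip_indices:
  assumes "\<And>I. P (flip (Ker k I)) \<longleftrightarrow> Q (Ker k I)"
  shows "bij_betw (\<lambda>I. I \<circ> flip_point) {I \<in> multi_indices N k. Q (Ker k I)} {I \<in> multi_indices N k. P (Ker k I)}"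
proof (rule bij_betw_byWitness[where f' = "\<lambda>I. I \<circ> flip_point"])
  have idx: "I \<circ> flip_point \<in> multi_indices N k" if "I \<in> multi_indices N k" for I
    unfolding multi_indices_def
  proof (rule PiE_I)
    have I: "I \<in> points k \<rightarrow>\<^sub>E {..<N}" using that by (simp add: multi_indices_def)
    show "(I \<circ> flip_point) x \<in> {..<N}" if "x \<in> points k" for x
      using PiE_mem[OF I, of "flip_point x"] that by (simp add: flip_point_points)
    show "(I \<circ> flip_point) x = undefined" if "x \<notin> points k" for x
      using PiE_arb[OF I, of "flip_point x"] that by (simp add: flip_point_points)
  qed
  show "(\<lambda>I. I \<circ> flip_point) ` {I \<in> multi_indices N k. Q (Ker k I)} \<subseteq> {I \<in> multi_indices N k. P (Ker k I)}"
    using idx assms by (auto simp: Ker_flip)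
  show "(\<lambda>I. I \<circ> flip_point) ` {I \<in> multi_indices N k. P (Ker k I)} \<subseteq> {I \<in> multi_indices N k. Q (Ker k I)}"
    using idx assms Ker_flip flip_flip by (auto simp: Ker_flip) (metis flip_flip Ker_flip assms)
qed (auto simp: fun_eq_iff flip_point_flip_point)

section \<open>Expectations of products of entries\<close>

definition entry_moment :: "'w measure \<Rightarrow> nat \<Rightarrow> (nat \<Rightarrow> 'w \<Rightarrow> complex mat) \<Rightarrow> (nat \<Rightarrow> nat) \<Rightarrow> (nat \<Rightarrow> nat) \<Rightarrow> complex" where
  "entry_moment W k A r c = (LINT \<omega>|W. (\<Prod>j\<in>{1..k}. A j \<omega> $$ (r j, c j)))"

lemma entry_moment_cong:
  assumes "\<And>j. j \<in> {1..k} \<Longrightarrow> r j = r' j" "\<And>j. j \<in> {1..k} \<Longrightarrow> c j = c' j"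
  shows "entry_moment W k A r c = entry_moment W k A r' c'"
proof -
  have "(\<Prod>j\<in>{1..k}. A j \<omega> $$ (r j, c j)) = (\<Prod>j\<in>{1..k}. A j \<omega> $$ (r' j, c' j))" for \<omega>
    by (rule prod.cong[OF refl]) (simp only: assms)
  then show ?thesis unfolding entry_moment_def by simp
qed

definition has_moments :: "'w measure \<Rightarrow> ('w \<Rightarrow> complex) \<Rightarrow> bool" where
  "has_moments W f \<longleftrightarrow> f \<in> borel_measurable W \<and> (\<forall>m::nat. integrable W (\<lambda>\<omega>. cmod (f \<omega>) ^ m))"

lemma has_moments_cmult:
  assumes "has_moments W f"
  shows "has_moments W (\<lambda>\<omega>. c * f \<omega>)"
  using assms by (auto simp: has_moments_def norm_mult power_mult_distrib)

text \<open>A product of \<open>n\<close> numbers is bounded by the \<open>n\<close>-th power of the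
  largest modulus, hence by the sum of all the \<open>n\<close>-th powers. The summand 1 covers the
  empty product.\<close>

lemma integrable_prod_has_moments:
  assumes "finite J" "\<And>j. j \<in> J \<Longrightarrow> has_moments W (f j)" "prob_space W"
  shows "integrable W (\<lambda>\<omega>. \<Prod>j\<in>J. f j \<omega>)"
proof -
  interpret prob_space W by fact
  let ?n = "card J"
  show ?thesis
  proof (rule Bochner_Integration.integrable_bound[where f = "\<lambda>\<omega>. 1 + (\<Sum>j\<in>J. cmod (f j \<omega>) ^ ?n)"])
    show "integrable W (\<lambda>\<omega>. 1 + (\<Sum>j\<in>J. cmod (f j \<omega>) ^ ?n))"
      using assms by (auto simp: has_moments_def)
    show "(\<lambda>\<omega>. \<Prod>j\<in>J. f j \<omega>) \<in> borel_measurable W"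
      using assms(2) by (intro borel_measurable_prod) (auto simp: has_moments_def)
    show "AE \<omega> in W. norm (\<Prod>j\<in>J. f j \<omega>) \<le> norm (1 + (\<Sum>j\<in>J. cmod (f j \<omega>) ^ ?n))"
    proof (rule AE_I2)
      fix \<omega>
      have nn: "0 \<le> (\<Sum>j\<in>J. cmod (f j \<omega>) ^ ?n)" by (intro sum_nonneg) simp
      have "norm (\<Prod>j\<in>J. f j \<omega>) \<le> 1 + (\<Sum>j\<in>J. cmod (f j \<omega>) ^ ?n)"
      proof (cases "J = {}")
        case False
        have fin: "finite ((\<lambda>j. cmod (f j \<omega>)) ` J)" using assms(1) by simp
        have "Max ((\<lambda>j. cmod (f j \<omega>)) ` J) \<in> (\<lambda>j. cmod (f j \<omega>)) ` J"
          by (rule Max_in[OF fin]) (use False in simp)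
        then obtain m where m: "Max ((\<lambda>j. cmod (f j \<omega>)) ` J) = cmod (f m \<omega>)" "m \<in> J"
          by (rule imageE)
        have "norm (\<Prod>j\<in>J. f j \<omega>) = (\<Prod>j\<in>J. cmod (f j \<omega>))" by (rule prod_norm[symmetric])
        also have "\<dots> \<le> (\<Prod>j\<in>J. cmod (f m \<omega>))"
          unfolding m(1)[symmetric] by (intro prod_mono conjI Max_ge[OF fin]) auto
        also have "\<dots> = cmod (f m \<omega>) ^ ?n" by simp
        also have "\<dots> \<le> (\<Sum>j\<in>J. cmod (f j \<omega>) ^ ?n)"
          by (rule member_le_sum[OF m(2)]) (use assms(1) in auto)
        finally show ?thesis by simp
      qed simp
      then show "norm (\<Prod>j\<in>J. f j \<omega>) \<le> norm (1 + (\<Sum>j\<in>J. cmod (f j \<omega>) ^ ?n))" using nn by simp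
    qed
  qed
qed

lemma space_mat_borel: "space (mat_borel N) = carrier_mat N N"
  by (simp add: mat_borel_def)

lemma measurable_entry:
  assumes "a < N" "b < N"
  shows "(\<lambda>A. A $$ (a, b)) \<in> borel_measurable (mat_borel N)"
proof -
  have "(\<lambda>A. \<lambda>ab\<in>{..<N} \<times> {..<N}. A $$ ab) \<in> mat_borel N \<rightarrow>\<^sub>M (\<Pi>\<^sub>M ab\<in>{..<N} \<times> {..<N}. borel :: complex measure)"
    unfolding mat_borel_def by (rule measurable_vimage_algebra1) (auto simp: space_PiM)
  from measurable_compose[OF this measurable_component_singleton[of "(a, b)"]] assms
  show ?thesis by simp
qed

lemma measurable_mat_borelI:
  assumes "\<And>\<omega>. \<omega> \<in> space W \<Longrightarrow> A \<omega> \<in> carrier_mat N N"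
    and "\<And>a b. a < N \<Longrightarrow> b < N \<Longrightarrow> (\<lambda>\<omega>. A \<omega> $$ (a, b)) \<in> borel_measurable W"
  shows "A \<in> W \<rightarrow>\<^sub>M mat_borel N"
  unfolding mat_borel_def
  by (rule measurable_vimage_algebra2) (use assms in \<open>auto intro!: measurable_restrict\<close>)

lemma random_matrix_carrier: "random_matrix W N A \<Longrightarrow> \<omega> \<in> space W \<Longrightarrow> A \<omega> \<in> carrier_mat N N"
  unfolding random_matrix_def using measurable_space[of A W "mat_borel N" \<omega>] by (simp add: space_mat_borel)

lemma random_matrix_has_moments:
  assumes "random_matrix W N A" "a < N" "b < N"
  shows "has_moments W (\<lambda>\<omega>. A \<omega> $$ (a, b))"
  using assms measurable_compose[OF _ measurable_entry[OF assms(2,3)], of A W]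
  by (auto simp: random_matrix_def has_moments_def)

lemma integrable_prod_entries:
  fixes k :: nat
  assumes "prob_space W" "\<And>j. j \<in> {1..k} \<Longrightarrow> random_matrix W N (A j)"
    and "\<And>j. j \<in> {1..k} \<Longrightarrow> r j < N" "\<And>j. j \<in> {1..k} \<Longrightarrow> c j < N"
  shows "integrable W (\<lambda>\<omega>. \<Prod>j\<in>{1..k}. A j \<omega> $$ (r j, c j))"
proof (rule integrable_prod_has_moments[OF _ _ assms(1)])
  show "has_moments W (\<lambda>\<omega>. A j \<omega> $$ (r j, c j))" if "j \<in> {1..k}" for j
    by (rule random_matrix_has_moments[OF assms(2-4)[OF that]])
qed simp

lemma finite_multi_indices: "finite (multi_indices N k)"
  unfolding multi_indices_def points_def by (intro finite_PiE) auto

lemma multi_indices_less: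
  assumes "I \<in> multi_indices N k" "j \<in> {1..k}"
  shows "I (Inl j) < N" "I (Inr j) < N"
proof -
  have I: "I \<in> points k \<rightarrow>\<^sub>E {..<N}" using assms(1) by (simp add: multi_indices_def)
  show "I (Inl j) < N" "I (Inr j) < N"
    using PiE_mem[OF I, of "Inl j"] PiE_mem[OF I, of "Inr j"] assms(2)
    unfolding Inl_points_iff Inr_points_iff lessThan_iff by blast+
qed

text \<open>Reindexing by the exchange of rows absorbs the flip in the definitions of the moments.
  Afterwards the bottom row carries the row indices of the entries and the top row the column
  indices. The predicates \<open>P\<close> and \<open>Q\<close> let one proof serve both kinds of
  moments.\<close>

lemma LINT_tr_sum_unit_tensors:
  assumes W: "prob_space W" and A: "\<And>j. j \<in> {1..k} \<Longrightarrow> random_matrix W N (A j)"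
    and PQ: "\<And>I. P (flip (Ker k I)) \<longleftrightarrow> Q (Ker k I)"
  shows "(LINT \<omega>|W. tr (tensor_pow k (\<lambda>j. A j \<omega>) * sum_unit_tensors N k {I \<in> multi_indices N k. P (Ker k I)})) =
    (\<Sum>I | I \<in> multi_indices N k \<and> Q (Ker k I). entry_moment W k A (\<lambda>j. I (Inr j)) (\<lambda>j. I (Inl j)))"
proof -
  let ?S = "{I \<in> multi_indices N k. P (Ker k I)}" and ?S' = "{I \<in> multi_indices N k. Q (Ker k I)}"
  have "(LINT \<omega>|W. tr (tensor_pow k (\<lambda>j. A j \<omega>) * sum_unit_tensors N k ?S)) =
      (LINT \<omega>|W. (\<Sum>I\<in>?S. \<Prod>j\<in>{1..k}. A j \<omega> $$ (I (Inl j), I (Inr j))))"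
    by (intro Bochner_Integration.integral_cong refl tr_mult_sum_unit_tensors)
      (use random_matrix_carrier[OF A] finite_multi_indices in auto)
  also have "\<dots> = (LINT \<omega>|W. (\<Sum>I\<in>?S'. \<Prod>j\<in>{1..k}. A j \<omega> $$ (I (Inr j), I (Inl j))))"
  proof -
    have "(\<Sum>I\<in>?S. \<Prod>j\<in>{1..k}. A j \<omega> $$ (I (Inl j), I (Inr j))) =
        (\<Sum>I\<in>?S'. \<Prod>j\<in>{1..k}. A j \<omega> $$ ((I \<circ> flip_point) (Inl j), (I \<circ> flip_point) (Inr j)))" for \<omega>
      by (rule sum.reindex_bij_betw[OF bij_betw_flip_indices, symmetric]) (rule PQ)
    then show ?thesis by simp
  qed
  also have "\<dots> = (\<Sum>I\<in>?S'. entry_moment W k A (\<lambda>j. I (Inr j)) (\<lambda>j. I (Inl j)))"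
    unfolding entry_moment_def
    by (rule Bochner_Integration.integral_sum, rule integrable_prod_entries[OF W A])
      (auto simp: multi_indices_less)
  finally show ?thesis .
qed

lemma Em_eq_sum:
  assumes "prob_space W" "\<And>j. j \<in> {1..k} \<Longrightarrow> random_matrix W N (A j)"
  shows "Em W N k p A = 1 / of_nat N ^ nc (join k p (id_part k)) *
    (\<Sum>I | I \<in> multi_indices N k \<and> finer p (Ker k I). entry_moment W k A (\<lambda>j. I (Inr j)) (\<lambda>j. I (Inl j)))"
  unfolding Em_def rho_def
  by (subst LINT_tr_sum_unit_tensors[OF assms, where Q = "finer p"]) (auto simp: finer_flip_iff)

lemma Em_c_eq_sum:
  assumes "prob_space W" "\<And>j. j \<in> {1..k} \<Longrightarrow> random_matrix W N (A j)"
  shows "Em_c W N k p A = 1 / of_nat N ^ nc (join k p (id_part k)) *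
    (\<Sum>I | I \<in> multi_indices N k \<and> Ker k I = p. entry_moment W k A (\<lambda>j. I (Inr j)) (\<lambda>j. I (Inl j)))"
  unfolding Em_c_def rho_c_def
  by (subst LINT_tr_sum_unit_tensors[OF assms, where Q = "\<lambda>q. q = p"]) (auto simp: flip_eq_iff)

lemma finer_perm_part_Ker_iff:
  assumes \<sigma>: "\<sigma> permutes {1..k}"
  shows "finer (perm_part k \<sigma>) (Ker k I) \<longleftrightarrow> (\<forall>j\<in>{1..k}. I (Inl j) = I (Inr (\<sigma> j)))"
proof -
  have pt: "Inl j \<in> points k" "Inr (\<sigma> j) \<in> points k" if "j \<in> {1..k}" for j
    using that permutes_in_image[OF \<sigma>, of j] unfolding points_def by blast+
  have "(\<exists>C\<in>Ker k I. {Inl j, Inr (\<sigma> j)} \<subseteq> C) \<longleftrightarrow> I (Inl j) = I (Inr (\<sigma> j))" if j: "j \<in> {1..k}" for j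
  proof
    assume "\<exists>C\<in>Ker k I. {Inl j, Inr (\<sigma> j)} \<subseteq> C"
    then show "I (Inl j) = I (Inr (\<sigma> j))" unfolding Ker_def by auto
  next
    assume eq: "I (Inl j) = I (Inr (\<sigma> j))"
    show "\<exists>C\<in>Ker k I. {Inl j, Inr (\<sigma> j)} \<subseteq> C"
      unfolding Ker_def by (rule bexI[OF _ imageI[OF pt(1)[OF j]]]) (use pt[OF j] eq in simp)
  qed
  then show ?thesis unfolding finer_def perm_part_def by simp
qed

text \<open>The blocks of the partition pair each top point with one bottom point, so the bottom row
  may be chosen freely and determines the top row.\<close>

lemma sum_perm_part_indices:
  assumes \<sigma>: "\<sigma> permutes {1..k}"
  shows "(\<Sum>I | I \<in> multi_indices N k \<and> finer (perm_part k \<sigma>) (Ker k I).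
      entry_moment W k A (\<lambda>j. I (Inr j)) (\<lambda>j. I (Inl j))) =
    (\<Sum>r\<in>{1..k} \<rightarrow>\<^sub>E {..<N}. entry_moment W k A r (r \<circ> \<sigma>))"
proof -
  let ?S = "{I. I \<in> multi_indices N k \<and> finer (perm_part k \<sigma>) (Ker k I)}"
  let ?R = "{1..k} \<rightarrow>\<^sub>E {..<N}"
  let ?f = "\<lambda>r. \<lambda>x\<in>points k. case_sum (r \<circ> \<sigma>) r x"
  have \<sigma>k: "\<sigma> j \<in> {1..k} \<longleftrightarrow> j \<in> {1..k}" for j by (rule permutes_in_image[OF \<sigma>])
  note pl = Inl_points_iff and pr = Inr_points_iff
  have "bij_betw ?f ?R ?S"
  proof (rule bij_betw_byWitness[where f' = "\<lambda>I. \<lambda>j\<in>{1..k}. I (Inr j)"])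
    show "\<forall>r\<in>?R. (\<lambda>j\<in>{1..k}. ?f r (Inr j)) = r"
    proof (intro ballI ext)
      fix r j assume "r \<in> ?R"
      then show "(\<lambda>j\<in>{1..k}. ?f r (Inr j)) j = r j" using PiE_arb[of r "{1..k}"] by (auto simp: pr)
    qed
    show "\<forall>I\<in>?S. ?f (\<lambda>j\<in>{1..k}. I (Inr j)) = I"
    proof (intro ballI ext)
      fix I x assume I: "I \<in> ?S"
      then have "I \<in> points k \<rightarrow>\<^sub>E {..<N}" by (simp add: multi_indices_def)
      then have arb: "I x = undefined" if "x \<notin> points k" by (rule PiE_arb[OF _ that])
      have eq: "\<forall>j\<in>{1..k}. I (Inl j) = I (Inr (\<sigma> j))" using I finer_perm_part_Ker_iff[OF \<sigma>] by simp
      show "?f (\<lambda>j\<in>{1..k}. I (Inr j)) x = I x"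
      proof (cases "x \<in> points k")
        case True
        then show ?thesis using eq by (cases x) (use \<sigma>k in \<open>auto simp: pl pr\<close>)
      qed (use arb in simp)
    qed
    show "?f ` ?R \<subseteq> ?S"
    proof (rule image_subsetI, rule CollectI, rule conjI)
      fix r assume r: "r \<in> ?R"
      have lt: "r j < N" if "j \<in> {1..k}" for j using PiE_mem[OF r that] by simp
      show "?f r \<in> multi_indices N k" unfolding multi_indices_def
      proof (rule PiE_I)
        fix x assume "x \<in> points k"
        then show "?f r x \<in> {..<N}" by (cases x) (use lt \<sigma>k in \<open>auto simp: pl pr\<close>)
      qed simp
      show "finer (perm_part k \<sigma>) (Ker k (?f r))"
        unfolding finer_perm_part_Ker_iff[OF \<sigma>] using \<sigma>k by (simp add: pl pr)
    qed
    show "(\<lambda>I. \<lambda>j\<in>{1..k}. I (Inr j)) ` ?S \<subseteq> ?R"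
      by (auto simp: multi_indices_less)
  qed
  from sum.reindex_bij_betw[OF this, symmetric]
  have "(\<Sum>I\<in>?S. entry_moment W k A (\<lambda>j. I (Inr j)) (\<lambda>j. I (Inl j))) =
      (\<Sum>r\<in>?R. entry_moment W k A (\<lambda>j. ?f r (Inr j)) (\<lambda>j. ?f r (Inl j)))" .
  also have "\<dots> = (\<Sum>r\<in>?R. entry_moment W k A r (r \<circ> \<sigma>))"
    by (intro sum.cong refl entry_moment_cong) (simp_all add: pl pr)
  finally show ?thesis .
qed

section \<open>Unitary invariance\<close>

lemma mat_adjoint_carrier: "A \<in> carrier_mat n m \<Longrightarrow> mat_adjoint A \<in> carrier_mat m n"
  unfolding mat_adjoint_def by auto

lemma mat_adjoint_index:
  fixes A :: "complex mat"
  assumes "A \<in> carrier_mat n m" "a < m" "b < n"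
  shows "mat_adjoint A $$ (a, b) = cnj (A $$ (b, a))"
  using assms unfolding mat_adjoint_def by (simp add: mat_of_rows_index)

text \<open>The equality of laws is tested on the function \<open>F\<close>, which multiplies by
  \<open>g\<close> from the right once more. This cancels the adjoint, so that on both sides the
  entries become linear in \<open>g\<close> and no conjugated coefficients remain.\<close>

lemma unitary_conj_moment:
  fixes r c :: "nat \<Rightarrow> nat"
  assumes W: "prob_space W" and M: "\<And>\<iota>. \<iota> \<in> \<I> \<Longrightarrow> random_matrix W N (M \<iota>)"
    and inv: "unitarily_invariant W N \<I> M" and i: "i \<in> {1..k} \<rightarrow> \<I>"
    and g: "g \<in> unitary_group N"
    and r: "\<And>j. j \<in> {1..k} \<Longrightarrow> r j < N" and c: "\<And>j. j \<in> {1..k} \<Longrightarrow> c j < N"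
  shows "(LINT \<omega>|W. (\<Prod>j\<in>{1..k}. (g * M (i j) \<omega>) $$ (r j, c j))) =
    (LINT \<omega>|W. (\<Prod>j\<in>{1..k}. (M (i j) \<omega> * g) $$ (r j, c j)))"
proof -
  have gc: "g \<in> carrier_mat N N" and gu: "mat_adjoint g * g = 1\<^sub>m N"
    using g by (auto simp: unitary_group_def)
  have ac: "mat_adjoint g \<in> carrier_mat N N" by (rule mat_adjoint_carrier[OF gc])
  have Mi: "random_matrix W N (M (i j))" if "j \<in> {1..k}" for j using M i that by blast
  have Mc: "M (i j) \<omega> \<in> carrier_mat N N" if "j \<in> {1..k}" "\<omega> \<in> space W" for j \<omega>
    by (rule random_matrix_carrier[OF Mi[OF that(1)] that(2)])
  let ?P = "\<Pi>\<^sub>M j\<in>{1..k}. mat_borel N"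
  define F where "F B = (\<Prod>j\<in>{1..k}. \<Sum>x<N. B j $$ (r j, x) * g $$ (x, c j))" for B :: "nat \<Rightarrow> complex mat"
  have F: "F \<in> borel_measurable ?P" unfolding F_def
  proof (intro borel_measurable_prod borel_measurable_sum borel_measurable_times borel_measurable_const)
    fix j x assume j: "j \<in> {1..k}" and x: "x \<in> {..<N}"
    show "(\<lambda>B. B j $$ (r j, x)) \<in> borel_measurable ?P"
      by (rule measurable_compose[OF measurable_component_singleton[OF j] measurable_entry]) (use r[OF j] x in auto)
  qed
  have m1: "(\<lambda>\<omega>. \<lambda>j\<in>{1..k}. M (i j) \<omega>) \<in> W \<rightarrow>\<^sub>M ?P"
    by (rule measurable_restrict) (use Mi in \<open>auto simp: random_matrix_def\<close>)
  have m2: "(\<lambda>\<omega>. \<lambda>j\<in>{1..k}. g * M (i j) \<omega> * mat_adjoint g) \<in> W \<rightarrow>\<^sub>M ?P"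
  proof (rule measurable_restrict, rule measurable_mat_borelI)
    fix j assume j: "j \<in> {1..k}"
    show "g * M (i j) \<omega> * mat_adjoint g \<in> carrier_mat N N" if "\<omega> \<in> space W" for \<omega>
      using gc ac Mc[OF j that] by simp
    fix a b assume ab: "a < N" "b < N"
    have meas: "(\<lambda>\<omega>. M (i j) \<omega> $$ (x, y)) \<in> borel_measurable W" if "x < N" "y < N" for x y
      using random_matrix_has_moments[OF Mi[OF j] that] by (simp add: has_moments_def)
    have "(\<lambda>\<omega>. \<Sum>y<N. (\<Sum>x<N. g $$ (a, x) * M (i j) \<omega> $$ (x, y)) * mat_adjoint g $$ (y, b)) \<in> borel_measurable W"
      by (intro borel_measurable_sum borel_measurable_times borel_measurable_const meas) auto
    moreover have "(\<Sum>y<N. (\<Sum>x<N. g $$ (a, x) * M (i j) \<omega> $$ (x, y)) * mat_adjoint g $$ (y, b)) =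
        (g * M (i j) \<omega> * mat_adjoint g) $$ (a, b)" if "\<omega> \<in> space W" for \<omega>
    proof -
      have "(g * M (i j) \<omega> * mat_adjoint g) $$ (a, b) = (\<Sum>y<N. (g * M (i j) \<omega>) $$ (a, y) * mat_adjoint g $$ (y, b))"
        by (rule index_mult_mat_sum[OF _ ac ab]) (use gc Mc[OF j that] in simp)
      also have "\<dots> = (\<Sum>y<N. (\<Sum>x<N. g $$ (a, x) * M (i j) \<omega> $$ (x, y)) * mat_adjoint g $$ (y, b))"
        by (rule sum.cong[OF refl]) (use index_mult_mat_sum[OF gc Mc[OF j that] ab(1)] in simp)
      finally show ?thesis by simp
    qed
    ultimately show "(\<lambda>\<omega>. (g * M (i j) \<omega> * mat_adjoint g) $$ (a, b)) \<in> borel_measurable W"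
      by (subst measurable_cong[where g = "\<lambda>\<omega>. \<Sum>y<N. (\<Sum>x<N. g $$ (a, x) * M (i j) \<omega> $$ (x, y)) * mat_adjoint g $$ (y, b)"]) auto
  qed
  have law: "distr W ?P (\<lambda>\<omega>. \<lambda>j\<in>{1..k}. g * M (i j) \<omega> * mat_adjoint g) = distr W ?P (\<lambda>\<omega>. \<lambda>j\<in>{1..k}. M (i j) \<omega>)"
    using inv g i unfolding unitarily_invariant_def joint_law_def by blast
  have e1: "F (\<lambda>j\<in>{1..k}. g * M (i j) \<omega> * mat_adjoint g) = (\<Prod>j\<in>{1..k}. (g * M (i j) \<omega>) $$ (r j, c j))"
    if \<omega>: "\<omega> \<in> space W" for \<omega>
    unfolding F_def
  proof (rule prod.cong[OF refl])
    fix j assume j: "j \<in> {1..k}"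
    let ?X = "g * M (i j) \<omega>"
    have X: "?X \<in> carrier_mat N N" using gc Mc[OF j \<omega>] by simp
    have "?X * mat_adjoint g * g = ?X"
      using assoc_mult_mat[OF X ac gc] right_mult_one_mat[OF X] by (simp only: gu)
    then have "?X $$ (r j, c j) = (?X * mat_adjoint g * g) $$ (r j, c j)" by simp
    also have "\<dots> = (\<Sum>x<N. (?X * mat_adjoint g) $$ (r j, x) * g $$ (x, c j))"
      by (rule index_mult_mat_sum[OF _ gc r[OF j] c[OF j]]) (use X ac in simp)
    finally show "(\<Sum>x<N. (\<lambda>j\<in>{1..k}. g * M (i j) \<omega> * mat_adjoint g) j $$ (r j, x) * g $$ (x, c j)) = ?X $$ (r j, c j)"
      using j by simp
  qed
  have e2: "F (\<lambda>j\<in>{1..k}. M (i j) \<omega>) = (\<Prod>j\<in>{1..k}. (M (i j) \<omega> * g) $$ (r j, c j))"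
    if \<omega>: "\<omega> \<in> space W" for \<omega>
    unfolding F_def
    by (rule prod.cong[OF refl]) (simp add: index_mult_mat_sum[OF Mc[OF _ \<omega>] gc r c])
  have "(LINT \<omega>|W. (\<Prod>j\<in>{1..k}. (g * M (i j) \<omega>) $$ (r j, c j))) =
      (LINT \<omega>|W. F (\<lambda>j\<in>{1..k}. g * M (i j) \<omega> * mat_adjoint g))"
    by (intro Bochner_Integration.integral_cong refl) (simp only: e1)
  also have "\<dots> = (LINT \<omega>|W. F (\<lambda>j\<in>{1..k}. M (i j) \<omega>))"
    using integral_distr[OF m2 F] integral_distr[OF m1 F] law by simp
  also have "\<dots> = (LINT \<omega>|W. (\<Prod>j\<in>{1..k}. (M (i j) \<omega> * g) $$ (r j, c j)))"
    by (intro Bochner_Integration.integral_cong refl) (simp only: e2)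
  finally show ?thesis .
qed

lemma unitary_coefficients_moment:
  fixes g :: "nat \<Rightarrow> nat \<Rightarrow> complex" and r c :: "nat \<Rightarrow> nat"
  assumes W: "prob_space W" and M: "\<And>\<iota>. \<iota> \<in> \<I> \<Longrightarrow> random_matrix W N (M \<iota>)"
    and inv: "unitarily_invariant W N \<I> M" and i: "i \<in> {1..k} \<rightarrow> \<I>"
    and g1: "\<And>a b. a < N \<Longrightarrow> b < N \<Longrightarrow> (\<Sum>x<N. g a x * cnj (g b x)) = (if a = b then 1 else 0)"
    and g2: "\<And>a b. a < N \<Longrightarrow> b < N \<Longrightarrow> (\<Sum>x<N. cnj (g x a) * g x b) = (if a = b then 1 else 0)"
    and r: "\<And>j. j \<in> {1..k} \<Longrightarrow> r j < N" and c: "\<And>j. j \<in> {1..k} \<Longrightarrow> c j < N"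
  shows "(LINT \<omega>|W. (\<Prod>j\<in>{1..k}. \<Sum>x<N. g (r j) x * M (i j) \<omega> $$ (x, c j))) =
    (LINT \<omega>|W. (\<Prod>j\<in>{1..k}. \<Sum>x<N. M (i j) \<omega> $$ (r j, x) * g x (c j)))"
proof -
  define G where "G = mat N N (\<lambda>(a, b). g a b)"
  have G: "G \<in> carrier_mat N N" by (simp add: G_def)
  have GA: "mat_adjoint G \<in> carrier_mat N N" by (rule mat_adjoint_carrier[OF G])
  have Ga: "mat_adjoint G $$ (a, b) = cnj (g b a)" if "a < N" "b < N" for a b
    unfolding mat_adjoint_index[OF G that] using that by (simp add: G_def)
  have GU: "G \<in> unitary_group N" unfolding unitary_group_def mem_Collect_eq
  proof (intro conjI G eq_matI)
    fix a b assume "a < dim_row (1\<^sub>m N :: complex mat)" "b < dim_col (1\<^sub>m N :: complex mat)"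
    then have ab: "a < N" "b < N" by auto
    have "(G * mat_adjoint G) $$ (a, b) = (\<Sum>x<N. g a x * cnj (g b x))"
      unfolding index_mult_mat_sum[OF G GA ab] by (rule sum.cong[OF refl]) (use ab Ga in \<open>simp add: G_def\<close>)
    then show "(G * mat_adjoint G) $$ (a, b) = 1\<^sub>m N $$ (a, b)" using g1[OF ab] ab by simp
    have "(mat_adjoint G * G) $$ (a, b) = (\<Sum>x<N. cnj (g x a) * g x b)"
      unfolding index_mult_mat_sum[OF GA G ab] by (rule sum.cong[OF refl]) (use ab Ga in \<open>simp add: G_def\<close>)
    then show "(mat_adjoint G * G) $$ (a, b) = 1\<^sub>m N $$ (a, b)" using g2[OF ab] ab by simp
  qed (use G GA in auto)
  have eq: "(LINT \<omega>|W. (\<Prod>j\<in>{1..k}. (G * M (i j) \<omega>) $$ (r j, c j))) =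
    (LINT \<omega>|W. (\<Prod>j\<in>{1..k}. (M (i j) \<omega> * G) $$ (r j, c j)))" by (rule unitary_conj_moment[OF W M inv i GU r c])
  have Mc: "M (i j) \<omega> \<in> carrier_mat N N" if "j \<in> {1..k}" "\<omega> \<in> space W" for j \<omega>
    by (rule random_matrix_carrier[OF M that(2)]) (use i that in blast)
  have left: "(\<Sum>x<N. g (r j) x * M (i j) \<omega> $$ (x, c j)) = (G * M (i j) \<omega>) $$ (r j, c j)"
    and right: "(\<Sum>x<N. M (i j) \<omega> $$ (r j, x) * g x (c j)) = (M (i j) \<omega> * G) $$ (r j, c j)"
    if j: "j \<in> {1..k}" and \<omega>: "\<omega> \<in> space W" for j \<omega>
    unfolding index_mult_mat_sum[OF G Mc[OF j \<omega>] r[OF j] c[OF j]]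
      index_mult_mat_sum[OF Mc[OF j \<omega>] G r[OF j] c[OF j]]
    by (rule sum.cong[OF refl]; use r[OF j] c[OF j] in \<open>simp add: G_def\<close>)+
  have "(LINT \<omega>|W. (\<Prod>j\<in>{1..k}. \<Sum>x<N. g (r j) x * M (i j) \<omega> $$ (x, c j))) =
      (LINT \<omega>|W. (\<Prod>j\<in>{1..k}. (G * M (i j) \<omega>) $$ (r j, c j)))"
    by (intro Bochner_Integration.integral_cong prod.cong refl) (rule left)
  also note eq
  also have "(LINT \<omega>|W. (\<Prod>j\<in>{1..k}. (M (i j) \<omega> * G) $$ (r j, c j))) =
      (LINT \<omega>|W. (\<Prod>j\<in>{1..k}. \<Sum>x<N. M (i j) \<omega> $$ (r j, x) * g x (c j)))"
    by (intro Bochner_Integration.integral_cong prod.cong refl) (rule right[symmetric])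
  finally show ?thesis .
qed

text \<open>Both integrals are polynomials in \<open>\<i> * of_real s\<close>, with expectations of
  mixed products as coefficients. They agree at infinitely many points, so their linear coefficients
  agree; this replaces differentiation under the integral.\<close>

lemma linear_coefficient_eq:
  fixes m u v :: "'a \<Rightarrow> 'w \<Rightarrow> complex"
  assumes W: "prob_space W" and J: "finite J"
    and mom: "\<And>j. j \<in> J \<Longrightarrow> has_moments W (m j)" "\<And>j. j \<in> J \<Longrightarrow> has_moments W (u j)" "\<And>j. j \<in> J \<Longrightarrow> has_moments W (v j)"
    and eq: "\<And>s :: real. (LINT \<omega>|W. (\<Prod>j\<in>J. m j \<omega> + \<i> * of_real s * u j \<omega>)) = (LINT \<omega>|W. (\<Prod>j\<in>J. m j \<omega> + \<i> * of_real s * v j \<omega>))"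
  shows "(\<Sum>j\<in>J. LINT \<omega>|W. (\<Prod>l\<in>J. if l = j then u l \<omega> else m l \<omega>)) =
    (\<Sum>j\<in>J. LINT \<omega>|W. (\<Prod>l\<in>J. if l = j then v l \<omega> else m l \<omega>))"
proof -
  define e where "e u X = (LINT \<omega>|W. (\<Prod>l\<in>J. if l \<in> X then m l \<omega> else u l \<omega>))" for u X
  define P where "P u = (\<Sum>X\<in>Pow J. monom (e u X) (card (J - X)))" for u
  have poly: "poly (P u) (\<i> * of_real s) = (LINT \<omega>|W. (\<Prod>j\<in>J. m j \<omega> + \<i> * of_real s * u j \<omega>))"
    if u: "\<And>j. j \<in> J \<Longrightarrow> has_moments W (u j)" for u and s :: real
  proof -
    have "(\<Prod>j\<in>J. m j \<omega> + \<i> * of_real s * u j \<omega>) =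
        (\<Sum>X\<in>Pow J. (\<i> * of_real s) ^ card (J - X) * (\<Prod>l\<in>J. if l \<in> X then m l \<omega> else u l \<omega>))" for \<omega>
      unfolding prod_add[OF J]
    proof (rule sum.cong[OF refl])
      fix X assume X: "X \<in> Pow J"
      have "(\<Prod>l\<in>J. if l \<in> X then m l \<omega> else u l \<omega>) = (\<Prod>l\<in>X. m l \<omega>) * (\<Prod>l\<in>J - X. u l \<omega>)"
        using X J by (subst prod.If_cases) (auto simp: Int_absorb1 Diff_eq)
      then show "(\<Prod>l\<in>X. m l \<omega>) * (\<Prod>l\<in>J - X. \<i> * of_real s * u l \<omega>) =
          (\<i> * of_real s) ^ card (J - X) * (\<Prod>l\<in>J. if l \<in> X then m l \<omega> else u l \<omega>)"
        by (simp add: prod.distrib)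
    qed
    then have "(LINT \<omega>|W. (\<Prod>j\<in>J. m j \<omega> + \<i> * of_real s * u j \<omega>)) =
        (LINT \<omega>|W. (\<Sum>X\<in>Pow J. (\<i> * of_real s) ^ card (J - X) * (\<Prod>l\<in>J. if l \<in> X then m l \<omega> else u l \<omega>)))"
      by simp
    also have "\<dots> = (\<Sum>X\<in>Pow J. (\<i> * of_real s) ^ card (J - X) * e u X)"
      unfolding e_def
    proof (subst Bochner_Integration.integral_sum)
      show "integrable W (\<lambda>\<omega>. (\<i> * of_real s) ^ card (J - X) * (\<Prod>l\<in>J. if l \<in> X then m l \<omega> else u l \<omega>))" for X
      proof (rule integrable_mult_right, rule integrable_prod_has_moments[OF J _ W])
        show "has_moments W (\<lambda>\<omega>. if l \<in> X then m l \<omega> else u l \<omega>)" if "l \<in> J" for l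
          using mom(1)[OF that] u[OF that] by (cases "l \<in> X") auto
      qed
    qed simp
    also have "\<dots> = poly (P u) (\<i> * of_real s)" by (simp add: P_def poly_sum poly_monom mult.commute)
    finally show ?thesis by simp
  qed
  have "P u = P v"
  proof (rule ccontr)
    assume "P u \<noteq> P v"
    then have "finite {x. poly (P u - P v) x = 0}" by (intro poly_roots_finite) simp
    moreover have "range (\<lambda>s :: real. \<i> * complex_of_real s) \<subseteq> {x. poly (P u - P v) x = 0}"
      using poly[OF mom(2)] poly[OF mom(3)] eq by auto
    ultimately have "finite (range (\<lambda>s :: real. \<i> * complex_of_real s))" by (rule rev_finite_subset)
    moreover have "inj (\<lambda>s :: real. \<i> * complex_of_real s)" by (rule injI) simp
    ultimately show False using finite_imageD infinite_UNIV_char_0 by blast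
  qed
  moreover have "coeff (P u) 1 = (\<Sum>j\<in>J. LINT \<omega>|W. (\<Prod>l\<in>J. if l = j then u l \<omega> else m l \<omega>))" for u
  proof -
    have "coeff (P u) 1 = (\<Sum>X\<in>Pow J. if card (J - X) = 1 then e u X else 0)"
      unfolding P_def coeff_sum by (intro sum.cong refl) auto
    also have "\<dots> = (\<Sum>X | X \<in> Pow J \<and> card (J - X) = 1. e u X)"
      by (rule sum.inter_filter[symmetric]) (use J in simp)
    also have "\<dots> = (\<Sum>j\<in>J. e u (J - {j}))"
    proof (rule sum.reindex_bij_betw[symmetric])
      show "bij_betw (\<lambda>j. J - {j}) J {X. X \<in> Pow J \<and> card (J - X) = 1}"
        unfolding bij_betw_def
      proof
        show "inj_on (\<lambda>j. J - {j}) J" by (rule inj_onI) blast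
        show "(\<lambda>j. J - {j}) ` J = {X. X \<in> Pow J \<and> card (J - X) = 1}"
        proof
          show "(\<lambda>j. J - {j}) ` J \<subseteq> {X. X \<in> Pow J \<and> card (J - X) = 1}"
            by (auto simp: double_diff)
          show "{X. X \<in> Pow J \<and> card (J - X) = 1} \<subseteq> (\<lambda>j. J - {j}) ` J"
          proof
            fix X assume "X \<in> {X. X \<in> Pow J \<and> card (J - X) = 1}"
            then obtain j where X: "X \<subseteq> J" and "J - X = {j}" by (auto simp: card_1_singleton_iff)
            then have "X = J - {j}" "j \<in> J" by blast+
            then show "X \<in> (\<lambda>j. J - {j}) ` J" by blast
          qed
        qed
      qed
    qed
    also have "\<dots> = (\<Sum>j\<in>J. LINT \<omega>|W. (\<Prod>l\<in>J. if l = j then u l \<omega> else m l \<omega>))"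
      unfolding e_def
      by (intro sum.cong Bochner_Integration.integral_cong prod.cong refl) auto
    finally show ?thesis .
  qed
  ultimately show ?thesis by metis
qed

lemma sum_two_deltas:
  fixes f :: "nat \<Rightarrow> complex"
  assumes "a < N" "p < N"
  shows "(\<Sum>z<N. ((if z = a then 1 else 0) + t * (if z = p then w else 0)) * f z) = f a + t * w * f p"
proof -
  have "(\<Sum>z<N. ((if z = a then 1 else 0) + t * (if z = p then w else 0)) * f z) =
      (\<Sum>z<N. (if z = a then f z else 0) + (if z = p then t * w * f z else 0))"
    by (intro sum.cong refl) (auto simp: algebra_simps)
  then show ?thesis using assms by (simp add: sum.distrib sum.delta)
qed

text \<open>The matrix \<open>H\<close> with entries \<open>w x\<close> at \<open>(x, \<pi> x)\<close> is a Hermitian involution, so \<open>1 + \<i> s H\<close> is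
  a multiple of a unitary matrix for every real \<open>s\<close>. The identity is the coefficient of \<open>s\<close> in the
  invariance under this matrix.\<close>

lemma infinitesimal_invariance:
  fixes w :: "nat \<Rightarrow> complex" and r c :: "nat \<Rightarrow> nat"
  assumes W: "prob_space W" and M: "\<And>\<iota>. \<iota> \<in> \<I> \<Longrightarrow> random_matrix W N (M \<iota>)"
    and inv: "unitarily_invariant W N \<I> M" and i: "i \<in> {1..k} \<rightarrow> \<I>"
    and \<pi>: "\<And>x. x < N \<Longrightarrow> \<pi> x < N" "\<And>x. \<pi> (\<pi> x) = x"
    and w: "\<And>x. w x * w (\<pi> x) = 1" "\<And>x. cnj (w x) = w (\<pi> x)"
    and r: "\<And>j. j \<in> {1..k} \<Longrightarrow> r j < N" and c: "\<And>j. j \<in> {1..k} \<Longrightarrow> c j < N"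
  defines "T \<equiv> entry_moment W k (\<lambda>j. M (i j))"
  shows "(\<Sum>j\<in>{1..k}. w (r j) * T (r(j := \<pi> (r j))) c) = (\<Sum>j\<in>{1..k}. w (\<pi> (c j)) * T r (c(j := \<pi> (c j))))"
proof -
  \<comment> \<open>As \<open>H\<close> is a Hermitian involution, \<open>1 + \<i> s H\<close> times
    its adjoint is the scalar \<open>1 + s\<^sup>2\<close>; this is its normalization. It occurs to
    the power \<open>k\<close> on both sides and cancels.\<close>
  define \<alpha> where "\<alpha> s = complex_of_real (1 / sqrt (1 + s\<^sup>2))" for s :: real
  define g where "g s x z = \<alpha> s * ((if z = x then 1 else 0) + \<i> * of_real s * (if z = \<pi> x then w x else 0))" for s x z
  have \<pi>_eq: "\<pi> x = y \<longleftrightarrow> x = \<pi> y" for x y using \<pi>(2) by metis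
  have \<alpha>: "\<alpha> s * \<alpha> s * (1 + (of_real s)\<^sup>2) = 1" "\<alpha> s \<noteq> 0" "cnj (\<alpha> s) = \<alpha> s" for s :: real
  proof -
    have pos: "1 + s\<^sup>2 > 0" by (simp add: add_pos_nonneg)
    then have "(1 / sqrt (1 + s\<^sup>2)) * (1 / sqrt (1 + s\<^sup>2)) * (1 + s\<^sup>2) = 1" by (simp add: field_simps)
    then have "complex_of_real ((1 / sqrt (1 + s\<^sup>2)) * (1 / sqrt (1 + s\<^sup>2)) * (1 + s\<^sup>2)) = 1" by simp
    then show "\<alpha> s * \<alpha> s * (1 + (of_real s)\<^sup>2) = 1" unfolding \<alpha>_def of_real_mult of_real_add of_real_power of_real_1 .
    have "sqrt (1 + s\<^sup>2) \<noteq> 0" using pos by simp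
    then show "\<alpha> s \<noteq> 0" by (simp add: \<alpha>_def)
    show "cnj (\<alpha> s) = \<alpha> s" by (simp add: \<alpha>_def)
  qed
  have herm: "cnj (if z = \<pi> x then w x else 0) = (if x = \<pi> z then w z else 0)" for x z
    using w(2)[of x] \<pi>_eq[of x z] by auto
  have uni: "(\<Sum>x<N. g s a x * cnj (g s b x)) = (if a = b then 1 else 0)" if ab: "a < N" "b < N" for a b s
  proof -
    let ?t = "\<i> * complex_of_real s"
    define f where "f z = (if z = b then 1 else 0) - ?t * (if z = \<pi> b then w (\<pi> b) else 0)" for z
    have "(\<Sum>x<N. g s a x * cnj (g s b x)) =
        (\<Sum>x<N. \<alpha> s * \<alpha> s * (((if x = a then 1 else 0) + ?t * (if x = \<pi> a then w a else 0)) * f x))"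
      by (intro sum.cong refl) (auto simp: g_def f_def \<alpha>(3) w(2) algebra_simps)
    also have "\<dots> = \<alpha> s * \<alpha> s * (f a + ?t * w a * f (\<pi> a))"
      unfolding sum_distrib_left[symmetric] by (subst sum_two_deltas) (use ab \<pi> in auto)
    also have "f a + ?t * w a * f (\<pi> a) = (if a = b then 1 + (of_real s)\<^sup>2 else 0)"
    proof (cases "a = b")
      case True
      have "?t * w a * (?t * w (\<pi> a)) = - ((of_real s)\<^sup>2 * (w a * w (\<pi> a)))"
        by (simp add: power2_eq_square algebra_simps)
      then have tt: "?t * w a * (?t * w (\<pi> a)) = - (of_real s)\<^sup>2" by (simp add: w(1))
      show ?thesis
      proof (cases "\<pi> a = a")
        case fp: True
        have "f a + ?t * w a * f (\<pi> a) = 1 - ?t * w a * (?t * w (\<pi> a))"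
          using True fp by (simp add: f_def algebra_simps)
        then show ?thesis using tt True by simp
      next
        case False
        have "f a + ?t * w a * f (\<pi> a) = 1 - ?t * w a * (?t * w (\<pi> a))"
          using True False by (auto simp: f_def algebra_simps)
        then show ?thesis using tt True by simp
      qed
    next
      case False
      then have "\<pi> a \<noteq> \<pi> b" using \<pi>(2) by metis
      then show ?thesis using False \<pi>_eq[of a b] by (auto simp: f_def \<pi>(2))
    qed
    finally show ?thesis using \<alpha>(1)[of s] by simp
  qed
  have sym: "cnj (g s x a) = \<alpha> s * ((if x = a then 1 else 0) - \<i> * of_real s * (if x = \<pi> a then w a else 0))" for s x a
  proof -
    have e1: "(if a = x then 1 else 0) = (if x = a then 1 else 0 :: complex)" by auto
    have e2: "cnj (if a = \<pi> x then w x else 0) = (if x = \<pi> a then w a else 0)" by (rule herm)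
    have "cnj (g s x a) = \<alpha> s * (cnj (if a = x then 1 else 0) - \<i> * of_real s * cnj (if a = \<pi> x then w x else 0))"
      unfolding g_def by (simp add: \<alpha>(3))
    then show ?thesis unfolding e2 e1 by simp
  qed
  \<comment> \<open>The adjoint belongs to the same family with \<open>- s\<close>, so the second
    unitarity relation is the first one at \<open>- s\<close>.\<close>
  have gneg: "cnj (g s x a) = g (- s) a x" for s x a
    by (simp only: sym) (simp add: g_def \<alpha>_def)
  have uni2: "(\<Sum>x<N. cnj (g s x a) * g s x b) = (if a = b then 1 else 0)" if ab: "a < N" "b < N" for a b s
  proof -
    have "(\<Sum>x<N. cnj (g s x a) * g s x b) = (\<Sum>x<N. g (- s) a x * cnj (g (- s) b x))"
      by (intro sum.cong refl) (simp add: gneg)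
    then show ?thesis using uni[OF ab, of "- s"] by simp
  qed
  have Mi: "random_matrix W N (M (i j))" if "j \<in> {1..k}" for j using M i that by blast
  let ?m = "\<lambda>j \<omega>. M (i j) \<omega> $$ (r j, c j)"
  let ?u = "\<lambda>j \<omega>. w (r j) * M (i j) \<omega> $$ (\<pi> (r j), c j)"
  let ?v = "\<lambda>j \<omega>. w (\<pi> (c j)) * M (i j) \<omega> $$ (r j, \<pi> (c j))"
  have key: "(LINT \<omega>|W. (\<Prod>j\<in>{1..k}. ?m j \<omega> + \<i> * of_real s * ?u j \<omega>)) =
      (LINT \<omega>|W. (\<Prod>j\<in>{1..k}. ?m j \<omega> + \<i> * of_real s * ?v j \<omega>))" for s
  proof -
    have L: "(\<Sum>x<N. g s (r j) x * M (i j) \<omega> $$ (x, c j)) = \<alpha> s * (?m j \<omega> + \<i> * of_real s * ?u j \<omega>)"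
      if "j \<in> {1..k}" for j \<omega>
    proof -
      have "(\<Sum>x<N. g s (r j) x * M (i j) \<omega> $$ (x, c j)) = \<alpha> s * (\<Sum>x<N. ((if x = r j then 1 else 0) +
          \<i> * of_real s * (if x = \<pi> (r j) then w (r j) else 0)) * M (i j) \<omega> $$ (x, c j))"
        unfolding g_def sum_distrib_left by (simp only: mult.assoc)
      then show ?thesis using r[OF that] \<pi>(1) by (subst (asm) sum_two_deltas) (auto simp: mult.assoc)
    qed
    have R: "(\<Sum>x<N. M (i j) \<omega> $$ (r j, x) * g s x (c j)) = \<alpha> s * (?m j \<omega> + \<i> * of_real s * ?v j \<omega>)"
      if "j \<in> {1..k}" for j \<omega>
    proof -
      have "g s x (c j) = \<alpha> s * ((if x = c j then 1 else 0) + \<i> * of_real s * (if x = \<pi> (c j) then w (\<pi> (c j)) else 0))" for x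
        unfolding g_def using \<pi>_eq[of x "c j"] by auto
      then have "(\<Sum>x<N. M (i j) \<omega> $$ (r j, x) * g s x (c j)) = \<alpha> s * (\<Sum>x<N. ((if x = c j then 1 else 0) +
          \<i> * of_real s * (if x = \<pi> (c j) then w (\<pi> (c j)) else 0)) * M (i j) \<omega> $$ (r j, x))"
        unfolding sum_distrib_left by (simp only: mult.assoc mult.commute[of "M (i j) \<omega> $$ _"])
      then show ?thesis using c[OF that] \<pi>(1) by (subst (asm) sum_two_deltas) (auto simp: mult.assoc)
    qed
    have "\<alpha> s ^ k * (LINT \<omega>|W. (\<Prod>j\<in>{1..k}. ?m j \<omega> + \<i> * of_real s * ?u j \<omega>)) =
        (LINT \<omega>|W. (\<Prod>j\<in>{1..k}. \<Sum>x<N. g s (r j) x * M (i j) \<omega> $$ (x, c j)))"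
    proof -
      have "(\<Prod>j\<in>{1..k}. \<Sum>x<N. g s (r j) x * M (i j) \<omega> $$ (x, c j)) =
          \<alpha> s ^ k * (\<Prod>j\<in>{1..k}. ?m j \<omega> + \<i> * of_real s * ?u j \<omega>)" for \<omega>
      proof -
        have "(\<Prod>j\<in>{1..k}. \<Sum>x<N. g s (r j) x * M (i j) \<omega> $$ (x, c j)) =
            (\<Prod>j\<in>{1..k}. \<alpha> s * (?m j \<omega> + \<i> * of_real s * ?u j \<omega>))" by (rule prod.cong[OF refl L])
        also have "\<dots> = \<alpha> s ^ k * (\<Prod>j\<in>{1..k}. ?m j \<omega> + \<i> * of_real s * ?u j \<omega>)"
          by (subst prod.distrib) (simp only: prod_constant card_atLeastAtMost diff_Suc_1)
        finally show ?thesis .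
      qed
      then show ?thesis by simp
    qed
    also have "\<dots> = (LINT \<omega>|W. (\<Prod>j\<in>{1..k}. \<Sum>x<N. M (i j) \<omega> $$ (r j, x) * g s x (c j)))"
      by (rule unitary_coefficients_moment[OF W M inv i uni uni2 r c])
    also have "\<dots> = \<alpha> s ^ k * (LINT \<omega>|W. (\<Prod>j\<in>{1..k}. ?m j \<omega> + \<i> * of_real s * ?v j \<omega>))"
    proof -
      have "(\<Prod>j\<in>{1..k}. \<Sum>x<N. M (i j) \<omega> $$ (r j, x) * g s x (c j)) =
          \<alpha> s ^ k * (\<Prod>j\<in>{1..k}. ?m j \<omega> + \<i> * of_real s * ?v j \<omega>)" for \<omega>
      proof -
        have "(\<Prod>j\<in>{1..k}. \<Sum>x<N. M (i j) \<omega> $$ (r j, x) * g s x (c j)) =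
            (\<Prod>j\<in>{1..k}. \<alpha> s * (?m j \<omega> + \<i> * of_real s * ?v j \<omega>))" by (rule prod.cong[OF refl R])
        also have "\<dots> = \<alpha> s ^ k * (\<Prod>j\<in>{1..k}. ?m j \<omega> + \<i> * of_real s * ?v j \<omega>)"
          by (subst prod.distrib) (simp only: prod_constant card_atLeastAtMost diff_Suc_1)
        finally show ?thesis .
      qed
      then show ?thesis by simp
    qed
    finally show ?thesis using \<alpha>(2)[of s] by simp
  qed
  have mom: "has_moments W (?m j)" "has_moments W (?u j)" "has_moments W (?v j)" if "j \<in> {1..k}" for j
    using random_matrix_has_moments[OF Mi[OF that]] has_moments_cmult r[OF that] c[OF that] \<pi>(1) by blast+
  have "(\<Sum>j\<in>{1..k}. LINT \<omega>|W. (\<Prod>l\<in>{1..k}. if l = j then ?u l \<omega> else ?m l \<omega>)) =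
      (\<Sum>j\<in>{1..k}. LINT \<omega>|W. (\<Prod>l\<in>{1..k}. if l = j then ?v l \<omega> else ?m l \<omega>))"
    by (rule linear_coefficient_eq[OF W _ mom(1) mom(2) mom(3) key]) auto
  moreover have "(LINT \<omega>|W. (\<Prod>l\<in>{1..k}. if l = j then ?u l \<omega> else ?m l \<omega>)) = w (r j) * T (r(j := \<pi> (r j))) c"
    if j: "j \<in> {1..k}" for j
  proof -
    have "(\<Prod>l\<in>{1..k}. if l = j then ?u l \<omega> else ?m l \<omega>) =
        w (r j) * (\<Prod>l\<in>{1..k}. M (i l) \<omega> $$ ((r(j := \<pi> (r j))) l, c l))" for \<omega>
      by (subst (1 2) prod.remove[OF _ j]) (auto intro!: prod.cong)
    then show ?thesis by (simp add: T_def entry_moment_def)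
  qed
  moreover have "(LINT \<omega>|W. (\<Prod>l\<in>{1..k}. if l = j then ?v l \<omega> else ?m l \<omega>)) = w (\<pi> (c j)) * T r (c(j := \<pi> (c j)))"
    if j: "j \<in> {1..k}" for j
  proof -
    have "(\<Prod>l\<in>{1..k}. if l = j then ?v l \<omega> else ?m l \<omega>) =
        w (\<pi> (c j)) * (\<Prod>l\<in>{1..k}. M (i l) \<omega> $$ (r l, (c(j := \<pi> (c j))) l))" for \<omega>
      by (subst (1 2) prod.remove[OF _ j]) (auto intro!: prod.cong)
    then show ?thesis by (simp add: T_def entry_moment_def)
  qed
  ultimately show ?thesis by simp
qed

text \<open>This is invariance under a single off-diagonal matrix unit, which is not Hermitian. It
  is recovered from Hermitian involutions on the transposition of \<open>a\<close> and
  \<open>b\<close>: the phases \<open>u = 1\<close> and \<open>u = \<i>\<close> separate the two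
  off-diagonal units, the signs \<open>e = 1\<close> and \<open>e = -1\<close> cancel the
  contribution of the diagonal.\<close>

lemma entry_moment_exchange:
  fixes r c :: "nat \<Rightarrow> nat"
  assumes W: "prob_space W" and M: "\<And>\<iota>. \<iota> \<in> \<I> \<Longrightarrow> random_matrix W N (M \<iota>)"
    and inv: "unitarily_invariant W N \<I> M" and i: "i \<in> {1..k} \<rightarrow> \<I>"
    and r: "\<And>j. j \<in> {1..k} \<Longrightarrow> r j < N" and c: "\<And>j. j \<in> {1..k} \<Longrightarrow> c j < N"
    and ab: "a < N" "b < N" "a \<noteq> b"
  defines "T \<equiv> entry_moment W k (\<lambda>j. M (i j))"
  shows "(\<Sum>j | j \<in> {1..k} \<and> r j = a. T (r(j := b)) c) = (\<Sum>j | j \<in> {1..k} \<and> c j = b. T r (c(j := a)))"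
proof -
  define \<pi> where "\<pi> = Transposition.transpose a b"
  define X where "X j = T (r(j := \<pi> (r j))) c" for j
  define Y where "Y j = T r (c(j := \<pi> (c j)))" for j
  define La where "La = (\<Sum>j\<in>{1..k}. if r j = a then X j else 0)"
  define Lb where "Lb = (\<Sum>j\<in>{1..k}. if r j = b then X j else 0)"
  define Lc where "Lc = (\<Sum>j\<in>{1..k}. if r j \<noteq> a \<and> r j \<noteq> b then X j else 0)"
  define Ra where "Ra = (\<Sum>j\<in>{1..k}. if c j = a then Y j else 0)"
  define Rb where "Rb = (\<Sum>j\<in>{1..k}. if c j = b then Y j else 0)"
  define Rc where "Rc = (\<Sum>j\<in>{1..k}. if c j \<noteq> a \<and> c j \<noteq> b then Y j else 0)"
  have rel: "u * La + cnj u * Lb + e * Lc = u * Rb + cnj u * Ra + e * Rc"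
    if u: "u * cnj u = 1" and e: "e * e = 1" "cnj e = e" for u e :: complex
  proof -
    define w where "w x = (if x = a then u else if x = b then cnj u else e)" for x
    have \<pi>a: "\<pi> a = b" "\<pi> b = a" and \<pi>x: "\<And>x. x \<noteq> a \<Longrightarrow> x \<noteq> b \<Longrightarrow> \<pi> x = x"
      by (auto simp: \<pi>_def Transposition.transpose_def)
    have "(\<Sum>j\<in>{1..k}. w (r j) * X j) = (\<Sum>j\<in>{1..k}. w (\<pi> (c j)) * Y j)"
      unfolding X_def Y_def T_def
    proof (rule infinitesimal_invariance[OF W M inv i _ _ _ _ r c])
      show "\<pi> x < N" if "x < N" for x using that ab by (auto simp: \<pi>_def Transposition.transpose_def)
      show "\<pi> (\<pi> x) = x" for x by (simp add: \<pi>_def)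
      show "w x * w (\<pi> x) = 1" for x
        using u e ab(3) \<pi>a \<pi>x[of x] by (cases "x = a"; cases "x = b") (auto simp: w_def mult.commute)
      show "cnj (w x) = w (\<pi> x)" for x
        using e ab(3) \<pi>a \<pi>x[of x] by (cases "x = a"; cases "x = b") (auto simp: w_def)
    qed
    moreover have "(\<Sum>j\<in>{1..k}. w (r j) * X j) = u * La + cnj u * Lb + e * Lc"
      unfolding La_def Lb_def Lc_def sum_distrib_left sum.distrib[symmetric]
      by (intro sum.cong refl) (use ab(3) in \<open>auto simp: w_def\<close>)
    moreover have "(\<Sum>j\<in>{1..k}. w (\<pi> (c j)) * Y j) = u * Rb + cnj u * Ra + e * Rc"
      unfolding Ra_def Rb_def Rc_def sum_distrib_left sum.distrib[symmetric]
    proof (intro sum.cong refl)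
      fix j
      show "w (\<pi> (c j)) * Y j = u * (if c j = b then Y j else 0) + cnj u * (if c j = a then Y j else 0) +
          e * (if c j \<noteq> a \<and> c j \<noteq> b then Y j else 0)"
        using ab(3) \<pi>a \<pi>x[of "c j"] by (cases "c j = a"; cases "c j = b") (auto simp: w_def)
    qed
    ultimately show ?thesis by simp
  qed
  have 1: "La + Lb + Lc = Rb + Ra + Rc" using rel[of 1 1] by simp
  have 2: "La + Lb - Lc = Rb + Ra - Rc" using rel[of 1 "-1"] by simp
  have 3: "\<i> * La - \<i> * Lb + Lc = \<i> * Rb - \<i> * Ra + Rc" using rel[of \<i> 1] by simp
  have 4: "\<i> * La - \<i> * Lb - Lc = \<i> * Rb - \<i> * Ra - Rc" using rel[of \<i> "-1"] by simp
  have "(La + Lb + Lc) + (La + Lb - Lc) = (Rb + Ra + Rc) + (Rb + Ra - Rc)" by (simp only: 1 2)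
  then have "2 * (La + Lb) = 2 * (Rb + Ra)" by (simp add: algebra_simps)
  then have s: "La + Lb = Rb + Ra" by (metis mult_left_cancel zero_neq_numeral)
  have "(\<i> * La - \<i> * Lb + Lc) + (\<i> * La - \<i> * Lb - Lc) = (\<i> * Rb - \<i> * Ra + Rc) + (\<i> * Rb - \<i> * Ra - Rc)"
    by (simp only: 3 4)
  then have "2 * \<i> * (La - Lb) = 2 * \<i> * (Rb - Ra)" by (simp add: algebra_simps)
  then have d: "La - Lb = Rb - Ra" by simp
  have "(La + Lb) + (La - Lb) = (Rb + Ra) + (Rb - Ra)" by (simp only: s d)
  then have "2 * La = 2 * Rb" by (simp add: algebra_simps)
  then have "La = Rb" by simp
  moreover have "La = (\<Sum>j | j \<in> {1..k} \<and> r j = a. T (r(j := b)) c)"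
    unfolding La_def X_def by (subst sum.inter_filter[symmetric]) (auto intro!: sum.cong simp: \<pi>_def)
  moreover have "Rb = (\<Sum>j | j \<in> {1..k} \<and> c j = b. T r (c(j := a)))"
    unfolding Rb_def Y_def by (subst sum.inter_filter[symmetric]) (auto intro!: sum.cong simp: \<pi>_def)
  ultimately show ?thesis by simp
qed

text \<open>The diagonal involution with entry \<open>-1\<close> at \<open>a\<close> and
  \<open>1\<close> elsewhere multiplies the moment by \<open>k\<close> minus twice the number of
  occurrences of \<open>a\<close>, among the row indices on one side and among the column indices on
  the other.\<close>

lemma entry_moment_balanced:
  fixes r c :: "nat \<Rightarrow> nat"
  assumes W: "prob_space W" and M: "\<And>\<iota>. \<iota> \<in> \<I> \<Longrightarrow> random_matrix W N (M \<iota>)"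
    and inv: "unitarily_invariant W N \<I> M" and i: "i \<in> {1..k} \<rightarrow> \<I>"
    and r: "\<And>j. j \<in> {1..k} \<Longrightarrow> r j < N" and c: "\<And>j. j \<in> {1..k} \<Longrightarrow> c j < N"
    and ne: "entry_moment W k (\<lambda>j. M (i j)) r c \<noteq> 0"
  shows "card {j \<in> {1..k}. r j = a} = card {j \<in> {1..k}. c j = a}"
proof -
  let ?T = "entry_moment W k (\<lambda>j. M (i j))"
  define w where "w x = (if x = a then -1 else 1 :: complex)" for x
  have "(\<Sum>j\<in>{1..k}. w (r j) * ?T (r(j := id (r j))) c) = (\<Sum>j\<in>{1..k}. w (id (c j)) * ?T r (c(j := id (c j))))"
    by (rule infinitesimal_invariance[OF W M inv i _ _ _ _ r c]) (auto simp: w_def)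
  then have "(\<Sum>j\<in>{1..k}. w (r j)) = (\<Sum>j\<in>{1..k}. w (c j))"
    using ne by (simp add: sum_distrib_right[symmetric])
  moreover have "(\<Sum>j\<in>{1..k}. w (f j)) = of_nat k - 2 * of_nat (card {j \<in> {1..k}. f j = a})" for f
  proof -
    have "(\<Sum>j\<in>{1..k}. w (f j)) = (\<Sum>j\<in>{1..k}. 1 - 2 * (if f j = a then 1 else 0))"
      by (intro sum.cong refl) (simp add: w_def)
    also have "\<dots> = of_nat k - 2 * (\<Sum>j\<in>{1..k}. if f j = a then 1 else 0)"
      by (simp add: sum_subtractf sum_distrib_left)
    also have "(\<Sum>j\<in>{1..k}. if f j = a then 1 else 0 :: complex) = of_nat (card {j \<in> {1..k}. f j = a})"
      by (subst sum.inter_filter[symmetric]) simp_all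
    finally show ?thesis .
  qed
  ultimately show ?thesis by simp
qed

text \<open>Invariance under the permutation matrix of the transposition. In the test the column
  indices are already transposed, so the factor on the right restores them.\<close>

lemma entry_moment_transpose:
  fixes r c :: "nat \<Rightarrow> nat"
  assumes W: "prob_space W" and M: "\<And>\<iota>. \<iota> \<in> \<I> \<Longrightarrow> random_matrix W N (M \<iota>)"
    and inv: "unitarily_invariant W N \<I> M" and i: "i \<in> {1..k} \<rightarrow> \<I>"
    and r: "\<And>j. j \<in> {1..k} \<Longrightarrow> r j < N" and c: "\<And>j. j \<in> {1..k} \<Longrightarrow> c j < N"
    and ab: "a < N" "b < N"
  shows "entry_moment W k (\<lambda>j. M (i j)) (\<lambda>j. Transposition.transpose a b (r j)) (\<lambda>j. Transposition.transpose a b (c j)) =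
    entry_moment W k (\<lambda>j. M (i j)) r c"
proof -
  let ?t = "Transposition.transpose a b"
  define g where "g x y = (if y = ?t x then 1 else 0 :: complex)" for x y
  have t: "?t x < N" if "x < N" for x using that ab by (auto simp: Transposition.transpose_def)
  have tt: "?t x = ?t y \<longleftrightarrow> x = y" for x y by (metis transpose_involutory)
  have sw: "y = ?t x \<longleftrightarrow> x = ?t y" for x y by (auto simp: Transposition.transpose_def)
  have "(LINT \<omega>|W. (\<Prod>j\<in>{1..k}. \<Sum>x<N. g (r j) x * M (i j) \<omega> $$ (x, ?t (c j)))) =
    (LINT \<omega>|W. (\<Prod>j\<in>{1..k}. \<Sum>x<N. M (i j) \<omega> $$ (r j, x) * g x (?t (c j))))"
  proof (rule unitary_coefficients_moment[OF W M inv i _ _ r])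
    show "(\<Sum>x<N. g a x * cnj (g b x)) = (if a = b then 1 else 0)" if "a < N" "b < N" for a b
    proof -
      have "(\<Sum>x<N. g a x * cnj (g b x)) = (\<Sum>x<N. if x = ?t a then (if a = b then 1 else 0) else 0)"
        by (intro sum.cong refl) (auto simp: g_def tt)
      then show ?thesis using t[OF that(1)] by simp
    qed
    show "(\<Sum>x<N. cnj (g x a) * g x b) = (if a = b then 1 else 0)" if "a < N" "b < N" for a b
    proof -
      have "(\<Sum>x<N. cnj (g x a) * g x b) = (\<Sum>x<N. if x = ?t a then (if a = b then 1 else 0) else 0)"
        by (intro sum.cong refl) (simp add: g_def sw)
      then show ?thesis using t[OF that(1)] by simp
    qed
  qed (use t c in auto)
  moreover have L: "(\<Sum>x<N. g (r j) x * M (i j) \<omega> $$ (x, ?t (c j))) = M (i j) \<omega> $$ (?t (r j), ?t (c j))"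
    if "j \<in> {1..k}" for j \<omega>
  proof -
    have "(\<Sum>x<N. g (r j) x * M (i j) \<omega> $$ (x, ?t (c j))) =
        (\<Sum>x<N. if x = ?t (r j) then M (i j) \<omega> $$ (x, ?t (c j)) else 0)"
      by (intro sum.cong refl) (auto simp: g_def)
    then show ?thesis using t[OF r[OF that]] by simp
  qed
  moreover have R: "(\<Sum>x<N. M (i j) \<omega> $$ (r j, x) * g x (?t (c j))) = M (i j) \<omega> $$ (r j, c j)"
    if "j \<in> {1..k}" for j \<omega>
  proof -
    have "(\<Sum>x<N. M (i j) \<omega> $$ (r j, x) * g x (?t (c j))) =
        (\<Sum>x<N. if x = c j then M (i j) \<omega> $$ (r j, x) else 0)"
      by (intro sum.cong refl) (auto simp: g_def tt)
    then show ?thesis using c[OF that] by simp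
  qed
  moreover have "(\<Prod>j\<in>{1..k}. \<Sum>x<N. g (r j) x * M (i j) \<omega> $$ (x, ?t (c j))) =
      (\<Prod>j\<in>{1..k}. M (i j) \<omega> $$ (?t (r j), ?t (c j)))" for \<omega>
    by (rule prod.cong[OF refl L])
  moreover have "(\<Prod>j\<in>{1..k}. \<Sum>x<N. M (i j) \<omega> $$ (r j, x) * g x (?t (c j))) =
      (\<Prod>j\<in>{1..k}. M (i j) \<omega> $$ (r j, c j))" for \<omega>
    by (rule prod.cong[OF refl R])
  ultimately show ?thesis unfolding entry_moment_def by simp
qed

text \<open>A colour which occurs twice among the row indices is split into two colours by means of
  the exchange relation, until the row indices are distinct.\<close>

lemma exchange_expansion:
  fixes T :: "(nat \<Rightarrow> nat) \<Rightarrow> (nat \<Rightarrow> nat) \<Rightarrow> complex"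
  assumes cong: "\<And>r r' c c'. (\<And>j. j \<in> {1..k} \<Longrightarrow> r j = r' j) \<Longrightarrow> (\<And>j. j \<in> {1..k} \<Longrightarrow> c j = c' j) \<Longrightarrow> T r c = T r' c'"
    and exch: "\<And>r c a b. (\<And>j. j \<in> {1..k} \<Longrightarrow> r j < N) \<Longrightarrow> (\<And>j. j \<in> {1..k} \<Longrightarrow> c j < N) \<Longrightarrow>
      a < N \<Longrightarrow> b < N \<Longrightarrow> a \<noteq> b \<Longrightarrow>
      (\<Sum>j | j \<in> {1..k} \<and> r j = a. T (r(j := b)) c) = (\<Sum>j | j \<in> {1..k} \<and> c j = b. T r (c(j := a)))"
    and bal: "\<And>r c a. (\<And>j. j \<in> {1..k} \<Longrightarrow> r j < N) \<Longrightarrow> (\<And>j. j \<in> {1..k} \<Longrightarrow> c j < N) \<Longrightarrow> T r c \<noteq> 0 \<Longrightarrow>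
      card {j \<in> {1..k}. r j = a} = card {j \<in> {1..k}. c j = a}"
    and trans: "\<And>r c a b. (\<And>j. j \<in> {1..k} \<Longrightarrow> r j < N) \<Longrightarrow> (\<And>j. j \<in> {1..k} \<Longrightarrow> c j < N) \<Longrightarrow>
      a < N \<Longrightarrow> b < N \<Longrightarrow> T (\<lambda>j. Transposition.transpose a b (r j)) (\<lambda>j. Transposition.transpose a b (c j)) = T r c"
    and kN: "k \<le> N"
    and r: "\<And>j. j \<in> {1..k} \<Longrightarrow> r j < N" and c: "\<And>j. j \<in> {1..k} \<Longrightarrow> c j < N"
  shows "T r c = (\<Sum>\<sigma> | \<sigma> permutes {1..k} \<and> (\<forall>j\<in>{1..k}. c j = r (\<sigma> j)). T (\<lambda>j. j - 1) (\<lambda>j. \<sigma> j - 1))"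
proof -
  define F where "F \<sigma> = T (\<lambda>j. j - 1) (\<lambda>j. \<sigma> j - 1)" for \<sigma> :: "nat \<Rightarrow> nat"
  define Q where "Q r c = {\<sigma>. \<sigma> permutes {1..k} \<and> (\<forall>j\<in>{1..k}. c j = r (\<sigma> j))}" for r c :: "nat \<Rightarrow> nat"
  have finQ: "finite (Q r c)" for r c
    by (rule finite_subset[OF _ finite_permutations[of "{1..k}"]]) (auto simp: Q_def)
  have perm_in: "\<sigma> j \<in> {1..k}" if "\<sigma> permutes {1..k}" "j \<in> {1..k}" for \<sigma> j
    using permutes_in_image[OF that(1), of j] that(2) by blast
  \<comment> \<open>For distinct row indices only their coincidence with the column indices matters:
    transpositions of colours move them one at a time to the standard values \<open>j - 1\<close>,
    each without disturbing those already in place.\<close>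
  have base: "T r (\<lambda>j. r (\<sigma> j)) = F \<sigma>" if \<sigma>: "\<sigma> permutes {1..k}" and "inj_on r {1..k}" "\<And>j. j \<in> {1..k} \<Longrightarrow> r j < N" for r \<sigma>
    using that(2,3)
  proof (induction "card {j\<in>{1..k}. r j \<noteq> j - 1}" arbitrary: r rule: less_induct)
    case less
    show ?case
    proof (cases "\<exists>j\<in>{1..k}. r j \<noteq> j - 1")
      case False
      show ?thesis unfolding F_def by (rule cong) (use False perm_in[OF \<sigma>] in blast)+
    next
      case True
      then obtain j where j: "j \<in> {1..k}" "r j \<noteq> j - 1" by blast
      let ?t = "Transposition.transpose (r j) (j - 1)"
      define r' where "r' l = ?t (r l)" for l
      have j1: "j - 1 < N" using j(1) kN by auto
      have r'N: "r' l < N" if "l \<in> {1..k}" for l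
        using less.prems(2)[OF that] less.prems(2)[OF j(1)] j1 by (auto simp: r'_def Transposition.transpose_def)
      have inj': "inj_on r' {1..k}"
      proof (rule inj_onI)
        fix x y assume xy: "x \<in> {1..k}" "y \<in> {1..k}" and "r' x = r' y"
        then have "?t (?t (r x)) = ?t (?t (r y))" by (simp add: r'_def)
        then have "r x = r y" by simp
        then show "x = y" using less.prems(1) xy by (auto dest: inj_onD)
      qed
      have "{l\<in>{1..k}. r' l \<noteq> l - 1} \<subset> {l\<in>{1..k}. r l \<noteq> l - 1}"
      proof
        show "{l\<in>{1..k}. r' l \<noteq> l - 1} \<subseteq> {l\<in>{1..k}. r l \<noteq> l - 1}"
        proof clarify
          fix l assume l: "l \<in> {1..k}" "r l = l - 1" and n: "r' l \<noteq> l - 1"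
          have "l \<noteq> j" using l j by auto
          then have "r l \<noteq> r j" using less.prems(1) l(1) j(1) by (auto dest: inj_onD)
          moreover have "r l \<noteq> j - 1" using l j(1) \<open>l \<noteq> j\<close> by auto
          ultimately have "r' l = r l" by (simp add: r'_def Transposition.transpose_def)
          then show False using n l(2) by simp
        qed
        have "r' j = j - 1" by (simp add: r'_def)
        then show "{l\<in>{1..k}. r' l \<noteq> l - 1} \<noteq> {l\<in>{1..k}. r l \<noteq> l - 1}" using j by blast
      qed
      then have "card {l\<in>{1..k}. r' l \<noteq> l - 1} < card {l\<in>{1..k}. r l \<noteq> l - 1}"
        by (intro psubset_card_mono) auto
      then have "T r' (\<lambda>l. r' (\<sigma> l)) = F \<sigma>" by (rule less.hyps[OF _ inj' r'N])
      moreover have "T r' (\<lambda>l. r' (\<sigma> l)) = T r (\<lambda>l. r (\<sigma> l))"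
        unfolding r'_def by (rule trans) (use less.prems(2) perm_in[OF \<sigma>] j j1 in auto)
      ultimately show ?thesis by simp
    qed
  qed
  have "T r c = sum F (Q r c)" using r c
  \<comment> \<open>The measure is the number of collisions among the row indices. The column
    indices are generalized because the exchange changes them.\<close>
  proof (induction "k - card (r ` {1..k})" arbitrary: r c rule: less_induct)
    case less
    show ?case
    proof (cases "\<forall>a. card {j \<in> {1..k}. r j = a} = card {j \<in> {1..k}. c j = a}")
      case False
      then have "T r c = 0" using bal[of r c] less.prems by blast
      moreover have "Q r c = {}"
      proof (rule ccontr)
        assume "Q r c \<noteq> {}"
        then obtain \<sigma> where \<sigma>: "\<sigma> permutes {1..k}" "\<forall>j\<in>{1..k}. c j = r (\<sigma> j)" by (auto simp: Q_def)
        have "bij_betw \<sigma> {j \<in> {1..k}. c j = a} {j \<in> {1..k}. r j = a}" for a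
        proof (rule bij_betw_byWitness[where f' = "inv \<sigma>"])
          show "\<sigma> ` {j \<in> {1..k}. c j = a} \<subseteq> {j \<in> {1..k}. r j = a}"
            using \<sigma>(2) perm_in[OF \<sigma>(1)] by auto
          show "inv \<sigma> ` {j \<in> {1..k}. r j = a} \<subseteq> {j \<in> {1..k}. c j = a}"
          proof (rule image_subsetI)
            fix j assume "j \<in> {j \<in> {1..k}. r j = a}"
            then have j: "j \<in> {1..k}" "r j = a" by auto
            have "inv \<sigma> j \<in> {1..k}" by (rule perm_in[OF permutes_inv[OF \<sigma>(1)] j(1)])
            moreover from this have "c (inv \<sigma> j) = a" using \<sigma>(2) j(2) permutes_inverses(1)[OF \<sigma>(1)] by simp
            ultimately show "inv \<sigma> j \<in> {j \<in> {1..k}. c j = a}" by blast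
          qed
        qed (simp_all add: permutes_inverses[OF \<sigma>(1)])
        from bij_betw_same_card[OF this] show False using False by simp
      qed
      ultimately show ?thesis by simp
    next
      case eq: True
      show ?thesis
      proof (cases "inj_on r {1..k}")
        case True
        have ex: "\<exists>l\<in>{1..k}. r l = c j" if j: "j \<in> {1..k}" for j
        proof -
          have "card {l \<in> {1..k}. c l = c j} \<noteq> 0" using j by auto
          then have "card {l \<in> {1..k}. r l = c j} \<noteq> 0" using eq by metis
          then have "{l \<in> {1..k}. r l = c j} \<noteq> {}" by (metis card.empty)
          then show ?thesis by blast
        qed
        \<comment> \<open>With injective \<open>r\<close>, balance says that \<open>c\<close> is a
          rearrangement of \<open>r\<close>. The position of \<open>c j\<close> in \<open>r\<close>
          is then the only possible value of the permutation at \<open>j\<close>.\<close>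
        define \<sigma> where "\<sigma> j = (if j \<in> {1..k} then (SOME l. l \<in> {1..k} \<and> r l = c j) else j)" for j
        have \<sigma>: "\<sigma> j \<in> {1..k} \<and> r (\<sigma> j) = c j" if "j \<in> {1..k}" for j
        proof -
          have "\<exists>l. l \<in> {1..k} \<and> r l = c j" using ex[OF that] by blast
          from someI_ex[OF this] show ?thesis using that by (simp only: \<sigma>_def if_True)
        qed
        have "inj_on \<sigma> {1..k}"
        proof (rule inj_onI, rule ccontr)
          fix x y assume x: "x \<in> {1..k}" and y: "y \<in> {1..k}" and "\<sigma> x = \<sigma> y" and ne: "x \<noteq> y"
          then have cxy: "c x = c y" using \<sigma>[OF x] \<sigma>[OF y] by simp
          have "2 = card {x, y}" using ne by simp
          also have "\<dots> \<le> card {l \<in> {1..k}. c l = c x}" using x y cxy by (intro card_mono) auto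
          also have "\<dots> = card {l \<in> {1..k}. r l = c x}" using eq by simp
          also have "\<dots> \<le> card {\<sigma> x}"
          proof (rule card_mono)
            show "{l \<in> {1..k}. r l = c x} \<subseteq> {\<sigma> x}"
            proof clarify
              fix l assume "l \<in> {1..k}" "r l = c x"
              then show "l = \<sigma> x" using inj_onD[OF True, of l "\<sigma> x"] \<sigma>[OF x] by simp
            qed
          qed simp
          finally show False by simp
        qed
        moreover have "\<sigma> ` {1..k} \<subseteq> {1..k}" using \<sigma> by blast
        ultimately have "bij_betw \<sigma> {1..k} {1..k}" by (simp add: bij_betw_def endo_inj_surj)
        then have perm: "\<sigma> permutes {1..k}" by (rule bij_imp_permutes) (auto simp: \<sigma>_def)
        have "Q r c = {\<sigma>}"
        proof
          show "{\<sigma>} \<subseteq> Q r c" using perm \<sigma> by (auto simp: Q_def)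
          show "Q r c \<subseteq> {\<sigma>}"
          proof
            fix \<tau> assume "\<tau> \<in> Q r c"
            then have \<tau>: "\<tau> permutes {1..k}" "\<And>j. j \<in> {1..k} \<Longrightarrow> c j = r (\<tau> j)" by (auto simp: Q_def)
            have "\<tau> j = \<sigma> j" for j
            proof (cases "j \<in> {1..k}")
              case j: True
              have "r (\<tau> j) = r (\<sigma> j)" using \<tau>(2)[OF j] \<sigma>[OF j] by simp
              then show ?thesis by (rule inj_onD[OF True _ perm_in[OF \<tau>(1) j] perm_in[OF perm j]])
            next
              case False
              then show ?thesis using permutes_not_in[OF \<tau>(1)] permutes_not_in[OF perm] by metis
            qed
            then show "\<tau> \<in> {\<sigma>}" by blast
          qed
        qed
        moreover have "T r c = T r (\<lambda>j. r (\<sigma> j))" by (rule cong) (use \<sigma> in auto)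
        ultimately show ?thesis using base[OF perm True less.prems(1)] by simp
      next
        case False
        then obtain j0 j1 where j0: "j0 \<in> {1..k}" and j1: "j1 \<in> {1..k}" "j0 \<noteq> j1" "r j0 = r j1"
          by (auto simp: inj_on_def)
        have lt: "card (r ` {1..k}) < k"
        proof -
          have "card (r ` {1..k}) \<noteq> card {1..k}" using False eq_card_imp_inj_on[of "{1..k}" r] by auto
          then show ?thesis using card_image_le[of "{1..k}" r] by simp
        qed
        have "\<not> {..<N} \<subseteq> r ` {1..k}"
        proof
          assume "{..<N} \<subseteq> r ` {1..k}"
          then have "N \<le> card (r ` {1..k})" using card_mono[of "r ` {1..k}" "{..<N}"] by simp
          then show False using lt kN by simp
        qed
        then obtain b where b: "b < N" "b \<notin> r ` {1..k}" by auto
        define a where "a = r j0"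
        have a: "a < N" "a \<noteq> b" using less.prems(1)[OF j0] b j0 by (auto simp: a_def)
        define r' where "r' = r(j0 := b)"
        have r'N: "r' j < N" if "j \<in> {1..k}" for j using less.prems(1) that b by (simp add: r'_def)
        have r'b: "r' j = b \<longleftrightarrow> j = j0" if "j \<in> {1..k}" for j using that b by (auto simp: r'_def)
        have img: "r' ` {1..k} = insert b (r ` {1..k})"
        proof
          show "insert b (r ` {1..k}) \<subseteq> r' ` {1..k}"
          proof
            fix x assume "x \<in> insert b (r ` {1..k})"
            then consider "x = b" | j where "j \<in> {1..k}" "x = r j" by blast
            then show "x \<in> r' ` {1..k}"
            proof cases
              case 1 then show ?thesis using j0 by (intro image_eqI[of _ _ j0]) (auto simp: r'_def)
            next
              case 2 then show ?thesis using j0 j1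
                by (intro image_eqI[of _ _ "if j = j0 then j1 else j"]) (auto simp: r'_def)
            qed
          qed
        qed (auto simp: r'_def)
        have "card (r' ` {1..k}) = Suc (card (r ` {1..k}))" unfolding img using b by simp
        then have dec: "k - card (r' ` {1..k}) < k - card (r ` {1..k})" using lt by simp
        have cb: "c j \<noteq> b" if "j \<in> {1..k}" for j
        proof
          assume "c j = b"
          then have "card {l \<in> {1..k}. c l = b} \<noteq> 0" using that by auto
          then have "card {l \<in> {1..k}. r l = b} \<noteq> 0" using eq by metis
          then have "{l \<in> {1..k}. r l = b} \<noteq> {}" by (metis card.empty)
          then show False using b(2) by blast
        qed
        \<comment> \<open>Since \<open>b\<close> is new, it occurs in \<open>r'\<close> only at
          \<open>j0\<close>, and the exchange relation read from \<open>r'\<close> back to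
          \<open>r\<close> has \<open>T r c\<close> as its only term on the left.\<close>
        have "{j. j \<in> {1..k} \<and> r' j = b} = {j0}" using r'b j0 by auto
        moreover have "r'(j0 := a) = r" by (auto simp: r'_def a_def)
        ultimately have "T r c = (\<Sum>j | j \<in> {1..k} \<and> r' j = b. T (r'(j := a)) c)" by simp
        also have "\<dots> = (\<Sum>j | j \<in> {1..k} \<and> c j = a. T r' (c(j := b)))"
          by (rule exch) (use r'N less.prems(2) a b in auto)
        also have "\<dots> = (\<Sum>j | j \<in> {1..k} \<and> c j = a. sum F (Q r' (c(j := b))))"
          by (intro sum.cong refl less.hyps[OF dec r'N]) (use less.prems(2) b in auto)
        also have "\<dots> = sum F (\<Union>j\<in>{j. j \<in> {1..k} \<and> c j = a}. Q r' (c(j := b)))"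
        proof (rule sum.UNION_disjoint[symmetric])
          have pre: "\<sigma> j = j0" if "\<sigma> \<in> Q r' (c(j := b))" "j \<in> {1..k}" for \<sigma> j
          proof -
            have \<sigma>: "\<sigma> permutes {1..k}" and "(c(j := b)) j = r' (\<sigma> j)" using that unfolding Q_def by blast+
            then show ?thesis using r'b[OF perm_in[OF \<sigma> that(2)]] by simp
          qed
          show "\<forall>j\<in>{j. j \<in> {1..k} \<and> c j = a}. \<forall>l\<in>{j. j \<in> {1..k} \<and> c j = a}. j \<noteq> l \<longrightarrow>
              Q r' (c(j := b)) \<inter> Q r' (c(l := b)) = {}"
          proof (intro ballI impI, rule ccontr)
            fix j l assume jl: "j \<in> {j. j \<in> {1..k} \<and> c j = a}" "l \<in> {j. j \<in> {1..k} \<and> c j = a}" "j \<noteq> l"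
              and "Q r' (c(j := b)) \<inter> Q r' (c(l := b)) \<noteq> {}"
            then obtain \<sigma> where \<sigma>: "\<sigma> \<in> Q r' (c(j := b))" "\<sigma> \<in> Q r' (c(l := b))" by blast
            then have "\<sigma> j = \<sigma> l" using pre jl by auto
            moreover have "inj \<sigma>" using \<sigma>(1) permutes_inj by (auto simp: Q_def)
            ultimately show False using jl(3) by (auto dest: injD)
          qed
        qed (use finQ in auto)
        \<comment> \<open>A permutation compatible with \<open>r\<close> and \<open>c\<close> is
          sorted by the point \<open>j\<close> that it sends to \<open>j0\<close>: this is the
          column index which has to be recoloured from \<open>a\<close> to \<open>b\<close>.\<close>
        also have "(\<Union>j\<in>{j. j \<in> {1..k} \<and> c j = a}. Q r' (c(j := b))) = Q r c"
        proof
          show "(\<Union>j\<in>{j. j \<in> {1..k} \<and> c j = a}. Q r' (c(j := b))) \<subseteq> Q r c"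
          proof
            fix \<sigma> assume "\<sigma> \<in> (\<Union>j\<in>{j. j \<in> {1..k} \<and> c j = a}. Q r' (c(j := b)))"
            then obtain j where j: "j \<in> {1..k}" "c j = a" and \<sigma>: "\<sigma> permutes {1..k}"
              "\<And>l. l \<in> {1..k} \<Longrightarrow> (c(j := b)) l = r' (\<sigma> l)" by (auto simp: Q_def)
            have \<sigma>j: "\<sigma> j = j0" using \<sigma>(2)[OF j(1)] r'b[OF perm_in[OF \<sigma>(1) j(1)]] by simp
            have "c l = r (\<sigma> l)" if l: "l \<in> {1..k}" for l
            proof (cases "l = j")
              case True then show ?thesis using \<sigma>j j by (simp add: a_def)
            next
              case False
              then have "\<sigma> l \<noteq> j0" using \<sigma>j permutes_inj[OF \<sigma>(1)] by (auto dest: injD)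
              then show ?thesis using \<sigma>(2)[OF l] False by (simp add: r'_def)
            qed
            then show "\<sigma> \<in> Q r c" using \<sigma>(1) by (simp add: Q_def)
          qed
          show "Q r c \<subseteq> (\<Union>j\<in>{j. j \<in> {1..k} \<and> c j = a}. Q r' (c(j := b)))"
          proof
            fix \<sigma> assume "\<sigma> \<in> Q r c"
            then have \<sigma>: "\<sigma> permutes {1..k}" "\<And>l. l \<in> {1..k} \<Longrightarrow> c l = r (\<sigma> l)" by (auto simp: Q_def)
            define j where "j = inv \<sigma> j0"
            have j: "j \<in> {1..k}" "\<sigma> j = j0"
              using perm_in[OF permutes_inv[OF \<sigma>(1)] j0] permutes_inverses(1)[OF \<sigma>(1)] by (auto simp: j_def)
            have "(c(j := b)) l = r' (\<sigma> l)" if l: "l \<in> {1..k}" for l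
            proof (cases "l = j")
              case True then show ?thesis using j by (simp add: r'_def)
            next
              case False
              then have "\<sigma> l \<noteq> j0" using j permutes_inj[OF \<sigma>(1)] by (auto dest: injD)
              then show ?thesis using \<sigma>(2)[OF l] False by (simp add: r'_def)
            qed
            moreover have "c j = a" using \<sigma>(2)[OF j(1)] j(2) by (simp add: a_def)
            ultimately show "\<sigma> \<in> (\<Union>j\<in>{j. j \<in> {1..k} \<and> c j = a}. Q r' (c(j := b)))"
              using \<sigma>(1) j(1) unfolding Q_def by blast
          qed
        qed
        finally show ?thesis .
      qed
    qed
  qed
  then show ?thesis by (simp add: F_def Q_def)
qed

section \<open>The order on partitions\<close>

definition block_of :: "'a set set \<Rightarrow> 'a \<Rightarrow> 'a set" where
  "block_of p x = (THE B. B \<in> p \<and> x \<in> B)"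

lemma block_of_eq:
  assumes "partition_on A p" "B \<in> p" "x \<in> B"
  shows "block_of p x = B"
  unfolding block_of_def
proof (rule the_equality)
  show "C = B" if "C \<in> p \<and> x \<in> C" for C
    using partition_block_eq[OF assms(1), of C B x] that assms(2,3) by blast
qed (use assms in blast)

lemma block_of_in:
  assumes "partition_on A p" "x \<in> A"
  shows "block_of p x \<in> p" "x \<in> block_of p x"
proof -
  have "x \<in> \<Union> p" using partition_onD1[OF assms(1)] assms(2) by simp
  then obtain B where "B \<in> p" "x \<in> B" by blast
  then show "block_of p x \<in> p" "x \<in> block_of p x" using block_of_eq[OF assms(1), of B x] by auto
qed

lemma join_is_join:
  assumes "partition_on (points k) p" "partition_on (points k) q"
  shows "is_join (points k) p q (join k p q)"
proof -
  obtain r where r: "is_join (points k) p q r" using is_join_exists[OF assms] by blast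
  then have "join k p q = r" unfolding join_def by (rule the_equality) (rule is_join_unique[OF _ r])
  then show ?thesis using r by simp
qed

text \<open>The fibres of \<open>f\<close> form a partition, and \<open>f\<close> is constant on the
  blocks of another partition iff the latter is finer. The claim is thus the universal property of
  the join, whose construction is not looked at.\<close>

lemma const_on_join_iff:
  assumes r: "is_join A p q r" and p: "partition_on A p" and q: "partition_on A q"
  shows "(\<forall>B\<in>r. \<forall>x\<in>B. \<forall>y\<in>B. f x = f y) \<longleftrightarrow>
    (\<forall>B\<in>p. \<forall>x\<in>B. \<forall>y\<in>B. f x = f y) \<and> (\<forall>B\<in>q. \<forall>x\<in>B. \<forall>y\<in>B. f x = f y)"
proof
  assume "\<forall>B\<in>r. \<forall>x\<in>B. \<forall>y\<in>B. f x = f y"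
  moreover have "finer p r" "finer q r" using r by (auto simp: is_join_def)
  ultimately show "(\<forall>B\<in>p. \<forall>x\<in>B. \<forall>y\<in>B. f x = f y) \<and> (\<forall>B\<in>q. \<forall>x\<in>B. \<forall>y\<in>B. f x = f y)"
    unfolding finer_def by (meson subsetD)
next
  assume const: "(\<forall>B\<in>p. \<forall>x\<in>B. \<forall>y\<in>B. f x = f y) \<and> (\<forall>B\<in>q. \<forall>x\<in>B. \<forall>y\<in>B. f x = f y)"
  define s where "s = (\<lambda>x. {y \<in> A. f y = f x}) ` A"
  have s: "partition_on A s"
  proof (rule partition_onI)
    show "\<Union> s = A" by (auto simp: s_def)
    show "disjnt C D" if "C \<in> s" "D \<in> s" "C \<noteq> D" for C D
      using that by (auto simp: s_def disjnt_def)
    show "{} \<notin> s" by (auto simp: s_def)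
  qed
  have fin: "finer t s" if t: "partition_on A t" "\<forall>B\<in>t. \<forall>x\<in>B. \<forall>y\<in>B. f x = f y" for t
    unfolding finer_def
  proof
    fix B assume B: "B \<in> t"
    have "B \<noteq> {}" "B \<subseteq> A" using t(1) B by (auto simp: partition_on_def)
    then obtain x where x: "x \<in> B" "x \<in> A" by blast
    have "B \<subseteq> {y \<in> A. f y = f x}" using \<open>B \<subseteq> A\<close> t(2) B x(1) by blast
    then show "\<exists>C\<in>s. B \<subseteq> C" using x(2) by (auto simp: s_def)
  qed
  have "finer p s" "finer q s" by (rule fin[OF p conjunct1[OF const]], rule fin[OF q conjunct2[OF const]])
  then have "finer r s" using r s unfolding is_join_def by blast
  show "\<forall>B\<in>r. \<forall>x\<in>B. \<forall>y\<in>B. f x = f y"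
  proof (intro ballI)
    fix B x y assume "B \<in> r" "x \<in> B" "y \<in> B"
    then obtain C where "C \<in> s" "x \<in> C" "y \<in> C" using \<open>finer r s\<close> unfolding finer_def by blast
    then show "f x = f y" by (auto simp: s_def)
  qed
qed

lemma finite_points: "finite (points k)"
  unfolding points_def by simp

lemma partition_id_part: "partition_on (points k) (id_part k)"
proof (rule partition_onI)
  show "\<Union> (id_part k) = points k"
  proof
    show "points k \<subseteq> \<Union> (id_part k)"
    proof
      fix x assume "x \<in> points k"
      then show "x \<in> \<Union> (id_part k)" by (cases x) (auto simp: id_part_def Inl_points_iff Inr_points_iff)
    qed
  qed (auto simp: id_part_def Inl_points_iff Inr_points_iff)
qed (auto simp: id_part_def disjnt_def)

lemma partition_perm_part:
  assumes "\<sigma> permutes {1..k}"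
  shows "partition_on (points k) (perm_part k \<sigma>)"
proof (rule partition_onI)
  have in': "\<sigma> j \<in> {1..k} \<longleftrightarrow> j \<in> {1..k}" for j by (rule permutes_in_image[OF assms])
  show "\<Union> (perm_part k \<sigma>) = points k"
  proof
    show "\<Union> (perm_part k \<sigma>) \<subseteq> points k"
      using in' unfolding perm_part_def by (auto simp: Inl_points_iff Inr_points_iff simp del: atLeastAtMost_iff)
    show "points k \<subseteq> \<Union> (perm_part k \<sigma>)"
    proof
      fix x assume x: "x \<in> points k"
      show "x \<in> \<Union> (perm_part k \<sigma>)"
      proof (cases x)
        case (Inl j)
        then show ?thesis using x unfolding perm_part_def Inl by (auto simp: Inl_points_iff)
      next
        case (Inr j)
        then have "inv \<sigma> j \<in> {1..k}" using x permutes_in_image[OF permutes_inv[OF assms], of j] by (simp add: Inr_points_iff)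
        moreover have "x \<in> {Inl (inv \<sigma> j), Inr (\<sigma> (inv \<sigma> j))}" using Inr permutes_inverses(1)[OF assms] by simp
        ultimately show ?thesis unfolding perm_part_def by blast
      qed
    qed
  qed
  show "disjnt B C" if "B \<in> perm_part k \<sigma>" "C \<in> perm_part k \<sigma>" "B \<noteq> C" for B C
    using that permutes_inj[OF assms] unfolding perm_part_def disjnt_def by (auto dest: injD)
qed (auto simp: perm_part_def)

lemma card_perm_part:
  shows "nc (perm_part k \<sigma>) = k"
proof -
  have "inj_on (\<lambda>i. {Inl i, Inr (\<sigma> i)}) {1..k}" by (rule inj_onI) (auto simp: doubleton_eq_iff)
  then show ?thesis unfolding perm_part_def by (simp add: card_image)
qed

lemma finer_perm_part_block:
  assumes p: "partition_on (points k) p" and \<sigma>: "\<sigma> permutes {1..k}" and fin: "finer (perm_part k \<sigma>) p"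
    and j: "j \<in> {1..k}"
  shows "block_of p (Inl j) = block_of p (Inr (\<sigma> j))"
proof -
  obtain C where "C \<in> p" "{Inl j, Inr (\<sigma> j)} \<subseteq> C"
    using fin j unfolding finer_def perm_part_def by blast
  then show ?thesis using block_of_eq[OF p, of C] by auto
qed

lemma bottom_blocks:
  assumes p: "partition_on (points k) p" and \<sigma>: "\<sigma> permutes {1..k}" and fin: "finer (perm_part k \<sigma>) p"
  shows "(\<lambda>j. block_of p (Inr j)) ` {1..k} = p"
proof
  show "(\<lambda>j. block_of p (Inr j)) ` {1..k} \<subseteq> p" using block_of_in(1)[OF p] by (auto simp: Inr_points_iff)
  show "p \<subseteq> (\<lambda>j. block_of p (Inr j)) ` {1..k}"
  proof
    fix B assume B: "B \<in> p"
    then have "B \<noteq> {}" "B \<subseteq> points k" using p by (auto simp: partition_on_def)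
    then obtain x where x: "x \<in> B" "x \<in> points k" by blast
    show "B \<in> (\<lambda>j. block_of p (Inr j)) ` {1..k}"
    proof (cases x)
      case (Inl j)
      then have j: "j \<in> {1..k}" using x by (simp add: Inl_points_iff)
      have "B = block_of p (Inr (\<sigma> j))"
        using finer_perm_part_block[OF p \<sigma> fin j] block_of_eq[OF p B x(1)] Inl by simp
      then show ?thesis using j permutes_in_image[OF \<sigma>, of j] by blast
    next
      case (Inr j)
      then have "j \<in> {1..k}" "B = block_of p (Inr j)"
        using x block_of_eq[OF p B x(1)] by (auto simp: Inr_points_iff)
      then show ?thesis by blast
    qed
  qed
qed

text \<open>The points of the bottom row represent all blocks of \<open>p\<close>, and a colouring is constant on
  \<open>p \<or> id\<close> iff on the bottom row it is constant on the cycles of \<open>\<sigma>\<close> and on the blocks of \<open>p\<close>.\<close>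

lemma card_join_id_part:
  assumes p: "partition_on (points k) p" and \<sigma>: "\<sigma> permutes {1..k}" and fin: "finer (perm_part k \<sigma>) p"
  shows "2 ^ nc (join k p (id_part k)) = card (const_fns 2 {1..k} (orbit \<sigma>) (\<lambda>j. block_of p (Inr j)))"
proof -
  let ?v = "\<lambda>j. block_of p (Inr j)"
  let ?F = "{f \<in> points k \<rightarrow>\<^sub>E {..<2::nat}. (\<forall>B\<in>p. \<forall>x\<in>B. \<forall>y\<in>B. f x = f y) \<and> (\<forall>B\<in>id_part k. \<forall>x\<in>B. \<forall>y\<in>B. f x = f y)}"
  let ?C = "const_fns 2 {1..k} (orbit \<sigma>) ?v"
  have J: "is_join (points k) p (id_part k) (join k p (id_part k))"
    by (rule join_is_join[OF p partition_id_part])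
  then have Jp: "partition_on (points k) (join k p (id_part k))" by (simp add: is_join_def)
  have "2 ^ nc (join k p (id_part k)) = card ?F"
    using card_const_on_partition[OF Jp finite_points, of 2]
    unfolding const_on_join_iff[OF J p partition_id_part] by simp
  also have "bij_betw (\<lambda>f. \<lambda>j\<in>{1..k}. f (Inr j)) ?F ?C"
  proof (rule bij_betw_byWitness[where f' = "\<lambda>g. \<lambda>x\<in>points k. case_sum g g x"])
    have idc: "f (Inl j) = f (Inr j)" if "f \<in> ?F" "j \<in> {1..k}" for f j
    proof -
      have B: "{Inl j, Inr j} \<in> id_part k" unfolding id_part_def by (rule imageI[OF that(2)])
      have "\<forall>B\<in>id_part k. \<forall>x\<in>B. \<forall>y\<in>B. f x = f y" using CollectD[OF that(1)] by (elim conjE)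
      from bspec[OF bspec[OF bspec[OF this B]]] show ?thesis by simp
    qed
    have pc: "f x = f y" if "f \<in> ?F" "x \<in> points k" "y \<in> points k" "block_of p x = block_of p y" for f x y
    proof -
      have B: "block_of p x \<in> p" "x \<in> block_of p x" "y \<in> block_of p x"
        using block_of_in[OF p that(2)] block_of_in(2)[OF p that(3)] that(4) by simp_all
      have "\<forall>B\<in>p. \<forall>x\<in>B. \<forall>y\<in>B. f x = f y" using CollectD[OF that(1)] by (elim conjE)
      from bspec[OF bspec[OF bspec[OF this B(1)] B(2)] B(3)] show ?thesis .
    qed
    show "\<forall>f\<in>?F. (\<lambda>x\<in>points k. case_sum (\<lambda>j\<in>{1..k}. f (Inr j)) (\<lambda>j\<in>{1..k}. f (Inr j)) x) = f"
    proof (intro ballI ext)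
      fix f x assume f: "f \<in> ?F"
      then have "f \<in> points k \<rightarrow>\<^sub>E {..<2}" by simp
      then have arb: "f x = undefined" if "x \<notin> points k" by (rule PiE_arb[OF _ that])
      show "(\<lambda>x\<in>points k. case_sum (\<lambda>j\<in>{1..k}. f (Inr j)) (\<lambda>j\<in>{1..k}. f (Inr j)) x) x = f x"
      proof (cases "x \<in> points k")
        case True
        then show ?thesis using idc[OF f] by (cases x) (auto simp: Inl_points_iff Inr_points_iff)
      qed (use arb in simp)
    qed
    show "\<forall>g\<in>?C. (\<lambda>j\<in>{1..k}. (\<lambda>x\<in>points k. case_sum g g x) (Inr j)) = g"
    proof (intro ballI ext)
      fix g j assume g: "g \<in> ?C"
      show "(\<lambda>j\<in>{1..k}. (\<lambda>x\<in>points k. case_sum g g x) (Inr j)) j = g j"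
        using const_fns_outside[OF g, of j] by (cases "j \<in> {1..k}") (simp_all add: Inr_points_iff)
    qed
    show "(\<lambda>f. \<lambda>j\<in>{1..k}. f (Inr j)) ` ?F \<subseteq> ?C"
    proof (rule image_subsetI)
      fix f assume f: "f \<in> ?F"
      then have fP: "f \<in> points k \<rightarrow>\<^sub>E {..<2}" by simp
      have inv: "f (Inr (\<sigma> j)) = f (Inr j)" if j: "j \<in> {1..k}" for j
      proof -
        have "f (Inr (\<sigma> j)) = f (Inl j)"
          by (rule pc[OF f]) (use j permutes_in_image[OF \<sigma>, of j] finer_perm_part_block[OF p \<sigma> fin j]
              in \<open>simp_all add: Inl_points_iff Inr_points_iff\<close>)
        then show ?thesis using idc[OF f j] by simp
      qed
      show "(\<lambda>j\<in>{1..k}. f (Inr j)) \<in> ?C" unfolding const_fns_def mem_Collect_eq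
      proof (intro conjI ballI impI)
        show "(\<lambda>j\<in>{1..k}. f (Inr j)) \<in> {1..k} \<rightarrow>\<^sub>E {..<2}"
          using PiE_mem[OF fP] by (auto simp: Inr_points_iff)
        fix x y assume xy: "x \<in> {1..k}" "y \<in> {1..k}" and same: "orbit \<sigma> x = orbit \<sigma> y \<or> ?v x = ?v y"
        from same have "f (Inr x) = f (Inr y)"
        proof
          assume "orbit \<sigma> x = orbit \<sigma> y"
          then have "x \<in> orbit \<sigma> y" using permutes_self_in_orbit[OF \<sigma>, of x] by simp
          from const_on_orbit[where f = "\<lambda>j. f (Inr j)" and A = "{1..k}" and \<sigma> = \<sigma>, OF _ \<sigma> xy(2) this] inv
          show ?thesis by blast
        next
          assume "?v x = ?v y"
          then show ?thesis by (intro pc[OF f]) (use xy in \<open>simp_all add: Inr_points_iff\<close>)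
        qed
        then show "(\<lambda>j\<in>{1..k}. f (Inr j)) x = (\<lambda>j\<in>{1..k}. f (Inr j)) y" using xy by simp
      qed
    qed
    show "(\<lambda>g. \<lambda>x\<in>points k. case_sum g g x) ` ?C \<subseteq> ?F"
    proof (rule image_subsetI)
      fix g assume g: "g \<in> ?C"
      let ?f = "\<lambda>x\<in>points k. case_sum g g x"
      have fl: "?f (Inl j) = g j" and fr: "?f (Inr j) = g j" if "j \<in> {1..k}" for j
        using that by (simp_all add: Inl_points_iff Inr_points_iff)
      have key: "\<exists>j\<in>{1..k}. ?f x = g j \<and> ?v j = block_of p x" if x: "x \<in> points k" for x
      proof (cases x)
        case (Inl j)
        then have j: "j \<in> {1..k}" using x by (simp add: Inl_points_iff)
        have \<sigma>j: "\<sigma> j \<in> {1..k}" using j permutes_in_image[OF \<sigma>, of j] by blast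
        have "g (\<sigma> j) = g j"
          by (rule const_fnsD[OF g \<sigma>j j]) (use permutes_orbit_apply[OF \<sigma>] in simp)
        then show ?thesis using fl[OF j] finer_perm_part_block[OF p \<sigma> fin j] \<sigma>j Inl by (intro bexI[of _ "\<sigma> j"]) simp_all
      next
        case (Inr j)
        then show ?thesis using x fr by (intro bexI[of _ j]) (simp_all add: Inr_points_iff)
      qed
      show "?f \<in> ?F"
      proof (intro CollectI conjI ballI)
        have gP: "g \<in> {1..k} \<rightarrow>\<^sub>E {..<2}" by (rule const_fns_PiE[OF g])
        show "?f \<in> points k \<rightarrow>\<^sub>E {..<2}"
        proof (rule PiE_I)
          fix x assume "x \<in> points k"
          then obtain j where "j \<in> {1..k}" "?f x = g j" using key by blast
          then show "?f x \<in> {..<2}" using PiE_mem[OF gP] by simp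
        qed simp
        show "?f x = ?f y" if B: "B \<in> p" "x \<in> B" "y \<in> B" for B x y
        proof -
          have "x \<in> points k" "y \<in> points k" using B p by (auto simp: partition_on_def)
          then obtain a b where a: "a \<in> {1..k}" "?f x = g a" "?v a = block_of p x"
            and b: "b \<in> {1..k}" "?f y = g b" "?v b = block_of p y" using key by metis
          have "?v a = ?v b" using a b block_of_eq[OF p B(1)] B(2,3) by simp
          then have "g a = g b" using const_fnsD[OF g a(1) b(1)] by blast
          then show ?thesis using a b by simp
        qed
        show "?f x = ?f y" if IB: "B \<in> id_part k" "x \<in> B" "y \<in> B" for B x y
        proof -
          obtain j where j: "j \<in> {1..k}" "B = {Inl j, Inr j}" using IB(1) unfolding id_part_def by blast
          have "?f z = g j" if z: "z \<in> B" for z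
          proof -
            consider "z = Inl j" | "z = Inr j" using z unfolding j(2) by blast
            then show ?thesis by cases (use fl[OF j(1)] fr[OF j(1)] in simp_all)
          qed
          then show ?thesis using IB(2,3) by metis
        qed
      qed
    qed
  qed
  from bij_betw_same_card[OF this] have "card ?F = card ?C" .
  finally show ?thesis .
qed

text \<open>For the partition of \<open>\<sigma>\<close> itself distinct bottom points lie in
  distinct blocks, so only the cycles of \<open>\<sigma>\<close> constrain the colourings counted
  above.\<close>

lemma nc_join_perm_part:
  assumes \<sigma>: "\<sigma> permutes {1..k}"
  shows "nc (join k (perm_part k \<sigma>) (id_part k)) = cyc {1..k} \<sigma>"
proof -
  let ?p = "perm_part k \<sigma>"
  have p: "partition_on (points k) ?p" by (rule partition_perm_part[OF \<sigma>])
  have fin: "finer ?p ?p" by (auto simp: finer_def)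
  have inj: "x = y" if xy: "x \<in> {1..k}" "y \<in> {1..k}" and eq: "block_of ?p (Inr x) = block_of ?p (Inr y)" for x y
  proof -
    have "Inr x \<in> block_of ?p (Inr x)" "Inr y \<in> block_of ?p (Inr x)" "block_of ?p (Inr x) \<in> ?p"
      using block_of_in[OF p, of "Inr x"] block_of_in[OF p, of "Inr y"] xy eq by (auto simp: Inr_points_iff)
    then show ?thesis unfolding perm_part_def by auto
  qed
  have "const_fns 2 {1..k} (orbit \<sigma>) (\<lambda>j. block_of ?p (Inr j)) = {f \<in> {1..k} \<rightarrow>\<^sub>E {..<2}. \<forall>x\<in>{1..k}. f (\<sigma> x) = f x}"
    (is "?L = ?R")
  proof
    show "?L \<subseteq> ?R"
    proof
      fix f assume f: "f \<in> ?L"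
      have "f (\<sigma> x) = f x" if "x \<in> {1..k}" for x
        by (rule const_fnsD[OF f _ that]) (use that permutes_in_image[OF \<sigma>, of x] permutes_orbit_apply[OF \<sigma>] in auto)
      then show "f \<in> ?R" using const_fns_PiE[OF f] by blast
    qed
    show "?R \<subseteq> ?L"
    proof
      fix f assume f: "f \<in> ?R"
      then have inv: "f (\<sigma> x) = f x" if "x \<in> {1..k}" for x using that by blast
      have "f x = f y" if xy: "x \<in> {1..k}" "y \<in> {1..k}" and "orbit \<sigma> x = orbit \<sigma> y \<or> block_of ?p (Inr x) = block_of ?p (Inr y)" for x y
        using that(3)
      proof
        assume "orbit \<sigma> x = orbit \<sigma> y"
        then have "x \<in> orbit \<sigma> y" using permutes_self_in_orbit[OF \<sigma>, of x] by simp
        from const_on_orbit[where f = f and A = "{1..k}" and \<sigma> = \<sigma>, OF _ \<sigma> xy(2) this] inv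
        show ?thesis by blast
      qed (use inj xy in blast)
      then show "f \<in> ?L" using f unfolding const_fns_def by blast
    qed
  qed
  then have "(2::nat) ^ nc (join k ?p (id_part k)) = 2 ^ cyc {1..k} \<sigma>"
    using card_join_id_part[OF p \<sigma> fin] card_invariant_functions[OF \<sigma>, of 2] by simp
  then show ?thesis by simp
qed

text \<open>The forest inequality with the bottom points as edges and with the cycles of
  \<open>\<sigma>\<close> and the blocks of \<open>p\<close> as vertices. The second part is the
  absence of nonzero flows \<open>h\<close> in the equality case.\<close>

lemma nc_join_inequality:
  assumes p: "partition_on (points k) p" and \<sigma>: "\<sigma> permutes {1..k}" and fin: "finer (perm_part k \<sigma>) p"
  shows "nc p + cyc {1..k} \<sigma> \<le> k + nc (join k p (id_part k))"
    and "nc p + cyc {1..k} \<sigma> = k + nc (join k p (id_part k)) \<Longrightarrow>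
      (\<And>a. a \<in> {1..k} \<Longrightarrow> (\<Sum>x\<in>{x\<in>{1..k}. orbit \<sigma> x = orbit \<sigma> a}. h x) = (0::int)) \<Longrightarrow>
      (\<And>a. a \<in> {1..k} \<Longrightarrow> (\<Sum>x\<in>{x\<in>{1..k}. block_of p (Inr x) = block_of p (Inr a)}. h x) = 0) \<Longrightarrow>
      a \<in> {1..k} \<Longrightarrow> h a = 0"
proof -
  let ?v = "\<lambda>j. block_of p (Inr j)"
  note forest = forest_inequality[of "{1..k}" "orbit \<sigma>" ?v]
  have e: "2 ^ (card (orbit \<sigma> ` {1..k}) + card (?v ` {1..k})) = (2::nat) ^ (nc p + cyc {1..k} \<sigma>)"
    unfolding bottom_blocks[OF p \<sigma> fin] by (simp add: cyc_def add.commute)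
  have e': "2 ^ card {1..k} * card (const_fns 2 {1..k} (orbit \<sigma>) ?v) = (2::nat) ^ (k + nc (join k p (id_part k)))"
    unfolding card_join_id_part[OF p \<sigma> fin, symmetric] by (simp add: power_add)
  have "(2::nat) ^ (nc p + cyc {1..k} \<sigma>) \<le> 2 ^ (k + nc (join k p (id_part k)))"
    using forest unfolding e e' by blast
  then show "nc p + cyc {1..k} \<sigma> \<le> k + nc (join k p (id_part k))"
    by (rule power_le_imp_le_exp[rotated]) simp
  assume eq: "nc p + cyc {1..k} \<sigma> = k + nc (join k p (id_part k))"
    and "\<And>a. a \<in> {1..k} \<Longrightarrow> (\<Sum>x\<in>{x\<in>{1..k}. orbit \<sigma> x = orbit \<sigma> a}. h x) = 0"
    and "\<And>a. a \<in> {1..k} \<Longrightarrow> (\<Sum>x\<in>{x\<in>{1..k}. ?v x = ?v a}. h x) = 0"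
    and "a \<in> {1..k}"
  then show "h a = 0" using forest unfolding e e' eq by blast
qed

lemma sqsupset_perm_part_iff:
  assumes p: "partition_on (points k) p" and \<sigma>: "\<sigma> permutes {1..k}"
  shows "sqsupset_part k (perm_part k \<sigma>) p \<longleftrightarrow> finer (perm_part k \<sigma>) p \<and>
    nc p + cyc {1..k} \<sigma> = k + nc (join k p (id_part k))"
  unfolding sqsupset_part_def nc_join_perm_part[OF \<sigma>] card_perm_part by auto

text \<open>If \<open>T\<close> is a union of cycles of \<open>\<tau>\<close>, the difference of the indicators of \<open>\<sigma> T\<close> and \<open>T\<close> is a flow
  on the forest of \<open>\<sigma>\<close> and \<open>p\<close>, since \<open>\<sigma> x\<close> and \<open>\<tau> x\<close> lie in the same block. Hence it vanishes.\<close>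

lemma sqsupset_preserves:
  assumes p: "partition_on (points k) p" and \<sigma>: "\<sigma> permutes {1..k}" and \<tau>: "\<tau> permutes {1..k}"
    and s\<sigma>: "sqsupset_part k (perm_part k \<sigma>) p" and s\<tau>: "finer (perm_part k \<tau>) p"
    and T: "\<And>x. x \<in> {1..k} \<Longrightarrow> \<tau> x \<in> T \<longleftrightarrow> x \<in> T" and x: "x \<in> {1..k}"
  shows "\<sigma> x \<in> T \<longleftrightarrow> x \<in> T"
proof -
  let ?A = "{1..k}"
  let ?v = "\<lambda>j. block_of p (Inr j)"
  define ind where "ind x = (if x \<in> T then 1 else 0 :: int)" for x
  define h where "h y = ind (inv \<sigma> y) - ind y" for y
  have fin: "finer (perm_part k \<sigma>) p" and eq: "nc p + cyc ?A \<sigma> = k + nc (join k p (id_part k))"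
    using s\<sigma> unfolding sqsupset_perm_part_iff[OF p \<sigma>] by auto
  have in\<sigma>: "\<sigma> x \<in> ?A \<longleftrightarrow> x \<in> ?A" and in\<tau>: "\<tau> x \<in> ?A \<longleftrightarrow> x \<in> ?A"
    and in\<sigma>': "inv \<sigma> x \<in> ?A \<longleftrightarrow> x \<in> ?A" and in\<tau>': "inv \<tau> x \<in> ?A \<longleftrightarrow> x \<in> ?A" for x
    by (rule permutes_in_image[OF \<sigma>] permutes_in_image[OF \<tau>] permutes_in_image[OF permutes_inv[OF \<sigma>]]
        permutes_in_image[OF permutes_inv[OF \<tau>]])+
  note inv = permutes_inverses[OF \<sigma>] permutes_inverses[OF \<tau>]
  have "h y = 0" if y: "y \<in> ?A" for y
  proof (rule nc_join_inequality(2)[OF p \<sigma> fin eq _ _ y])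
    fix a assume a: "a \<in> ?A"
    let ?O = "{x\<in>?A. orbit \<sigma> x = orbit \<sigma> a}"
    have "bij_betw \<sigma> ?O ?O"
    proof (rule bij_betw_byWitness[where f' = "inv \<sigma>"])
      show "\<sigma> ` ?O \<subseteq> ?O" using in\<sigma> permutes_orbit_apply[OF \<sigma>] by blast
      show "inv \<sigma> ` ?O \<subseteq> ?O"
      proof (rule image_subsetI)
        fix z assume "z \<in> ?O"
        then show "inv \<sigma> z \<in> ?O"
          using in\<sigma>'[of z] permutes_orbit_apply[OF \<sigma>, of "inv \<sigma> z"] inv by auto
      qed
    qed (simp_all add: inv)
    then have "(\<Sum>x\<in>?O. ind (inv \<sigma> (\<sigma> x))) = (\<Sum>x\<in>?O. ind (inv \<sigma> x))" by (rule sum.reindex_bij_betw)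
    then show "(\<Sum>x\<in>?O. h x) = 0" by (simp add: h_def sum_subtractf inv)
    let ?Q = "{x\<in>?A. ?v x = ?v a}"
    \<comment> \<open>\<open>?P\<close> collects the top points in the block of \<open>a\<close>.
      Both permutations map it bijectively onto the bottom points \<open>?Q\<close> of that block,
      so the sum along \<open>\<sigma>\<close> can be exchanged for the sum along
      \<open>\<tau>\<close>, under which \<open>T\<close> is stable.\<close>
    let ?P = "{x\<in>?A. block_of p (Inl x) = ?v a}"
    have b: "bij_betw \<rho> ?P ?Q" if \<rho>: "\<rho> permutes ?A" and f: "finer (perm_part k \<rho>) p" for \<rho>
    proof (rule bij_betw_byWitness[where f' = "inv \<rho>"])
      show "\<rho> ` ?P \<subseteq> ?Q"
      proof (rule image_subsetI)
        fix z assume "z \<in> ?P"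
        then show "\<rho> z \<in> ?Q" using permutes_in_image[OF \<rho>, of z] finer_perm_part_block[OF p \<rho> f, of z] by auto
      qed
      show "inv \<rho> ` ?Q \<subseteq> ?P"
      proof (rule image_subsetI)
        fix z assume z: "z \<in> ?Q"
        then have "inv \<rho> z \<in> ?A" using permutes_in_image[OF permutes_inv[OF \<rho>], of z] by simp
        then show "inv \<rho> z \<in> ?P"
          using z finer_perm_part_block[OF p \<rho> f, of "inv \<rho> z"] permutes_inverses(1)[OF \<rho>, of z] by simp
      qed
    qed (simp_all add: permutes_inverses[OF \<rho>])
    have "(\<Sum>x\<in>?Q. ind (inv \<sigma> x)) = (\<Sum>x\<in>?P. ind (inv \<sigma> (\<sigma> x)))"
      by (rule sum.reindex_bij_betw[OF b[OF \<sigma> fin], symmetric])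
    also have "\<dots> = (\<Sum>x\<in>?P. ind (\<tau> x))" by (rule sum.cong[OF refl]) (use T in \<open>auto simp: inv ind_def\<close>)
    also have "\<dots> = (\<Sum>x\<in>?Q. ind x)" by (rule sum.reindex_bij_betw[OF b[OF \<tau> s\<tau>]])
    finally show "(\<Sum>x\<in>?Q. h x) = 0" by (simp add: h_def sum_subtractf)
  qed
  from this[of "\<sigma> x"] show ?thesis using in\<sigma>[of x] x by (auto simp: h_def ind_def inv split: if_splits)
qed

text \<open>The points \<open>\<sigma> x\<close> and \<open>\<tau> x\<close> lie in one block of
  \<open>p\<close> and, since \<open>\<tau>\<close> preserves the cycles of \<open>\<sigma>\<close>,
  in one cycle of \<open>\<sigma>\<close>. If they were distinct, these two parallel edges would
  carry the nonzero flow with values \<open>1\<close> and \<open>-1\<close>.\<close>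

lemma sqsupset_perm_part_unique:
  assumes p: "partition_on (points k) p" and \<sigma>: "\<sigma> permutes {1..k}" and \<tau>: "\<tau> permutes {1..k}"
    and s\<sigma>: "sqsupset_part k (perm_part k \<sigma>) p" and s\<tau>: "sqsupset_part k (perm_part k \<tau>) p"
  shows "\<sigma> = \<tau>"
proof (rule ext)
  fix x
  let ?A = "{1..k}"
  have f\<sigma>: "finer (perm_part k \<sigma>) p" and eq: "nc p + cyc ?A \<sigma> = k + nc (join k p (id_part k))"
    using s\<sigma> unfolding sqsupset_perm_part_iff[OF p \<sigma>] by auto
  have f\<tau>: "finer (perm_part k \<tau>) p" using s\<tau> unfolding sqsupset_perm_part_iff[OF p \<tau>] by auto
  show "\<sigma> x = \<tau> x"
  proof (cases "x \<in> ?A")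
    case x: True
    have mem: "\<sigma> y \<in> orbit \<sigma> x \<longleftrightarrow> y \<in> orbit \<sigma> x" for y
      using permutes_orbit_apply[OF \<sigma>, of y] permutes_orbit_eq_iff[OF \<sigma>, of x y] permutes_orbit_eq_iff[OF \<sigma>, of x "\<sigma> y"]
      by auto
    have "\<tau> x \<in> orbit \<sigma> x \<longleftrightarrow> x \<in> orbit \<sigma> x"
      by (rule sqsupset_preserves[OF p \<tau> \<sigma> s\<tau> f\<sigma> mem x])
    then have orb: "orbit \<sigma> (\<tau> x) = orbit \<sigma> (\<sigma> x)"
      using permutes_self_in_orbit[OF \<sigma>, of x] permutes_orbit_eq[OF \<sigma>, of "\<tau> x" x] permutes_orbit_apply[OF \<sigma>, of x] by simp
    have blk: "block_of p (Inr (\<tau> x)) = block_of p (Inr (\<sigma> x))"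
      using finer_perm_part_block[OF p \<sigma> f\<sigma> x] finer_perm_part_block[OF p \<tau> f\<tau> x] by simp
    have \<sigma>x: "\<sigma> x \<in> ?A" and \<tau>x: "\<tau> x \<in> ?A"
      using x permutes_in_image[OF \<sigma>, of x] permutes_in_image[OF \<tau>, of x] by blast+
    show ?thesis
    proof (rule ccontr)
      assume ne: "\<sigma> x \<noteq> \<tau> x"
      define h where "h y = (if y = \<sigma> x then 1 else 0) - (if y = \<tau> x then 1 else 0 :: int)" for y
      have zero: "(\<Sum>y\<in>{y\<in>?A. w y = w a}. h y) = 0" if "w (\<tau> x) = w (\<sigma> x)" for w :: "nat \<Rightarrow> 'c" and a
        using \<sigma>x \<tau>x that by (simp add: h_def sum_subtractf)
      have "h (\<sigma> x) = 0"
        by (rule nc_join_inequality(2)[OF p \<sigma> f\<sigma> eq zero[of "orbit \<sigma>", OF orb] zero[of "\<lambda>j. block_of p (Inr j)", OF blk] \<sigma>x])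
      then show False using ne by (simp add: h_def)
    qed
  next
    case False
    then show ?thesis using permutes_not_in[OF \<sigma>] permutes_not_in[OF \<tau>] by metis
  qed
qed

section \<open>Asymptotics\<close>

text \<open>The coefficient \<open>F \<sigma>\<close> of the overview, with distinct row indices;
  the shift by one comes from matrix indices starting at 0.\<close>

definition base_moment :: "'w measure \<Rightarrow> nat \<Rightarrow> (nat \<Rightarrow> 'w \<Rightarrow> complex mat) \<Rightarrow> (nat \<Rightarrow> nat) \<Rightarrow> complex" where
  "base_moment W k A \<sigma> = entry_moment W k A (\<lambda>j. j - 1) (\<lambda>j. \<sigma> j - 1)"

lemma entry_moment_expansion:
  fixes r c :: "nat \<Rightarrow> nat"
  assumes W: "prob_space W" and M: "\<And>\<iota>. \<iota> \<in> \<I> \<Longrightarrow> random_matrix W N (M \<iota>)"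
    and inv: "unitarily_invariant W N \<I> M" and i: "i \<in> {1..k} \<rightarrow> \<I>" and kN: "k \<le> N"
    and r: "\<And>j. j \<in> {1..k} \<Longrightarrow> r j < N" and c: "\<And>j. j \<in> {1..k} \<Longrightarrow> c j < N"
  shows "entry_moment W k (\<lambda>j. M (i j)) r c =
    (\<Sum>\<sigma> | \<sigma> permutes {1..k} \<and> (\<forall>j\<in>{1..k}. c j = r (\<sigma> j)). base_moment W k (\<lambda>j. M (i j)) \<sigma>)"
  unfolding base_moment_def
proof (rule exchange_expansion[OF _ _ _ _ kN r c])
  show "entry_moment W k (\<lambda>j. M (i j)) r c = entry_moment W k (\<lambda>j. M (i j)) r' c'"
    if "\<And>j. j \<in> {1..k} \<Longrightarrow> r j = r' j" "\<And>j. j \<in> {1..k} \<Longrightarrow> c j = c' j" for r r' c c'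
    by (rule entry_moment_cong[OF that])
  show "(\<Sum>j | j \<in> {1..k} \<and> r j = a. entry_moment W k (\<lambda>j. M (i j)) (r(j := b)) c) =
      (\<Sum>j | j \<in> {1..k} \<and> c j = b. entry_moment W k (\<lambda>j. M (i j)) r (c(j := a)))"
    if "\<And>j. j \<in> {1..k} \<Longrightarrow> r j < N" "\<And>j. j \<in> {1..k} \<Longrightarrow> c j < N" "a < N" "b < N" "a \<noteq> b" for r c a b
    by (rule entry_moment_exchange[OF W M inv i that])
  show "card {j \<in> {1..k}. r j = a} = card {j \<in> {1..k}. c j = a}"
    if "\<And>j. j \<in> {1..k} \<Longrightarrow> r j < N" "\<And>j. j \<in> {1..k} \<Longrightarrow> c j < N"
      "entry_moment W k (\<lambda>j. M (i j)) r c \<noteq> 0" for r c a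
    by (rule entry_moment_balanced[OF W M inv i that])
  show "entry_moment W k (\<lambda>j. M (i j)) (\<lambda>j. Transposition.transpose a b (r j)) (\<lambda>j. Transposition.transpose a b (c j)) =
      entry_moment W k (\<lambda>j. M (i j)) r c"
    if "\<And>j. j \<in> {1..k} \<Longrightarrow> r j < N" "\<And>j. j \<in> {1..k} \<Longrightarrow> c j < N" "a < N" "b < N" for r c a b
    by (rule entry_moment_transpose[OF W M inv i that])
qed

section \<open>Expansion of the moments over permutations\<close>

lemma Em_perm_part:
  assumes W: "prob_space W" and A: "\<And>j. j \<in> {1..k} \<Longrightarrow> random_matrix W N (A j)" and \<sigma>: "\<sigma> permutes {1..k}"
  shows "Em W N k (perm_part k \<sigma>) A =
    1 / of_nat N ^ cyc {1..k} \<sigma> * (\<Sum>r\<in>{1..k} \<rightarrow>\<^sub>E {..<N}. entry_moment W k A r (r \<circ> \<sigma>))"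
proof -
  have "Em W N k (perm_part k \<sigma>) A = 1 / of_nat N ^ nc (join k (perm_part k \<sigma>) (id_part k)) *
    (\<Sum>I | I \<in> multi_indices N k \<and> finer (perm_part k \<sigma>) (Ker k I).
      entry_moment W k A (\<lambda>j. I (Inr j)) (\<lambda>j. I (Inl j)))"
    by (rule Em_eq_sum[OF W A])
  then show ?thesis unfolding nc_join_perm_part[OF \<sigma>] sum_perm_part_indices[OF \<sigma>] .
qed

text \<open>The index \<open>r\<close> contributes to \<open>\<tau>\<close> iff
  \<open>r \<circ> \<sigma>\<close> and \<open>r \<circ> \<tau>\<close> agree, that is, iff
  \<open>r\<close> is constant on the cycles of \<open>\<sigma> \<circ> inv \<tau>\<close>; counting
  these \<open>r\<close> gives the power of \<open>N\<close>.\<close>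

lemma Em_perm_part_expansion:
  assumes W: "prob_space W" and M: "\<And>\<iota>. \<iota> \<in> \<I> \<Longrightarrow> random_matrix W N (M \<iota>)"
    and inv: "unitarily_invariant W N \<I> M" and i: "i \<in> {1..k} \<rightarrow> \<I>" and kN: "k \<le> N"
    and \<sigma>: "\<sigma> permutes {1..k}"
  shows "Em W N k (perm_part k \<sigma>) (\<lambda>j. M (i j)) = 1 / of_nat N ^ cyc {1..k} \<sigma> *
    (\<Sum>\<tau> | \<tau> permutes {1..k}. base_moment W k (\<lambda>j. M (i j)) \<tau> * of_nat N ^ cyc {1..k} (\<sigma> \<circ> inv \<tau>))"
proof -
  let ?R = "{1..k} \<rightarrow>\<^sub>E {..<N}" and ?P = "{\<tau>. \<tau> permutes {1..k}}"
  let ?T = "entry_moment W k (\<lambda>j. M (i j))" and ?F = "base_moment W k (\<lambda>j. M (i j))"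
  have A: "random_matrix W N (M (i j))" if "j \<in> {1..k}" for j using M i that by blast
  have fin: "finite ?R" "finite ?P" by (auto intro: finite_PiE finite_permutations)
  have \<sigma>k: "\<sigma> j \<in> {1..k} \<longleftrightarrow> j \<in> {1..k}" for j by (rule permutes_in_image[OF \<sigma>])
  have "(\<Sum>r\<in>?R. ?T r (r \<circ> \<sigma>)) = (\<Sum>r\<in>?R. \<Sum>\<tau>\<in>?P. if \<forall>j\<in>{1..k}. r (\<sigma> j) = r (\<tau> j) then ?F \<tau> else 0)"
  proof (rule sum.cong[OF refl])
    fix r assume r: "r \<in> ?R"
    have lt: "r j < N" if "j \<in> {1..k}" for j using PiE_mem[OF r that] by simp
    have "?T r (r \<circ> \<sigma>) = (\<Sum>\<tau> | \<tau> permutes {1..k} \<and> (\<forall>j\<in>{1..k}. (r \<circ> \<sigma>) j = r (\<tau> j)). ?F \<tau>)"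
      by (rule entry_moment_expansion[OF W M inv i kN]) (use lt \<sigma>k in auto)
    also have "\<dots> = (\<Sum>\<tau>\<in>{\<tau> \<in> ?P. \<forall>j\<in>{1..k}. r (\<sigma> j) = r (\<tau> j)}. ?F \<tau>)" by (rule sum.cong) auto
    also have "\<dots> = (\<Sum>\<tau>\<in>?P. if \<forall>j\<in>{1..k}. r (\<sigma> j) = r (\<tau> j) then ?F \<tau> else 0)"
      by (rule sum.inter_filter[OF fin(2)])
    finally show "?T r (r \<circ> \<sigma>) = (\<Sum>\<tau>\<in>?P. if \<forall>j\<in>{1..k}. r (\<sigma> j) = r (\<tau> j) then ?F \<tau> else 0)" .
  qed
  also have "\<dots> = (\<Sum>\<tau>\<in>?P. \<Sum>r\<in>?R. if \<forall>j\<in>{1..k}. r (\<sigma> j) = r (\<tau> j) then ?F \<tau> else 0)" by (rule sum.swap)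
  also have "\<dots> = (\<Sum>\<tau>\<in>?P. ?F \<tau> * of_nat N ^ cyc {1..k} (\<sigma> \<circ> inv \<tau>))"
  proof (rule sum.cong[OF refl])
    fix \<tau> assume "\<tau> \<in> ?P"
    then have \<tau>: "\<tau> permutes {1..k}" by simp
    have iff: "(\<forall>j\<in>{1..k}. r (\<sigma> j) = r (\<tau> j)) \<longleftrightarrow> (\<forall>x\<in>{1..k}. r ((\<sigma> \<circ> inv \<tau>) x) = r x)" for r :: "nat \<Rightarrow> nat"
    proof
      assume l: "\<forall>j\<in>{1..k}. r (\<sigma> j) = r (\<tau> j)"
      show "\<forall>x\<in>{1..k}. r ((\<sigma> \<circ> inv \<tau>) x) = r x"
      proof
        fix x assume "x \<in> {1..k}"
        then have "inv \<tau> x \<in> {1..k}" using permutes_in_image[OF permutes_inv[OF \<tau>], of x] by blast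
        then have "r (\<sigma> (inv \<tau> x)) = r (\<tau> (inv \<tau> x))" using l by blast
        then show "r ((\<sigma> \<circ> inv \<tau>) x) = r x" by (simp add: permutes_inverses(1)[OF \<tau>])
      qed
    next
      assume rr: "\<forall>x\<in>{1..k}. r ((\<sigma> \<circ> inv \<tau>) x) = r x"
      show "\<forall>j\<in>{1..k}. r (\<sigma> j) = r (\<tau> j)"
      proof
        fix j assume "j \<in> {1..k}"
        then have "\<tau> j \<in> {1..k}" using permutes_in_image[OF \<tau>, of j] by blast
        then have "r ((\<sigma> \<circ> inv \<tau>) (\<tau> j)) = r (\<tau> j)" using rr by blast
        then show "r (\<sigma> j) = r (\<tau> j)" by (simp add: permutes_inverses(2)[OF \<tau>])
      qed
    qed
    have "(\<Sum>r\<in>?R. if \<forall>j\<in>{1..k}. r (\<sigma> j) = r (\<tau> j) then ?F \<tau> else 0) =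
        (\<Sum>r\<in>{r \<in> ?R. \<forall>x\<in>{1..k}. r ((\<sigma> \<circ> inv \<tau>) x) = r x}. ?F \<tau>)"
      unfolding iff by (rule sum.inter_filter[OF fin(1), symmetric])
    also have "\<dots> = of_nat (card {r \<in> ?R. \<forall>x\<in>{1..k}. r ((\<sigma> \<circ> inv \<tau>) x) = r x}) * ?F \<tau>" by (rule sum_constant)
    also have "card {r \<in> ?R. \<forall>x\<in>{1..k}. r ((\<sigma> \<circ> inv \<tau>) x) = r x} = N ^ cyc {1..k} (\<sigma> \<circ> inv \<tau>)"
      by (rule card_invariant_functions[OF permutes_compose[OF permutes_inv[OF \<tau>] \<sigma>]]) simp
    finally show "(\<Sum>r\<in>?R. if \<forall>j\<in>{1..k}. r (\<sigma> j) = r (\<tau> j) then ?F \<tau> else 0) =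
        ?F \<tau> * of_nat N ^ cyc {1..k} (\<sigma> \<circ> inv \<tau>)" by simp
  qed
  finally have sum: "(\<Sum>r\<in>?R. ?T r (r \<circ> \<sigma>)) = (\<Sum>\<tau>\<in>?P. ?F \<tau> * of_nat N ^ cyc {1..k} (\<sigma> \<circ> inv \<tau>))" .
  have "Em W N k (perm_part k \<sigma>) (\<lambda>j. M (i j)) = 1 / of_nat N ^ cyc {1..k} \<sigma> * (\<Sum>r\<in>?R. ?T r (r \<circ> \<sigma>))"
    by (rule Em_perm_part[OF W A \<sigma>])
  then show ?thesis unfolding sum .
qed

lemma Ker_eq_iff:
  assumes p: "partition_on (points k) p"
  shows "Ker k I = p \<longleftrightarrow> (\<forall>x\<in>points k. \<forall>y\<in>points k. I x = I y \<longleftrightarrow> block_of p x = block_of p y)"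
proof
  assume K: "Ker k I = p"
  have blk: "block_of p x = {b \<in> points k. I b = I x}" if "x \<in> points k" for x
    by (rule block_of_eq[OF p]) (use that K in \<open>auto simp: Ker_def\<close>)
  show "\<forall>x\<in>points k. \<forall>y\<in>points k. I x = I y \<longleftrightarrow> block_of p x = block_of p y"
    using blk by auto
next
  assume I: "\<forall>x\<in>points k. \<forall>y\<in>points k. I x = I y \<longleftrightarrow> block_of p x = block_of p y"
  have blk: "{b \<in> points k. I b = I a} = block_of p a" if a: "a \<in> points k" for a
  proof -
    have sub: "block_of p a \<subseteq> points k" using block_of_in[OF p a] p by (auto simp: partition_on_def)
    show ?thesis
    proof
      show "{b \<in> points k. I b = I a} \<subseteq> block_of p a"
      proof
        fix b assume "b \<in> {b \<in> points k. I b = I a}"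
        then have "b \<in> points k" "block_of p b = block_of p a" using I a by auto
        then show "b \<in> block_of p a" using block_of_in(2)[OF p, of b] by simp
      qed
      show "block_of p a \<subseteq> {b \<in> points k. I b = I a}"
      proof
        fix b assume b: "b \<in> block_of p a"
        then have "block_of p b = block_of p a" by (rule block_of_eq[OF p block_of_in(1)[OF p a]])
        then show "b \<in> {b \<in> points k. I b = I a}" using I a b sub by auto
      qed
    qed
  qed
  have "Ker k I = block_of p ` points k" unfolding Ker_def by (rule image_cong[OF refl blk])
  also have "\<dots> = p"
  proof
    show "block_of p ` points k \<subseteq> p" using block_of_in(1)[OF p] by blast
    show "p \<subseteq> block_of p ` points k"
    proof
      fix B assume B: "B \<in> p"
      then have "B \<noteq> {}" "B \<subseteq> points k" using p by (auto simp: partition_on_def)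
      then obtain x where "x \<in> B" "x \<in> points k" by blast
      then show "B \<in> block_of p ` points k" using block_of_eq[OF p B] by blast
    qed
  qed
  finally show "Ker k I = p" .
qed

text \<open>Such an index is an injective choice of colours for the blocks. For \<open>N\<close>
  smaller than the number of blocks truncated subtraction makes one factor vanish, as it
  should.\<close>

lemma card_indices_Ker:
  assumes p: "partition_on (points k) p"
  shows "card {I. I \<in> multi_indices N k \<and> Ker k I = p} = (\<Prod>j<nc p. N - j)"
proof -
  let ?S = "{I. I \<in> multi_indices N k \<and> Ker k I = p}" and ?G = "{f \<in> p \<rightarrow>\<^sub>E {..<N}. inj_on f p}"
  have finp: "finite p" by (rule finite_elements[OF finite_points p])
  have rep: "(SOME x. x \<in> B) \<in> B" if "B \<in> p" for B
  proof -
    have "B \<noteq> {}" using that p by (auto simp: partition_on_def)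
    then show ?thesis by (rule some_in_eq[THEN iffD2])
  qed
  have sub: "B \<subseteq> points k" if "B \<in> p" for B using p that by (auto simp: partition_on_def)
  have "bij_betw (\<lambda>f. \<lambda>x\<in>points k. f (block_of p x)) ?G ?S"
  proof (rule bij_betw_byWitness[where f' = "\<lambda>I. \<lambda>B\<in>p. I (SOME x. x \<in> B)"])
    show "\<forall>f\<in>?G. (\<lambda>B\<in>p. (\<lambda>x\<in>points k. f (block_of p x)) (SOME x. x \<in> B)) = f"
    proof (intro ballI ext)
      fix f B assume "f \<in> ?G"
      then have f: "f \<in> p \<rightarrow>\<^sub>E {..<N}" by simp
      show "(\<lambda>B\<in>p. (\<lambda>x\<in>points k. f (block_of p x)) (SOME x. x \<in> B)) B = f B"
      proof (cases "B \<in> p")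
        case True
        then show ?thesis using rep[OF True] sub[OF True] block_of_eq[OF p True rep[OF True]] by auto
      qed (use PiE_arb[OF f] in simp)
    qed
    show "\<forall>I\<in>?S. (\<lambda>x\<in>points k. (\<lambda>B\<in>p. I (SOME x. x \<in> B)) (block_of p x)) = I"
    proof (intro ballI ext)
      fix I x assume I: "I \<in> ?S"
      then have IP: "I \<in> points k \<rightarrow>\<^sub>E {..<N}" by (simp add: multi_indices_def)
      show "(\<lambda>x\<in>points k. (\<lambda>B\<in>p. I (SOME x. x \<in> B)) (block_of p x)) x = I x"
      proof (cases "x \<in> points k")
        case True
        let ?B = "block_of p x"
        have B: "?B \<in> p" by (rule block_of_in(1)[OF p True])
        have "block_of p (SOME x. x \<in> ?B) = ?B" by (rule block_of_eq[OF p B rep[OF B]])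
        moreover have "(SOME x. x \<in> ?B) \<in> points k" using rep[OF B] sub[OF B] by blast
        ultimately have "I (SOME x. x \<in> ?B) = I x" using I Ker_eq_iff[OF p] True by blast
        then show ?thesis using True B by simp
      qed (use PiE_arb[OF IP] in simp)
    qed
    show "(\<lambda>f. \<lambda>x\<in>points k. f (block_of p x)) ` ?G \<subseteq> ?S"
    proof (rule image_subsetI, rule CollectI, rule conjI)
      fix f assume f: "f \<in> ?G"
      then have fP: "f \<in> p \<rightarrow>\<^sub>E {..<N}" by simp
      show "(\<lambda>x\<in>points k. f (block_of p x)) \<in> multi_indices N k"
        unfolding multi_indices_def using PiE_mem[OF fP] block_of_in(1)[OF p] by simp
      show "Ker k (\<lambda>x\<in>points k. f (block_of p x)) = p"
        unfolding Ker_eq_iff[OF p]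
      proof (intro ballI)
        fix x y assume xy: "x \<in> points k" "y \<in> points k"
        have "inj_on f p" using f by simp
        then show "(\<lambda>x\<in>points k. f (block_of p x)) x = (\<lambda>x\<in>points k. f (block_of p x)) y \<longleftrightarrow>
            block_of p x = block_of p y"
          using xy block_of_in(1)[OF p xy(1)] block_of_in(1)[OF p xy(2)] by (auto dest: inj_onD)
      qed
    qed
    show "(\<lambda>I. \<lambda>B\<in>p. I (SOME x. x \<in> B)) ` ?S \<subseteq> ?G"
    proof (rule image_subsetI, rule CollectI, rule conjI)
      fix I assume I: "I \<in> ?S"
      then have IP: "I \<in> points k \<rightarrow>\<^sub>E {..<N}" by (simp add: multi_indices_def)
      show "(\<lambda>B\<in>p. I (SOME x. x \<in> B)) \<in> p \<rightarrow>\<^sub>E {..<N}"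
      proof (rule PiE_I)
        fix B assume B: "B \<in> p"
        have "(SOME x. x \<in> B) \<in> points k" using rep[OF B] sub[OF B] by blast
        then show "(\<lambda>B\<in>p. I (SOME x. x \<in> B)) B \<in> {..<N}" using PiE_mem[OF IP] B by simp
      qed simp
      show "inj_on (\<lambda>B\<in>p. I (SOME x. x \<in> B)) p"
      proof (rule inj_onI)
        fix B C assume B: "B \<in> p" and C: "C \<in> p"
          and "(\<lambda>B\<in>p. I (SOME x. x \<in> B)) B = (\<lambda>B\<in>p. I (SOME x. x \<in> B)) C"
        then have "I (SOME x. x \<in> B) = I (SOME x. x \<in> C)" by simp
        moreover have "(SOME x. x \<in> B) \<in> points k" "(SOME x. x \<in> C) \<in> points k"
          using rep[OF B] sub[OF B] rep[OF C] sub[OF C] by blast+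
        ultimately have "block_of p (SOME x. x \<in> B) = block_of p (SOME x. x \<in> C)"
          using I Ker_eq_iff[OF p] by blast
        then show "B = C" using block_of_eq[OF p B rep[OF B]] block_of_eq[OF p C rep[OF C]] by simp
      qed
    qed
  qed
  from bij_betw_same_card[OF this] have "card ?S = card ?G" by simp
  also have "\<dots> = (\<Prod>j<nc p. N - j)"
    using card_inj_on_subset_funcset[OF finp, of "{..<N}" p] by (simp add: lessThan_atLeast0)
  finally show ?thesis .
qed

text \<open>For an index with kernel exactly \<open>p\<close>, the permutations in the expansion of
  its entry moment are those finer than \<open>p\<close>. They do not depend on the index, so the
  sum over indices is a mere count.\<close>

lemma Em_c_expansion:
  assumes W: "prob_space W" and M: "\<And>\<iota>. \<iota> \<in> \<I> \<Longrightarrow> random_matrix W N (M \<iota>)"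
    and inv: "unitarily_invariant W N \<I> M" and i: "i \<in> {1..k} \<rightarrow> \<I>" and kN: "k \<le> N"
    and p: "partition_on (points k) p"
  shows "Em_c W N k p (\<lambda>j. M (i j)) = 1 / of_nat N ^ nc (join k p (id_part k)) *
    (of_nat (\<Prod>j<nc p. N - j) *
      (\<Sum>\<sigma> | \<sigma> permutes {1..k} \<and> finer (perm_part k \<sigma>) p. base_moment W k (\<lambda>j. M (i j)) \<sigma>))"
proof -
  let ?S = "{I. I \<in> multi_indices N k \<and> Ker k I = p}"
  let ?F = "base_moment W k (\<lambda>j. M (i j))"
  have A: "random_matrix W N (M (i j))" if "j \<in> {1..k}" for j using M i that by blast
  have "(\<Sum>I\<in>?S. entry_moment W k (\<lambda>j. M (i j)) (\<lambda>j. I (Inr j)) (\<lambda>j. I (Inl j))) =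
      (\<Sum>I\<in>?S. \<Sum>\<sigma> | \<sigma> permutes {1..k} \<and> finer (perm_part k \<sigma>) p. ?F \<sigma>)"
  proof (rule sum.cong[OF refl])
    fix I assume I: "I \<in> ?S"
    have "entry_moment W k (\<lambda>j. M (i j)) (\<lambda>j. I (Inr j)) (\<lambda>j. I (Inl j)) =
        (\<Sum>\<sigma> | \<sigma> permutes {1..k} \<and> (\<forall>j\<in>{1..k}. I (Inl j) = I (Inr (\<sigma> j))). ?F \<sigma>)"
      by (rule entry_moment_expansion[OF W M inv i kN]) (use I multi_indices_less in auto)
    also have "{\<sigma>. \<sigma> permutes {1..k} \<and> (\<forall>j\<in>{1..k}. I (Inl j) = I (Inr (\<sigma> j)))} =
        {\<sigma>. \<sigma> permutes {1..k} \<and> finer (perm_part k \<sigma>) p}"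
      using finer_perm_part_Ker_iff[of _ k I] I by auto
    finally show "entry_moment W k (\<lambda>j. M (i j)) (\<lambda>j. I (Inr j)) (\<lambda>j. I (Inl j)) =
        (\<Sum>\<sigma> | \<sigma> permutes {1..k} \<and> finer (perm_part k \<sigma>) p. ?F \<sigma>)" .
  qed
  also have "\<dots> = of_nat (card ?S) * (\<Sum>\<sigma> | \<sigma> permutes {1..k} \<and> finer (perm_part k \<sigma>) p. ?F \<sigma>)"
    by (rule sum_constant)
  finally have sum: "(\<Sum>I\<in>?S. entry_moment W k (\<lambda>j. M (i j)) (\<lambda>j. I (Inr j)) (\<lambda>j. I (Inl j))) =
      of_nat (card ?S) * (\<Sum>\<sigma> | \<sigma> permutes {1..k} \<and> finer (perm_part k \<sigma>) p. ?F \<sigma>)" .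
  have "Em_c W N k p (\<lambda>j. M (i j)) = 1 / of_nat N ^ nc (join k p (id_part k)) *
      (\<Sum>I\<in>?S. entry_moment W k (\<lambda>j. M (i j)) (\<lambda>j. I (Inr j)) (\<lambda>j. I (Inl j)))"
    by (rule Em_c_eq_sum[OF W A])
  then show ?thesis unfolding sum card_indices_Ker[OF p] .
qed

section \<open>Limits of powers of \<open>N\<close> and of unitriangular systems\<close>

lemma tendsto_power_quotient:
  assumes "a \<le> b"
  shows "(\<lambda>N. of_nat N ^ a / of_nat N ^ b :: complex) \<longlonglongrightarrow> (if a = b then 1 else 0)"
proof (cases "a = b")
  case True
  have "\<forall>\<^sub>F N in sequentially. of_nat N ^ a / of_nat N ^ b = (1 :: complex)"
    using eventually_gt_at_top[of 0] by eventually_elim (simp add: True)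
  then show ?thesis unfolding True by (simp add: tendsto_eventually)
next
  case False
  then have ab: "a < b" using assms by simp
  have "(\<lambda>N. (1 / of_nat N) ^ (b - a) :: complex) \<longlonglongrightarrow> 0 ^ (b - a)"
    by (intro tendsto_power lim_1_over_n)
  moreover have "\<forall>\<^sub>F N in sequentially. (1 / of_nat N) ^ (b - a) = (of_nat N ^ a / of_nat N ^ b :: complex)"
    using eventually_gt_at_top[of 0]
  proof eventually_elim
    case (elim N)
    have "of_nat N ^ b = (of_nat N ^ a * of_nat N ^ (b - a) :: complex)" using ab by (simp flip: power_add)
    then show ?case using elim by (simp add: power_one_over)
  qed
  ultimately have "(\<lambda>N. of_nat N ^ a / of_nat N ^ b :: complex) \<longlonglongrightarrow> 0 ^ (b - a)"
    by (rule Lim_transform_eventually)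
  then show ?thesis using ab by (simp add: zero_power)
qed

lemma tendsto_falling_factorial_quotient:
  "(\<lambda>N. of_nat (\<Prod>j<n. N - j) / of_nat N ^ n :: complex) \<longlonglongrightarrow> 1"
proof -
  have "(\<lambda>N. \<Prod>j<n. 1 - of_nat j * (1 / of_nat N) :: complex) \<longlonglongrightarrow> (\<Prod>j<n. 1 - of_nat j * 0)"
    by (intro tendsto_prod tendsto_diff tendsto_const tendsto_mult lim_1_over_n)
  moreover have "\<forall>\<^sub>F N in sequentially. (\<Prod>j<n. 1 - of_nat j * (1 / of_nat N)) = (of_nat (\<Prod>j<n. N - j) / of_nat N ^ n :: complex)"
    using eventually_gt_at_top[of n]
  proof eventually_elim
    case (elim N)
    have "(of_nat (\<Prod>j<n. N - j) / of_nat N ^ n :: complex) = (\<Prod>j<n. of_nat (N - j) / of_nat N)"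
      by (simp add: prod_dividef)
    also have "\<dots> = (\<Prod>j<n. 1 - of_nat j * (1 / of_nat N))"
      by (rule prod.cong[OF refl]) (use elim in \<open>simp add: of_nat_diff field_simps\<close>)
    finally show ?case by simp
  qed
  ultimately have "(\<lambda>N. of_nat (\<Prod>j<n. N - j) / of_nat N ^ n :: complex) \<longlonglongrightarrow> (\<Prod>j<n. 1 - of_nat j * 0)"
    by (rule Lim_transform_eventually)
  then show ?thesis by simp
qed

text \<open>Boundedness of the unknowns is not known in advance, so the estimate is made relative to their
  total size.\<close>

lemma unitriangular_tendsto_zero:
  fixes g :: "nat \<Rightarrow> 'a \<Rightarrow> 'a \<Rightarrow> complex" and d :: "nat \<Rightarrow> 'a \<Rightarrow> complex" and h :: "'a \<Rightarrow> nat"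
  assumes P: "finite P"
    and g: "\<And>s t. s \<in> P \<Longrightarrow> t \<in> P \<Longrightarrow> (\<lambda>N. g N s t) \<longlonglongrightarrow> (if R s t then 1 else 0)"
    and R: "\<And>s. s \<in> P \<Longrightarrow> R s s" "\<And>s t. s \<in> P \<Longrightarrow> t \<in> P \<Longrightarrow> R s t \<Longrightarrow> s \<noteq> t \<Longrightarrow> h t < h s"
    and lim: "\<And>s. s \<in> P \<Longrightarrow> (\<lambda>N. \<Sum>t\<in>P. g N s t * d N t) \<longlonglongrightarrow> 0"
    and s: "s \<in> P"
  shows "(\<lambda>N. d N s) \<longlonglongrightarrow> 0"
proof -
  define m where "m N = (\<Sum>t\<in>P. cmod (d N t))" for N
  have m0: "0 \<le> m N" for N unfolding m_def by (intro sum_nonneg) simp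
  have mge: "cmod (d N t) \<le> m N" if "t \<in> P" for N t
    unfolding m_def by (rule member_le_sum[OF that]) (use P in auto)
  define \<epsilon> where "\<epsilon> s N = (\<Sum>t\<in>P. cmod (g N s t - (if R s t then 1 else 0)))" for s N
  have \<epsilon>: "\<epsilon> s \<longlonglongrightarrow> 0" if "s \<in> P" for s
  proof -
    have "(\<lambda>N. \<Sum>t\<in>P. cmod (g N s t - (if R s t then 1 else 0))) \<longlonglongrightarrow> (\<Sum>t\<in>P. 0)"
      using g[OF that] by (intro tendsto_sum tendsto_norm_zero) (simp add: LIM_zero)
    then show ?thesis by (simp add: \<epsilon>_def[abs_def])
  qed
  \<comment> \<open>Induction on the height \<open>h\<close>: the equation for \<open>s\<close>
    expresses \<open>d N s\<close> by unknowns of smaller height, up to a null sequence and an error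
    of size \<open>\<epsilon> s N * m N\<close>. The factor \<open>m N\<close> is carried along, as
    it may still be unbounded.\<close>
  have bound: "\<exists>a b. a \<longlonglongrightarrow> (0 :: real) \<and> b \<longlonglongrightarrow> (0 :: real) \<and> (\<forall>N. cmod (d N s) \<le> a N + b N * m N)" if "s \<in> P" for s
    using that
  proof (induction "h s" arbitrary: s rule: less_induct)
    case less
    let ?L = "{t \<in> P. R s t \<and> t \<noteq> s}"
    have "\<forall>t\<in>?L. \<exists>ab. fst ab \<longlonglongrightarrow> (0 :: real) \<and> snd ab \<longlonglongrightarrow> (0 :: real) \<and> (\<forall>N. cmod (d N t) \<le> fst ab N + snd ab N * m N)"
    proof
      fix t assume t: "t \<in> ?L"
      then have "h t < h s" using R(2)[OF less.prems, of t] by auto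
      from less.hyps[OF this] t obtain a b where "a \<longlonglongrightarrow> (0 :: real)" "b \<longlonglongrightarrow> (0 :: real)" "\<forall>N. cmod (d N t) \<le> a N + b N * m N"
        by blast
      then show "\<exists>ab. fst ab \<longlonglongrightarrow> (0 :: real) \<and> snd ab \<longlonglongrightarrow> (0 :: real) \<and> (\<forall>N. cmod (d N t) \<le> fst ab N + snd ab N * m N)"
        by (intro exI[of _ "(a, b)"]) simp
    qed
    from bchoice[OF this] obtain ab where ab: "\<forall>t\<in>?L. fst (ab t) \<longlonglongrightarrow> (0 :: real) \<and> snd (ab t) \<longlonglongrightarrow> (0 :: real) \<and>
        (\<forall>N. cmod (d N t) \<le> fst (ab t) N + snd (ab t) N * m N)" by blast
    define a where "a N = cmod (\<Sum>t\<in>P. g N s t * d N t) + (\<Sum>t\<in>?L. fst (ab t) N)" for N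
    define b where "b N = (\<Sum>t\<in>?L. snd (ab t) N) + \<epsilon> s N" for N
    have "a \<longlonglongrightarrow> 0 + (\<Sum>t\<in>?L. 0)" unfolding a_def
      using ab lim[OF less.prems] by (intro tendsto_add tendsto_sum tendsto_norm_zero) auto
    moreover have "b \<longlonglongrightarrow> (\<Sum>t\<in>?L. 0) + 0" unfolding b_def
      using ab \<epsilon>[OF less.prems] by (intro tendsto_add tendsto_sum) auto
    moreover have "cmod (d N s) \<le> a N + b N * m N" for N
    proof -
      have finL: "finite ?L" using P by simp
      have "(\<Sum>t\<in>P. (if R s t then 1 else 0) * d N t) = (\<Sum>t\<in>P. if R s t then d N t else 0)"
        by (intro sum.cong refl) simp
      also have "\<dots> = (\<Sum>t\<in>{t \<in> P. R s t}. d N t)" by (rule sum.inter_filter[OF P, symmetric])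
      also have "{t \<in> P. R s t} = insert s ?L" using less.prems R(1) by auto
      also have "(\<Sum>t\<in>insert s ?L. d N t) = d N s + (\<Sum>t\<in>?L. d N t)" using finL by simp
      finally have "d N s = (\<Sum>t\<in>P. g N s t * d N t) - (\<Sum>t\<in>?L. d N t) -
          (\<Sum>t\<in>P. (g N s t - (if R s t then 1 else 0)) * d N t)"
        by (simp add: left_diff_distrib sum_subtractf)
      then have "cmod (d N s) \<le> cmod (\<Sum>t\<in>P. g N s t * d N t) + cmod (\<Sum>t\<in>?L. d N t) +
          cmod (\<Sum>t\<in>P. (g N s t - (if R s t then 1 else 0)) * d N t)"
        by (metis (no_types, lifting) norm_triangle_ineq4 add_right_mono order_trans)
      moreover have "cmod (\<Sum>t\<in>?L. d N t) \<le> (\<Sum>t\<in>?L. fst (ab t) N) + (\<Sum>t\<in>?L. snd (ab t) N) * m N"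
      proof -
        have "cmod (\<Sum>t\<in>?L. d N t) \<le> (\<Sum>t\<in>?L. cmod (d N t))" by (rule norm_sum)
        also have "\<dots> \<le> (\<Sum>t\<in>?L. fst (ab t) N + snd (ab t) N * m N)" using ab by (intro sum_mono) blast
        finally show ?thesis by (simp add: sum.distrib sum_distrib_right)
      qed
      moreover have "cmod (\<Sum>t\<in>P. (g N s t - (if R s t then 1 else 0)) * d N t) \<le> \<epsilon> s N * m N"
      proof -
        have "cmod (\<Sum>t\<in>P. (g N s t - (if R s t then 1 else 0)) * d N t) \<le>
            (\<Sum>t\<in>P. cmod ((g N s t - (if R s t then 1 else 0)) * d N t))" by (rule norm_sum)
        also have "\<dots> \<le> (\<Sum>t\<in>P. cmod (g N s t - (if R s t then 1 else 0)) * m N)"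
          unfolding norm_mult by (intro sum_mono mult_left_mono mge) auto
        finally show ?thesis by (simp add: \<epsilon>_def sum_distrib_right)
      qed
      ultimately show ?thesis unfolding a_def b_def by (simp add: distrib_right)
    qed
    ultimately show ?case by (intro exI[of _ a] exI[of _ b]) simp
  qed
  have "\<forall>s\<in>P. \<exists>ab. fst ab \<longlonglongrightarrow> (0 :: real) \<and> snd ab \<longlonglongrightarrow> (0 :: real) \<and> (\<forall>N. cmod (d N s) \<le> fst ab N + snd ab N * m N)"
  proof
    fix s assume "s \<in> P"
    from bound[OF this] obtain a b where "a \<longlonglongrightarrow> (0 :: real)" "b \<longlonglongrightarrow> (0 :: real)" "\<forall>N. cmod (d N s) \<le> a N + b N * m N"
      by blast
    then show "\<exists>ab. fst ab \<longlonglongrightarrow> (0 :: real) \<and> snd ab \<longlonglongrightarrow> (0 :: real) \<and> (\<forall>N. cmod (d N s) \<le> fst ab N + snd ab N * m N)"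
      by (intro exI[of _ "(a, b)"]) simp
  qed
  from bchoice[OF this] obtain ab where ab: "\<forall>s\<in>P. fst (ab s) \<longlonglongrightarrow> (0 :: real) \<and> snd (ab s) \<longlonglongrightarrow> (0 :: real) \<and>
      (\<forall>N. cmod (d N s) \<le> fst (ab s) N + snd (ab s) N * m N)" by blast
  define a where "a N = (\<Sum>s\<in>P. fst (ab s) N)" for N
  define b where "b N = (\<Sum>s\<in>P. snd (ab s) N)" for N
  have "a \<longlonglongrightarrow> (\<Sum>s\<in>P. 0)" "b \<longlonglongrightarrow> (\<Sum>s\<in>P. 0)" unfolding a_def b_def using ab by (intro tendsto_sum; blast)+
  then have a: "a \<longlonglongrightarrow> 0" and b: "b \<longlonglongrightarrow> 0" by simp_all
  have mle: "m N \<le> a N + b N * m N" for N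
  proof -
    have "m N \<le> (\<Sum>s\<in>P. fst (ab s) N + snd (ab s) N * m N)" unfolding m_def[of N]
      using ab unfolding m_def by (intro sum_mono) blast
    then show ?thesis by (simp add: a_def b_def sum.distrib sum_distrib_right)
  qed
  \<comment> \<open>Summing the bounds gives \<open>m N \<le> a N + b N * m N\<close>. As soon as
    \<open>b N\<close> is below one half, the last term can be absorbed, and \<open>2 * a N\<close>
    bounds \<open>m N\<close>.\<close>
  have "\<forall>\<^sub>F N in sequentially. b N < 1 / 2" by (rule order_tendstoD(2)[OF b]) simp
  then have "\<forall>\<^sub>F N in sequentially. norm (d N s) \<le> 2 * a N"
  proof eventually_elim
    case (elim N)
    have "b N * m N \<le> 1 / 2 * m N" by (rule mult_right_mono) (use elim m0 in auto)
    then have "m N \<le> 2 * a N" using mle[of N] by simp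
    then show ?case using mge[OF s, of N] by simp
  qed
  moreover have "(\<lambda>N. 2 * a N) \<longlonglongrightarrow> 0" using tendsto_mult_right_zero[OF a, of 2] by simp
  ultimately show ?thesis by (rule Lim_null_comparison)
qed

text \<open>The distance to the identity, \<open>card A - cyc A\<close>, is the height that makes
  the system for the coefficients unitriangular. Equality would leave \<open>card A\<close> cycles
  to \<open>\<sigma> \<circ> inv \<tau>\<close>, which would then be the identity.\<close>

lemma geo_cyc_less:
  assumes fin: "finite A" and \<sigma>: "\<sigma> permutes A" and geo: "geo A \<sigma> \<tau>" and ne: "\<sigma> \<noteq> \<tau>"
  shows "card A - cyc A \<tau> < card A - cyc A \<sigma>"
proof -
  have \<tau>: "\<tau> permutes A" and eq: "cyc A \<tau> + cyc A (\<sigma> \<circ> inv \<tau>) = card A + cyc A \<sigma>"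
    using geo by (auto simp: geo_def)
  let ?\<rho> = "\<sigma> \<circ> inv \<tau>"
  have \<rho>: "?\<rho> permutes A" by (rule permutes_compose[OF permutes_inv[OF \<tau>] \<sigma>])
  have le: "cyc A f \<le> card A" for f :: "'a \<Rightarrow> 'a" unfolding cyc_def by (rule card_image_le[OF fin])
  have "cyc A ?\<rho> \<noteq> card A"
  proof
    assume "cyc A ?\<rho> = card A"
    then have "card A \<le> card {a\<in>A. ?\<rho> a = a}" using two_cyc_le[OF \<rho> fin] by simp
    then have "{a\<in>A. ?\<rho> a = a} = A" using card_seteq[OF fin, of "{a\<in>A. ?\<rho> a = a}"] by blast
    then have "?\<rho> a = a" for a using permutes_not_in[OF \<rho>, of a] by blast
    then have "?\<rho> = id" by (simp add: fun_eq_iff)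
    then show False using ne comp_inv_eq_iff[OF \<tau>, of \<sigma> id] by simp
  qed
  then show ?thesis using le[of ?\<rho>] le[of \<tau>] eq by linarith
qed

lemma geo_self:
  assumes "finite A" "\<sigma> permutes A"
  shows "geo A \<sigma> \<sigma>"
proof -
  have "orbit id ` A = (\<lambda>x. {x}) ` A" using orbit_eq_singleton_iff[of id] by (intro image_cong refl) simp
  then have "cyc A id = card A" by (simp add: cyc_def card_image)
  then show ?thesis using assms by (simp add: geo_def permutes_inv_o[OF assms(2)])
qed

text \<open>Distinct cycles give distinct words, because the points of a word form the cycle; so no
  factor is lost when the words are collected in a set.\<close>

lemma cycles_prod_eq:
  assumes \<tau>: "\<tau> permutes {1..k}"
  shows "(\<Prod>c\<in>cycles k \<tau>. \<kappa> (map i c)) = cycle_prod {1..k} \<tau> \<kappa> i"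
proof -
  have perm: "permutation \<tau>" using \<tau> permutation_permutes by blast
  have "inj_on (\<lambda>C. support \<tau> (Min C)) (orbit \<tau> ` {1..k})"
  proof (rule inj_onI)
    have set: "set (support \<tau> (Min C)) = C" if C: "C \<in> orbit \<tau> ` {1..k}" for C
    proof -
      obtain x where x: "x \<in> {1..k}" "C = orbit \<tau> x" using C by blast
      have "finite C" "C \<noteq> {}"
        using x finite_orbit[OF permutes_self_in_orbit[OF \<tau>]] orbit_nonempty[of \<tau>] by auto
      then have "Min C \<in> C" by simp
      then show ?thesis using x permutes_orbit_eq[OF \<tau>, of "Min C" x] set_support_eq_orbit[OF perm, of "Min C"] by simp
    qed
    fix C D assume "C \<in> orbit \<tau> ` {1..k}" "D \<in> orbit \<tau> ` {1..k}" "support \<tau> (Min C) = support \<tau> (Min D)"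
    then show "C = D" using set by metis
  qed
  then show ?thesis unfolding cycles_def cycle_prod_def by (simp add: prod.reindex)
qed

section \<open>Traces of products as sums over closed paths\<close>

lemma sum_PiE_insert:
  assumes "a \<notin> A"
  shows "(\<Sum>r\<in>insert a A \<rightarrow>\<^sub>E S. f r) = (\<Sum>r\<in>A \<rightarrow>\<^sub>E S. \<Sum>z\<in>S. f (r(a := z)))"
proof -
  have "(\<Sum>r\<in>insert a A \<rightarrow>\<^sub>E S. f r) = (\<Sum>(z, r)\<in>S \<times> (A \<rightarrow>\<^sub>E S). f (r(a := z)))"
    unfolding PiE_insert_eq by (subst sum.reindex[OF inj_combinator[OF assms]]) (simp add: case_prod_unfold)
  also have "\<dots> = (\<Sum>z\<in>S. \<Sum>r\<in>A \<rightarrow>\<^sub>E S. f (r(a := z)))" by (rule sum.cartesian_product[symmetric])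
  finally show ?thesis by (subst sum.swap)
qed

lemma foldr_mat_mult:
  fixes B :: "nat \<Rightarrow> complex mat"
  assumes "\<And>j. j \<in> set xs \<Longrightarrow> B j \<in> carrier_mat N N" "X \<in> carrier_mat N N"
  shows "foldr (\<lambda>j A. B j * A) xs X = foldr (\<lambda>j A. B j * A) xs (1\<^sub>m N) * X \<and>
    foldr (\<lambda>j A. B j * A) xs (1\<^sub>m N) \<in> carrier_mat N N"
  using assms(1)
proof (induction xs)
  case Nil
  then show ?case using assms(2) by simp
next
  case (Cons j xs)
  let ?Q = "foldr (\<lambda>j A. B j * A) xs (1\<^sub>m N)"
  have IH: "foldr (\<lambda>j A. B j * A) xs X = ?Q * X" "?Q \<in> carrier_mat N N" using Cons by auto
  have "B j \<in> carrier_mat N N" using Cons.prems by simp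
  then show ?case using IH assoc_mult_mat[OF _ IH(2) assms(2), of "B j"] by simp
qed

text \<open>A sum over paths with \<open>n\<close> steps, hence \<open>Suc n\<close> vertices, with
  prescribed ends. Appending a factor on the right prolongs the path by one vertex, which is the
  induction.\<close>

lemma mat_prod_entry:
  fixes B :: "nat \<Rightarrow> complex mat"
  assumes B: "\<And>j. j \<in> {1..n} \<Longrightarrow> B j \<in> carrier_mat N N" and "x < N" "y < N"
  shows "foldr (\<lambda>j A. B j * A) [1..<Suc n] (1\<^sub>m N) $$ (x, y) =
    (\<Sum>r\<in>{1..Suc n} \<rightarrow>\<^sub>E {..<N}. if r 1 = x \<and> r (Suc n) = y then \<Prod>j\<in>{1..n}. B j $$ (r j, r (Suc j)) else 0)"
  using assms
proof (induction n arbitrary: y)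
  case 0
  have "(\<Sum>r\<in>{1..Suc 0} \<rightarrow>\<^sub>E {..<N}. if r 1 = x \<and> r (Suc 0) = y then 1 else 0 :: complex) =
      (\<Sum>r\<in>insert (1::nat) {} \<rightarrow>\<^sub>E {..<N}. if r 1 = x \<and> r 1 = y then 1 else 0)"
    by simp
  also have "\<dots> = (\<Sum>z<N. if z = x \<and> z = y then 1 else 0)"
    by (subst sum_PiE_insert) auto
  also have "\<dots> = (\<Sum>z<N. if z = x then (if x = y then 1 else 0) else 0)" by (intro sum.cong refl) auto
  also have "\<dots> = (if x = y then 1 else 0)" using 0 by simp
  finally have a: "(\<Sum>r\<in>{1..Suc 0} \<rightarrow>\<^sub>E {..<N}. if r 1 = x \<and> r (Suc 0) = y then 1 else 0 :: complex) =
      (if x = y then 1 else 0)" .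
  have b: "(\<Sum>r\<in>{1..Suc 0} \<rightarrow>\<^sub>E {..<N}. if r 1 = x \<and> r (Suc 0) = y
      then \<Prod>j\<in>{1..0}. B j $$ (r j, r (Suc j)) else 0) =
      (\<Sum>r\<in>{1..Suc 0} \<rightarrow>\<^sub>E {..<N}. if r 1 = x \<and> r (Suc 0) = y then 1 else 0)"
    by (intro sum.cong refl) simp
  have c: "foldr (\<lambda>j A. B j * A) [1..<Suc 0] (1\<^sub>m N) $$ (x, y) = (if x = y then 1 else 0)"
    using 0 by simp
  show ?case by (rule trans[OF c trans[OF b a, symmetric]])
next
  case (Suc n)
  let ?Q = "\<lambda>n. foldr (\<lambda>j A. B j * A) [1..<Suc n] (1\<^sub>m N)"
  let ?R = "{1..Suc n} \<rightarrow>\<^sub>E {..<N}"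
  let ?p = "\<lambda>r. \<Prod>j\<in>{1..n}. B j $$ (r j, r (Suc j))"
  have Bn: "B (Suc n) \<in> carrier_mat N N" using Suc.prems(1) by simp
  have car: "?Q n \<in> carrier_mat N N"
    by (rule conjunct2[OF foldr_mat_mult[OF _ Bn]]) (use Suc.prems(1) in auto)
  have "?Q (Suc n) = foldr (\<lambda>j A. B j * A) [1..<Suc n] (B (Suc n) * 1\<^sub>m N)" by simp
  also have "B (Suc n) * 1\<^sub>m N = B (Suc n)" using Bn by simp
  also have "foldr (\<lambda>j A. B j * A) [1..<Suc n] (B (Suc n)) = ?Q n * B (Suc n)"
    by (rule conjunct1[OF foldr_mat_mult[OF _ Bn]]) (use Suc.prems(1) in auto)
  finally have "?Q (Suc n) $$ (x, y) = (\<Sum>z<N. ?Q n $$ (x, z) * B (Suc n) $$ (z, y))"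
    using index_mult_mat_sum[OF car Bn Suc.prems(2,3)] by simp
  also have "\<dots> = (\<Sum>z<N. (\<Sum>r\<in>?R. if r 1 = x \<and> r (Suc n) = z then ?p r else 0) * B (Suc n) $$ (z, y))"
  proof (rule sum.cong[OF refl])
    fix z assume "z \<in> {..<N}"
    then have z: "z < N" by simp
    have "?Q n $$ (x, z) = (\<Sum>r\<in>?R. if r 1 = x \<and> r (Suc n) = z then ?p r else 0)"
      by (rule Suc.IH) (use Suc.prems z in auto)
    then show "?Q n $$ (x, z) * B (Suc n) $$ (z, y) =
        (\<Sum>r\<in>?R. if r 1 = x \<and> r (Suc n) = z then ?p r else 0) * B (Suc n) $$ (z, y)" by simp
  qed
  also have "\<dots> = (\<Sum>r\<in>?R. \<Sum>z<N. (if r 1 = x \<and> r (Suc n) = z then ?p r else 0) * B (Suc n) $$ (z, y))"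
    unfolding sum_distrib_right by (rule sum.swap)
  also have "\<dots> = (\<Sum>r\<in>?R. if r 1 = x then ?p r * B (Suc n) $$ (r (Suc n), y) else 0)"
  proof (rule sum.cong[OF refl])
    fix r assume "r \<in> ?R"
    then have rn: "r (Suc n) < N" using PiE_mem[of r "{1..Suc n}" "\<lambda>_. {..<N}" "Suc n"] by simp
    have "(\<Sum>z<N. (if r 1 = x \<and> r (Suc n) = z then ?p r else 0) * B (Suc n) $$ (z, y)) =
        (\<Sum>z<N. if z = r (Suc n) then (if r 1 = x then ?p r * B (Suc n) $$ (z, y) else 0) else 0)"
      by (intro sum.cong refl) auto
    also have "\<dots> = (if r 1 = x then ?p r * B (Suc n) $$ (r (Suc n), y) else 0)" using rn by simp
    finally show "(\<Sum>z<N. (if r 1 = x \<and> r (Suc n) = z then ?p r else 0) * B (Suc n) $$ (z, y)) =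
        (if r 1 = x then ?p r * B (Suc n) $$ (r (Suc n), y) else 0)" .
  qed
  also have "\<dots> = (\<Sum>r\<in>?R. \<Sum>w<N. if r 1 = x \<and> w = y then ?p r * B (Suc n) $$ (r (Suc n), w) else 0)"
  proof (rule sum.cong[OF refl])
    fix r
    have "(\<Sum>w<N. if r 1 = x \<and> w = y then ?p r * B (Suc n) $$ (r (Suc n), w) else 0) =
        (\<Sum>w<N. if w = y then (if r 1 = x then ?p r * B (Suc n) $$ (r (Suc n), w) else 0) else 0)"
      by (intro sum.cong refl) auto
    also have "\<dots> = (if r 1 = x then ?p r * B (Suc n) $$ (r (Suc n), y) else 0)" using Suc.prems(3) by simp
    finally show "(if r 1 = x then ?p r * B (Suc n) $$ (r (Suc n), y) else 0) =
        (\<Sum>w<N. if r 1 = x \<and> w = y then ?p r * B (Suc n) $$ (r (Suc n), w) else 0)" by simp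
  qed
  also have "\<dots> = (\<Sum>r\<in>?R. \<Sum>w<N. if (r(Suc (Suc n) := w)) 1 = x \<and> (r(Suc (Suc n) := w)) (Suc (Suc n)) = y
      then \<Prod>j\<in>{1..Suc n}. B j $$ ((r(Suc (Suc n) := w)) j, (r(Suc (Suc n) := w)) (Suc j)) else 0)"
  proof (intro sum.cong refl if_cong)
    fix r w
    have "(\<Prod>j\<in>{1..Suc n}. B j $$ ((r(Suc (Suc n) := w)) j, (r(Suc (Suc n) := w)) (Suc j))) =
        (\<Prod>j\<in>{1..n}. B j $$ ((r(Suc (Suc n) := w)) j, (r(Suc (Suc n) := w)) (Suc j))) * B (Suc n) $$ (r (Suc n), w)"
      by simp
    also have "(\<Prod>j\<in>{1..n}. B j $$ ((r(Suc (Suc n) := w)) j, (r(Suc (Suc n) := w)) (Suc j))) = ?p r"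
      by (rule prod.cong) auto
    finally show "?p r * B (Suc n) $$ (r (Suc n), w) =
        (\<Prod>j\<in>{1..Suc n}. B j $$ ((r(Suc (Suc n) := w)) j, (r(Suc (Suc n) := w)) (Suc j)))" by simp
  qed auto
  also have "\<dots> = (\<Sum>r\<in>{1..Suc (Suc n)} \<rightarrow>\<^sub>E {..<N}. if r 1 = x \<and> r (Suc (Suc n)) = y
      then \<Prod>j\<in>{1..Suc n}. B j $$ (r j, r (Suc j)) else 0)"
  proof -
    have ins: "{1..Suc (Suc n)} = insert (Suc (Suc n)) {1..Suc n}" by auto
    show ?thesis unfolding ins by (rule sum_PiE_insert[symmetric]) simp
  qed
  finally show ?case .
qed

text \<open>The trace closes the path: identifying the vertex \<open>Suc n\<close> with the vertex 1
  turns the successor into the full cycle.\<close>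

lemma tr_mat_prod:
  fixes B :: "nat \<Rightarrow> complex mat"
  assumes B: "\<And>j. j \<in> {1..n} \<Longrightarrow> B j \<in> carrier_mat N N" and n: "n \<ge> 1"
  shows "tr (foldr (\<lambda>j A. B j * A) [1..<n + 1] (1\<^sub>m N)) =
    (\<Sum>r\<in>{1..n} \<rightarrow>\<^sub>E {..<N}. \<Prod>j\<in>{1..n}. B j $$ (r j, r (full_cycle n j)))"
proof -
  let ?Q = "foldr (\<lambda>j A. B j * A) [1..<Suc n] (1\<^sub>m N)"
  let ?g = "\<lambda>r. \<Prod>j\<in>{1..n}. B j $$ (r j, r (Suc j))"
  have "?Q \<in> carrier_mat N N" by (rule conjunct2[OF foldr_mat_mult[of _ _ _ "1\<^sub>m N"]]) (use B in auto)
  then have "tr ?Q = (\<Sum>x<N. ?Q $$ (x, x))" by (simp add: tr_def del: upt_Suc)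
  also have "\<dots> = (\<Sum>x<N. \<Sum>r\<in>{1..Suc n} \<rightarrow>\<^sub>E {..<N}. if r 1 = x \<and> r (Suc n) = x then ?g r else 0)"
    by (intro sum.cong refl mat_prod_entry[OF B]) auto
  also have "\<dots> = (\<Sum>r\<in>{1..Suc n} \<rightarrow>\<^sub>E {..<N}. \<Sum>x<N. if r 1 = x \<and> r (Suc n) = x then ?g r else 0)"
    by (rule sum.swap)
  also have "\<dots> = (\<Sum>r\<in>{1..Suc n} \<rightarrow>\<^sub>E {..<N}. if r (Suc n) = r 1 then ?g r else 0)"
  proof (rule sum.cong[OF refl])
    fix r assume "r \<in> {1..Suc n} \<rightarrow>\<^sub>E {..<N}"
    then have r1: "r 1 < N" using PiE_mem[of r "{1..Suc n}" "\<lambda>_. {..<N}" 1] by simp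
    have "(\<Sum>x<N. if r 1 = x \<and> r (Suc n) = x then ?g r else 0) =
        (\<Sum>x<N. if x = r 1 then (if r (Suc n) = r 1 then ?g r else 0) else 0)"
      by (intro sum.cong refl) auto
    then show "(\<Sum>x<N. if r 1 = x \<and> r (Suc n) = x then ?g r else 0) = (if r (Suc n) = r 1 then ?g r else 0)"
      using r1 by simp
  qed
  also have "{1..Suc n} = insert (Suc n) {1..n}" by auto
  also have "(\<Sum>r\<in>insert (Suc n) {1..n} \<rightarrow>\<^sub>E {..<N}. if r (Suc n) = r 1 then ?g r else 0) =
      (\<Sum>r\<in>{1..n} \<rightarrow>\<^sub>E {..<N}. \<Sum>z<N. if (r(Suc n := z)) (Suc n) = (r(Suc n := z)) 1 then ?g (r(Suc n := z)) else 0)"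
    by (rule sum_PiE_insert) simp
  also have "\<dots> = (\<Sum>r\<in>{1..n} \<rightarrow>\<^sub>E {..<N}. \<Prod>j\<in>{1..n}. B j $$ (r j, r (full_cycle n j)))"
  proof (rule sum.cong[OF refl])
    fix r assume "r \<in> {1..n} \<rightarrow>\<^sub>E {..<N}"
    then have r1: "r 1 < N" using PiE_mem[of r "{1..n}" "\<lambda>_. {..<N}" 1] n by simp
    have "(\<Sum>z<N. if (r(Suc n := z)) (Suc n) = (r(Suc n := z)) 1 then ?g (r(Suc n := z)) else 0) =
        (\<Sum>z<N. if z = r 1 then ?g (r(Suc n := z)) else 0)"
      by (intro sum.cong refl) (use n in auto)
    also have "\<dots> = ?g (r(Suc n := r 1))" using r1 by simp
    also have "\<dots> = (\<Prod>j\<in>{1..n}. B j $$ (r j, r (full_cycle n j)))"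
    proof (rule prod.cong[OF refl])
      fix j assume j: "j \<in> {1..n}"
      show "B j $$ ((r(Suc n := r 1)) j, (r(Suc n := r 1)) (Suc j)) = B j $$ (r j, r (full_cycle n j))"
        unfolding full_cycle_apply[OF j] using j by simp
    qed
    finally show "(\<Sum>z<N. if (r(Suc n := z)) (Suc n) = (r(Suc n := z)) 1 then ?g (r(Suc n := z)) else 0) =
        (\<Prod>j\<in>{1..n}. B j $$ (r j, r (full_cycle n j)))" .
  qed
  finally show ?thesis by simp
qed

lemma mean_trace_eq_Em:
  assumes W: "prob_space W" and M: "\<And>\<iota>. \<iota> \<in> \<I> \<Longrightarrow> random_matrix W N (M \<iota>)"
    and i: "i \<in> {1..n} \<rightarrow> \<I>" and n: "n \<ge> 1"
  shows "mean_trace W N M (map i [1..<n + 1]) = Em W N n (perm_part n (full_cycle n)) (\<lambda>j. M (i j))"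
proof -
  let ?R = "{1..n} \<rightarrow>\<^sub>E {..<N}"
  have A: "random_matrix W N (M (i j))" if "j \<in> {1..n}" for j using M i that by blast
  have "mean_trace W N M (map i [1..<n + 1]) =
      (LINT \<omega>|W. 1 / of_nat N * (\<Sum>r\<in>?R. \<Prod>j\<in>{1..n}. M (i j) \<omega> $$ (r j, r (full_cycle n j))))"
    unfolding mean_trace_def
  proof (rule Bochner_Integration.integral_cong[OF refl])
    fix \<omega> assume \<omega>: "\<omega> \<in> space W"
    have "foldr (\<lambda>i A. M i \<omega> * A) (map i [1..<n + 1]) (1\<^sub>m N) = foldr (\<lambda>j A. M (i j) \<omega> * A) [1..<n + 1] (1\<^sub>m N)"
      by (simp add: foldr_map comp_def del: upt_Suc)
    then show "1 / of_nat N * tr (foldr (\<lambda>i A. M i \<omega> * A) (map i [1..<n + 1]) (1\<^sub>m N)) =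
        1 / of_nat N * (\<Sum>r\<in>?R. \<Prod>j\<in>{1..n}. M (i j) \<omega> $$ (r j, r (full_cycle n j)))"
      using tr_mat_prod[where B = "\<lambda>j. M (i j) \<omega>", OF random_matrix_carrier[OF A \<omega>] n] by simp
  qed
  also have "\<dots> = 1 / of_nat N * (LINT \<omega>|W. (\<Sum>r\<in>?R. \<Prod>j\<in>{1..n}. M (i j) \<omega> $$ (r j, r (full_cycle n j))))"
    by (rule integral_mult_right_zero)
  also have "(LINT \<omega>|W. (\<Sum>r\<in>?R. \<Prod>j\<in>{1..n}. M (i j) \<omega> $$ (r j, r (full_cycle n j)))) =
      (\<Sum>r\<in>?R. entry_moment W n (\<lambda>j. M (i j)) r (r \<circ> full_cycle n))"
    unfolding entry_moment_def comp_def
  proof (rule Bochner_Integration.integral_sum)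
    fix r assume r: "r \<in> ?R"
    have lt: "r j < N" if "j \<in> {1..n}" for j using PiE_mem[OF r that] by simp
    show "integrable W (\<lambda>\<omega>. \<Prod>j\<in>{1..n}. M (i j) \<omega> $$ (r j, r (full_cycle n j)))"
    proof (rule integrable_prod_entries[OF W A lt])
      show "r (full_cycle n j) < N" if "j \<in> {1..n}" for j
        using lt permutes_in_image[OF full_cycle_permutes[of n], of j] that by blast
    qed
  qed
  also have "1 / of_nat N * \<dots> = Em W N n (perm_part n (full_cycle n)) (\<lambda>j. M (i j))"
  proof -
    have "orbit (full_cycle n) ` {1..n} = {{1..n}}"
      using cyclic_succ_full_cycle[of n] n by (auto simp: cyclic_succ_def image_constant_conv cong: image_cong_simp)
    then have "cyc {1..n} (full_cycle n) = 1" by (simp add: cyc_def)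
    moreover have "Em W N n (perm_part n (full_cycle n)) (\<lambda>j. M (i j)) = 1 / of_nat N ^ cyc {1..n} (full_cycle n) *
        (\<Sum>r\<in>?R. entry_moment W n (\<lambda>j. M (i j)) r (r \<circ> full_cycle n))"
      by (rule Em_perm_part[OF W A full_cycle_permutes])
    ultimately show ?thesis by simp
  qed
  finally show ?thesis .
qed

text \<open>Permuting the factors of the product by \<open>\<pi>\<close> and composing the row index
  with \<open>\<pi>\<close> are bijections of the index sets; the power of \<open>N\<close> agrees
  because conjugate permutations have equally many cycles.\<close>

lemma Em_conj:
  assumes W: "prob_space W" and A: "\<And>j. j \<in> {1..k} \<Longrightarrow> random_matrix W N (A j)"
    and \<pi>: "\<pi> permutes {1..k}" and \<sigma>: "\<sigma> permutes {1..k}"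
  shows "Em W N k (perm_part k (\<pi> \<circ> \<sigma> \<circ> inv \<pi>)) A = Em W N k (perm_part k \<sigma>) (\<lambda>j. A (\<pi> j))"
proof -
  let ?R = "{1..k} \<rightarrow>\<^sub>E {..<N}"
  let ?s = "\<pi> \<circ> \<sigma> \<circ> inv \<pi>"
  have \<pi>k: "\<rho> j \<in> {1..k} \<longleftrightarrow> j \<in> {1..k}" if "\<rho> permutes {1..k}" for \<rho> j by (rule permutes_in_image[OF that])
  have A': "random_matrix W N (A (\<pi> j))" if "j \<in> {1..k}" for j using A \<pi>k[OF \<pi>] that by blast
  have PiE: "r \<circ> \<rho> \<in> ?R" if r: "r \<in> ?R" and \<rho>: "\<rho> permutes {1..k}" for r \<rho>
  proof (rule PiE_I)
    show "(r \<circ> \<rho>) x \<in> {..<N}" if "x \<in> {1..k}" for x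
      using PiE_mem[OF r, of "\<rho> x"] \<pi>k[OF \<rho>, of x] that by simp
    show "(r \<circ> \<rho>) x = undefined" if "x \<notin> {1..k}" for x
      using PiE_arb[OF r that] permutes_not_in[OF \<rho> that] by simp
  qed
  have bij: "bij_betw (\<lambda>r. r \<circ> \<pi>) ?R ?R"
  proof (rule bij_betw_byWitness[where f' = "\<lambda>r. r \<circ> inv \<pi>"])
    show "(\<lambda>r. r \<circ> \<pi>) ` ?R \<subseteq> ?R" using PiE \<pi> by blast
    show "(\<lambda>r. r \<circ> inv \<pi>) ` ?R \<subseteq> ?R" using PiE permutes_inv[OF \<pi>] by blast
  qed (simp_all add: comp_assoc permutes_inv_o[OF \<pi>])
  have "entry_moment W k A r (r \<circ> ?s) = entry_moment W k (\<lambda>j. A (\<pi> j)) (r \<circ> \<pi>) ((r \<circ> \<pi>) \<circ> \<sigma>)" for r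
  proof -
    have "(\<Prod>j\<in>{1..k}. A j \<omega> $$ (r j, (r \<circ> ?s) j)) =
        (\<Prod>j\<in>{1..k}. A (\<pi> j) \<omega> $$ (r (\<pi> j), (r \<circ> ?s) (\<pi> j)))" for \<omega>
      by (rule prod.reindex_bij_betw[OF permutes_imp_bij[OF \<pi>], symmetric])
    then show ?thesis unfolding entry_moment_def by (simp add: permutes_inverses(2)[OF \<pi>])
  qed
  then have "(\<Sum>r\<in>?R. entry_moment W k A r (r \<circ> ?s)) =
      (\<Sum>r\<in>?R. entry_moment W k (\<lambda>j. A (\<pi> j)) (r \<circ> \<pi>) ((r \<circ> \<pi>) \<circ> \<sigma>))" by simp
  also have "\<dots> = (\<Sum>r\<in>?R. entry_moment W k (\<lambda>j. A (\<pi> j)) r (r \<circ> \<sigma>))"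
    by (rule sum.reindex_bij_betw[OF bij])
  finally have sum: "(\<Sum>r\<in>?R. entry_moment W k A r (r \<circ> ?s)) = (\<Sum>r\<in>?R. entry_moment W k (\<lambda>j. A (\<pi> j)) r (r \<circ> \<sigma>))" .
  have "Em W N k (perm_part k ?s) A = 1 / of_nat N ^ cyc {1..k} ?s * (\<Sum>r\<in>?R. entry_moment W k A r (r \<circ> ?s))"
    by (rule Em_perm_part[OF W A conj_permutes[OF \<pi> \<sigma>]])
  moreover have "Em W N k (perm_part k \<sigma>) (\<lambda>j. A (\<pi> j)) =
      1 / of_nat N ^ cyc {1..k} \<sigma> * (\<Sum>r\<in>?R. entry_moment W k (\<lambda>j. A (\<pi> j)) r (r \<circ> \<sigma>))"
    by (rule Em_perm_part[OF W A' \<sigma>])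
  moreover have "cyc {1..k} ?s = cyc {1..k} \<sigma>" by (rule cyc_conj[OF \<pi> \<sigma>]) simp
  ultimately show ?thesis by (simp only: sum)
qed

lemma perm_part_tens: "perm_part (k + l) (tens k \<sigma>\<^sub>1 \<sigma>\<^sub>2) = tensor_part k (perm_part k \<sigma>\<^sub>1) (perm_part l \<sigma>\<^sub>2)"
proof -
  have "perm_part (k + l) (tens k \<sigma>\<^sub>1 \<sigma>\<^sub>2) = (\<lambda>i. {Inl i, Inr (tens k \<sigma>\<^sub>1 \<sigma>\<^sub>2 i)}) ` {1..k} \<union>
      (\<lambda>i. {Inl (k + i), Inr (tens k \<sigma>\<^sub>1 \<sigma>\<^sub>2 (k + i))}) ` {1..l}"
    unfolding perm_part_def interval_split image_Un image_image ..
  also have "(\<lambda>i. {Inl i, Inr (tens k \<sigma>\<^sub>1 \<sigma>\<^sub>2 i)}) ` {1..k} = perm_part k \<sigma>\<^sub>1"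
    unfolding perm_part_def by (rule image_cong) (auto simp: tens_def)
  also have "(\<lambda>i. {Inl (k + i), Inr (tens k \<sigma>\<^sub>1 \<sigma>\<^sub>2 (k + i))}) ` {1..l} =
      (\<lambda>B. map_sum (\<lambda>i. k + i) (\<lambda>i. k + i) ` B) ` perm_part l \<sigma>\<^sub>2"
    unfolding perm_part_def image_image by (rule image_cong) (auto simp: tens_def)
  finally show ?thesis by (simp add: tensor_part_def)
qed

lemma lim_cong:
  assumes "\<forall>\<^sub>F N in sequentially. X N = Y N"
  shows "lim X = lim Y"
  unfolding lim_def using tendsto_cong[OF assms] by simp

theorem theorem4p4:
  fixes W :: "nat \<Rightarrow> 'w measure"
    and \<I> :: "'i set"
    and M :: "nat \<Rightarrow> 'i \<Rightarrow> 'w \<Rightarrow> complex mat"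
    and \<kappa> :: "'i list \<Rightarrow> complex"
    and k :: nat
    and p :: "(nat + nat) set set"
    and i :: "nat \<Rightarrow> 'i"
  assumes "\<And>N. N \<ge> 1 \<Longrightarrow> prob_space (W N)"
    and "\<And>N \<iota>. N \<ge> 1 \<Longrightarrow> \<iota> \<in> \<I> \<Longrightarrow> random_matrix (W N) N (M N \<iota>)"
    and "\<And>N. N \<ge> 1 \<Longrightarrow> unitarily_invariant (W N) N \<I> (M N)"
    and "converges_in_nc_distribution W \<I> M"
    and "asymptotic_S_factorization W \<I> M"
    and "free_cumulants \<I> (limit_distribution W M) \<kappa>"
    and "p \<in> partitions k"
    and "i \<in> {1..k} \<rightarrow> \<I>"
  shows "(\<lambda>N. Em_c (W N) N k p (\<lambda>j. M N (i j))) \<longlonglongrightarrow>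
           (if p \<in> S_bar k then \<Prod>c\<in>cycles k (Mb k p). \<kappa> (map i c) else 0)"
proof -
  note W = assms(1) and M = assms(2) and inv = assms(3) and i = assms(8)
  have p: "partition_on (points k) p" using assms(7) by (simp add: partitions_def)
  define E where "E k \<sigma> i = limit_Em W M k (perm_part k \<sigma>) i" for k \<sigma> i
  have E_lim: "(\<lambda>N. Em (W N) N k (perm_part k \<sigma>) (\<lambda>j. M N (i j))) \<longlonglongrightarrow> E k \<sigma> i"
    if "\<sigma> permutes {1..k}" "i \<in> {1..k} \<rightarrow> \<I>" for k \<sigma> i
    using assms(5) that unfolding asymptotic_S_factorization_def E_def limit_Em_def convergent_LIMSEQ_iff by blast
  have E_geo: "E k \<sigma> i = geo_sum {1..k} \<sigma> \<kappa> i" if "\<sigma> permutes {1..k}" "i \<in> {1..k} \<rightarrow> \<I>" for k \<sigma> i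
  proof (rule moments_eq_geo_sum(2)[OF assms(6) _ _ _ _ that])
    show "E k (\<pi> \<circ> \<sigma> \<circ> inv \<pi>) i = E k \<sigma> (i \<circ> \<pi>)"
      if "\<pi> permutes {1..k}" "\<sigma> permutes {1..k}" "i \<in> {1..k} \<rightarrow> \<I>" for k \<pi> \<sigma> i
      unfolding E_def limit_Em_def
    proof (rule lim_cong, rule eventually_sequentiallyI[of 1])
      fix N :: nat assume N: "N \<ge> 1"
      show "Em (W N) N k (perm_part k (\<pi> \<circ> \<sigma> \<circ> inv \<pi>)) (\<lambda>j. M N (i j)) =
          Em (W N) N k (perm_part k \<sigma>) (\<lambda>j. M N ((i \<circ> \<pi>) j))"
        using Em_conj[OF W[OF N] _ that(1,2), of N "\<lambda>j. M N (i j)"] M[OF N] that(3) by (auto simp: Pi_iff)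
    qed
    show "E (k + l) (tens k \<sigma>\<^sub>1 \<sigma>\<^sub>2) i = E k \<sigma>\<^sub>1 i * E l \<sigma>\<^sub>2 (\<lambda>j. i (k + j))"
      if "\<sigma>\<^sub>1 permutes {1..k}" "\<sigma>\<^sub>2 permutes {1..l}" "i \<in> {1..k + l} \<rightarrow> \<I>" for k l \<sigma>\<^sub>1 \<sigma>\<^sub>2 i
      using assms(5) that unfolding asymptotic_S_factorization_def E_def perm_part_tens by blast
    show "E n (full_cycle n) i = limit_distribution W M (map i [1..<n + 1])"
      if "n \<ge> 1" "i \<in> {1..n} \<rightarrow> \<I>" for n i
      unfolding E_def limit_Em_def limit_distribution_def
    proof (rule lim_cong, rule eventually_sequentiallyI[of 1])
      fix N :: nat assume N: "N \<ge> 1"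
      show "Em (W N) N n (perm_part n (full_cycle n)) (\<lambda>j. M N (i j)) = mean_trace (W N) N (M N) (map i [1..<n + 1])"
        by (rule mean_trace_eq_Em[OF W[OF N] M[OF N] that(2,1), symmetric])
    qed
    \<comment> \<open>With no columns there is one empty index, the product is empty and the power
      of \<open>N\<close> is \<open>1\<close>, so the moment is the total mass. This is a
      probability only from \<open>N = 1\<close> on, which suffices in the limit.\<close>
    show "E 0 id i = 1" for i
    proof -
      have "\<forall>\<^sub>F N in sequentially. Em (W N) N 0 (perm_part 0 id) (\<lambda>j. M N (i j)) = 1"
      proof (rule eventually_sequentiallyI[of 1])
        fix N :: nat assume N: "N \<ge> 1"
        interpret prob_space "W N" by (rule W[OF N])
        have "Em (W N) N 0 (perm_part 0 id) (\<lambda>j. M N (i j)) = 1 / of_nat N ^ cyc {1..0::nat} id *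
            (\<Sum>r\<in>{1..0} \<rightarrow>\<^sub>E {..<N}. entry_moment (W N) 0 (\<lambda>j. M N (i j)) r (r \<circ> id))"
          by (rule Em_perm_part[OF W[OF N]]) (auto intro: permutes_id)
        then show "Em (W N) N 0 (perm_part 0 id) (\<lambda>j. M N (i j)) = 1"
          by (simp add: cyc_def entry_moment_def prob_space)
      qed
      then have "(\<lambda>N. Em (W N) N 0 (perm_part 0 id) (\<lambda>j. M N (i j))) \<longlonglongrightarrow> 1" by (rule tendsto_eventually)
      then show ?thesis unfolding E_def limit_Em_def by (rule limI)
    qed
  qed
  define P where "P = {\<tau>. \<tau> permutes {1..k}}"
  have finP: "finite P" by (simp add: P_def finite_permutations)
  define cy where "cy = cyc {1..k}"
  define Z where "Z \<tau> = cycle_prod {1..k} \<tau> \<kappa> i" for \<tau>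
  define F where "F N = base_moment (W N) k (\<lambda>j. M N (i j))" for N
  \<comment> \<open>The coefficient rescaled as in the overview. It and the weights below are
    written as quotients of natural powers, so that no exponent has to be negative.\<close>
  define x where "x N \<tau> = of_nat N ^ k / of_nat N ^ cy \<tau> * F N \<tau>" for N \<tau>
  define g where "g N \<sigma> \<tau> = (of_nat N ^ (cy \<tau> + cy (\<sigma> \<circ> inv \<tau>)) / of_nat N ^ (k + cy \<sigma>) :: complex)" for N \<sigma> \<tau>
  have F_x: "F N \<tau> = x N \<tau> * (of_nat N ^ cy \<tau> / of_nat N ^ k)" if "N \<ge> 1" for N \<tau>
    using that by (simp add: x_def)
  have Em_g: "(\<Sum>\<tau>\<in>P. g N \<sigma> \<tau> * x N \<tau>) = Em (W N) N k (perm_part k \<sigma>) (\<lambda>j. M N (i j))"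
    if N: "N \<ge> 1" "N \<ge> k" and \<sigma>: "\<sigma> \<in> P" for N \<sigma>
  proof -
    have \<sigma>p: "\<sigma> permutes {1..k}" using \<sigma> by (simp add: P_def)
    have "Em (W N) N k (perm_part k \<sigma>) (\<lambda>j. M N (i j)) = 1 / of_nat N ^ cy \<sigma> *
        (\<Sum>\<tau>\<in>P. F N \<tau> * of_nat N ^ cy (\<sigma> \<circ> inv \<tau>))"
      unfolding P_def cy_def F_def
      by (rule Em_perm_part_expansion[OF W[OF N(1)] M[OF N(1)] inv[OF N(1)] i N(2) \<sigma>p])
    also have "\<dots> = (\<Sum>\<tau>\<in>P. g N \<sigma> \<tau> * x N \<tau>)"
      unfolding sum_distrib_left
      by (intro sum.cong refl) (use N(1) in \<open>simp add: F_x g_def power_add field_simps\<close>)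
    finally show ?thesis by simp
  qed
  have x_lim: "(\<lambda>N. x N \<tau>) \<longlonglongrightarrow> Z \<tau>" if \<tau>: "\<tau> \<in> P" for \<tau>
  proof -
    have g_lim: "(\<lambda>N. g N \<sigma> \<tau>) \<longlonglongrightarrow> (if geo {1..k} \<sigma> \<tau> then 1 else 0)" if "\<sigma> \<in> P" "\<tau> \<in> P" for \<sigma> \<tau>
    proof -
      have perm: "\<sigma> permutes {1..k}" "\<tau> permutes {1..k}" using that by (auto simp: P_def)
      have "cy \<tau> + cy (\<sigma> \<circ> inv \<tau>) \<le> k + cy \<sigma>"
        using cyc_triangle(1)[OF _ perm] by (simp add: cy_def)
      from tendsto_power_quotient[OF this] show ?thesis
        using perm by (simp add: g_def geo_def cy_def)
    qed
    \<comment> \<open>The proposed limits \<open>Z\<close> solve the limiting system exactly, since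
      the limits of the moments are sums over geodesics. Thus the differences solve the system with
      a right-hand side tending to 0.\<close>
    have "(\<lambda>N. x N \<tau> - Z \<tau>) \<longlonglongrightarrow> 0"
    proof (rule unitriangular_tendsto_zero[where P = P and g = g and R = "geo {1..k}" and h = "\<lambda>\<tau>. k - cy \<tau>"
          and d = "\<lambda>N \<tau>. x N \<tau> - Z \<tau>", OF finP g_lim _ _ _ \<tau>])
      show "geo {1..k} \<sigma> \<sigma>" if "\<sigma> \<in> P" for \<sigma> by (rule geo_self) (use that in \<open>auto simp: P_def\<close>)
      show "k - cy \<tau> < k - cy \<sigma>" if "\<sigma> \<in> P" "geo {1..k} \<sigma> \<tau>" "\<sigma> \<noteq> \<tau>" for \<sigma> \<tau>
        using geo_cyc_less[of "{1..k}" \<sigma> \<tau>] that by (simp add: cy_def P_def)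
      fix \<sigma> assume \<sigma>: "\<sigma> \<in> P"
      then have \<sigma>p: "\<sigma> permutes {1..k}" by (simp add: P_def)
      have "\<forall>\<^sub>F N in sequentially. Em (W N) N k (perm_part k \<sigma>) (\<lambda>j. M N (i j)) = (\<Sum>\<tau>\<in>P. g N \<sigma> \<tau> * x N \<tau>)"
        by (rule eventually_sequentiallyI[of "max 1 k"]) (use Em_g \<sigma> in auto)
      with E_lim[OF \<sigma>p i] have "(\<lambda>N. \<Sum>\<tau>\<in>P. g N \<sigma> \<tau> * x N \<tau>) \<longlonglongrightarrow> E k \<sigma> i"
        by (rule Lim_transform_eventually)
      moreover have "(\<lambda>N. \<Sum>\<tau>\<in>P. g N \<sigma> \<tau> * Z \<tau>) \<longlonglongrightarrow> (\<Sum>\<tau>\<in>P. (if geo {1..k} \<sigma> \<tau> then 1 else 0) * Z \<tau>)"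
        by (intro tendsto_sum tendsto_mult g_lim \<sigma> tendsto_const)
      moreover have "(\<Sum>\<tau>\<in>P. (if geo {1..k} \<sigma> \<tau> then 1 else 0) * Z \<tau>) = E k \<sigma> i"
      proof -
        have "(\<Sum>\<tau>\<in>P. (if geo {1..k} \<sigma> \<tau> then 1 else 0) * Z \<tau>) = (\<Sum>\<tau>\<in>P. if geo {1..k} \<sigma> \<tau> then Z \<tau> else 0)"
          by (intro sum.cong refl) simp
        also have "\<dots> = (\<Sum>\<tau>\<in>{\<tau> \<in> P. geo {1..k} \<sigma> \<tau>}. Z \<tau>)" by (rule sum.inter_filter[OF finP, symmetric])
        also have "{\<tau> \<in> P. geo {1..k} \<sigma> \<tau>} = {\<tau>. geo {1..k} \<sigma> \<tau>}" by (auto simp: P_def geo_def)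
        finally show ?thesis unfolding E_geo[OF \<sigma>p i] geo_sum_def Z_def .
      qed
      ultimately have "(\<lambda>N. (\<Sum>\<tau>\<in>P. g N \<sigma> \<tau> * x N \<tau>) - (\<Sum>\<tau>\<in>P. g N \<sigma> \<tau> * Z \<tau>)) \<longlonglongrightarrow> E k \<sigma> i - E k \<sigma> i"
        by (intro tendsto_diff) simp_all
      then show "(\<lambda>N. \<Sum>\<tau>\<in>P. g N \<sigma> \<tau> * (x N \<tau> - Z \<tau>)) \<longlonglongrightarrow> 0"
        by (simp add: right_diff_distrib sum_subtractf)
    qed
    then show ?thesis by (simp add: LIM_zero_iff)
  qed
  define Q where "Q = {\<sigma>. \<sigma> permutes {1..k} \<and> finer (perm_part k \<sigma>) p}"
  have QP: "Q \<subseteq> P" by (auto simp: Q_def P_def)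
  then have finQ: "finite Q" by (rule finite_subset[OF _ finP])
  define J where "J = nc (join k p (id_part k))"
  \<comment> \<open>The first quotient compares the number of injective colourings of the blocks
    with that of all colourings and tends to 1. The second has nonpositive degree by
    \<open>nc_join_inequality\<close>.\<close>
  define c where "c N \<sigma> = (of_nat (\<Prod>j<nc p. N - j) / of_nat N ^ nc p * (of_nat N ^ (nc p + cy \<sigma>) / of_nat N ^ (k + J)) :: complex)" for N \<sigma>
  have Em_c_eq: "(\<Sum>\<sigma>\<in>Q. c N \<sigma> * x N \<sigma>) = Em_c (W N) N k p (\<lambda>j. M N (i j))" if N: "N \<ge> 1" "N \<ge> k" for N
  proof -
    have "Em_c (W N) N k p (\<lambda>j. M N (i j)) = 1 / of_nat N ^ J * (of_nat (\<Prod>j<nc p. N - j) * (\<Sum>\<sigma>\<in>Q. F N \<sigma>))"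
      unfolding J_def Q_def F_def
      by (rule Em_c_expansion[OF W[OF N(1)] M[OF N(1)] inv[OF N(1)] i N(2) p])
    also have "\<dots> = (\<Sum>\<sigma>\<in>Q. c N \<sigma> * x N \<sigma>)"
      unfolding sum_distrib_left
      by (intro sum.cong refl) (use N(1) in \<open>simp add: F_x c_def power_add field_simps\<close>)
    finally show ?thesis by simp
  qed
  have "(\<lambda>N. \<Sum>\<sigma>\<in>Q. c N \<sigma> * x N \<sigma>) \<longlonglongrightarrow> (\<Sum>\<sigma>\<in>Q. (1 * (if nc p + cy \<sigma> = k + J then 1 else 0)) * Z \<sigma>)"
  proof (intro tendsto_sum tendsto_mult)
    fix \<sigma> assume \<sigma>: "\<sigma> \<in> Q"
    show "(\<lambda>N. x N \<sigma>) \<longlonglongrightarrow> Z \<sigma>" using x_lim QP \<sigma> by blast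
    have "nc p + cy \<sigma> \<le> k + J" unfolding cy_def J_def
      by (rule nc_join_inequality(1)[OF p]) (use \<sigma> in \<open>auto simp: Q_def\<close>)
    then show "(\<lambda>N. c N \<sigma>) \<longlonglongrightarrow> 1 * (if nc p + cy \<sigma> = k + J then 1 else 0)"
      unfolding c_def by (intro tendsto_mult tendsto_falling_factorial_quotient tendsto_power_quotient)
  qed
  moreover have "\<forall>\<^sub>F N in sequentially. (\<Sum>\<sigma>\<in>Q. c N \<sigma> * x N \<sigma>) = Em_c (W N) N k p (\<lambda>j. M N (i j))"
    by (rule eventually_sequentiallyI[of "max 1 k"]) (use Em_c_eq in auto)
  ultimately have "(\<lambda>N. Em_c (W N) N k p (\<lambda>j. M N (i j))) \<longlonglongrightarrow>
      (\<Sum>\<sigma>\<in>Q. (1 * (if nc p + cy \<sigma> = k + J then 1 else 0)) * Z \<sigma>)"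
    by (rule Lim_transform_eventually)
  also have "(\<Sum>\<sigma>\<in>Q. (1 * (if nc p + cy \<sigma> = k + J then 1 else 0)) * Z \<sigma>) =
      (\<Sum>\<sigma>\<in>Q. if nc p + cy \<sigma> = k + J then Z \<sigma> else 0)" by (intro sum.cong refl) simp
  also have "\<dots> = (\<Sum>\<sigma>\<in>{\<sigma> \<in> Q. nc p + cy \<sigma> = k + J}. Z \<sigma>)" by (rule sum.inter_filter[OF finQ, symmetric])
  \<comment> \<open>The surviving terms are those of degree 0, and this is the equality in the
    relation \<open>\<sqsupset>\<close>: the sum is empty outside \<open>S_bar\<close> and otherwise
    reduces to the term of \<open>Mb k p\<close>.\<close>
  also have "{\<sigma> \<in> Q. nc p + cy \<sigma> = k + J} = {\<sigma>. \<sigma> permutes {1..k} \<and> sqsupset_part k (perm_part k \<sigma>) p}"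
    using sqsupset_perm_part_iff[OF p] by (auto simp: Q_def cy_def J_def)
  also have "sum Z \<dots> = (if p \<in> S_bar k then \<Prod>c\<in>cycles k (Mb k p). \<kappa> (map i c) else 0)"
  proof (cases "p \<in> S_bar k")
    case True
    then obtain \<sigma> where \<sigma>: "\<sigma> permutes {1..k}" "sqsupset_part k (perm_part k \<sigma>) p" by (auto simp: S_bar_def)
    have uniq: "\<tau> = \<sigma>" if "\<tau> permutes {1..k} \<and> sqsupset_part k (perm_part k \<tau>) p" for \<tau>
      using sqsupset_perm_part_unique[OF p _ \<sigma>(1) _ \<sigma>(2)] that by blast
    have "Mb k p = \<sigma>" unfolding Mb_def by (rule the_equality) (use \<sigma> uniq in blast)+
    moreover have "{\<sigma>. \<sigma> permutes {1..k} \<and> sqsupset_part k (perm_part k \<sigma>) p} = {\<sigma>}" using \<sigma> uniq by blast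
    ultimately show ?thesis using True cycles_prod_eq[OF \<sigma>(1), of \<kappa> i] by (simp add: Z_def)
  next
    case False
    then have "{\<sigma>. \<sigma> permutes {1..k} \<and> sqsupset_part k (perm_part k \<sigma>) p} = {}"
      using assms(7) unfolding S_bar_def by blast
    then show ?thesis using False by (simp only: sum.empty if_False)
  qed
  finally show ?thesis .
qed

end
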